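(* If there exists a relaxed compensator for Problem (MF-LQ), then Problem (MF-LQ) is well-posed, i.e. for every $x\in\mathbb R^n$ the infimum $\inf_{u(\cdot)\in\mathscr U[0,T]}J(x;u(\cdot))$ is finite.
   Context: Setting. Fix $T>0$ and positive integers $n,m$. $(\Omega,\mathcal F,\mathbb P,\mathbb F)$ is a complete filtered probability space carrying a one-dimensional standard Brownian motion $W(\cdot)$, with $\mathbb F=\{\mathcal F_t\}$ its natural filtration augmented by all $\mathbb P$-null sets. $\mathbb S^n$ is the set of symmetric $n\times n$ real matrices. For a Euclidean or matrix space $\mathbb H$: $L^\infty(0,T;\mathbb H)$ is the space of $\mathbb H$-valued (deterministic) continuous functions $\varphi$ with $\mathrm{esssup}_{t\in[0,T]}|\varphi(t)|<\infty$; $L^2_{\mathbb F}(0,T;\mathbb H)$ is the space of $\mathbb F$-progressively measurable $\mathbb H$-valued processes with $\mathbb E\int_0^T|\varphi(t)|^2dt<\infty$; $L^2_{\mathbb F}(\Omega;C([0,T];\mathbb H))$ is the space of $\mathbb F$-progressively measurable processes with a.s. continuous paths and $\mathbb E[\sup_{t\in[0,T]}|\varphi(t)|^2]<\infty$. Admissible controls: $\mathscr U[0,T]=L^2_{\mathbb F}(0,T;\mathbb R^m)$. Coefficients: $A,\widetilde A,C,\widetilde C\in L^\infty(0,T;\mathbb R^{n\times n})$, $B,\widetilde B,D,\widetilde D\in L^\infty(0,T;\mathbb R^{n\times m})$, $Q,\widetilde Q\in L^\infty(0,T;\mathbb S^n)$, $S,\widetilde S\in L^\infty(0,T;\mathbb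 R^{n\times m})$, $R,\widetilde R\in L^\infty(0,T;\mathbb S^m)$, $G,\widetilde G\in\mathbb S^n$ (no definiteness is assumed). Write $\widehat F=F+\widetilde F$ for each $F\in\{A,B,C,D,Q,S,R,G\}$. State equation: for $x\in\mathbb R^n$, $u\in\mathscr U[0,T]$, $X(\cdot)=X(\cdot;x,u(\cdot))\in L^2_{\mathbb F}(\Omega;C([0,T];\mathbb R^n))$ is the unique solution of $$dX=\{AX+\widetilde A\,\mathbb E[X]+Bu+\widetilde B\,\mathbb E[u]\}dt+\{CX+\widetilde C\,\mathbb E[X]+Du+\widetilde D\,\mathbb E[u]\}dW(t),\quad X(0)=x.$$ Cost functional: $$\begin{aligned}J(x;u(\cdot))=\mathbb E\Big\{&\int_0^T\big[\langle QX,X\rangle+\langle\widetilde Q\,\mathbb E[X],\mathbb E[X]\rangle+2\langle Su,X\rangle+2\langle\widetilde S\,\mathbb E[u],\mathbb E[X]\rangle+\langle Ru,u\rangle+\langle\widetilde R\,\mathbb E[u],\mathbb E[u]\rangle\big]dt\\&+\langle GX(T),X(T)\rangle+\langle\widetilde G\,\mathbb E[X(T)],\mathbb E[X(T)]\rangle\Big\}.\end{aligned}$$ Problem (MF-LQ) is to minimize $J(x;u(\cdot))$ over $u\in\mathscr U[0,T]$. Relaxed compensator: $\Lambda[0,T]$ is the set of functions $F:[0,T]\to\mathbb S^n$ of the form $F(t)=F(0)+\int_0^tf(s)ds$ with $f\in L^\infty(0,T;\mathbb S^n)$. For $(H,K)\in\Lambda[0,T]\times\Lambda[0,T]$ let $$\begin{aligned}&Q^{H,K}=\dot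 H+HA+A^\top H+C^\top HC+Q,&&\widehat Q^{H,K}=\dot K+K\widehat A+\widehat A^\top K+\widehat C^\top H\widehat C+\widehat Q,\\&S^{H,K}=HB+C^\top HD+S,&&\widehat S^{H,K}=K\widehat B+\widehat C^\top H\widehat D+\widehat S,\\&R^{H,K}=D^\top HD+R,&&\widehat R^{H,K}=\widehat D^\top H\widehat D+\widehat R,\\&G^{H,K}=G-H(T),&&\widehat G^{H,K}=\widehat G-K(T),\end{aligned}$$ and $\mathbf Q^{H,K}=\begin{pmatrix}Q^{H,K}&O\\O&\widehat Q^{H,K}\end{pmatrix}$, and likewise $\mathbf S^{H,K},\mathbf R^{H,K},\mathbf G^{H,K}$ (block diagonal with the unhatted and hatted entries). For a symmetric-matrix-valued function $f$ on $[0,T]$, $f(\cdot)\ge0$ means $f(t)$ is positive semidefinite for a.e. $t$, and $f(\cdot)\gg0$ means there is a constant $\delta>0$ with $f(\cdot)-\delta I\ge0$. $(H,K)$ is called a relaxed compensator for Problem (MF-LQ) if $$\begin{pmatrix}\mathbf Q^{H,K}(\cdot)&\mathbf S^{H,K}(\cdot)\\\mathbf S^{H,K}(\cdot)^\top&\mathbf R^{H,K}(\cdot)\end{pmatrix}\ge0,\quad\mathbf R^{H,K}(\cdot)\gg0,\quad\mathbf G^{H,K}\ge0.$$ *)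

theory Defs
  imports "HOL-Probability.Probability" "HOL-Probability.Essential_Supremum"
begin

section \<open>Filtration, Brownian motion, processes\<close>

text \<open>Processes are curried functions of time and sample point; only times in \<open>[0,\<infinity>)\<close>
  (for \<open>W\<close>), respectively \<open>[0,T]\<close>, are relevant.\<close>

definition augmented_filtration :: "'w measure \<Rightarrow> (real \<Rightarrow> 'w \<Rightarrow> real) \<Rightarrow> real \<Rightarrow> 'w measure" where
  "augmented_filtration M W t =
     sigma (space M)
       ({W s -` B \<inter> space M | s B. 0 \<le> s \<and> s \<le> t \<and> B \<in> sets borel} \<union> null_sets M)"

definition brownian_motion :: "'w measure \<Rightarrow> (real \<Rightarrow> 'w measure) \<Rightarrow> (real \<Rightarrow> 'w \<Rightarrow> real) \<Rightarrow> bool" where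
  "brownian_motion M F W \<longleftrightarrow>
     (\<forall>t\<ge>0. subalgebra M (F t) \<and> W t \<in> borel_measurable M \<and> W t \<in> borel_measurable (F t)) \<and>
     (AE \<omega> in M. W 0 \<omega> = 0) \<and>
     (AE \<omega> in M. continuous_on {0..} (\<lambda>t. W t \<omega>)) \<and>
     (\<forall>s t. 0 \<le> s \<and> s < t \<longrightarrow>
        distributed M lborel (\<lambda>\<omega>. W t \<omega> - W s \<omega>) (normal_density 0 (sqrt (t - s))) \<and>
        prob_space.indep_set M (sets (F s))
          (sets (vimage_algebra (space M) (\<lambda>\<omega>. W t \<omega> - W s \<omega>) borel)))"

definition progressive ::
    "(real \<Rightarrow> 'w measure) \<Rightarrow> real \<Rightarrow> (real \<Rightarrow> 'w \<Rightarrow> 'h::euclidean_space) \<Rightarrow> bool" where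
  "progressive F T \<phi> \<longleftrightarrow>
     (\<forall>t\<in>{0..T}. (\<lambda>(s, \<omega>). \<phi> s \<omega>)
        \<in> borel_measurable (restrict_space borel {0..t} \<Otimes>\<^sub>M F t))"

text \<open>The squared norm of \<open>L\<^sup>2([0,T] \<times> \<Omega>)\<close>, with value \<open>\<infinity>\<close> allowed.\<close>

definition sq_norm_L2 ::
    "'w measure \<Rightarrow> real \<Rightarrow> (real \<Rightarrow> 'w \<Rightarrow> 'h::euclidean_space) \<Rightarrow> ennreal" where
  "sq_norm_L2 M T \<phi> =
     (\<integral>\<^sup>+\<omega>. (\<integral>\<^sup>+t\<in>{0..T}. ennreal ((norm (\<phi> t \<omega>))\<^sup>2) \<partial>lborel) \<partial>M)"

definition L2F ::
    "'w measure \<Rightarrow> (real \<Rightarrow> 'w measure) \<Rightarrow> real \<Rightarrow> (real \<Rightarrow> 'w \<Rightarrow> 'h::euclidean_space) set" where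
  "L2F M F T = {\<phi>. progressive F T \<phi> \<and> sq_norm_L2 M T \<phi> < \<infinity>}"

definition L2F_C ::
    "'w measure \<Rightarrow> (real \<Rightarrow> 'w measure) \<Rightarrow> real \<Rightarrow> (real \<Rightarrow> 'w \<Rightarrow> 'h::euclidean_space) set" where
  "L2F_C M F T =
     {\<phi>. progressive F T \<phi> \<and>
         (AE \<omega> in M. continuous_on {0..T} (\<lambda>t. \<phi> t \<omega>)) \<and>
         (\<integral>\<^sup>+\<omega>. (SUP t\<in>{0..T}. ennreal ((norm (\<phi> t \<omega>))\<^sup>2)) \<partial>M) < \<infinity>}"

section \<open>The Ito integral\<close>

text \<open>A simple integrand is \<open>\<Sum>i<N. 1\<^bsub>(\<tau> i, \<tau> (i+1)]\<^esub> \<xi> i\<close> with a deterministic partition and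
  bounded \<open>F (\<tau> i)\<close>-measurable \<open>\<xi> i\<close>; a triple \<open>(N, \<tau>, \<xi>)\<close> represents it.\<close>

type_synonym ('w, 'h) simple_data = "nat \<times> (nat \<Rightarrow> real) \<times> (nat \<Rightarrow> 'w \<Rightarrow> 'h)"

definition valid_simple ::
    "'w measure \<Rightarrow> (real \<Rightarrow> 'w measure) \<Rightarrow> real \<Rightarrow> ('w, 'h::euclidean_space) simple_data \<Rightarrow> bool" where
  "valid_simple M F T = (\<lambda>(N, \<tau>, \<xi>).
     (\<forall>i<N. 0 \<le> \<tau> i \<and> \<tau> i \<le> \<tau> (Suc i) \<and> \<tau> (Suc i) \<le> T \<and>
            \<xi> i \<in> borel_measurable (F (\<tau> i)) \<and>
            (\<exists>c. \<forall>\<omega>\<in>space M. norm (\<xi> i \<omega>) \<le> c)))"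

definition simple_integrand ::
    "('w, 'h::euclidean_space) simple_data \<Rightarrow> real \<Rightarrow> 'w \<Rightarrow> 'h" where
  "simple_integrand = (\<lambda>(N, \<tau>, \<xi>) t \<omega>.
     (\<Sum>i<N. indicator {\<tau> i<..\<tau> (Suc i)} t *\<^sub>R \<xi> i \<omega>))"

definition simple_integral ::
    "(real \<Rightarrow> 'w \<Rightarrow> real) \<Rightarrow> ('w, 'h::euclidean_space) simple_data \<Rightarrow> real \<Rightarrow> 'w \<Rightarrow> 'h" where
  "simple_integral W = (\<lambda>(N, \<tau>, \<xi>) t \<omega>.
     (\<Sum>i<N. (W (min t (\<tau> (Suc i))) \<omega> - W (min t (\<tau> i)) \<omega>) *\<^sub>R \<xi> i \<omega>))"

text \<open>\<open>Y t = \<integral>\<^sub>0\<^sup>t \<phi> dW\<close> almost surely, for each \<open>t \<in> [0,T]\<close>: the usual definition as the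
  \<open>L\<^sup>2\<close>-limit of the integrals of simple integrands approximating \<open>\<phi>\<close>. By the Ito isometry
  \<open>\<phi>\<close> determines each \<open>Y t\<close> up to a null set.\<close>

definition is_ito_integral ::
    "'w measure \<Rightarrow> (real \<Rightarrow> 'w measure) \<Rightarrow> (real \<Rightarrow> 'w \<Rightarrow> real) \<Rightarrow> real \<Rightarrow>
     (real \<Rightarrow> 'w \<Rightarrow> 'h::euclidean_space) \<Rightarrow> (real \<Rightarrow> 'w \<Rightarrow> 'h) \<Rightarrow> bool" where
  "is_ito_integral M F W T \<phi> Y \<longleftrightarrow>
     \<phi> \<in> L2F M F T \<and>
     (\<forall>t\<in>{0..T}. Y t \<in> borel_measurable M) \<and>
     (\<exists>d. (\<forall>k. valid_simple M F T (d k)) \<and>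
          (\<lambda>k. sq_norm_L2 M T (\<lambda>t \<omega>. \<phi> t \<omega> - simple_integrand (d k) t \<omega>)) \<longlonglongrightarrow> 0 \<and>
          (\<forall>t\<in>{0..T}.
             (\<lambda>k::nat. \<integral>\<^sup>+\<omega>. ennreal ((norm (Y t \<omega> - simple_integral W (d k) t \<omega>))\<^sup>2) \<partial>M)
               \<longlonglongrightarrow> 0))"

section \<open>Coefficients\<close>

definition symmetric_matrix :: "real^'k^'k \<Rightarrow> bool" where
  "symmetric_matrix X \<longleftrightarrow> transpose X = X"

text \<open>The coefficient space \<open>L\<^sup>\<infinity>(0,T;H)\<close>, whose elements are required to be continuous; on the
  compact interval the bound on the essential supremum is then automatic.\<close>

definition Linf :: "real \<Rightarrow> (real \<Rightarrow> 'h::euclidean_space) set" where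
  "Linf T = {\<phi>. continuous_on {0..T} \<phi> \<and>
     esssup (restrict_space lborel {0..T}) (\<lambda>t. ereal (norm (\<phi> t))) < \<infinity>}"

definition Linf_sym :: "real \<Rightarrow> (real \<Rightarrow> real^'k^'k) set" where
  "Linf_sym T = {\<phi> \<in> Linf T. \<forall>t\<in>{0..T}. symmetric_matrix (\<phi> t)}"

text \<open>A problem is given by two values of the following record: \<open>P\<close> holds \<open>A, B, \<dots>, G\<close>
  and \<open>P'\<close> holds the mean-field coefficients (those with a tilde). A matrix in
  \<open>\<real>\<^bsup>k \<times> l\<^esup>\<close> has type \<open>real^'l^'k\<close>.\<close>

record ('n, 'm) lq_data =
  Aco :: "real \<Rightarrow> real^'n^'n"
  Bco :: "real \<Rightarrow> real^'m^'n"
  Cco :: "real \<Rightarrow> real^'n^'n"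
  Dco :: "real \<Rightarrow> real^'m^'n"
  Qco :: "real \<Rightarrow> real^'n^'n"
  Sco :: "real \<Rightarrow> real^'m^'n"
  Rco :: "real \<Rightarrow> real^'m^'m"
  Gco :: "real^'n^'n"

definition lq_coefficients :: "real \<Rightarrow> ('n::finite, 'm::finite) lq_data \<Rightarrow> bool" where
  "lq_coefficients T P \<longleftrightarrow>
     Aco P \<in> Linf T \<and> Bco P \<in> Linf T \<and> Cco P \<in> Linf T \<and> Dco P \<in> Linf T \<and>
     Qco P \<in> Linf_sym T \<and> Sco P \<in> Linf T \<and> Rco P \<in> Linf_sym T \<and>
     symmetric_matrix (Gco P)"

text \<open>The coefficients with a hat.\<close>

definition hat_data ::
    "('n::finite, 'm::finite) lq_data \<Rightarrow> ('n, 'm) lq_data \<Rightarrow> ('n, 'm) lq_data" where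
  "hat_data P P' =
     \<lparr> Aco = (\<lambda>t. Aco P t + Aco P' t), Bco = (\<lambda>t. Bco P t + Bco P' t),
       Cco = (\<lambda>t. Cco P t + Cco P' t), Dco = (\<lambda>t. Dco P t + Dco P' t),
       Qco = (\<lambda>t. Qco P t + Qco P' t), Sco = (\<lambda>t. Sco P t + Sco P' t),
       Rco = (\<lambda>t. Rco P t + Rco P' t), Gco = Gco P + Gco P' \<rparr>"

section \<open>State equation, cost functional, well-posedness\<close>

definition drift_term ::
    "'w measure \<Rightarrow> ('n::finite, 'm::finite) lq_data \<Rightarrow> ('n, 'm) lq_data \<Rightarrow>
     (real \<Rightarrow> 'w \<Rightarrow> real^'m) \<Rightarrow> (real \<Rightarrow> 'w \<Rightarrow> real^'n) \<Rightarrow> real \<Rightarrow> 'w \<Rightarrow> real^'n" where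
  "drift_term M P P' u X t \<omega> =
     Aco P t *v X t \<omega> + Aco P' t *v integral\<^sup>L M (X t) +
     Bco P t *v u t \<omega> + Bco P' t *v integral\<^sup>L M (u t)"

definition diffusion_term ::
    "'w measure \<Rightarrow> ('n::finite, 'm::finite) lq_data \<Rightarrow> ('n, 'm) lq_data \<Rightarrow>
     (real \<Rightarrow> 'w \<Rightarrow> real^'m) \<Rightarrow> (real \<Rightarrow> 'w \<Rightarrow> real^'n) \<Rightarrow> real \<Rightarrow> 'w \<Rightarrow> real^'n" where
  "diffusion_term M P P' u X t \<omega> =
     Cco P t *v X t \<omega> + Cco P' t *v integral\<^sup>L M (X t) +
     Dco P t *v u t \<omega> + Dco P' t *v integral\<^sup>L M (u t)"

definition is_state ::
    "'w measure \<Rightarrow> (real \<Rightarrow> 'w \<Rightarrow> real) \<Rightarrow> real \<Rightarrow>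
     ('n::finite, 'm::finite) lq_data \<Rightarrow> ('n, 'm) lq_data \<Rightarrow>
     real^'n \<Rightarrow> (real \<Rightarrow> 'w \<Rightarrow> real^'m) \<Rightarrow> (real \<Rightarrow> 'w \<Rightarrow> real^'n) \<Rightarrow> bool" where
  "is_state M W T P P' x u X \<longleftrightarrow>
     X \<in> L2F_C M (augmented_filtration M W) T \<and>
     (\<exists>Y. is_ito_integral M (augmented_filtration M W) W T (diffusion_term M P P' u X) Y \<and>
        (\<forall>t\<in>{0..T}. AE \<omega> in M.
           X t \<omega> = x + (LINT s:{0..t}|lborel. drift_term M P P' u X s \<omega>) + Y t \<omega>))"

definition admissible_controls ::
    "'w measure \<Rightarrow> (real \<Rightarrow> 'w \<Rightarrow> real) \<Rightarrow> real \<Rightarrow> (real \<Rightarrow> 'w \<Rightarrow> real^'m) set" where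
  "admissible_controls M W T = L2F M (augmented_filtration M W) T"

text \<open>The cost of the control \<open>u\<close> with state process \<open>X\<close>.\<close>

definition cost ::
    "'w measure \<Rightarrow> real \<Rightarrow> ('n::finite, 'm::finite) lq_data \<Rightarrow> ('n, 'm) lq_data \<Rightarrow>
     (real \<Rightarrow> 'w \<Rightarrow> real^'m) \<Rightarrow> (real \<Rightarrow> 'w \<Rightarrow> real^'n) \<Rightarrow> real" where
  "cost M T P P' u X =
     (LINT \<omega>|M.
        (LINT t:{0..T}|lborel.
           (Qco P t *v X t \<omega>) \<bullet> X t \<omega> +
           (Qco P' t *v integral\<^sup>L M (X t)) \<bullet> integral\<^sup>L M (X t) +
           2 * ((Sco P t *v u t \<omega>) \<bullet> X t \<omega>) +
           2 * ((Sco P' t *v integral\<^sup>L M (u t)) \<bullet> integral\<^sup>L M (X t)) +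
           (Rco P t *v u t \<omega>) \<bullet> u t \<omega> +
           (Rco P' t *v integral\<^sup>L M (u t)) \<bullet> integral\<^sup>L M (u t)) +
        (Gco P *v X T \<omega>) \<bullet> X T \<omega> +
        (Gco P' *v integral\<^sup>L M (X T)) \<bullet> integral\<^sup>L M (X T))"

text \<open>For \<open>u\<close> admissible the state process is unique up to indistinguishability and \<open>cost\<close> does not
  distinguish between its versions; hence the inner infimum, over the solutions \<open>X\<close> of the state
  equation, is that of the single value \<open>J(x;u)\<close>. The infimum is taken in the extended
  reals and is \<open>\<infinity>\<close> if there is no solution for any control.\<close>

definition value_function ::
    "'w measure \<Rightarrow> (real \<Rightarrow> 'w \<Rightarrow> real) \<Rightarrow> real \<Rightarrow>
     ('n::finite, 'm::finite) lq_data \<Rightarrow> ('n, 'm) lq_data \<Rightarrow> real^'n \<Rightarrow> ereal" where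
  "value_function M W T P P' x =
     (INF u \<in> admissible_controls M W T. INF X \<in> {X. is_state M W T P P' x u X}.
        ereal (cost M T P P' u X))"

definition well_posed ::
    "'w measure \<Rightarrow> (real \<Rightarrow> 'w \<Rightarrow> real) \<Rightarrow> real \<Rightarrow>
     ('n::finite, 'm::finite) lq_data \<Rightarrow> ('n, 'm) lq_data \<Rightarrow> bool" where
  "well_posed M W T P P' \<longleftrightarrow> (\<forall>x. \<bar>value_function M W T P P' x\<bar> \<noteq> \<infinity>)"

section \<open>Relaxed compensators\<close>

definition psd :: "real^'k^'k \<Rightarrow> bool" where
  "psd X \<longleftrightarrow> symmetric_matrix X \<and> (\<forall>v. 0 \<le> (X *v v) \<bullet> v)"

definition nonneg_on :: "real \<Rightarrow> (real \<Rightarrow> real^'k^'k) \<Rightarrow> bool" where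
  "nonneg_on T f \<longleftrightarrow> (AE t in lborel. t \<in> {0..T} \<longrightarrow> psd (f t))"

definition uniformly_pos_on :: "real \<Rightarrow> (real \<Rightarrow> real^'k^'k) \<Rightarrow> bool" where
  "uniformly_pos_on T f \<longleftrightarrow> (\<exists>\<delta>>0. nonneg_on T (\<lambda>t. f t - \<delta> *\<^sub>R mat 1))"

definition block ::
    "real^'a^'c \<Rightarrow> real^'b^'c \<Rightarrow> real^'a^'d \<Rightarrow> real^'b^'d \<Rightarrow> real^('a + 'b)^('c + 'd)" where
  "block X Y Z V = (\<chi> i j. case i of
       Inl k \<Rightarrow> (case j of Inl l \<Rightarrow> X $ k $ l | Inr l \<Rightarrow> Y $ k $ l)
     | Inr k \<Rightarrow> (case j of Inl l \<Rightarrow> Z $ k $ l | Inr l \<Rightarrow> V $ k $ l))"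

definition block_diag :: "real^'a^'c \<Rightarrow> real^'b^'d \<Rightarrow> real^('a + 'b)^('c + 'd)" where
  "block_diag X V = block X 0 0 V"

definition Lambda :: "real \<Rightarrow> (real \<Rightarrow> real^'n^'n) set" where
  "Lambda T = {F. (\<forall>t\<in>{0..T}. symmetric_matrix (F t)) \<and>
     (\<exists>f\<in>Linf_sym T. \<forall>t\<in>{0..T}. F t = F 0 + (LINT s:{0..t}|lborel. f s))}"

text \<open>The matrices without and with a hat are instances of one formula, in which \<open>L\<close> is the
  function entering through \<open>\<dot>L + LA + A\<^sup>\<top>L\<close> and \<open>LB\<close> and \<open>H\<close> the one between \<open>C\<close>, \<open>D\<close>:
  \<open>L = H\<close> and coefficients \<open>P\<close> without a hat, \<open>L = K\<close> and coefficients \<open>hat_data P P'\<close> with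
  a hat.\<close>

definition Q_comp ::
    "real \<Rightarrow> ('n::finite, 'm::finite) lq_data \<Rightarrow> (real \<Rightarrow> real^'n^'n) \<Rightarrow> (real \<Rightarrow> real^'n^'n) \<Rightarrow>
     real \<Rightarrow> real^'n^'n" where
  "Q_comp T P L H t =
     vector_derivative L (at t within {0..T}) + L t ** Aco P t + transpose (Aco P t) ** L t +
     transpose (Cco P t) ** H t ** Cco P t + Qco P t"

definition S_comp ::
    "('n::finite, 'm::finite) lq_data \<Rightarrow> (real \<Rightarrow> real^'n^'n) \<Rightarrow> (real \<Rightarrow> real^'n^'n) \<Rightarrow>
     real \<Rightarrow> real^'m^'n" where
  "S_comp P L H t = L t ** Bco P t + transpose (Cco P t) ** H t ** Dco P t + Sco P t"

definition R_comp ::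
    "('n::finite, 'm::finite) lq_data \<Rightarrow> (real \<Rightarrow> real^'n^'n) \<Rightarrow> real \<Rightarrow> real^'m^'m" where
  "R_comp P H t = transpose (Dco P t) ** H t ** Dco P t + Rco P t"

definition G_comp ::
    "real \<Rightarrow> ('n::finite, 'm::finite) lq_data \<Rightarrow> (real \<Rightarrow> real^'n^'n) \<Rightarrow> real^'n^'n" where
  "G_comp T P L = Gco P - L T"

definition relaxed_compensator ::
    "real \<Rightarrow> ('n::finite, 'm::finite) lq_data \<Rightarrow> ('n, 'm) lq_data \<Rightarrow>
     (real \<Rightarrow> real^'n^'n) \<Rightarrow> (real \<Rightarrow> real^'n^'n) \<Rightarrow> bool" where
  "relaxed_compensator T P P' H K \<longleftrightarrow>
     H \<in> Lambda T \<and> K \<in> Lambda T \<and>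
     (let Ph = hat_data P P';
          QQ = (\<lambda>t. block_diag (Q_comp T P H H t) (Q_comp T Ph K H t));
          SS = (\<lambda>t. block_diag (S_comp P H H t) (S_comp Ph K H t));
          RR = (\<lambda>t. block_diag (R_comp P H t) (R_comp Ph H t));
          GG = block_diag (G_comp T P H) (G_comp T Ph K)
      in nonneg_on T (\<lambda>t. block (QQ t) (SS t) (transpose (SS t)) (RR t)) \<and>
         uniformly_pos_on T RR \<and> psd GG)"

end

theory Submission
  imports Defs
begin

text \<open>
  Write \<open>m = E X\<close>. For a state \<open>X\<close> with control \<open>u\<close>, Ito's formula in expectation for
  \<open>\<langle>H X, X\<rangle> + \<langle>(K - H) m, m\<rangle>\<close> turns the cost into \<open>\<langle>K(0) x, x\<rangle>\<close>
  plus the expectation of the compensated quadratic forms, evaluated at the centred pair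
  \<open>(X - E X, u - E u)\<close> and at the means \<open>(E X, E u)\<close>; the compensator makes these forms
  nonnegative, so \<open>\<langle>K(0) x, x\<rangle>\<close> bounds the value from below. Only second moments of
  \<open>X\<close> enter, hence Ito's formula reduces to the Ito isometry, the martingale property and Fubini.

  The value is also below \<open>\<infinity>\<close>, which requires a solution of the state equation for at
  least one control. For \<open>u = 0\<close> it is the limit of Picard iterates, whose stochastic integrals
  have continuous versions by the maximal inequality.
\<close>

section \<open>Square-integrable functions\<close>

text \<open>Two functions are needed because the mean and the fluctuation obey different equations.
  Put X0 = X - E X. Cross terms of X0 with the mean have expectation 0, so the expected test
  quantity equals E <H X0, X0> + <K m, m>. The centred part starts at 0 and the mean at x, so only
  K(0) survives in the bound. The mean carries no noise: the diffusion evaluated at the means drives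
  X0, so it is weighted by H, not by K, in the hatted matrices.

  The definition of the Ito integral shapes the rest. It fixes each Y t only up to a null set and
  gives Y neither continuous paths nor joint measurability in time and sample point. Hence the
  martingale property is used in weak form, as orthogonality to square-integrable
  \<open>F s\<close>-measurable variables, and under time integrals Y is replaced by X - x minus the
  drift integral. Existence meets the reverse difficulty: a state must be progressive with
  continuous paths, so L2 convergence at each time is raised to uniform convergence of paths by the
  maximal inequality, at geometric rates.\<close>

definition sq_int :: "'a measure \<Rightarrow> ('a \<Rightarrow> 'h::euclidean_space) \<Rightarrow> bool" where
  "sq_int M f \<longleftrightarrow> f \<in> borel_measurable M \<and> integrable M (\<lambda>x. (norm (f x))\<^sup>2)"

text \<open>The extended value makes sense before finiteness is known, and it is the form in which
  the definition of the Ito integral states its convergences. Bochner integrals of products rely on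
  \<open>sq_int\<close> instead.\<close>

definition nsq :: "'a measure \<Rightarrow> ('a \<Rightarrow> 'h::euclidean_space) \<Rightarrow> ennreal" where
  "nsq M f = (\<integral>\<^sup>+x. ennreal ((norm (f x))\<^sup>2) \<partial>M)"

lemma sq_int_measurable: "sq_int M f \<Longrightarrow> f \<in> borel_measurable M"
  by (simp add: sq_int_def)

lemma sq_int_iff_nsq: "sq_int M f \<longleftrightarrow> f \<in> borel_measurable M \<and> nsq M f < \<infinity>"
  unfolding sq_int_def nsq_def by (auto simp: integrable_iff_bounded)

lemma nsq_eq_integral: "sq_int M f \<Longrightarrow> nsq M f = ennreal (\<integral>x. (norm (f x))\<^sup>2 \<partial>M)"
  unfolding sq_int_def nsq_def by (intro nn_integral_eq_integral) auto

text \<open>Squared norms are kept in place of Minkowski's inequality; each splitting of a sum then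
  costs a factor 2, the origin of many constants below.\<close>

lemma norm_add_sq_le: "(norm (x + y))\<^sup>2 \<le> 2 * (norm x)\<^sup>2 + 2 * (norm (y::'h::real_normed_vector))\<^sup>2"
proof -
  have "(norm (x + y))\<^sup>2 \<le> (norm x + norm y)\<^sup>2"
    by (intro power_mono norm_triangle_ineq) auto
  also have "\<dots> \<le> 2 * (norm x)\<^sup>2 + 2 * (norm y)\<^sup>2"
    using sum_squares_bound[of "norm x" "norm y"] by (simp add: power2_sum)
  finally show ?thesis .
qed

lemma nsq_add_le:
  assumes [measurable]: "f \<in> borel_measurable M" "g \<in> borel_measurable M"
  shows "nsq M (\<lambda>x. f x + g x) \<le> 2 * nsq M f + 2 * nsq M g"
proof -
  have "nsq M (\<lambda>x. f x + g x) \<le> (\<integral>\<^sup>+x. 2 * ennreal ((norm (f x))\<^sup>2) + 2 * ennreal ((norm (g x))\<^sup>2) \<partial>M)"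
    unfolding nsq_def
  proof (intro nn_integral_mono)
    fix x
    have "ennreal ((norm (f x + g x))\<^sup>2) \<le> ennreal (2 * (norm (f x))\<^sup>2 + 2 * (norm (g x))\<^sup>2)"
      by (intro ennreal_leI norm_add_sq_le)
    also have "\<dots> = 2 * ennreal ((norm (f x))\<^sup>2) + 2 * ennreal ((norm (g x))\<^sup>2)"
      by (simp add: ennreal_plus ennreal_mult)
    finally show "ennreal ((norm (f x + g x))\<^sup>2)
        \<le> 2 * ennreal ((norm (f x))\<^sup>2) + 2 * ennreal ((norm (g x))\<^sup>2)" .
  qed
  also have "\<dots> = 2 * nsq M f + 2 * nsq M g"
    unfolding nsq_def by (simp add: nn_integral_add nn_integral_cmult)
  finally show ?thesis .
qed

lemma nsq_uminus: "nsq M (\<lambda>x. - f x) = nsq M f"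
  by (simp add: nsq_def)

lemma nsq_diff_le:
  assumes "f \<in> borel_measurable M" "g \<in> borel_measurable M"
  shows "nsq M (\<lambda>x. f x - g x) \<le> 2 * nsq M f + 2 * nsq M g"
  using nsq_add_le[OF assms(1), of "\<lambda>x. - g x"] assms(2) by (simp add: nsq_uminus)

lemma ennreal_two_mult_less_top: "a < \<infinity> \<Longrightarrow> b < \<infinity> \<Longrightarrow> 2 * a + 2 * (b::ennreal) < \<infinity>"
  by (simp add: ennreal_mult_less_top)

lemma sq_int_add: "sq_int M f \<Longrightarrow> sq_int M g \<Longrightarrow> sq_int M (\<lambda>x. f x + g x)"
  unfolding sq_int_iff_nsq
  using ennreal_two_mult_less_top[of "nsq M f" "nsq M g"] nsq_add_le[of f M g]
  by (auto intro: le_less_trans)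

lemma sq_int_bounded_linear:
  assumes "bounded_linear L" "sq_int M f"
  shows "sq_int M (\<lambda>x. L (f x))"
proof -
  obtain K where K: "\<And>x. norm (L x) \<le> norm x * K" "0 < K"
    using bounded_linear.pos_bounded[OF assms(1)] by blast
  have [measurable]: "f \<in> borel_measurable M" "L \<in> borel_measurable borel"
    using assms by (auto simp: sq_int_def intro!: borel_measurable_continuous_onI
        linear_continuous_on)
  show ?thesis
    unfolding sq_int_def
  proof
    show "(\<lambda>x. L (f x)) \<in> borel_measurable M" by simp
    show "integrable M (\<lambda>x. (norm (L (f x)))\<^sup>2)"
    proof (rule Bochner_Integration.integrable_bound)
      show "integrable M (\<lambda>x. K\<^sup>2 * (norm (f x))\<^sup>2)" using assms(2) by (auto simp: sq_int_def)
      show "AE x in M. norm ((norm (L (f x)))\<^sup>2) \<le> norm (K\<^sup>2 * (norm (f x))\<^sup>2)"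
        using K(1) by (auto simp: power_mult_distrib[symmetric] mult.commute intro!: power_mono)
    qed simp
  qed
qed

lemma sq_int_uminus: "sq_int M f \<Longrightarrow> sq_int M (\<lambda>x. - f x)"
  by (simp add: sq_int_def)

lemma sq_int_diff: "sq_int M f \<Longrightarrow> sq_int M g \<Longrightarrow> sq_int M (\<lambda>x. f x - g x)"
  using sq_int_add[of M f "\<lambda>x. - g x"] sq_int_uminus[of M g] by simp

lemma sq_int_zero [simp]: "sq_int M (\<lambda>x. 0)"
  by (simp add: sq_int_def)

lemma sq_int_sum: "(\<And>i. i \<in> I \<Longrightarrow> sq_int M (f i)) \<Longrightarrow> sq_int M (\<lambda>x. \<Sum>i\<in>I. f i x)"
  by (induction I rule: infinite_finite_induct) (auto intro: sq_int_add)

lemma (in finite_measure) sq_int_const [simp]: "sq_int M (\<lambda>x. c)"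
  by (simp add: sq_int_def)

lemma (in finite_measure) sq_int_of_bounded:
  assumes "f \<in> borel_measurable M" "\<And>x. x \<in> space M \<Longrightarrow> norm (f x) \<le> c"
  shows "sq_int M f"
  unfolding sq_int_def
proof
  show "integrable M (\<lambda>x. (norm (f x))\<^sup>2)"
    by (rule integrable_const_bound[of _ "c\<^sup>2"]) (use assms in \<open>auto intro!: AE_I2 power_mono\<close>)
qed fact

lemma inner_le_norm_sq: "\<bar>x \<bullet> y\<bar> \<le> (norm x)\<^sup>2 + (norm (y::'h::euclidean_space))\<^sup>2"
proof -
  have "\<bar>x \<bullet> y\<bar> \<le> norm x * norm y" by (rule Cauchy_Schwarz_ineq2)
  also have "\<dots> \<le> (norm x)\<^sup>2 + (norm y)\<^sup>2"
    using sum_squares_bound[of "norm x" "norm y"] zero_le_power2[of "norm x"] zero_le_power2[of "norm y"]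
      mult_nonneg_nonneg[OF norm_ge_zero[of x] norm_ge_zero[of y]] by linarith
  finally show ?thesis .
qed

lemma sq_int_inner:
  assumes "sq_int M f" "sq_int M g"
  shows "integrable M (\<lambda>x. f x \<bullet> g x)"
proof (rule Bochner_Integration.integrable_bound)
  show "integrable M (\<lambda>x. (norm (f x))\<^sup>2 + (norm (g x))\<^sup>2)" using assms by (auto simp: sq_int_def)
  show "(\<lambda>x. f x \<bullet> g x) \<in> borel_measurable M" using assms by (auto simp: sq_int_def)
qed (use inner_le_norm_sq in \<open>auto intro!: AE_I2 simp: abs_of_nonneg\<close>)

lemma sq_int_mult:
  fixes f g :: "'a \<Rightarrow> real"
  shows "sq_int M f \<Longrightarrow> sq_int M g \<Longrightarrow> integrable M (\<lambda>x. f x * g x)"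
  using sq_int_inner[of M f g] by simp

lemma (in finite_measure) sq_int_integrable:
  assumes "sq_int M f"
  shows "integrable M f"
proof (rule Bochner_Integration.integrable_bound)
  show "integrable M (\<lambda>x. 1 + (norm (f x))\<^sup>2)" using assms by (auto simp: sq_int_def)
  have "norm y \<le> 1 + (norm y)\<^sup>2" for y :: 'b
    using sum_squares_bound[of "norm y" 1] by (simp add: power2_eq_square) (metis add.commute add_increasing2 dual_order.trans linear mult_right_mono mult.left_neutral norm_ge_zero zero_le_mult_iff)
  then show "AE x in M. norm (f x) \<le> norm (1 + (norm (f x))\<^sup>2)" by auto
qed (use assms in \<open>auto simp: sq_int_def\<close>)

text \<open>The pointwise inequality reduces inner products to products of norms, for which the
  inequality for nonnegative integrals is available; finiteness of the right side brings it back to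
  Bochner integrals.\<close>

lemma sq_int_Cauchy_Schwarz:
  assumes f: "sq_int M f" and g: "sq_int M g"
  shows "\<bar>\<integral>x. f x \<bullet> g x \<partial>M\<bar> \<le> sqrt (\<integral>x. (norm (f x))\<^sup>2 \<partial>M) * sqrt (\<integral>x. (norm (g x))\<^sup>2 \<partial>M)"
proof -
  have [measurable]: "f \<in> borel_measurable M" "g \<in> borel_measurable M"
    using assms by (auto simp: sq_int_def)
  have int: "integrable M (\<lambda>x. norm (f x) * norm (g x))"
    using sq_int_mult[of M "\<lambda>x. norm (f x)" "\<lambda>x. norm (g x)"] assms by (auto simp: sq_int_def)
  let ?I = "\<integral>x. norm (f x) * norm (g x) \<partial>M"
  have "\<bar>\<integral>x. f x \<bullet> g x \<partial>M\<bar> \<le> (\<integral>x. \<bar>f x \<bullet> g x\<bar> \<partial>M)" by (rule integral_abs_bound)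
  also have "\<dots> \<le> ?I"
    by (intro integral_mono int integrable_abs sq_int_inner f g Cauchy_Schwarz_ineq2)
  also have "?I \<le> sqrt (\<integral>x. (norm (f x))\<^sup>2 \<partial>M) * sqrt (\<integral>x. (norm (g x))\<^sup>2 \<partial>M)"
  proof -
    have "ennreal (?I\<^sup>2) = (\<integral>\<^sup>+x. ennreal (norm (f x)) * ennreal (norm (g x)) \<partial>M)\<^sup>2"
      by (subst ennreal_power[symmetric])
         (auto simp: ennreal_mult[symmetric] nn_integral_eq_integral[OF int] intro!: integral_nonneg_AE)
    also have "\<dots> \<le> (\<integral>\<^sup>+x. (ennreal (norm (f x)))\<^sup>2 \<partial>M) * (\<integral>\<^sup>+x. (ennreal (norm (g x)))\<^sup>2 \<partial>M)"
      by (rule Cauchy_Schwarz_nn_integral) simp_all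
    also have "\<dots> = nsq M f * nsq M g" by (simp add: nsq_def ennreal_power)
    also have "\<dots> = ennreal ((\<integral>x. (norm (f x))\<^sup>2 \<partial>M) * (\<integral>x. (norm (g x))\<^sup>2 \<partial>M))"
      by (simp add: nsq_eq_integral f g ennreal_mult)
    finally have "?I\<^sup>2 \<le> (\<integral>x. (norm (f x))\<^sup>2 \<partial>M) * (\<integral>x. (norm (g x))\<^sup>2 \<partial>M)"
      by (subst (asm) ennreal_le_iff) (auto intro!: mult_nonneg_nonneg integral_nonneg_AE)
    then show ?thesis
      by (metis real_le_rsqrt real_sqrt_mult)
  qed
  finally show ?thesis .
qed

lemma nsq_tendsto_imp_integral:
  assumes "\<And>k. sq_int M (f k)" "(\<lambda>k. nsq M (f k)) \<longlonglongrightarrow> 0"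
  shows "(\<lambda>k. \<integral>x. (norm (f k x))\<^sup>2 \<partial>M) \<longlonglongrightarrow> 0"
proof -
  have "(\<lambda>k. enn2real (nsq M (f k))) \<longlonglongrightarrow> 0"
    using tendsto_enn2real[of "\<lambda>k. nsq M (f k)" 0] assms(2) by simp
  then show ?thesis by (simp add: nsq_eq_integral assms(1) integral_nonneg_AE)
qed

text \<open>One approximant at finite distance from \<open>g\<close> suffices: \<open>g\<close> is
  the sum of that approximant and the difference.\<close>

lemma sq_int_limit:
  assumes "\<And>k. sq_int M (f k)" "g \<in> borel_measurable M" "(\<lambda>k. nsq M (\<lambda>x. g x - f k x)) \<longlonglongrightarrow> 0"
  shows "sq_int M g"
proof -
  have "eventually (\<lambda>k. nsq M (\<lambda>x. g x - f k x) < 1) sequentially"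
    using assms(3) by (rule order_tendstoD) simp
  then obtain k where k: "nsq M (\<lambda>x. g x - f k x) < 1" by (auto simp: eventually_sequentially)
  then have "sq_int M (\<lambda>x. g x - f k x)"
    using assms(1,2) by (simp add: sq_int_iff_nsq less_trans[OF k] borel_measurable_diff)
  from sq_int_add[OF this assms(1)[of k]] show ?thesis by simp
qed

text \<open>Up to signs the error is the sum of the products of f' - f k with g' - g k, of f' - f k
  with g', and of f' with g' - g k; Cauchy-Schwarz sends each to 0. The isometry and the martingale
  property pass from simple to general integrands through this continuity.\<close>

lemma tendsto_integral_inner:
  assumes f: "\<And>k. sq_int M (f k)" "sq_int M f'" "(\<lambda>k. nsq M (\<lambda>x. f' x - f k x)) \<longlonglongrightarrow> 0"
  assumes g: "\<And>k. sq_int M (g k)" "sq_int M g'" "(\<lambda>k. nsq M (\<lambda>x. g' x - g k x)) \<longlonglongrightarrow> 0"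
  shows "(\<lambda>k. \<integral>x. f k x \<bullet> g k x \<partial>M) \<longlonglongrightarrow> (\<integral>x. f' x \<bullet> g' x \<partial>M)"
proof -
  define a where "a k = sqrt (\<integral>x. (norm (f' x - f k x))\<^sup>2 \<partial>M)" for k
  define b where "b k = sqrt (\<integral>x. (norm (g' x - g k x))\<^sup>2 \<partial>M)" for k
  define A where "A = sqrt (\<integral>x. (norm (f' x))\<^sup>2 \<partial>M)"
  define B where "B = sqrt (\<integral>x. (norm (g' x))\<^sup>2 \<partial>M)"
  note df = sq_int_diff[OF f(2,1)] and dg = sq_int_diff[OF g(2,1)]
  have a: "a \<longlonglongrightarrow> 0" and b: "b \<longlonglongrightarrow> 0"
    unfolding a_def b_def
    using tendsto_real_sqrt[OF nsq_tendsto_imp_integral[OF df f(3)]]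
      tendsto_real_sqrt[OF nsq_tendsto_imp_integral[OF dg g(3)]] by simp_all
  have "norm ((\<integral>x. f k x \<bullet> g k x \<partial>M) - (\<integral>x. f' x \<bullet> g' x \<partial>M)) \<le> a k * b k + a k * B + A * b k" for k
  proof -
    have "(\<integral>x. f k x \<bullet> g k x \<partial>M) - (\<integral>x. f' x \<bullet> g' x \<partial>M)
        = (\<integral>x. (f' x - f k x) \<bullet> (g' x - g k x) \<partial>M) - (\<integral>x. (f' x - f k x) \<bullet> g' x \<partial>M)
          - (\<integral>x. f' x \<bullet> (g' x - g k x) \<partial>M)"
      using f(1)[of k] f(2) g(1)[of k] g(2)
      by (simp add: inner_diff_left inner_diff_right sq_int_inner)
    then show ?thesis
      using sq_int_Cauchy_Schwarz[OF df dg, of k k] sq_int_Cauchy_Schwarz[OF df g(2), of k]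
        sq_int_Cauchy_Schwarz[OF f(2) dg, of k] unfolding a_def b_def A_def B_def by simp
  qed
  moreover have "(\<lambda>k. a k * b k + a k * B + A * b k) \<longlonglongrightarrow> 0"
    using tendsto_add[OF tendsto_add[OF tendsto_mult[OF a b] tendsto_mult_right[OF a, of B]]
        tendsto_mult_left[OF b, of A]] by simp
  ultimately have "(\<lambda>k. (\<integral>x. f k x \<bullet> g k x \<partial>M) - (\<integral>x. f' x \<bullet> g' x \<partial>M)) \<longlonglongrightarrow> 0"
    by (rule Lim_null_comparison[OF always_eventually[rule_format]])
  then show ?thesis by (rule LIM_zero_cancel)
qed

lemma tendsto_nsq:
  assumes "\<And>k. sq_int M (f k)" "sq_int M f'" "(\<lambda>k. nsq M (\<lambda>x. f' x - f k x)) \<longlonglongrightarrow> 0"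
  shows "(\<lambda>k. nsq M (f k)) \<longlonglongrightarrow> nsq M f'"
  using tendsto_integral_inner[OF assms assms]
  by (simp add: nsq_eq_integral assms(1,2) power2_norm_eq_inner)

section \<open>Brownian motion and its filtration\<close>

text \<open>The filtration is kept abstract, with the consequences of its construction as axioms.
  \<open>null_sets_filtration\<close> is what augmentation provides: limits may be redefined on null
  sets without loss of adaptedness.\<close>

locale brownian_filtration = prob_space M for M :: "'w measure" +
  fixes F :: "real \<Rightarrow> 'w measure" and W :: "real \<Rightarrow> 'w \<Rightarrow> real"
  assumes subalg: "0 \<le> t \<Longrightarrow> subalgebra M (F t)"
    and filtration_mono: "0 \<le> s \<Longrightarrow> s \<le> t \<Longrightarrow> sets (F s) \<subseteq> sets (F t)"
    and null_sets_filtration: "0 \<le> t \<Longrightarrow> null_sets M \<subseteq> sets (F t)"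
    and W_adapted: "0 \<le> t \<Longrightarrow> W t \<in> borel_measurable (F t)"
    and W_cont: "AE \<omega> in M. continuous_on {0..} (\<lambda>t. W t \<omega>)"
    and W_dist: "0 \<le> s \<Longrightarrow> s < t \<Longrightarrow>
      distributed M lborel (\<lambda>\<omega>. W t \<omega> - W s \<omega>) (normal_density 0 (sqrt (t - s)))"
    and W_indep: "0 \<le> s \<Longrightarrow> s < t \<Longrightarrow>
      indep_set (sets (F s)) (sets (vimage_algebra (space M) (\<lambda>\<omega>. W t \<omega> - W s \<omega>) borel))"
begin

lemma space_filtration: "0 \<le> t \<Longrightarrow> space (F t) = space M"
  using subalg[of t] by (simp add: subalgebra_def)

lemma measurable_filtration_M: "0 \<le> t \<Longrightarrow> f \<in> measurable (F t) N \<Longrightarrow> f \<in> measurable M N"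
  using measurable_from_subalg[OF subalg] by blast

lemma measurable_filtration_mono:
  "0 \<le> s \<Longrightarrow> s \<le> t \<Longrightarrow> f \<in> measurable (F s) N \<Longrightarrow> f \<in> measurable (F t) N"
  by (rule measurable_mono[THEN subsetD, of N N "F s" "F t"])
     (auto simp: space_filtration filtration_mono)

lemma W_measurable: "0 \<le> t \<Longrightarrow> W t \<in> borel_measurable M"
  using W_adapted measurable_filtration_M by blast

text \<open>Moments of a centred Gaussian of variance t - s, read off from its density; s = t is
  separate because the density is given for s < t only.\<close>

lemma increment_integrable:
  assumes "0 \<le> s" "s \<le> t"
  shows "integrable M (\<lambda>\<omega>. W t \<omega> - W s \<omega>)" "(\<integral>\<omega>. W t \<omega> - W s \<omega> \<partial>M) = 0"
    "integrable M (\<lambda>\<omega>. (W t \<omega> - W s \<omega>)\<^sup>2)" "(\<integral>\<omega>. (W t \<omega> - W s \<omega>)\<^sup>2 \<partial>M) = t - s"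
proof -
  consider "s = t" | "s < t" using assms by linarith
  then have "integrable M (\<lambda>\<omega>. W t \<omega> - W s \<omega>) \<and> (\<integral>\<omega>. W t \<omega> - W s \<omega> \<partial>M) = 0 \<and>
    integrable M (\<lambda>\<omega>. (W t \<omega> - W s \<omega>)\<^sup>2) \<and> (\<integral>\<omega>. (W t \<omega> - W s \<omega>)\<^sup>2 \<partial>M) = t - s"
  proof cases
    case 2
    define \<sigma> where "\<sigma> = sqrt (t - s)"
    have \<sigma>: "0 < \<sigma>" "\<sigma>\<^sup>2 = t - s" using 2 by (auto simp: \<sigma>_def)
    note D = W_dist[OF assms(1) 2, folded \<sigma>_def]
    have nn: "\<And>x. 0 \<le> normal_density 0 \<sigma> x" by simp
    have i1: "integrable M (\<lambda>\<omega>. W t \<omega> - W s \<omega>)"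
      using distributed_integrable[OF D, of "\<lambda>x. x"] integrable_normal_moment[OF \<sigma>(1), of 0 1] nn by simp
    have e1: "(\<integral>\<omega>. W t \<omega> - W s \<omega> \<partial>M) = 0"
      using distributed_integral[OF D, of "\<lambda>x. x"] integral_normal_moment_odd[OF \<sigma>(1), of 0 0] nn by simp
    have i2: "integrable M (\<lambda>\<omega>. (W t \<omega> - W s \<omega>)\<^sup>2)"
      using distributed_integrable[OF D, of "\<lambda>x. x\<^sup>2"] integrable_normal_moment[OF \<sigma>(1), of 0 2] nn by simp
    have e2: "(\<integral>\<omega>. (W t \<omega> - W s \<omega>)\<^sup>2 \<partial>M) = t - s"
      using distributed_integral[OF D, of "\<lambda>x. x\<^sup>2"] integral_normal_moment_even[OF \<sigma>(1), of 0 1] nn \<sigma>(2)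
      by (simp add: fact_2)
    from i1 e1 i2 e2 show ?thesis by simp
  qed simp
  then show "integrable M (\<lambda>\<omega>. W t \<omega> - W s \<omega>)" "(\<integral>\<omega>. W t \<omega> - W s \<omega> \<partial>M) = 0"
    "integrable M (\<lambda>\<omega>. (W t \<omega> - W s \<omega>)\<^sup>2)" "(\<integral>\<omega>. (W t \<omega> - W s \<omega>)\<^sup>2 \<partial>M) = t - s" by auto
qed

text \<open>Independence is given for \<open>F s\<close> and the \<sigma>-algebra of the increment;
  those generated by \<open>\<zeta>\<close> and by \<open>g\<close> of the increment are contained
  in them. Below \<open>g\<close> is the identity or the square.\<close>

lemma increment_indep_var:
  assumes "0 \<le> s" "s < t" "\<zeta> \<in> borel_measurable (F s)" "g \<in> borel_measurable borel"
  shows "indep_var borel \<zeta> borel (\<lambda>\<omega>. g (W t \<omega> - W s \<omega>) :: real)"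
  unfolding indep_var_eq
proof (intro conjI)
  have [measurable]: "\<zeta> \<in> borel_measurable M" "W t \<in> borel_measurable M" "W s \<in> borel_measurable M"
    "g \<in> borel_measurable borel"
    using assms W_measurable[of t] W_measurable[of s] measurable_filtration_M by auto
  show "random_variable borel \<zeta>" "random_variable borel (\<lambda>\<omega>. g (W t \<omega> - W s \<omega>))" by simp_all
  let ?D = "\<lambda>\<omega>. W t \<omega> - W s \<omega>"
  let ?V = "vimage_algebra (space M) ?D borel"
  have "sigma_sets (space M) {\<zeta> -` A \<inter> space M |A. A \<in> sets borel} \<subseteq> sets (F s)"
    using measurable_sets[OF assms(3)] space_filtration[OF assms(1)] sets.top[of "F s"]
    by (intro sets.sigma_sets_subset'[of _ "F s", simplified]) auto
  moreover have "?D \<in> measurable ?V borel" by (rule measurable_vimage_algebra1) simp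
  then have "(\<lambda>\<omega>. g (?D \<omega>)) \<in> borel_measurable ?V" by simp
  then have "sigma_sets (space M) {(\<lambda>\<omega>. g (?D \<omega>)) -` A \<inter> space M |A. A \<in> sets borel} \<subseteq> sets ?V"
    using sets.top[of ?V] by (intro sets.sigma_sets_subset'[of _ ?V, simplified]) (auto dest: measurable_sets)
  ultimately show "indep_set (sigma_sets (space M) {\<zeta> -` A \<inter> space M |A. A \<in> sets borel})
     (sigma_sets (space M) {(\<lambda>\<omega>. g (?D \<omega>)) -` A \<inter> space M |A. A \<in> sets borel})"
    using W_indep[OF assms(1,2)] unfolding indep_sets2_eq by (meson order_trans subsetD)
qed

text \<open>Given \<open>F s\<close>, the increment has conditional mean 0 and conditional variance
  t - s; testing with \<open>\<zeta>\<close> expresses this without conditional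
  expectations.\<close>

lemma increment_moments:
  fixes \<zeta> :: "'w \<Rightarrow> real"
  assumes "0 \<le> s" "s \<le> t" "\<zeta> \<in> borel_measurable (F s)" "integrable M \<zeta>"
  shows "integrable M (\<lambda>\<omega>. \<zeta> \<omega> * (W t \<omega> - W s \<omega>))" "(\<integral>\<omega>. \<zeta> \<omega> * (W t \<omega> - W s \<omega>) \<partial>M) = 0"
    "integrable M (\<lambda>\<omega>. \<zeta> \<omega> * (W t \<omega> - W s \<omega>)\<^sup>2)"
    "(\<integral>\<omega>. \<zeta> \<omega> * (W t \<omega> - W s \<omega>)\<^sup>2 \<partial>M) = (t - s) * (\<integral>\<omega>. \<zeta> \<omega> \<partial>M)"
proof -
  consider "s = t" | "s < t" using assms by linarith
  then have "integrable M (\<lambda>\<omega>. \<zeta> \<omega> * (W t \<omega> - W s \<omega>)) \<and> (\<integral>\<omega>. \<zeta> \<omega> * (W t \<omega> - W s \<omega>) \<partial>M) = 0 \<and>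
    integrable M (\<lambda>\<omega>. \<zeta> \<omega> * (W t \<omega> - W s \<omega>)\<^sup>2) \<and>
    (\<integral>\<omega>. \<zeta> \<omega> * (W t \<omega> - W s \<omega>)\<^sup>2 \<partial>M) = (t - s) * (\<integral>\<omega>. \<zeta> \<omega> \<partial>M)"
  proof cases
    case 2
    note I1 = increment_indep_var[OF assms(1) 2 assms(3), of "\<lambda>x. x", simplified]
    note I2 = increment_indep_var[OF assms(1) 2 assms(3), of "\<lambda>x. x\<^sup>2", simplified]
    note inc = increment_integrable[OF assms(1,2)]
    show ?thesis
      using indep_var_integrable[OF I1 assms(4) inc(1)] indep_var_lebesgue_integral[OF I1 assms(4) inc(1)]
        indep_var_integrable[OF I2 assms(4) inc(3)] indep_var_lebesgue_integral[OF I2 assms(4) inc(3)]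
        inc(2,4) by (simp add: mult.commute)
  qed simp
  then show "integrable M (\<lambda>\<omega>. \<zeta> \<omega> * (W t \<omega> - W s \<omega>))" "(\<integral>\<omega>. \<zeta> \<omega> * (W t \<omega> - W s \<omega>) \<partial>M) = 0"
    "integrable M (\<lambda>\<omega>. \<zeta> \<omega> * (W t \<omega> - W s \<omega>)\<^sup>2)"
    "(\<integral>\<omega>. \<zeta> \<omega> * (W t \<omega> - W s \<omega>)\<^sup>2 \<partial>M) = (t - s) * (\<integral>\<omega>. \<zeta> \<omega> \<partial>M)" by auto
qed

text \<open>With a \<le> a', the first increment is cut at a'. Its part up to a' is known at time a'
  and pairs to 0 with the second increment. The rest starts at a' like the second increment, and
  only their common stretch contributes, by its length. The last integrability is a hypothesis
  because \<open>\<zeta>\<close> times an increment is unbounded.\<close>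

lemma overlap_aux:
  fixes \<zeta> :: "'w \<Rightarrow> real"
  assumes "0 \<le> a" "a \<le> b" "a \<le> a'" "a' \<le> b'"
    and \<zeta>: "\<zeta> \<in> borel_measurable (F a')" "integrable M \<zeta>" "integrable M (\<lambda>\<omega>. \<zeta> \<omega> * (W (min b a') \<omega> - W a \<omega>))"
  shows "integrable M (\<lambda>\<omega>. \<zeta> \<omega> * (W b \<omega> - W a \<omega>) * (W b' \<omega> - W a' \<omega>)) \<and>
    (\<integral>\<omega>. \<zeta> \<omega> * (W b \<omega> - W a \<omega>) * (W b' \<omega> - W a' \<omega>) \<partial>M) = max 0 (min b b' - a') * (\<integral>\<omega>. \<zeta> \<omega> \<partial>M)"
proof -
  have adW: "W r \<in> borel_measurable (F q)" if "0 \<le> r" "r \<le> q" for r q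
    using measurable_filtration_mono[OF that W_adapted] that by auto
  have 1: "integrable M (\<lambda>\<omega>. \<zeta> \<omega> * (W (min b a') \<omega> - W a \<omega>) * (W b' \<omega> - W a' \<omega>))"
    "(\<integral>\<omega>. \<zeta> \<omega> * (W (min b a') \<omega> - W a \<omega>) * (W b' \<omega> - W a' \<omega>) \<partial>M) = 0"
    using increment_moments(1,2)[of a' b' "\<lambda>\<omega>. \<zeta> \<omega> * (W (min b a') \<omega> - W a \<omega>)"]
      assms adW[of "min b a'" a'] adW[of a a'] by auto
  show ?thesis
  proof (cases "b \<le> a'")
    case True
    then show ?thesis using 1 by (simp add: min_absorb1 max_def)
  next
    case False
    \<comment> \<open>The two increments run together up to \<open>c\<close>; from \<open>c\<close>
      to \<open>d\<close> only one of them continues, and this excess has mean 0 given the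
      past.\<close>
    define c d where "c = min b b'" and "d = max b b'"
    have cd: "a' \<le> c" "c \<le> d" "{c, d} = {b, b'}" using False assms by (auto simp: c_def d_def)
    have prod: "(W b \<omega> - W a' \<omega>) * (W b' \<omega> - W a' \<omega>) =
        (W c \<omega> - W a' \<omega>)\<^sup>2 + (W c \<omega> - W a' \<omega>) * (W d \<omega> - W c \<omega>)" for \<omega>
      by (cases "b \<le> b'") (auto simp: c_def d_def algebra_simps power2_eq_square)
    note i2 = increment_moments[of a' c \<zeta>, OF _ cd(1) \<zeta>(1,2)]
    have "(\<lambda>\<omega>. \<zeta> \<omega> * (W c \<omega> - W a' \<omega>)) \<in> borel_measurable (F c)"
      using measurable_filtration_mono[OF _ cd(1) \<zeta>(1)] adW[of c c] adW[of a' c] assms cd by auto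
    note i3 = increment_moments(1,2)[OF _ cd(2) this i2(1)]
    have eq: "\<zeta> \<omega> * (W b \<omega> - W a \<omega>) * (W b' \<omega> - W a' \<omega>) =
       \<zeta> \<omega> * (W (min b a') \<omega> - W a \<omega>) * (W b' \<omega> - W a' \<omega>) + (\<zeta> \<omega> * (W c \<omega> - W a' \<omega>)\<^sup>2 +
        \<zeta> \<omega> * (W c \<omega> - W a' \<omega>) * (W d \<omega> - W c \<omega>))" for \<omega>
    proof -
      have "\<zeta> \<omega> * (W b \<omega> - W a \<omega>) * (W b' \<omega> - W a' \<omega>) =
        \<zeta> \<omega> * (W a' \<omega> - W a \<omega>) * (W b' \<omega> - W a' \<omega>) + \<zeta> \<omega> * ((W b \<omega> - W a' \<omega>) * (W b' \<omega> - W a' \<omega>))"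
        by (simp add: algebra_simps)
      then show ?thesis using False by (simp add: prod min_absorb2 distrib_left mult.assoc)
    qed
    have "0 \<le> a'" "0 \<le> c" "max 0 (min b b' - a') = c - a'"
      using assms cd by (auto simp: c_def)
    then show ?thesis using 1 i2 i3 unfolding eq by simp
  qed
qed

text \<open>The factor is the length of the intersection of the two intervals. Their position is
  arbitrary, so that sums over overlapping families need no common refinement. Boundedness of
  \<open>\<zeta>\<close> supplies the integrability that \<open>overlap_aux\<close> asks
  for.\<close>

lemma overlap:
  fixes \<zeta> :: "'w \<Rightarrow> real"
  assumes "0 \<le> a" "a \<le> b" "0 \<le> a'" "a' \<le> b'" "\<zeta> \<in> borel_measurable (F (max a a'))"
    and bd: "\<And>\<omega>. \<omega> \<in> space M \<Longrightarrow> \<bar>\<zeta> \<omega>\<bar> \<le> c"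
  shows "integrable M (\<lambda>\<omega>. \<zeta> \<omega> * (W b \<omega> - W a \<omega>) * (W b' \<omega> - W a' \<omega>))"
    "(\<integral>\<omega>. \<zeta> \<omega> * (W b \<omega> - W a \<omega>) * (W b' \<omega> - W a' \<omega>) \<partial>M)
      = max 0 (min b b' - max a a') * (\<integral>\<omega>. \<zeta> \<omega> \<partial>M)"
proof -
  have [measurable]: "\<zeta> \<in> borel_measurable M" using measurable_filtration_M[OF _ assms(5)] assms(1) by (simp add: le_max_iff_disj)
  have z: "integrable M \<zeta>" by (rule integrable_const_bound[of _ c]) (use bd in auto)
  have z2: "integrable M (\<lambda>\<omega>. \<zeta> \<omega> * (W q \<omega> - W p \<omega>))" if "0 \<le> p" "p \<le> q" for p q
  proof (rule Bochner_Integration.integrable_bound)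
    show "integrable M (\<lambda>\<omega>. c * (W q \<omega> - W p \<omega>))"
      using increment_integrable(1)[OF that] by auto
    show "(\<lambda>\<omega>. \<zeta> \<omega> * (W q \<omega> - W p \<omega>)) \<in> borel_measurable M"
      using W_measurable that by auto
    show "AE \<omega> in M. norm (\<zeta> \<omega> * (W q \<omega> - W p \<omega>)) \<le> norm (c * (W q \<omega> - W p \<omega>))"
      using bd by (auto simp: abs_mult intro!: AE_I2 mult_right_mono order_trans[OF bd abs_ge_self])
  qed
  have "integrable M (\<lambda>\<omega>. \<zeta> \<omega> * (W b \<omega> - W a \<omega>) * (W b' \<omega> - W a' \<omega>)) \<and>
    (\<integral>\<omega>. \<zeta> \<omega> * (W b \<omega> - W a \<omega>) * (W b' \<omega> - W a' \<omega>) \<partial>M)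
      = max 0 (min b b' - max a a') * (\<integral>\<omega>. \<zeta> \<omega> \<partial>M)"
  proof (cases "a \<le> a'")
    case True
    then show ?thesis using overlap_aux[of a b a' b' \<zeta>] assms z z2[of a "min b a'"] by (simp add: max_absorb2)
  next
    case False
    then show ?thesis using overlap_aux[of a' b' a b \<zeta>] assms z z2[of a' "min b' a"]
      by (simp add: max_absorb1 min.commute mult.commute mult.left_commute)
  qed
  then show "integrable M (\<lambda>\<omega>. \<zeta> \<omega> * (W b \<omega> - W a \<omega>) * (W b' \<omega> - W a' \<omega>))"
    "(\<integral>\<omega>. \<zeta> \<omega> * (W b \<omega> - W a \<omega>) * (W b' \<omega> - W a' \<omega>) \<partial>M)
      = max 0 (min b b' - max a a') * (\<integral>\<omega>. \<zeta> \<omega> \<partial>M)" by auto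
qed

end

lemma integral_sum2:
  fixes g :: "'i \<Rightarrow> 'j \<Rightarrow> 'a \<Rightarrow> real"
  assumes "\<And>i j. i \<in> I \<Longrightarrow> j \<in> J \<Longrightarrow> integrable N (g i j)"
  shows "(\<integral>x. (\<Sum>i\<in>I. \<Sum>j\<in>J. g i j x) \<partial>N) = (\<Sum>i\<in>I. \<Sum>j\<in>J. \<integral>x. g i j x \<partial>N)"
  by (subst Bochner_Integration.integral_sum)
     (auto intro!: sum.cong Bochner_Integration.integral_sum Bochner_Integration.integrable_sum assms)

context brownian_filtration
begin

section \<open>Simple integrands\<close>

text \<open>Both sides expand into the same double sum over pairs of intervals, weighted with the
  lengths of their intersections: on the left by \<open>overlap\<close>, on the right by integrating
  products of indicators. The index type is arbitrary and the intervals may overlap, as the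
  difference of two simple integrals requires.\<close>

lemma elementary_isometry:
  fixes \<xi> :: "'i \<Rightarrow> 'w \<Rightarrow> 'h::euclidean_space"
  assumes "finite I" and ab: "\<And>i. i \<in> I \<Longrightarrow> 0 \<le> a i \<and> a i \<le> b i"
    and meas: "\<And>i. i \<in> I \<Longrightarrow> \<xi> i \<in> borel_measurable (F (a i))"
    and bd: "\<And>i. i \<in> I \<Longrightarrow> \<exists>c. \<forall>\<omega>\<in>space M. norm (\<xi> i \<omega>) \<le> c"
  shows "sq_int M (\<lambda>\<omega>. \<Sum>i\<in>I. (W (b i) \<omega> - W (a i) \<omega>) *\<^sub>R \<xi> i \<omega>)"
    "nsq M (\<lambda>\<omega>. \<Sum>i\<in>I. (W (b i) \<omega> - W (a i) \<omega>) *\<^sub>R \<xi> i \<omega>)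
      = (\<integral>\<^sup>+\<omega>. (\<integral>\<^sup>+t. ennreal ((norm (\<Sum>i\<in>I. indicator {a i<..b i} t *\<^sub>R \<xi> i \<omega>))\<^sup>2) \<partial>lborel) \<partial>M)"
proof -
  define D where "D i \<omega> = W (b i) \<omega> - W (a i) \<omega>" for i \<omega>
  define S where "S \<omega> = (\<Sum>i\<in>I. D i \<omega> *\<^sub>R \<xi> i \<omega>)" for \<omega>
  define ov where "ov i j = max 0 (min (b i) (b j) - max (a i) (a j))" for i j
  have [measurable]: "\<And>i. i \<in> I \<Longrightarrow> \<xi> i \<in> borel_measurable M"
    using meas ab measurable_filtration_M by blast
  have D_meas [measurable]: "\<And>i. i \<in> I \<Longrightarrow> D i \<in> borel_measurable M"
    unfolding D_def using ab by (intro borel_measurable_diff W_measurable) force+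
  have S_meas [measurable]: "S \<in> borel_measurable M"
    unfolding S_def by (intro borel_measurable_sum borel_measurable_scaleR) auto
  have ij: "integrable M (\<lambda>\<omega>. (\<xi> i \<omega> \<bullet> \<xi> j \<omega>) * D i \<omega> * D j \<omega>) \<and> integrable M (\<lambda>\<omega>. \<xi> i \<omega> \<bullet> \<xi> j \<omega>) \<and>
     (\<integral>\<omega>. (\<xi> i \<omega> \<bullet> \<xi> j \<omega>) * D i \<omega> * D j \<omega> \<partial>M) = ov i j * (\<integral>\<omega>. \<xi> i \<omega> \<bullet> \<xi> j \<omega> \<partial>M)"
    if "i \<in> I" "j \<in> I" for i j
  proof -
    obtain c c' where c: "\<And>\<omega>. \<omega>\<in>space M \<Longrightarrow> norm (\<xi> i \<omega>) \<le> c" "\<And>\<omega>. \<omega>\<in>space M \<Longrightarrow> norm (\<xi> j \<omega>) \<le> c'"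
      using bd[OF \<open>i \<in> I\<close>] bd[OF \<open>j \<in> I\<close>] by auto
    have bdd: "\<bar>\<xi> i \<omega> \<bullet> \<xi> j \<omega>\<bar> \<le> c\<^sup>2 + c'\<^sup>2" if "\<omega> \<in> space M" for \<omega>
      using inner_le_norm_sq[of "\<xi> i \<omega>" "\<xi> j \<omega>"] power_mono[OF c(1)[OF that] norm_ge_zero, of 2]
        power_mono[OF c(2)[OF that] norm_ge_zero, of 2] by linarith
    have m: "(\<lambda>\<omega>. \<xi> i \<omega> \<bullet> \<xi> j \<omega>) \<in> borel_measurable (F (max (a i) (a j)))"
      using measurable_filtration_mono[OF _ _ meas[OF \<open>i \<in> I\<close>], of "max (a i) (a j)"]
        measurable_filtration_mono[OF _ _ meas[OF \<open>j \<in> I\<close>], of "max (a i) (a j)"] ab that by auto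
    have "integrable M (\<lambda>\<omega>. \<xi> i \<omega> \<bullet> \<xi> j \<omega>)"
      by (rule integrable_const_bound[of _ "c\<^sup>2 + c'\<^sup>2"]) (use bdd that in auto)
    then show ?thesis
      using overlap[OF _ _ _ _ m bdd, of "b i" "b j"] ab that unfolding D_def ov_def by auto
  qed
  have SS: "(norm (S \<omega>))\<^sup>2 = (\<Sum>i\<in>I. \<Sum>j\<in>I. (\<xi> i \<omega> \<bullet> \<xi> j \<omega>) * D i \<omega> * D j \<omega>)" for \<omega>
    unfolding S_def power2_norm_eq_inner inner_sum_left inner_sum_right by (simp add: mult_ac inner_commute)
  have intS: "integrable M (\<lambda>\<omega>. (norm (S \<omega>))\<^sup>2)"
    unfolding SS using ij by (intro Bochner_Integration.integrable_sum) auto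
  have "(\<integral>\<omega>. (norm (S \<omega>))\<^sup>2 \<partial>M) = (\<Sum>i\<in>I. \<Sum>j\<in>I. (\<integral>\<omega>. (\<xi> i \<omega> \<bullet> \<xi> j \<omega>) * D i \<omega> * D j \<omega> \<partial>M))"
    unfolding SS using ij by (intro integral_sum2) auto
  also have "\<dots> = (\<Sum>i\<in>I. \<Sum>j\<in>I. (\<integral>\<omega>. ov i j * (\<xi> i \<omega> \<bullet> \<xi> j \<omega>) \<partial>M))"
    using ij by (intro sum.cong refl) auto
  also have "\<dots> = (\<integral>\<omega>. (\<Sum>i\<in>I. \<Sum>j\<in>I. ov i j * (\<xi> i \<omega> \<bullet> \<xi> j \<omega>)) \<partial>M)"
    using ij by (intro integral_sum2[symmetric]) auto
  finally have eqS: "(\<integral>\<omega>. (norm (S \<omega>))\<^sup>2 \<partial>M) = (\<integral>\<omega>. (\<Sum>i\<in>I. \<Sum>j\<in>I. ov i j * (\<xi> i \<omega> \<bullet> \<xi> j \<omega>)) \<partial>M)" .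
  have inner_t: "(\<integral>\<^sup>+t. ennreal ((norm (\<Sum>i\<in>I. indicator {a i<..b i} t *\<^sub>R \<xi> i \<omega>))\<^sup>2) \<partial>lborel)
       = ennreal (\<Sum>i\<in>I. \<Sum>j\<in>I. ov i j * (\<xi> i \<omega> \<bullet> \<xi> j \<omega>)) \<and>
       0 \<le> (\<Sum>i\<in>I. \<Sum>j\<in>I. ov i j * (\<xi> i \<omega> \<bullet> \<xi> j \<omega>))" for \<omega>
  proof -
    have e: "(norm (\<Sum>i\<in>I. indicator {a i<..b i} t *\<^sub>R \<xi> i \<omega>))\<^sup>2 =
       (\<Sum>i\<in>I. \<Sum>j\<in>I. indicator {max (a i) (a j)<..min (b i) (b j)} t * (\<xi> i \<omega> \<bullet> \<xi> j \<omega>))" for t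
      unfolding power2_norm_eq_inner inner_sum_left inner_sum_right
      by (auto intro!: sum.cong simp: indicator_def inner_commute)
    have i0: "integrable lborel (\<lambda>t. indicator {p<..q} t * c) \<and>
      (\<integral>t. indicator {p<..q} t * c \<partial>lborel) = max 0 (q - p) * c" for p q c :: real
      by (cases "p \<le> q") (auto simp: max_def)
    have i1: "integrable lborel (\<lambda>t. (norm (\<Sum>i\<in>I. indicator {a i<..b i} t *\<^sub>R \<xi> i \<omega>))\<^sup>2)"
      unfolding e using i0 by (intro Bochner_Integration.integrable_sum) auto
    have i2: "(\<integral>t. (norm (\<Sum>i\<in>I. indicator {a i<..b i} t *\<^sub>R \<xi> i \<omega>))\<^sup>2 \<partial>lborel)
        = (\<Sum>i\<in>I. \<Sum>j\<in>I. ov i j * (\<xi> i \<omega> \<bullet> \<xi> j \<omega>))"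
      unfolding e ov_def i0[THEN conjunct2, symmetric] using i0 by (intro integral_sum2) auto
    show ?thesis
      unfolding i2[symmetric] using nn_integral_eq_integral[OF i1] by (auto intro!: integral_nonneg_AE)
  qed
  show "sq_int M (\<lambda>\<omega>. \<Sum>i\<in>I. (W (b i) \<omega> - W (a i) \<omega>) *\<^sub>R \<xi> i \<omega>)"
    using intS S_meas unfolding sq_int_def S_def D_def by simp
  have intR: "integrable M (\<lambda>\<omega>. \<Sum>i\<in>I. \<Sum>j\<in>I. ov i j * (\<xi> i \<omega> \<bullet> \<xi> j \<omega>))"
    using ij by (intro Bochner_Integration.integrable_sum) auto
  have "nsq M S = ennreal (\<integral>\<omega>. (norm (S \<omega>))\<^sup>2 \<partial>M)"
    unfolding nsq_def by (rule nn_integral_eq_integral[OF intS]) simp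
  also have "\<dots> = (\<integral>\<^sup>+\<omega>. ennreal (\<Sum>i\<in>I. \<Sum>j\<in>I. ov i j * (\<xi> i \<omega> \<bullet> \<xi> j \<omega>)) \<partial>M)"
    unfolding eqS using intR inner_t by (intro nn_integral_eq_integral[symmetric]) auto
  finally show "nsq M (\<lambda>\<omega>. \<Sum>i\<in>I. (W (b i) \<omega> - W (a i) \<omega>) *\<^sub>R \<xi> i \<omega>)
      = (\<integral>\<^sup>+\<omega>. (\<integral>\<^sup>+t. ennreal ((norm (\<Sum>i\<in>I. indicator {a i<..b i} t *\<^sub>R \<xi> i \<omega>))\<^sup>2) \<partial>lborel) \<partial>M)"
    using inner_t unfolding S_def D_def by simp
qed

text \<open>An interval that starts after t contributes nothing up to time t, but its coefficient
  need not be \<open>F t\<close>-measurable and its truncation at t has its left end beyond its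
  right end. Such indices are removed before \<open>elementary_isometry\<close> is applied.\<close>

definition active :: "real \<Rightarrow> ('w, 'h::euclidean_space) simple_data \<Rightarrow> nat set" where
  "active t = (\<lambda>(N, \<tau>, \<xi>). {i. i < N \<and> \<tau> i \<le> t})"

lemma simple_integral_active:
  "simple_integral W (N, \<tau>, \<xi>) t \<omega> =
    (\<Sum>i\<in>active t (N, \<tau>, \<xi>). (W (min t (\<tau> (Suc i))) \<omega> - W (\<tau> i) \<omega>) *\<^sub>R \<xi> i \<omega>)"
  if "valid_simple M F T (N, \<tau>, \<xi>)"
proof -
  have "simple_integral W (N, \<tau>, \<xi>) t \<omega> =
    (\<Sum>i\<in>active t (N, \<tau>, \<xi>). (W (min t (\<tau> (Suc i))) \<omega> - W (min t (\<tau> i)) \<omega>) *\<^sub>R \<xi> i \<omega>)"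
    unfolding simple_integral_def active_def split_conv
  proof (intro sum.mono_neutral_right ballI)
    fix i assume i: "i \<in> {..<N} - {i. i < N \<and> \<tau> i \<le> t}"
    then have "t < \<tau> i" "\<tau> i \<le> \<tau> (Suc i)" using that by (auto simp: valid_simple_def)
    then show "(W (min t (\<tau> (Suc i))) \<omega> - W (min t (\<tau> i)) \<omega>) *\<^sub>R \<xi> i \<omega> = 0"
      by (simp add: min_def)
  qed auto
  also have "\<dots> = (\<Sum>i\<in>active t (N, \<tau>, \<xi>). (W (min t (\<tau> (Suc i))) \<omega> - W (\<tau> i) \<omega>) *\<^sub>R \<xi> i \<omega>)"
    by (intro sum.cong refl) (auto simp: active_def min_absorb2)
  finally show ?thesis .
qed

lemma simple_integrand_active:
  "indicator {0..t} s *\<^sub>R simple_integrand (N, \<tau>, \<xi>) s \<omega> =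
    (\<Sum>i\<in>active t (N, \<tau>, \<xi>). indicator {\<tau> i<..min t (\<tau> (Suc i))} s *\<^sub>R \<xi> i \<omega>)"
  if "valid_simple M F T (N, \<tau>, \<xi>)"
proof -
  have "indicator {0..t} s *\<^sub>R simple_integrand (N, \<tau>, \<xi>) s \<omega> =
    (\<Sum>i<N. indicator {0..t} s *\<^sub>R indicator {\<tau> i<..\<tau> (Suc i)} s *\<^sub>R \<xi> i \<omega>)"
    by (simp only: simple_integrand_def split_conv scaleR_sum_right)
  also have "\<dots> = (\<Sum>i\<in>active t (N, \<tau>, \<xi>). indicator {0..t} s *\<^sub>R indicator {\<tau> i<..\<tau> (Suc i)} s *\<^sub>R \<xi> i \<omega>)"
    unfolding active_def split_conv by (intro sum.mono_neutral_right ballI) (auto simp: indicator_def)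
  also have "\<dots> = (\<Sum>i\<in>active t (N, \<tau>, \<xi>). indicator {\<tau> i<..min t (\<tau> (Suc i))} s *\<^sub>R \<xi> i \<omega>)"
    using that by (intro sum.cong refl) (force simp: active_def valid_simple_def indicator_def)
  finally show ?thesis .
qed

lemma sq_norm_L2_indicator:
  "sq_norm_L2 M t \<phi> = (\<integral>\<^sup>+\<omega>. (\<integral>\<^sup>+s. ennreal ((norm (indicator {0..t} s *\<^sub>R \<phi> s \<omega>))\<^sup>2) \<partial>lborel) \<partial>M)"
  unfolding sq_norm_L2_def by (intro nn_integral_cong) (auto simp: indicator_def)

text \<open>On the disjoint union of the two families of intervals, with the coefficients of
  \<open>d'\<close> negated, the difference is a single elementary sum; overlaps between the two
  partitions are harmless.\<close>

lemma simple_difference_isometry: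
  fixes d d' :: "('w, 'h::euclidean_space) simple_data"
  assumes d: "valid_simple M F T d" and d': "valid_simple M F T d'" and t: "0 \<le> t"
  shows "nsq M (\<lambda>\<omega>. simple_integral W d t \<omega> - simple_integral W d' t \<omega>)
     = sq_norm_L2 M t (\<lambda>s \<omega>. simple_integrand d s \<omega> - simple_integrand d' s \<omega>)"
proof -
  obtain N \<tau> \<xi> where D: "d = (N, \<tau>, \<xi>)" by (cases d)
  obtain N' \<tau>' \<xi>' where D': "d' = (N', \<tau>', \<xi>')" by (cases d')
  let ?I = "active t d <+> active t d'"
  define a where "a = case_sum \<tau> \<tau>'"
  define b where "b = case_sum (\<lambda>i. min t (\<tau> (Suc i))) (\<lambda>i. min t (\<tau>' (Suc i)))"
  define x where "x = case_sum \<xi> (\<lambda>i \<omega>. - \<xi>' i \<omega>)"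
  have fin: "finite (active t d)" "finite (active t d')"
    by (auto simp: active_def D D')
  have "nsq M (\<lambda>\<omega>. \<Sum>i\<in>?I. (W (b i) \<omega> - W (a i) \<omega>) *\<^sub>R x i \<omega>)
      = (\<integral>\<^sup>+\<omega>. (\<integral>\<^sup>+t. ennreal ((norm (\<Sum>i\<in>?I. indicator {a i<..b i} t *\<^sub>R x i \<omega>))\<^sup>2) \<partial>lborel) \<partial>M)"
  proof (rule elementary_isometry)
    show "finite ?I" using fin by simp
    show "0 \<le> a i \<and> a i \<le> b i" if "i \<in> ?I" for i
      using that d d' by (auto simp: a_def b_def D D' active_def valid_simple_def)
    show "x i \<in> borel_measurable (F (a i))" if "i \<in> ?I" for i
      using that d d' by (auto simp: a_def x_def D D' active_def valid_simple_def)
    show "\<exists>c. \<forall>\<omega>\<in>space M. norm (x i \<omega>) \<le> c" if "i \<in> ?I" for i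
      using that d d' by (auto simp: x_def D D' active_def valid_simple_def)
  qed
  moreover have "(\<Sum>i\<in>?I. (W (b i) \<omega> - W (a i) \<omega>) *\<^sub>R x i \<omega>)
      = simple_integral W d t \<omega> - simple_integral W d' t \<omega>" for \<omega>
    using fin unfolding D D' simple_integral_active[OF d[unfolded D]] simple_integral_active[OF d'[unfolded D']]
    by (simp add: sum.Plus a_def b_def x_def sum_negf scaleR_right.minus)
  moreover have "(\<Sum>i\<in>?I. indicator {a i<..b i} s *\<^sub>R x i \<omega>)
      = indicator {0..t} s *\<^sub>R (simple_integrand d s \<omega> - simple_integrand d' s \<omega>)" for s \<omega>
    using fin unfolding scaleR_diff_right D D' simple_integrand_active[OF d[unfolded D]]
      simple_integrand_active[OF d'[unfolded D']]
    by (simp only: sum.Plus[OF fin[unfolded D D']] a_def b_def x_def comp_def old.sum.case scaleR_minus_right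
        sum_negf diff_conv_add_uminus)
  ultimately show ?thesis by (simp add: sq_norm_L2_indicator)
qed

lemma simple_integral_sq_int:
  fixes d :: "('w, 'h::euclidean_space) simple_data"
  assumes d: "valid_simple M F T d"
  shows "sq_int M (simple_integral W d t)"
proof -
  obtain N \<tau> \<xi> where D: "d = (N, \<tau>, \<xi>)" by (cases d)
  have "sq_int M (\<lambda>\<omega>. \<Sum>i\<in>active t d. (W (min t (\<tau> (Suc i))) \<omega> - W (\<tau> i) \<omega>) *\<^sub>R \<xi> i \<omega>)"
    by (rule elementary_isometry) (use d in \<open>auto simp: D active_def valid_simple_def\<close>)
  moreover have "simple_integral W d t = (\<lambda>\<omega>. \<Sum>i\<in>active t d. (W (min t (\<tau> (Suc i))) \<omega> - W (\<tau> i) \<omega>) *\<^sub>R \<xi> i \<omega>)"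
    using simple_integral_active[OF d[unfolded D]] by (auto simp: D)
  ultimately show ?thesis by simp
qed

lemma simple_integral_adapted:
  fixes d :: "('w, 'h::euclidean_space) simple_data"
  assumes d: "valid_simple M F T d" and t: "0 \<le> t"
  shows "simple_integral W d t \<in> borel_measurable (F t)"
proof -
  obtain N \<tau> \<xi> where D: "d = (N, \<tau>, \<xi>)" by (cases d)
  have "(\<lambda>\<omega>. \<Sum>i\<in>active t d. (W (min t (\<tau> (Suc i))) \<omega> - W (\<tau> i) \<omega>) *\<^sub>R \<xi> i \<omega>) \<in> borel_measurable (F t)"
  proof (intro borel_measurable_sum borel_measurable_scaleR borel_measurable_diff)
    fix i assume "i \<in> active t d"
    then have i: "0 \<le> \<tau> i" "\<tau> i \<le> \<tau> (Suc i)" "\<tau> i \<le> t" "\<xi> i \<in> borel_measurable (F (\<tau> i))"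
      using d by (auto simp: D active_def valid_simple_def)
    show "W (min t (\<tau> (Suc i))) \<in> borel_measurable (F t)" "W (\<tau> i) \<in> borel_measurable (F t)"
      using i t by (auto intro!: measurable_filtration_mono[OF _ _ W_adapted])
    show "\<xi> i \<in> borel_measurable (F t)"
      using i measurable_filtration_mono by blast
  qed
  moreover have "simple_integral W d t = (\<lambda>\<omega>. \<Sum>i\<in>active t d. (W (min t (\<tau> (Suc i))) \<omega> - W (\<tau> i) \<omega>) *\<^sub>R \<xi> i \<omega>)"
    using simple_integral_active[OF d[unfolded D]] by (auto simp: D)
  ultimately show ?thesis by simp
qed

lemma simple_integral_continuous:
  fixes d :: "('w, 'h::euclidean_space) simple_data"
  assumes d: "valid_simple M F T d" and c: "continuous_on {0..} (\<lambda>t. W t \<omega>)"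
  shows "continuous_on {0..} (\<lambda>t. simple_integral W d t \<omega>)"
proof -
  obtain N \<tau> \<xi> where D: "d = (N, \<tau>, \<xi>)" by (cases d)
  have "continuous_on {0..} (\<lambda>t. W (min t r) \<omega>)" if "0 \<le> r" for r
    by (rule continuous_on_compose2[OF c]) (use that in \<open>auto intro!: continuous_intros\<close>)
  then show ?thesis
    using d unfolding D simple_integral_def split_conv valid_simple_def
    by (intro continuous_intros) force+
qed

text \<open>The martingale property in weak form: increments after s are orthogonal to every
  square-integrable \<open>F s\<close>-measurable variable. This form survives L2 limits and avoids
  conditional expectations.\<close>

lemma simple_integral_martingale:
  fixes d :: "('w, 'h::euclidean_space) simple_data"
  assumes d: "valid_simple M F T d" and st: "0 \<le> s" "s \<le> t"
    and Z: "sq_int M Z" "Z \<in> borel_measurable (F s)"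
  shows "(\<integral>\<omega>. (simple_integral W d t \<omega> - simple_integral W d s \<omega>) \<bullet> Z \<omega> \<partial>M) = 0"
proof -
  obtain N \<tau> \<xi> where D: "d = (N, \<tau>, \<xi>)" by (cases d)
  \<comment> \<open>Each interval is clipped to [s, t]; the two clipped ends coincide if the
    interval ends by time s.\<close>
  let ?p = "\<lambda>i. max s (\<tau> i)" and ?q = "\<lambda>i. max s (min t (\<tau> (Suc i)))"
  have inc: "(W (min t (\<tau> (Suc i))) \<omega> - W (min t (\<tau> i)) \<omega>) - (W (min s (\<tau> (Suc i))) \<omega> - W (min s (\<tau> i)) \<omega>)
     = (if \<tau> i \<le> t then W (?q i) \<omega> - W (?p i) \<omega> else 0)" if "i < N" for i \<omega>
    using d that st by (auto simp: D valid_simple_def max_def min_def)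
  have eq: "(simple_integral W d t \<omega> - simple_integral W d s \<omega>) \<bullet> Z \<omega>
     = (\<Sum>i\<in>active t d. (\<xi> i \<omega> \<bullet> Z \<omega>) * (W (?q i) \<omega> - W (?p i) \<omega>))" for \<omega>
  proof -
    have "(simple_integral W d t \<omega> - simple_integral W d s \<omega>) =
       (\<Sum>i<N. (if \<tau> i \<le> t then W (?q i) \<omega> - W (?p i) \<omega> else 0) *\<^sub>R \<xi> i \<omega>)"
      unfolding D simple_integral_def split_conv sum_subtractf[symmetric] scaleR_diff_left[symmetric]
      by (intro sum.cong refl arg_cong2[where f = scaleR]) (use inc in auto)
    also have "\<dots> = (\<Sum>i\<in>active t d. (W (?q i) \<omega> - W (?p i) \<omega>) *\<^sub>R \<xi> i \<omega>)"
      unfolding D active_def split_conv by (intro sum.mono_neutral_cong_right) auto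
    finally show ?thesis by (simp add: inner_sum_left mult.commute)
  qed
  have "integrable M (\<lambda>\<omega>. (\<xi> i \<omega> \<bullet> Z \<omega>) * (W (?q i) \<omega> - W (?p i) \<omega>)) \<and>
     (\<integral>\<omega>. (\<xi> i \<omega> \<bullet> Z \<omega>) * (W (?q i) \<omega> - W (?p i) \<omega>) \<partial>M) = 0" if "i \<in> active t d" for i
  proof -
    have i: "0 \<le> \<tau> i" "\<tau> i \<le> \<tau> (Suc i)" "\<tau> i \<le> t" "\<xi> i \<in> borel_measurable (F (\<tau> i))"
      "\<exists>c. \<forall>\<omega>\<in>space M. norm (\<xi> i \<omega>) \<le> c"
      using d that by (auto simp: D active_def valid_simple_def)
    have "sq_int M (\<xi> i)" using i measurable_filtration_M sq_int_of_bounded by metis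
    then have "integrable M (\<lambda>\<omega>. \<xi> i \<omega> \<bullet> Z \<omega>)" using Z sq_int_inner by blast
    moreover have "(\<lambda>\<omega>. \<xi> i \<omega> \<bullet> Z \<omega>) \<in> borel_measurable (F (?p i))"
      using measurable_filtration_mono[OF _ _ i(4), of "?p i"] measurable_filtration_mono[OF _ _ Z(2), of "?p i"]
        i st by (intro borel_measurable_inner) auto
    ultimately show ?thesis
      using increment_moments(1,2)[of "?p i" "?q i" "\<lambda>\<omega>. \<xi> i \<omega> \<bullet> Z \<omega>"] i st by (auto simp: max_def)
  qed
  then show ?thesis unfolding eq by (subst Bochner_Integration.integral_sum) auto
qed

end

section \<open>The Ito integral: isometry and martingale property\<close>

abbreviation time_measure :: "real \<Rightarrow> real measure" where
  "time_measure t \<equiv> restrict_space lborel {0..t}"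

lemma finite_time_measure: "finite_measure (time_measure t)"
  by (rule finite_measureI) (cases "0 \<le> t"; simp add: emeasure_restrict_space space_restrict_space)

lemma nsq_cong: "(\<And>x. x \<in> space M \<Longrightarrow> f x = g x) \<Longrightarrow> nsq M f = nsq M g"
  unfolding nsq_def by (intro nn_integral_cong) simp

lemma tendsto_0_ennreal_le:
  "(\<And>k. f k \<le> g k) \<Longrightarrow> g \<longlonglongrightarrow> 0 \<Longrightarrow> f \<longlonglongrightarrow> (0::ennreal)"
  by (rule tendsto_sandwich[of "\<lambda>_. 0" f sequentially g]) auto

lemma nsq_diff_tendsto:
  assumes [measurable]: "f \<in> borel_measurable M" "g \<in> borel_measurable M"
    "\<And>k. fs k \<in> borel_measurable M" "\<And>k. gs k \<in> borel_measurable M"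
    and f: "(\<lambda>k. nsq M (\<lambda>x. f x - fs k x)) \<longlonglongrightarrow> 0" and g: "(\<lambda>k. nsq M (\<lambda>x. g x - gs k x)) \<longlonglongrightarrow> 0"
  shows "(\<lambda>k. nsq M (\<lambda>x. (f x - g x) - (fs k x - gs k x))) \<longlonglongrightarrow> 0"
proof (rule tendsto_0_ennreal_le)
  show "nsq M (\<lambda>x. (f x - g x) - (fs k x - gs k x))
      \<le> 2 * nsq M (\<lambda>x. f x - fs k x) + 2 * nsq M (\<lambda>x. g x - gs k x)" for k
  proof -
    have "nsq M (\<lambda>x. (f x - g x) - (fs k x - gs k x)) = nsq M (\<lambda>x. (f x - fs k x) - (g x - gs k x))"
      by (intro nsq_cong) (simp add: algebra_simps)
    also have "\<dots> \<le> 2 * nsq M (\<lambda>x. f x - fs k x) + 2 * nsq M (\<lambda>x. g x - gs k x)"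
      by (intro nsq_diff_le) simp_all
    finally show "nsq M (\<lambda>x. (f x - g x) - (fs k x - gs k x))
      \<le> 2 * nsq M (\<lambda>x. f x - fs k x) + 2 * nsq M (\<lambda>x. g x - gs k x)" .
  qed
  have "(\<lambda>k. 2 * nsq M (\<lambda>x. f x - fs k x) + 2 * nsq M (\<lambda>x. g x - gs k x)) \<longlonglongrightarrow> 2 * 0 + 2 * 0"
    by (intro tendsto_add ennreal_tendsto_cmult f g) auto
  then show "(\<lambda>k. 2 * nsq M (\<lambda>x. f x - fs k x) + 2 * nsq M (\<lambda>x. g x - gs k x)) \<longlonglongrightarrow> 0"
    by simp
qed

lemma simple_integrand_linear:
  assumes "bounded_linear L"
  shows "L (simple_integrand (N, \<tau>, \<xi>) t \<omega>) = simple_integrand (N, \<tau>, \<lambda>i \<omega>. L (\<xi> i \<omega>)) t \<omega>"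
    "L (simple_integral W (N, \<tau>, \<xi>) t \<omega>) = simple_integral W (N, \<tau>, \<lambda>i \<omega>. L (\<xi> i \<omega>)) t \<omega>"
proof -
  interpret bounded_linear L by fact
  show "L (simple_integrand (N, \<tau>, \<xi>) t \<omega>) = simple_integrand (N, \<tau>, \<lambda>i \<omega>. L (\<xi> i \<omega>)) t \<omega>"
    "L (simple_integral W (N, \<tau>, \<xi>) t \<omega>) = simple_integral W (N, \<tau>, \<lambda>i \<omega>. L (\<xi> i \<omega>)) t \<omega>"
    unfolding simple_integrand_def simple_integral_def split_conv by (simp_all only: sum scaleR)
qed

context brownian_filtration
begin

text \<open>Tonelli identifies the iterated integral with a norm on the product of time and sample
  space, so that the facts about \<open>nsq\<close> apply to processes.\<close>

lemma sq_norm_L2_eq_nsq: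
  fixes \<phi> :: "real \<Rightarrow> 'w \<Rightarrow> 'h::euclidean_space"
  assumes [measurable]: "(\<lambda>(s, \<omega>). \<phi> s \<omega>) \<in> borel_measurable (time_measure t \<Otimes>\<^sub>M M)"
  shows "sq_norm_L2 M t \<phi> = nsq (time_measure t \<Otimes>\<^sub>M M) (\<lambda>(s, \<omega>). \<phi> s \<omega>)"
proof -
  interpret tm: finite_measure "time_measure t" by (rule finite_time_measure)
  interpret P: pair_sigma_finite "time_measure t" M ..
  have "nsq (time_measure t \<Otimes>\<^sub>M M) (\<lambda>(s, \<omega>). \<phi> s \<omega>)
     = (\<integral>\<^sup>+p. (\<lambda>(s, \<omega>). ennreal ((norm (\<phi> s \<omega>))\<^sup>2)) p \<partial>(time_measure t \<Otimes>\<^sub>M M))"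
    unfolding nsq_def by (intro nn_integral_cong) auto
  also have "\<dots> = (\<integral>\<^sup>+\<omega>. (\<integral>\<^sup>+s. ennreal ((norm (\<phi> s \<omega>))\<^sup>2) \<partial>time_measure t) \<partial>M)"
    by (subst P.nn_integral_snd[symmetric]) auto
  also have "\<dots> = sq_norm_L2 M t \<phi>"
    unfolding sq_norm_L2_def by (intro nn_integral_cong nn_integral_restrict_space) simp
  finally show ?thesis ..
qed

lemma progressive_joint:
  assumes "progressive F T \<phi>" "0 \<le> t" "t \<le> T"
  shows "(\<lambda>(s, \<omega>). \<phi> s \<omega>) \<in> borel_measurable (time_measure t \<Otimes>\<^sub>M M)"
proof -
  have p: "(\<lambda>(s, \<omega>). \<phi> s \<omega>) \<in> borel_measurable (restrict_space borel {0..t} \<Otimes>\<^sub>M F t)"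
    using assms by (auto simp: progressive_def)
  have "(\<lambda>\<omega>. \<omega>) \<in> measurable M (F t)"
    using subalg[OF assms(2)] by (auto simp: measurable_def subalgebra_def)
  then have "(\<lambda>p. (fst p, snd p)) \<in> measurable (time_measure t \<Otimes>\<^sub>M M) (restrict_space borel {0..t} \<Otimes>\<^sub>M F t)"
    by (intro measurable_Pair measurable_compose[OF measurable_snd])
      (auto simp: measurable_cong_sets[OF refl sets_restrict_space_cong[OF sets_lborel]])
  from measurable_compose[OF this p] show ?thesis by simp
qed

lemma simple_integrand_joint:
  fixes d :: "('w, 'h::euclidean_space) simple_data"
  assumes d: "valid_simple M F T d"
  shows "(\<lambda>(s, \<omega>). simple_integrand d s \<omega>) \<in> borel_measurable (time_measure t \<Otimes>\<^sub>M M)"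
proof -
  obtain N \<tau> \<xi> where D: "d = (N, \<tau>, \<xi>)" by (cases d)
  have [measurable]: "i < N \<Longrightarrow> \<xi> i \<in> borel_measurable M" for i
    using d measurable_filtration_M[of "\<tau> i" "\<xi> i"] by (auto simp: D valid_simple_def)
  have [measurable]: "fst \<in> borel_measurable (time_measure t \<Otimes>\<^sub>M M)"
    by (rule measurable_compose[OF measurable_fst]) (simp add: measurable_restrict_space1)
  have "(\<lambda>p. \<Sum>i<N. indicator {\<tau> i<..\<tau> (Suc i)} (fst p) *\<^sub>R \<xi> i (snd p))
     \<in> borel_measurable (time_measure t \<Otimes>\<^sub>M M)"
    by (intro borel_measurable_sum borel_measurable_scaleR) auto
  then show ?thesis by (simp add: D simple_integrand_def split_beta')
qed

lemma sq_norm_L2_mono: "s \<le> t \<Longrightarrow> sq_norm_L2 M s \<phi> \<le> sq_norm_L2 M t \<phi>"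
  unfolding sq_norm_L2_def by (intro nn_integral_mono) (auto simp: indicator_def)

lemma L2F_sq_int:
  assumes "\<phi> \<in> L2F M F T" "0 \<le> t" "t \<le> T"
  shows "sq_int (time_measure t \<Otimes>\<^sub>M M) (\<lambda>(s, \<omega>). \<phi> s \<omega>)"
  using assms progressive_joint[of T \<phi> t] sq_norm_L2_eq_nsq[of \<phi> t] sq_norm_L2_mono[of t T \<phi>]
  by (auto simp: L2F_def sq_int_iff_nsq intro: le_less_trans)

lemma ito_approximation:
  fixes Y :: "real \<Rightarrow> 'w \<Rightarrow> 'h::euclidean_space"
  assumes "is_ito_integral M F W T \<phi> Y"
  obtains d where "\<And>k. valid_simple M F T (d k)"
    "(\<lambda>k. sq_norm_L2 M T (\<lambda>t \<omega>. \<phi> t \<omega> - simple_integrand (d k) t \<omega>)) \<longlonglongrightarrow> 0"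
    "\<And>t. t \<in> {0..T} \<Longrightarrow> (\<lambda>k. nsq M (\<lambda>\<omega>. Y t \<omega> - simple_integral W (d k) t \<omega>)) \<longlonglongrightarrow> 0"
    "\<phi> \<in> L2F M F T" "\<And>t. t \<in> {0..T} \<Longrightarrow> Y t \<in> borel_measurable M"
  using assms unfolding is_ito_integral_def nsq_def[symmetric] by blast

text \<open>The isometry for differences of simple integrands passes to the limit along two
  unrelated approximating sequences. The version for differences yields the isometry itself, the
  covariance by polarization and the contraction estimate of the Picard iteration.\<close>

lemma ito_difference_isometry:
  fixes Y Y' :: "real \<Rightarrow> 'w \<Rightarrow> 'h::euclidean_space"
  assumes "is_ito_integral M F W T \<phi> Y" "is_ito_integral M F W T \<phi>' Y'" "0 \<le> t" "t \<le> T"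
  shows "nsq M (\<lambda>\<omega>. Y t \<omega> - Y' t \<omega>) = sq_norm_L2 M t (\<lambda>s \<omega>. \<phi> s \<omega> - \<phi>' s \<omega>)"
proof -
  let ?\<Pi> = "time_measure t \<Otimes>\<^sub>M M"
  \<comment> \<open>All that is needed about one process at the fixed time t, stated generally so
    that it applies to both.\<close>
  have conv: "\<exists>d. (\<forall>k. valid_simple M F T (d k)) \<and>
       (\<lambda>k. nsq ?\<Pi> (\<lambda>p. (\<lambda>(s, \<omega>). \<phi> s \<omega>) p - (\<lambda>(s, \<omega>). simple_integrand (d k) s \<omega>) p)) \<longlonglongrightarrow> 0 \<and>
       (\<lambda>k. nsq M (\<lambda>\<omega>. Y t \<omega> - simple_integral W (d k) t \<omega>)) \<longlonglongrightarrow> 0 \<and>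
       (\<forall>k. sq_int ?\<Pi> (\<lambda>(s, \<omega>). simple_integrand (d k) s \<omega>)) \<and> sq_int ?\<Pi> (\<lambda>(s, \<omega>). \<phi> s \<omega>) \<and>
       sq_int M (Y t)"
    if ito: "is_ito_integral M F W T \<phi> Y" for \<phi> and Y :: "real \<Rightarrow> 'w \<Rightarrow> 'h"
  proof -
    obtain d where d: "\<And>k. valid_simple M F T (d k)"
      "(\<lambda>k. sq_norm_L2 M T (\<lambda>t \<omega>. \<phi> t \<omega> - simple_integrand (d k) t \<omega>)) \<longlonglongrightarrow> 0"
      "(\<lambda>k. nsq M (\<lambda>\<omega>. Y t \<omega> - simple_integral W (d k) t \<omega>)) \<longlonglongrightarrow> 0"
      and phi: "\<phi> \<in> L2F M F T" and Y: "Y t \<in> borel_measurable M"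
      using assms(3,4) by (rule_tac ito_approximation[OF ito]) auto
    have m1: "(\<lambda>(s, \<omega>). \<phi> s \<omega>) \<in> borel_measurable ?\<Pi>"
      using L2F_sq_int[OF phi assms(3,4)] by (simp add: sq_int_def)
    note m2 = simple_integrand_joint[OF d(1), of _ t]
    have m3: "(\<lambda>(s, \<omega>). \<phi> s \<omega> - simple_integrand (d k) s \<omega>) \<in> borel_measurable ?\<Pi>" for k
      using borel_measurable_diff[OF m1 m2[of k]] by (simp add: split_beta')
    have c1: "(\<lambda>k. sq_norm_L2 M t (\<lambda>t \<omega>. \<phi> t \<omega> - simple_integrand (d k) t \<omega>)) \<longlonglongrightarrow> 0"
      by (rule tendsto_0_ennreal_le[OF sq_norm_L2_mono d(2)]) (rule assms)
    have c2: "(\<lambda>k. nsq ?\<Pi> (\<lambda>p. (\<lambda>(s, \<omega>). \<phi> s \<omega>) p - (\<lambda>(s, \<omega>). simple_integrand (d k) s \<omega>) p)) \<longlonglongrightarrow> 0"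
      using c1 sq_norm_L2_eq_nsq[OF m3] by (simp add: split_beta')
    \<comment> \<open>Comparison with the empty simple integrand (\<open>N\<close> = 0) turns the
      isometry for differences into one for \<open>d k\<close>, whose norm is therefore
      finite.\<close>
    have "sq_norm_L2 M t (simple_integrand (d k)) = nsq M (simple_integral W (d k) t)" for k
      using simple_difference_isometry[OF d(1)[of k] _ assms(3), of "(0, \<lambda>_. 0, \<lambda>_ _. 0)"]
      by (simp add: valid_simple_def simple_integral_def simple_integrand_def)
    then have "sq_int ?\<Pi> (\<lambda>(s, \<omega>). simple_integrand (d k) s \<omega>)" for k
      using simple_integral_sq_int[OF d(1)[of k], of t] m2[of k] sq_norm_L2_eq_nsq[OF m2[of k]]
      by (simp add: sq_int_iff_nsq)
    moreover have "sq_int M (Y t)"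
      using sq_int_limit[OF simple_integral_sq_int[OF d(1)] Y d(3)] .
    ultimately show ?thesis using d c2 L2F_sq_int[OF phi assms(3,4)] by blast
  qed
  obtain d where d: "\<And>k. valid_simple M F T (d k)"
      "(\<lambda>k. nsq ?\<Pi> (\<lambda>p. (\<lambda>(s, \<omega>). \<phi> s \<omega>) p - (\<lambda>(s, \<omega>). simple_integrand (d k) s \<omega>) p)) \<longlonglongrightarrow> 0"
       "(\<lambda>k. nsq M (\<lambda>\<omega>. Y t \<omega> - simple_integral W (d k) t \<omega>)) \<longlonglongrightarrow> 0"
       "\<And>k. sq_int ?\<Pi> (\<lambda>(s, \<omega>). simple_integrand (d k) s \<omega>)" "sq_int ?\<Pi> (\<lambda>(s, \<omega>). \<phi> s \<omega>)" "sq_int M (Y t)"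
    using conv[OF assms(1)] by auto
  obtain d' where d': "\<And>k. valid_simple M F T (d' k)"
      "(\<lambda>k. nsq ?\<Pi> (\<lambda>p. (\<lambda>(s, \<omega>). \<phi>' s \<omega>) p - (\<lambda>(s, \<omega>). simple_integrand (d' k) s \<omega>) p)) \<longlonglongrightarrow> 0"
       "(\<lambda>k. nsq M (\<lambda>\<omega>. Y' t \<omega> - simple_integral W (d' k) t \<omega>)) \<longlonglongrightarrow> 0"
       "\<And>k. sq_int ?\<Pi> (\<lambda>(s, \<omega>). simple_integrand (d' k) s \<omega>)" "sq_int ?\<Pi> (\<lambda>(s, \<omega>). \<phi>' s \<omega>)" "sq_int M (Y' t)"
    using conv[OF assms(2)] by auto
  note I = simple_integral_sq_int[OF d(1), of _ t] and I' = simple_integral_sq_int[OF d'(1), of _ t]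
  have A: "(\<lambda>k. nsq M (\<lambda>\<omega>. simple_integral W (d k) t \<omega> - simple_integral W (d' k) t \<omega>))
      \<longlonglongrightarrow> nsq M (\<lambda>\<omega>. Y t \<omega> - Y' t \<omega>)"
    using d(6) d'(6) I I' by (intro tendsto_nsq sq_int_diff nsq_diff_tendsto d(3) d'(3) sq_int_measurable)
  have B: "(\<lambda>k. nsq ?\<Pi> (\<lambda>p. (\<lambda>(s, \<omega>). simple_integrand (d k) s \<omega>) p - (\<lambda>(s, \<omega>). simple_integrand (d' k) s \<omega>) p))
      \<longlonglongrightarrow> nsq ?\<Pi> (\<lambda>p. (\<lambda>(s, \<omega>). \<phi> s \<omega>) p - (\<lambda>(s, \<omega>). \<phi>' s \<omega>) p)"
    by (intro tendsto_nsq sq_int_diff nsq_diff_tendsto d(2,4,5) d'(2,4,5) sq_int_measurable[OF d(4)]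
        sq_int_measurable[OF d'(4)] sq_int_measurable[OF d(5)] sq_int_measurable[OF d'(5)])
  have e1: "nsq M (\<lambda>\<omega>. simple_integral W (d k) t \<omega> - simple_integral W (d' k) t \<omega>)
     = nsq ?\<Pi> (\<lambda>p. (\<lambda>(s, \<omega>). simple_integrand (d k) s \<omega>) p - (\<lambda>(s, \<omega>). simple_integrand (d' k) s \<omega>) p)" for k
    unfolding simple_difference_isometry[OF d(1) d'(1) assms(3)]
    using sq_norm_L2_eq_nsq[of "\<lambda>s \<omega>. simple_integrand (d k) s \<omega> - simple_integrand (d' k) s \<omega>" t]
      borel_measurable_diff[OF sq_int_measurable[OF d(4)] sq_int_measurable[OF d'(4)], of k k]
    by (simp add: split_beta')
  have e2: "sq_norm_L2 M t (\<lambda>s \<omega>. \<phi> s \<omega> - \<phi>' s \<omega>)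
     = nsq ?\<Pi> (\<lambda>p. (\<lambda>(s, \<omega>). \<phi> s \<omega>) p - (\<lambda>(s, \<omega>). \<phi>' s \<omega>) p)"
    using sq_norm_L2_eq_nsq[of "\<lambda>s \<omega>. \<phi> s \<omega> - \<phi>' s \<omega>" t]
      borel_measurable_diff[OF sq_int_measurable[OF d(5)] sq_int_measurable[OF d'(5)]]
    by (simp add: split_beta')
  show ?thesis unfolding e2 using LIMSEQ_unique[OF A B[folded e1]] .
qed

text \<open>Serves twice: as the comparison integral in \<open>ito_isometry\<close>, and as the
  martingale part of the mean process, which is deterministic.\<close>

lemma ito_zero: "is_ito_integral M F W T (\<lambda>_ _. 0) (\<lambda>_ _. 0)"
  unfolding is_ito_integral_def
proof (intro conjI exI[of _ "\<lambda>k. (0, \<lambda>_. 0, \<lambda>_ _. 0)"])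
  show "(\<lambda>_ _. 0) \<in> L2F M F T" by (simp add: L2F_def progressive_def sq_norm_L2_def)
qed (simp_all add: valid_simple_def simple_integral_def simple_integrand_def sq_norm_L2_def)

lemma ito_isometry:
  fixes Y :: "real \<Rightarrow> 'w \<Rightarrow> 'h::euclidean_space"
  assumes "is_ito_integral M F W T \<phi> Y" "0 \<le> t" "t \<le> T"
  shows "nsq M (Y t) = sq_norm_L2 M t \<phi>"
  using ito_difference_isometry[OF assms(1) ito_zero assms(2,3)] by simp

lemma ito_sq_int:
  fixes Y :: "real \<Rightarrow> 'w \<Rightarrow> 'h::euclidean_space"
  assumes "is_ito_integral M F W T \<phi> Y" "0 \<le> t" "t \<le> T"
  shows "sq_int M (Y t)"
  using ito_isometry[OF assms] assms sq_norm_L2_mono[OF assms(3), of \<phi>]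
  by (auto simp: sq_int_iff_nsq is_ito_integral_def L2F_def intro: le_less_trans)

text \<open>Orthogonality to \<open>Z\<close> holds for the approximating simple integrals and is
  closed under L2 convergence.\<close>

lemma ito_martingale:
  fixes Y :: "real \<Rightarrow> 'w \<Rightarrow> 'h::euclidean_space"
  assumes ito: "is_ito_integral M F W T \<phi> Y" and st: "0 \<le> s" "s \<le> t" "t \<le> T"
    and Z: "sq_int M Z" "Z \<in> borel_measurable (F s)"
  shows "(\<integral>\<omega>. (Y t \<omega> - Y s \<omega>) \<bullet> Z \<omega> \<partial>M) = 0"
proof -
  obtain d where d: "\<And>k. valid_simple M F T (d k)"
    "\<And>t. t \<in> {0..T} \<Longrightarrow> (\<lambda>k. nsq M (\<lambda>\<omega>. Y t \<omega> - simple_integral W (d k) t \<omega>)) \<longlonglongrightarrow> 0"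
    by (rule ito_approximation[OF ito]) auto
  note I = simple_integral_sq_int[OF d(1)]
  have Y: "sq_int M (Y t)" "sq_int M (Y s)" using ito_sq_int[OF ito] st by auto
  have "(\<lambda>k. \<integral>\<omega>. (simple_integral W (d k) t \<omega> - simple_integral W (d k) s \<omega>) \<bullet> Z \<omega> \<partial>M)
      \<longlonglongrightarrow> (\<integral>\<omega>. (Y t \<omega> - Y s \<omega>) \<bullet> Z \<omega> \<partial>M)"
    using st by (intro tendsto_integral_inner sq_int_diff nsq_diff_tendsto I Y Z d(2)
        sq_int_measurable[OF I] sq_int_measurable[OF Y(1)] sq_int_measurable[OF Y(2)])
      (simp_all add: nsq_def)
  then show ?thesis
    using simple_integral_martingale[OF d(1) st(1,2) Z] by (simp add: LIMSEQ_const_iff)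
qed

text \<open>The definition does not prescribe Y 0; the isometry at time 0 does, because a single
  time has Lebesgue measure 0.\<close>

lemma ito_initial:
  fixes Y :: "real \<Rightarrow> 'w \<Rightarrow> 'h::euclidean_space"
  assumes "is_ito_integral M F W T \<phi> Y" "0 \<le> T"
  shows "AE \<omega> in M. Y 0 \<omega> = 0"
proof -
  have "AE t in lborel. t \<noteq> (0::real)" using AE_lborel_singleton[of "0::real"] by simp
  then have "(\<integral>\<^sup>+t\<in>{0..0}. ennreal ((norm (\<phi> t \<omega>))\<^sup>2) \<partial>lborel) = (\<integral>\<^sup>+t. 0 \<partial>(lborel :: real measure))" for \<omega>
    by (intro nn_integral_cong_AE) (auto simp: indicator_def)
  then have "nsq M (Y 0) = 0"
    unfolding ito_isometry[OF assms(1) order_refl assms(2)] sq_norm_L2_def by simp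
  moreover have [measurable]: "Y 0 \<in> borel_measurable M"
    using ito_sq_int[OF assms(1) order_refl assms(2)] sq_int_measurable by blast
  ultimately show ?thesis by (auto simp: nsq_def nn_integral_0_iff_AE)
qed

text \<open>Simple integrands are mapped by applying \<open>L\<close> to their coefficients, and
  squared distances grow by at most the factor K^2. With \<open>L\<close> a coordinate this reduces
  vector-valued integrals to scalar ones.\<close>

lemma ito_linear:
  fixes Y :: "real \<Rightarrow> 'w \<Rightarrow> 'h::euclidean_space" and L :: "'h \<Rightarrow> 'g::euclidean_space"
  assumes L: "bounded_linear L" and ito: "is_ito_integral M F W T \<phi> Y"
  shows "is_ito_integral M F W T (\<lambda>t \<omega>. L (\<phi> t \<omega>)) (\<lambda>t \<omega>. L (Y t \<omega>))"
proof -
  obtain K where K: "\<And>x. norm (L x) \<le> norm x * K" "0 < K"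
    using bounded_linear.pos_bounded[OF L] by blast
  have Lm: "L \<in> borel_measurable borel"
    using L by (intro borel_measurable_continuous_onI linear_continuous_on)
  have sq: "ennreal ((norm (L x))\<^sup>2) \<le> ennreal (K\<^sup>2) * ennreal ((norm x)\<^sup>2)" for x
  proof -
    have "(norm (L x))\<^sup>2 \<le> (norm x * K)\<^sup>2" using K by (intro power_mono) auto
    then have "(norm (L x))\<^sup>2 \<le> K\<^sup>2 * (norm x)\<^sup>2" by (simp add: power_mult_distrib mult.commute)
    then show ?thesis by (simp add: ennreal_mult[symmetric] ennreal_leI)
  qed
  obtain d where d: "\<And>k. valid_simple M F T (d k)"
      "(\<lambda>k. sq_norm_L2 M T (\<lambda>t \<omega>. \<phi> t \<omega> - simple_integrand (d k) t \<omega>)) \<longlonglongrightarrow> 0"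
      "\<And>t. t \<in> {0..T} \<Longrightarrow> (\<lambda>k. nsq M (\<lambda>\<omega>. Y t \<omega> - simple_integral W (d k) t \<omega>)) \<longlonglongrightarrow> 0"
    and phi: "\<phi> \<in> L2F M F T" and Y: "\<And>t. t \<in> {0..T} \<Longrightarrow> Y t \<in> borel_measurable M"
    by (rule ito_approximation[OF ito]) auto
  define e where "e k = (case d k of (N, \<tau>, \<xi>) \<Rightarrow> (N, \<tau>, \<lambda>i \<omega>. L (\<xi> i \<omega>)))" for k
  have e: "simple_integrand (e k) t \<omega> = L (simple_integrand (d k) t \<omega>)"
    "simple_integral W (e k) t \<omega> = L (simple_integral W (d k) t \<omega>)" for k t \<omega>
    by (cases "d k"; simp add: e_def simple_integrand_linear[OF L])+
  have ev: "valid_simple M F T (e k)" for k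
  proof -
    obtain N \<tau> \<xi> where D: "d k = (N, \<tau>, \<xi>)" by (cases "d k")
    have "\<exists>c. \<forall>\<omega>\<in>space M. norm (L (\<xi> i \<omega>)) \<le> c" if bdd: "\<exists>c. \<forall>\<omega>\<in>space M. norm (\<xi> i \<omega>) \<le> c" for i
    proof -
      obtain c where "\<forall>\<omega>\<in>space M. norm (\<xi> i \<omega>) \<le> c" using bdd by blast
      then have "\<forall>\<omega>\<in>space M. norm (L (\<xi> i \<omega>)) \<le> c * K"
        using K by (meson mult_right_mono order_trans less_imp_le)
      then show ?thesis by blast
    qed
    moreover have "(\<lambda>\<omega>. L (\<xi> i \<omega>)) \<in> borel_measurable (F (\<tau> i))" if "i < N" for i
      by (rule measurable_compose[OF _ Lm]) (use d(1)[of k] that in \<open>auto simp: D valid_simple_def\<close>)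
    ultimately show ?thesis
      using d(1)[of k] by (simp add: D e_def valid_simple_def)
  qed
  interpret bounded_linear L by fact
  have L2: "sq_norm_L2 M T (\<lambda>t \<omega>. L (\<psi> t \<omega>)) \<le> ennreal (K\<^sup>2) * sq_norm_L2 M T \<psi>"
    if m: "(\<lambda>(s, \<omega>). \<psi> s \<omega>) \<in> borel_measurable (time_measure T \<Otimes>\<^sub>M M)" for \<psi>
  proof -
    have "(\<lambda>(s, \<omega>). L (\<psi> s \<omega>)) \<in> borel_measurable (time_measure T \<Otimes>\<^sub>M M)"
      using measurable_compose[OF m Lm] by (simp add: split_beta')
    then have "sq_norm_L2 M T (\<lambda>t \<omega>. L (\<psi> t \<omega>)) = nsq (time_measure T \<Otimes>\<^sub>M M) (\<lambda>(s, \<omega>). L (\<psi> s \<omega>))"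
      by (rule sq_norm_L2_eq_nsq)
    also have "\<dots> \<le> (\<integral>\<^sup>+p. ennreal (K\<^sup>2) * ennreal ((norm ((\<lambda>(s, \<omega>). \<psi> s \<omega>) p))\<^sup>2) \<partial>(time_measure T \<Otimes>\<^sub>M M))"
      unfolding nsq_def using sq by (intro nn_integral_mono) (auto simp: split_beta')
    also have "\<dots> = ennreal (K\<^sup>2) * sq_norm_L2 M T \<psi>"
      unfolding sq_norm_L2_eq_nsq[OF m] nsq_def
      by (intro nn_integral_cmult measurable_compose[OF m, of "\<lambda>x. ennreal ((norm x)\<^sup>2)"]) simp
    finally show ?thesis .
  qed
  show ?thesis
  proof (cases "0 \<le> T")
    case True
    have m1: "(\<lambda>(s, \<omega>). \<phi> s \<omega>) \<in> borel_measurable (time_measure T \<Otimes>\<^sub>M M)"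
      using progressive_joint[of T \<phi> T] phi True by (simp add: L2F_def)
    show ?thesis
      unfolding is_ito_integral_def nsq_def[symmetric]
    proof (intro conjI exI[of _ e] allI ballI ev)
      have "progressive F T (\<lambda>t \<omega>. L (\<phi> t \<omega>))"
        using phi measurable_compose[OF _ Lm] unfolding L2F_def progressive_def split_beta' by blast
      then show "(\<lambda>t \<omega>. L (\<phi> t \<omega>)) \<in> L2F M F T"
        using phi L2[OF m1] by (auto simp: L2F_def ennreal_mult_less_top intro: le_less_trans)
      show "(\<lambda>\<omega>. L (Y t \<omega>)) \<in> borel_measurable M" if "t \<in> {0..T}" for t
        using measurable_compose[OF Y[OF that] Lm] .
      have "(\<lambda>(s, \<omega>). \<phi> s \<omega> - simple_integrand (d k) s \<omega>) \<in> borel_measurable (time_measure T \<Otimes>\<^sub>M M)" for k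
        using borel_measurable_diff[OF m1 simple_integrand_joint[OF d(1)]] by (simp add: split_beta')
      note L2' = L2[OF this]
      show "(\<lambda>k. sq_norm_L2 M T (\<lambda>t \<omega>. L (\<phi> t \<omega>) - simple_integrand (e k) t \<omega>)) \<longlonglongrightarrow> 0"
        unfolding e diff[symmetric]
        by (rule tendsto_0_ennreal_le[OF L2'])
           (use ennreal_tendsto_cmult[OF _ d(2), of "ennreal (K\<^sup>2)"] in auto)
      show "(\<lambda>k. nsq M (\<lambda>\<omega>. L (Y t \<omega>) - simple_integral W (e k) t \<omega>)) \<longlonglongrightarrow> 0" if t: "t \<in> {0..T}" for t
      proof -
        have "nsq M (\<lambda>\<omega>. L (Y t \<omega> - simple_integral W (d k) t \<omega>))
          \<le> ennreal (K\<^sup>2) * nsq M (\<lambda>\<omega>. Y t \<omega> - simple_integral W (d k) t \<omega>)" for k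
          unfolding nsq_def using Y[OF t] sq_int_measurable[OF simple_integral_sq_int[OF d(1)]]
          by (subst nn_integral_cmult[symmetric]) (auto intro!: nn_integral_mono sq)
        note le = this
        show ?thesis
          unfolding e diff[symmetric]
          by (rule tendsto_0_ennreal_le[OF le])
             (use ennreal_tendsto_cmult[OF _ d(3)[OF t], of "ennreal (K\<^sup>2)"] in auto)
      qed
    qed
  next
    \<comment> \<open>For T < 0 the time interval is empty: the norms vanish and the conditions over
      time are void.\<close>
    case False
    then show ?thesis
      using phi d ev unfolding is_ito_integral_def
      by (intro conjI exI[of _ e]) (auto simp: L2F_def progressive_def sq_norm_L2_def)
  qed
qed

end

section \<open>Maximal inequality and completeness\<close>

text \<open>A deterministic form of Doob's inequality: the sum is a discrete integral of the running
  maximum, whose expectation will have a sign. Completing the square in m n - 2 s n produces the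
  constant 4.\<close>

lemma maximal_pathwise:
  fixes s :: "nat \<Rightarrow> real"
  defines "m n \<equiv> Max (s ` {..n})"
  assumes nonneg: "\<And>i. 0 \<le> s i"
  shows "(m n)\<^sup>2 \<le> 4 * (s n)\<^sup>2 - 4 * (\<Sum>k<n. m k * (s (Suc k) - s k))"
proof -
  \<comment> \<open>The bound is inductive: while the maximum stays, both sides grow alike; when it
    jumps to s (Suc n), the right side gains an extra 2 (s (Suc n) - m n)^2.\<close>
  have "4 * (\<Sum>k<n. m k * (s (Suc k) - s k)) \<le> 4 * m n * s n - 2 * (m n)\<^sup>2"
  proof (induction n)
    case 0
    then show ?case by (simp add: m_def power2_eq_square)
  next
    case (Suc n)
    have m': "m (Suc n) = max (m n) (s (Suc n))"
      by (simp add: m_def atMost_Suc max.commute)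
    have "4 * m n * s (Suc n) - 2 * (m n)\<^sup>2 \<le> 4 * m (Suc n) * s (Suc n) - 2 * (m (Suc n))\<^sup>2"
    proof (cases "s (Suc n) \<le> m n")
      case False
      have "0 \<le> 2 * (s (Suc n) - m n)\<^sup>2" by simp
      then show ?thesis using False unfolding m' by (simp add: max_def power2_eq_square algebra_simps)
    qed (simp add: m' max_def)
    then show ?case using Suc by (simp add: algebra_simps)
  qed
  moreover have "0 \<le> (m n - 2 * s n)\<^sup>2" by simp
  ultimately show ?thesis by (simp add: power2_eq_square algebra_simps)
qed

text \<open>For a continuous path the dyadic points suffice, so that an uncountable supremum becomes
  a countable one, which is measurable in the sample point.\<close>

lemma SUP_sq_dyadic:
  fixes y :: "real \<Rightarrow> 'h::euclidean_space"
  assumes T: "0 < T" and c: "continuous_on {0..T} y"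
  shows "(SUP t\<in>{0..T}. ennreal ((norm (y t))\<^sup>2))
    = (SUP n. SUP k\<in>{..2 ^ n::nat}. ennreal ((norm (y (T * real k / 2 ^ n)))\<^sup>2))" (is "_ = ?R")
proof (rule antisym)
  show "(SUP t\<in>{0..T}. ennreal ((norm (y t))\<^sup>2)) \<le> ?R"
  proof (rule SUP_least)
    fix t assume t: "t \<in> {0..T}"
    \<comment> \<open>\<open>k n\<close> is the index of the last point of the n-th grid not after
      t; \<open>s n\<close> is this point, at most T / 2^n before t.\<close>
    define k where "k n = nat \<lfloor>2 ^ n * (t / T)\<rfloor>" for n :: nat
    define s where "s n = T * real (k n) / 2 ^ n" for n
    have tT: "0 \<le> t / T" "t / T \<le> 1" using t T by (auto simp: divide_simps)
    have k: "real (k n) \<le> 2 ^ n * (t / T)" "2 ^ n * (t / T) < real (k n) + 1" for n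
    proof -
      have "0 \<le> 2 ^ n * (t / T)" using tT(1) by (intro mult_nonneg_nonneg) auto
      then have "real (k n) = of_int \<lfloor>2 ^ n * (t / T)\<rfloor>" unfolding k_def by (intro of_nat_nat) simp
      then show "real (k n) \<le> 2 ^ n * (t / T)" "2 ^ n * (t / T) < real (k n) + 1"
        using floor_correct[of "2 ^ n * (t / T)"] by linarith+
    qed
    have k2: "k n \<le> 2 ^ n" for n
    proof -
      have "real (k n) \<le> 2 ^ n * 1" by (rule order_trans[OF k(1) mult_left_mono[OF tT(2)]]) simp
      then show ?thesis by (metis mult.right_neutral of_nat_le_iff of_nat_numeral of_nat_power)
    qed
    have s1: "s n \<le> t" "t - T / 2 ^ n \<le> s n" "0 \<le> s n" for n
    proof -
      have e: "T * (2 ^ n * (t / T)) = 2 ^ n * t" using T by simp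
      have "T * real (k n) \<le> 2 ^ n * t" "2 ^ n * t \<le> T * (real (k n) + 1)"
        using mult_left_mono[OF k(1)[of n], of T] mult_left_mono[OF less_imp_le[OF k(2)[of n]], of T] T e by auto
      then have "s n \<le> t" "t \<le> T * (real (k n) + 1) / 2 ^ n"
        unfolding s_def by (simp_all add: divide_le_eq le_divide_eq mult.commute)
      moreover have "T * (real (k n) + 1) / 2 ^ n = s n + T / 2 ^ n"
        by (simp add: s_def distrib_left add_divide_distrib)
      ultimately show "s n \<le> t" "t - T / 2 ^ n \<le> s n" "0 \<le> s n"
        unfolding s_def using T by simp_all
    qed
    have "s \<longlonglongrightarrow> t"
    proof (rule tendsto_sandwich)
      have "(\<lambda>n. t - T * (1 / 2) ^ n) \<longlonglongrightarrow> t - T * 0" by (intro tendsto_intros LIMSEQ_realpow_zero) auto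
      then show "(\<lambda>n. t - T / 2 ^ n) \<longlonglongrightarrow> t" by (simp add: power_divide)
    qed (use s1 in auto)
    then have "(\<lambda>n. y (s n)) \<longlonglongrightarrow> y t"
      using s1 t by (intro continuous_on_tendsto_compose[OF c]) (auto intro!: always_eventually order_trans[OF s1(1)])
    then have conv: "(\<lambda>n. ennreal ((norm (y (s n)))\<^sup>2)) \<longlonglongrightarrow> ennreal ((norm (y t))\<^sup>2)"
      by (intro tendsto_ennrealI tendsto_power tendsto_norm)
    have le: "ennreal ((norm (y (s n)))\<^sup>2) \<le> ?R" for n
      unfolding s_def using k2[of n] by (intro SUP_upper2[of n] SUP_upper2[of "k n"]) auto
    show "ennreal ((norm (y t))\<^sup>2) \<le> ?R" by (rule LIMSEQ_le_const2[OF conv]) (use le in blast)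
  qed
  show "?R \<le> (SUP t\<in>{0..T}. ennreal ((norm (y t))\<^sup>2))"
  proof (intro SUP_least)
    fix n and k :: nat assume "k \<in> {..2 ^ n}"
    then have "real k \<le> 2 ^ n" by (metis atMost_iff of_nat_le_iff of_nat_numeral of_nat_power)
    then have "T * real k / 2 ^ n \<in> {0..T}" using T by (auto simp: divide_simps)
    then show "ennreal ((norm (y (T * real k / 2 ^ n)))\<^sup>2) \<le> (SUP t\<in>{0..T}. ennreal ((norm (y t))\<^sup>2))"
      by (rule SUP_upper)
  qed
qed

text \<open>Consecutive distances r / 2^k have the tail sum 2 r / 2^k.\<close>

lemma geometric_cauchy:
  fixes z :: "nat \<Rightarrow> 'a::banach"
  assumes step: "\<And>k. norm (z (Suc k) - z k) \<le> r * (1 / 2) ^ k"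
  shows "convergent z" "norm (z k - lim z) \<le> 2 * r * (1 / 2) ^ k"
proof -
  have r: "0 \<le> r" using order_trans[OF norm_ge_zero step[of 0]] by simp
  have bound: "norm (z (k + n) - z k) \<le> 2 * r * (1 / 2) ^ k" for k n
  proof -
    \<comment> \<open>The factor 1 - (1 / 2)^n is the exact partial geometric sum; it lets the
      induction close and is dropped afterwards.\<close>
    have "norm (z (k + n) - z k) \<le> 2 * r * (1 / 2) ^ k * (1 - (1 / 2) ^ n)"
    proof (induction n)
      case (Suc n)
      have "norm (z (k + Suc n) - z k) \<le> norm (z (Suc (k + n)) - z (k + n)) + norm (z (k + n) - z k)"
        using norm_triangle_ineq[of "z (Suc (k + n)) - z (k + n)" "z (k + n) - z k"] by simp
      then show ?case using Suc step[of "k + n"] by (simp add: algebra_simps power_add)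
    qed simp
    also have "\<dots> \<le> 2 * r * (1 / 2) ^ k * 1" using r by (intro mult_left_mono) auto
    finally show ?thesis by simp
  qed
  have "Cauchy z"
  proof (rule CauchyI')
    fix e :: real assume "0 < e"
    have "(\<lambda>k. 2 * r * (1 / 2) ^ k) \<longlonglongrightarrow> 2 * r * 0" by (intro tendsto_intros LIMSEQ_realpow_zero) auto
    then have "\<forall>\<^sub>F k in sequentially. 2 * r * (1 / 2) ^ k < e"
      using \<open>0 < e\<close> by (intro order_tendstoD(2)) auto
    then obtain k0 where k0: "\<And>k. k \<ge> k0 \<Longrightarrow> 2 * r * (1 / 2) ^ k < e" by (auto simp: eventually_sequentially)
    show "\<exists>M. \<forall>m\<ge>M. \<forall>n>m. dist (z m) (z n) < e"
    proof (intro exI[of _ k0] allI impI)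
      fix m n assume "k0 \<le> m" "m < n"
      then show "dist (z m) (z n) < e"
        using bound[of m "n - m"] k0[of m] by (simp add: dist_norm norm_minus_commute)
    qed
  qed
  then show conv: "convergent z" by (rule Cauchy_convergent)
  have "(\<lambda>n. norm (z (k + n) - z k)) \<longlonglongrightarrow> norm (lim z - z k)"
    using conv LIMSEQ_ignore_initial_segment[of z "lim z" k]
    by (intro tendsto_norm tendsto_diff tendsto_const) (simp add: convergent_LIMSEQ_iff add.commute)
  then have "norm (lim z - z k) \<le> 2 * r * (1 / 2) ^ k"
    by (rule LIMSEQ_le_const2) (use bound in auto)
  then show "norm (z k - lim z) \<le> 2 * r * (1 / 2) ^ k" by (simp add: norm_minus_commute)
qed

section \<open>Suprema over time, Doob's inequality and completeness\<close>

context brownian_filtration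
begin

text \<open>Continuity is asked almost surely only, because simple integrals inherit it from
  W.\<close>

definition continuous_adapted :: "real \<Rightarrow> (real \<Rightarrow> 'w \<Rightarrow> 'h::euclidean_space) \<Rightarrow> bool" where
  "continuous_adapted T Y \<longleftrightarrow> (\<forall>t\<in>{0..T}. Y t \<in> borel_measurable (F t)) \<and>
     (AE \<omega> in M. continuous_on {0..T} (\<lambda>t. Y t \<omega>))"

definition sup_sq :: "real \<Rightarrow> (real \<Rightarrow> 'w \<Rightarrow> 'h::euclidean_space) \<Rightarrow> 'w \<Rightarrow> ennreal" where
  "sup_sq T Y \<omega> = (SUP t\<in>{0..T}. ennreal ((norm (Y t \<omega>))\<^sup>2))"

text \<open>\<open>sup_sq\<close> is an uncountable supremum without measurability at hand; this
  countable version is measurable and agrees with it almost surely. Integrals are moved here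
  wherever additivity or monotone convergence is invoked.\<close>

definition dyadic_sup_sq :: "real \<Rightarrow> (real \<Rightarrow> 'w \<Rightarrow> 'h::euclidean_space) \<Rightarrow> 'w \<Rightarrow> ennreal" where
  "dyadic_sup_sq T Y \<omega> = (SUP n. SUP k\<in>{..2 ^ n::nat}. ennreal ((norm (Y (T * real k / 2 ^ n) \<omega>))\<^sup>2))"

lemma continuous_adapted_measurable:
  "continuous_adapted T Y \<Longrightarrow> 0 \<le> t \<Longrightarrow> t \<le> T \<Longrightarrow> Y t \<in> borel_measurable M"
  using measurable_filtration_M[of t "Y t"] by (auto simp: continuous_adapted_def)

lemma dyadic_in_range: "0 < T \<Longrightarrow> k \<le> 2 ^ n \<Longrightarrow> 0 \<le> T * real k / 2 ^ n \<and> T * real k / 2 ^ n \<le> T"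
proof -
  assume "0 < T" "k \<le> 2 ^ n"
  then have "real k \<le> 2 ^ n" by (metis of_nat_le_iff of_nat_numeral of_nat_power)
  then show ?thesis using \<open>0 < T\<close> by (auto simp: divide_simps)
qed

lemma sup_sq_AE_dyadic:
  assumes "0 < T" "continuous_adapted T Y"
  shows "AE \<omega> in M. sup_sq T Y \<omega> = dyadic_sup_sq T Y \<omega>"
proof -
  have "AE \<omega> in M. continuous_on {0..T} (\<lambda>t. Y t \<omega>)" using assms(2) by (simp add: continuous_adapted_def)
  then show ?thesis
    unfolding sup_sq_def dyadic_sup_sq_def by eventually_elim (rule SUP_sq_dyadic[OF assms(1)])
qed

lemma dyadic_level_measurable:
  assumes T: "0 < T" and ca: "continuous_adapted T Y"
  shows "(\<lambda>\<omega>. SUP k\<in>{..2 ^ n::nat}. ennreal ((norm (Y (T * real k / 2 ^ n) \<omega>))\<^sup>2)) \<in> borel_measurable M"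
proof (rule borel_measurable_SUP)
  fix k :: nat assume "k \<in> {..2 ^ n}"
  then have "k \<le> 2 ^ n" by simp
  note r = dyadic_in_range[OF T this, THEN conjunct1] dyadic_in_range[OF T this, THEN conjunct2]
  note [measurable] = continuous_adapted_measurable[OF ca r]
  show "(\<lambda>\<omega>. ennreal ((norm (Y (T * real k / 2 ^ n) \<omega>))\<^sup>2)) \<in> borel_measurable M" by simp
qed simp

lemma dyadic_sup_sq_measurable:
  assumes "0 < T" "continuous_adapted T Y"
  shows "dyadic_sup_sq T Y \<in> borel_measurable M"
  unfolding dyadic_sup_sq_def
  by (rule borel_measurable_SUP[OF _ dyadic_level_measurable[OF assms]]) simp

lemma nn_integral_sup_sq:
  assumes "0 < T" "continuous_adapted T Y"
  shows "(\<integral>\<^sup>+\<omega>. sup_sq T Y \<omega> \<partial>M) = (\<integral>\<^sup>+\<omega>. dyadic_sup_sq T Y \<omega> \<partial>M)"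
  using sup_sq_AE_dyadic[OF assms] by (rule nn_integral_cong_AE)

lemma nsq_le_sup_sq: "t \<in> {0..T} \<Longrightarrow> nsq M (Y t) \<le> (\<integral>\<^sup>+\<omega>. sup_sq T Y \<omega> \<partial>M)"
  unfolding nsq_def sup_sq_def by (intro nn_integral_mono SUP_upper)

lemma continuous_adapted_diff:
  "continuous_adapted T Y \<Longrightarrow> continuous_adapted T Z \<Longrightarrow> continuous_adapted T (\<lambda>t \<omega>. Y t \<omega> - Z t \<omega>)"
  by (auto simp: continuous_adapted_def intro!: continuous_on_diff borel_measurable_diff)

lemma sup_sq_add_le:
  assumes "0 < T" "continuous_adapted T Y" "continuous_adapted T Z"
  shows "(\<integral>\<^sup>+\<omega>. sup_sq T (\<lambda>t \<omega>. Y t \<omega> + Z t \<omega>) \<omega> \<partial>M)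
    \<le> 2 * (\<integral>\<^sup>+\<omega>. sup_sq T Y \<omega> \<partial>M) + 2 * (\<integral>\<^sup>+\<omega>. sup_sq T Z \<omega> \<partial>M)"
proof -
  note [measurable] = dyadic_sup_sq_measurable[OF assms(1,2)] dyadic_sup_sq_measurable[OF assms(1,3)]
  have "sup_sq T (\<lambda>t \<omega>. Y t \<omega> + Z t \<omega>) \<omega> \<le> 2 * sup_sq T Y \<omega> + 2 * sup_sq T Z \<omega>" for \<omega>
    unfolding sup_sq_def
  proof (rule SUP_least)
    fix t assume t: "t \<in> {0..T}"
    have "ennreal ((norm (Y t \<omega> + Z t \<omega>))\<^sup>2) \<le> ennreal (2 * (norm (Y t \<omega>))\<^sup>2 + 2 * (norm (Z t \<omega>))\<^sup>2)"
      by (intro ennreal_leI norm_add_sq_le)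
    also have "\<dots> = 2 * ennreal ((norm (Y t \<omega>))\<^sup>2) + 2 * ennreal ((norm (Z t \<omega>))\<^sup>2)"
      by (simp add: ennreal_mult)
    also have "\<dots> \<le> 2 * (SUP t\<in>{0..T}. ennreal ((norm (Y t \<omega>))\<^sup>2)) + 2 * (SUP t\<in>{0..T}. ennreal ((norm (Z t \<omega>))\<^sup>2))"
      using t by (intro add_mono mult_left_mono SUP_upper) auto
    finally show "ennreal ((norm (Y t \<omega> + Z t \<omega>))\<^sup>2) \<le> \<dots>" .
  qed
  then have "(\<integral>\<^sup>+\<omega>. sup_sq T (\<lambda>t \<omega>. Y t \<omega> + Z t \<omega>) \<omega> \<partial>M)
     \<le> (\<integral>\<^sup>+\<omega>. 2 * sup_sq T Y \<omega> + 2 * sup_sq T Z \<omega> \<partial>M)" by (rule nn_integral_mono)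
  also have "\<dots> = (\<integral>\<^sup>+\<omega>. 2 * dyadic_sup_sq T Y \<omega> + 2 * dyadic_sup_sq T Z \<omega> \<partial>M)"
    using sup_sq_AE_dyadic[OF assms(1,2)] sup_sq_AE_dyadic[OF assms(1,3)]
    by (intro nn_integral_cong_AE) auto
  also have "\<dots> = 2 * (\<integral>\<^sup>+\<omega>. sup_sq T Y \<omega> \<partial>M) + 2 * (\<integral>\<^sup>+\<omega>. sup_sq T Z \<omega> \<partial>M)"
    unfolding nn_integral_sup_sq[OF assms(1,2)] nn_integral_sup_sq[OF assms(1,3)]
    by (simp add: nn_integral_add nn_integral_cmult)
  finally show ?thesis .
qed

text \<open>Doob's L2 inequality for vector-valued martingales. The increment, tested with the
  running maximum times the direction of Y k, has expectation 0. Pairing Y (Suc k) with that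
  direction gives at most its norm, so the discrete integral in \<open>maximal_pathwise\<close> has
  nonnegative expectation and may be dropped.\<close>

lemma discrete_maximal_inequality:
  fixes Y :: "nat \<Rightarrow> 'w \<Rightarrow> 'h::euclidean_space"
  assumes Y: "\<And>i. i \<le> n \<Longrightarrow> sq_int M (Y i)"
    and mart: "\<And>i Z. i < n \<Longrightarrow> sq_int M Z \<Longrightarrow> Z \<in> borel_measurable (G i) \<Longrightarrow>
      (\<integral>\<omega>. (Y (Suc i) \<omega> - Y i \<omega>) \<bullet> Z \<omega> \<partial>M) = 0"
    and adapt: "\<And>i j. i \<le> j \<Longrightarrow> j \<le> n \<Longrightarrow> Y i \<in> borel_measurable (G j)"
  shows "(\<integral>\<^sup>+\<omega>. (SUP k\<in>{..n}. ennreal ((norm (Y k \<omega>))\<^sup>2)) \<partial>M) \<le> 4 * nsq M (Y n)"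
proof -
  \<comment> \<open>Norms are continued by 0 beyond n, which makes s square integrable at every
    index.\<close>
  define s where "s \<omega> i = (if i \<le> n then norm (Y i \<omega>) else 0)" for \<omega> i
  define m where "m \<omega> k = Max (s \<omega> ` {..k})" for \<omega> k
  \<comment> \<open>\<open>sgn\<close> is the normalized vector, with value 0 at 0: pairing with
    \<open>Y k\<close> returns its norm times \<open>m\<close>, and the norm of \<open>Z k\<close>
    is at most \<open>m\<close>.\<close>
  define Z where "Z k \<omega> = m \<omega> k *\<^sub>R sgn (Y k \<omega>)" for k \<omega>
  have m_nonneg: "0 \<le> m \<omega> k" for \<omega> k
  proof -
    have "0 \<le> s \<omega> 0" by (simp add: s_def)
    also have "\<dots> \<le> m \<omega> k" unfolding m_def by (rule Max_ge) auto
    finally show ?thesis .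
  qed
  have m_le: "m \<omega> k \<le> (\<Sum>i\<le>k. s \<omega> i)" for \<omega> k
  proof -
    have "0 \<le> s \<omega> i" for i by (simp add: s_def)
    then show ?thesis unfolding m_def by (intro Max.boundedI) (auto intro!: member_le_sum)
  qed
  have m_meas: "(\<lambda>\<omega>. m \<omega> k) \<in> borel_measurable N"
    if "\<And>i. i \<le> k \<Longrightarrow> (\<lambda>\<omega>. s \<omega> i) \<in> borel_measurable N" for k N
    using that
  proof (induction k)
    case (Suc k)
    have "m \<omega> (Suc k) = max (s \<omega> (Suc k)) (m \<omega> k)" for \<omega> by (simp add: m_def atMost_Suc)
    then show ?case using Suc by simp
  qed (simp add: m_def)
  have s_sq: "sq_int M (\<lambda>\<omega>. s \<omega> i)" for i
    using Y[of i] by (cases "i \<le> n") (auto simp: s_def sq_int_def)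
  have m_sq: "sq_int M (\<lambda>\<omega>. m \<omega> k)" for k
    unfolding sq_int_def
  proof
    show mm: "(\<lambda>\<omega>. m \<omega> k) \<in> borel_measurable M"
      by (rule m_meas) (use s_sq sq_int_measurable in blast)
    show "integrable M (\<lambda>\<omega>. (norm (m \<omega> k))\<^sup>2)"
    proof (rule Bochner_Integration.integrable_bound)
      show "integrable M (\<lambda>\<omega>. (norm (\<Sum>i\<le>k. s \<omega> i))\<^sup>2)"
        using sq_int_sum[of "{..k}" M "\<lambda>i \<omega>. s \<omega> i"] s_sq by (simp add: sq_int_def)
      show "AE \<omega> in M. norm ((norm (m \<omega> k))\<^sup>2) \<le> norm ((norm (\<Sum>i\<le>k. s \<omega> i))\<^sup>2)"
        using m_le m_nonneg order_trans[OF m_nonneg m_le] by (auto intro!: power_mono)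
    qed (use mm in measurable)
  qed
  have Z_sq: "sq_int M (Z k)" and Z_meas: "Z k \<in> borel_measurable (G k)" if "k \<le> n" for k
  proof -
    have sgn_meas: "(\<lambda>\<omega>. sgn (f \<omega>)) \<in> borel_measurable N"
      if "f \<in> borel_measurable N" for f :: "'w \<Rightarrow> 'h" and N
      unfolding sgn_div_norm using that by measurable
    have ms: "(\<lambda>\<omega>. s \<omega> i) \<in> borel_measurable (G k)" if "i \<le> k" for i
      unfolding s_def using adapt[OF that \<open>k \<le> n\<close>] by auto
    show "Z k \<in> borel_measurable (G k)"
      unfolding Z_def using m_meas[OF ms] sgn_meas[OF adapt[OF order_refl that]] by auto
    have "Z k \<in> borel_measurable M"
      unfolding Z_def using sq_int_measurable[OF m_sq] sgn_meas[OF sq_int_measurable[OF Y[OF that]]] by auto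
    moreover have "integrable M (\<lambda>\<omega>. (norm (Z k \<omega>))\<^sup>2)"
    proof (rule Bochner_Integration.integrable_bound)
      show "integrable M (\<lambda>\<omega>. (norm (m \<omega> k))\<^sup>2)" using m_sq by (simp add: sq_int_def)
      show "AE \<omega> in M. norm ((norm (Z k \<omega>))\<^sup>2) \<le> norm ((norm (m \<omega> k))\<^sup>2)"
        by (auto simp: Z_def norm_sgn)
    qed (use \<open>Z k \<in> borel_measurable M\<close> in measurable)
    ultimately show "sq_int M (Z k)" by (simp add: sq_int_def)
  qed
  have "(\<integral>\<omega>. (m \<omega> n)\<^sup>2 \<partial>M) \<le> 4 * (\<integral>\<omega>. (norm (Y n \<omega>))\<^sup>2 \<partial>M)"
  proof -
    have ms: "integrable M (\<lambda>\<omega>. m \<omega> k * (s \<omega> (Suc k) - s \<omega> k))" for k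
      by (intro sq_int_mult sq_int_diff m_sq s_sq)
    have "(\<integral>\<omega>. (m \<omega> n)\<^sup>2 \<partial>M) \<le> (\<integral>\<omega>. 4 * (norm (Y n \<omega>))\<^sup>2 - 4 * (\<Sum>k<n. m \<omega> k * (s \<omega> (Suc k) - s \<omega> k)) \<partial>M)"
    proof (rule integral_mono)
      show "(m \<omega> n)\<^sup>2 \<le> 4 * (norm (Y n \<omega>))\<^sup>2 - 4 * (\<Sum>k<n. m \<omega> k * (s \<omega> (Suc k) - s \<omega> k))" for \<omega>
        using maximal_pathwise[of "s \<omega>" n] by (auto simp: m_def s_def)
      show "integrable M (\<lambda>\<omega>. (m \<omega> n)\<^sup>2)" using m_sq[of n] by (simp add: sq_int_def)
      show "integrable M (\<lambda>\<omega>. 4 * (norm (Y n \<omega>))\<^sup>2 - 4 * (\<Sum>k<n. m \<omega> k * (s \<omega> (Suc k) - s \<omega> k)))"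
        using ms Y[of n] by (auto simp: sq_int_def)
    qed
    also have "\<dots> = 4 * (\<integral>\<omega>. (norm (Y n \<omega>))\<^sup>2 \<partial>M) - 4 * (\<Sum>k<n. (\<integral>\<omega>. m \<omega> k * (s \<omega> (Suc k) - s \<omega> k) \<partial>M))"
      using ms Y[of n] by (simp add: sq_int_def)
    also have "\<dots> \<le> 4 * (\<integral>\<omega>. (norm (Y n \<omega>))\<^sup>2 \<partial>M)"
    proof -
      have "0 \<le> (\<integral>\<omega>. m \<omega> k * (s \<omega> (Suc k) - s \<omega> k) \<partial>M)" if k: "k < n" for k
      proof -
        have "0 = (\<integral>\<omega>. (Y (Suc k) \<omega> - Y k \<omega>) \<bullet> Z k \<omega> \<partial>M)"
          using mart[OF k Z_sq Z_meas] k by simp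
        also have "\<dots> \<le> (\<integral>\<omega>. m \<omega> k * (s \<omega> (Suc k) - s \<omega> k) \<partial>M)"
        proof (rule integral_mono)
          show "integrable M (\<lambda>\<omega>. (Y (Suc k) \<omega> - Y k \<omega>) \<bullet> Z k \<omega>)"
            using k by (intro sq_int_inner sq_int_diff Y Z_sq) auto
          show "(Y (Suc k) \<omega> - Y k \<omega>) \<bullet> Z k \<omega> \<le> m \<omega> k * (s \<omega> (Suc k) - s \<omega> k)" for \<omega>
          proof -
            have "norm (sgn (Y k \<omega>)) \<le> 1" by (simp add: norm_sgn)
            then have "Y (Suc k) \<omega> \<bullet> sgn (Y k \<omega>) \<le> norm (Y (Suc k) \<omega>)"
              using norm_cauchy_schwarz[of "Y (Suc k) \<omega>" "sgn (Y k \<omega>)"]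
              by (metis mult.right_neutral mult_left_mono norm_ge_zero order_trans)
            moreover have "Y k \<omega> \<bullet> sgn (Y k \<omega>) = norm (Y k \<omega>)"
              by (cases "Y k \<omega> = 0") (simp_all add: sgn_div_norm power2_norm_eq_inner[symmetric] power2_eq_square)
            ultimately have "(Y (Suc k) \<omega> - Y k \<omega>) \<bullet> sgn (Y k \<omega>) \<le> s \<omega> (Suc k) - s \<omega> k"
              using k by (simp add: s_def inner_diff_left)
            then show ?thesis
              unfolding Z_def inner_scaleR_right by (intro mult_left_mono m_nonneg)
          qed
        qed (rule ms)
        finally show ?thesis .
      qed
      then have "0 \<le> (\<Sum>k<n. (\<integral>\<omega>. m \<omega> k * (s \<omega> (Suc k) - s \<omega> k) \<partial>M))"
        by (intro sum_nonneg) auto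
      then show ?thesis by simp
    qed
    finally show ?thesis .
  qed
  then have "ennreal (\<integral>\<omega>. (m \<omega> n)\<^sup>2 \<partial>M) \<le> ennreal (4 * (\<integral>\<omega>. (norm (Y n \<omega>))\<^sup>2 \<partial>M))"
    by (rule ennreal_leI)
  also have "\<dots> = 4 * nsq M (Y n)"
    using nsq_eq_integral[OF Y[of n]] by (simp add: ennreal_mult)
  also have "ennreal (\<integral>\<omega>. (m \<omega> n)\<^sup>2 \<partial>M) = nsq M (\<lambda>\<omega>. m \<omega> n)"
    using nsq_eq_integral[OF m_sq[of n]] by simp
  finally have "nsq M (\<lambda>\<omega>. m \<omega> n) \<le> 4 * nsq M (Y n)" .
  moreover have "(\<integral>\<^sup>+\<omega>. (SUP k\<in>{..n}. ennreal ((norm (Y k \<omega>))\<^sup>2)) \<partial>M) \<le> nsq M (\<lambda>\<omega>. m \<omega> n)"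
    unfolding nsq_def
  proof (intro nn_integral_mono SUP_least ennreal_leI)
    fix \<omega> k assume "k \<in> {..n}"
    then have "norm (Y k \<omega>) = s \<omega> k" "s \<omega> k \<le> m \<omega> n" by (auto simp: s_def m_def intro!: Max_ge)
    then show "(norm (Y k \<omega>))\<^sup>2 \<le> (norm (m \<omega> n))\<^sup>2"
      using m_nonneg[of \<omega> n] norm_ge_zero[of "Y k \<omega>"] by (simp add: power_mono)
  qed
  ultimately show ?thesis by (rule order_trans[rotated])
qed

text \<open>Each dyadic grid satisfies the discrete inequality with the same bound, that of the
  final time; the grids are nested, so monotone convergence reaches the full supremum.\<close>

lemma maximal_inequality:
  fixes Y :: "real \<Rightarrow> 'w \<Rightarrow> 'h::euclidean_space"
  assumes T: "0 < T" and ca: "continuous_adapted T Y"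
    and Y: "\<And>t. 0 \<le> t \<Longrightarrow> t \<le> T \<Longrightarrow> sq_int M (Y t)"
    and mart: "\<And>s t Z. 0 \<le> s \<Longrightarrow> s \<le> t \<Longrightarrow> t \<le> T \<Longrightarrow> sq_int M Z \<Longrightarrow> Z \<in> borel_measurable (F s) \<Longrightarrow>
      (\<integral>\<omega>. (Y t \<omega> - Y s \<omega>) \<bullet> Z \<omega> \<partial>M) = 0"
  shows "(\<integral>\<^sup>+\<omega>. sup_sq T Y \<omega> \<partial>M) \<le> 4 * nsq M (Y T)"
proof -
  define g where "g n \<omega> = (SUP k\<in>{..2 ^ n::nat}. ennreal ((norm (Y (T * real k / 2 ^ n) \<omega>))\<^sup>2))" for n :: nat and \<omega>
  have [measurable]: "g n \<in> borel_measurable M" for n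
    unfolding g_def by (rule dyadic_level_measurable[OF T ca])
  have "incseq g"
  proof (intro incseq_SucI le_funI)
    fix n \<omega>
    show "g n \<omega> \<le> g (Suc n) \<omega>"
      unfolding g_def
    proof (rule SUP_least)
      fix k :: nat assume "k \<in> {..2 ^ n}"
      then show "ennreal ((norm (Y (T * real k / 2 ^ n) \<omega>))\<^sup>2)
        \<le> (SUP k\<in>{..2 ^ Suc n}. ennreal ((norm (Y (T * real k / 2 ^ Suc n) \<omega>))\<^sup>2))"
        \<comment> \<open>Grid n sits inside grid n + 1: the index k becomes 2 k.\<close>
        by (intro SUP_upper2[of "2 * k"]) (auto simp: field_simps)
    qed
  qed
  have "(\<integral>\<^sup>+\<omega>. sup_sq T Y \<omega> \<partial>M) = (\<integral>\<^sup>+\<omega>. (SUP n. g n \<omega>) \<partial>M)"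
    unfolding nn_integral_sup_sq[OF T ca] dyadic_sup_sq_def g_def ..
  also have "\<dots> = (SUP n. \<integral>\<^sup>+\<omega>. g n \<omega> \<partial>M)"
    using \<open>incseq g\<close> by (intro nn_integral_monotone_convergence_SUP) auto
  also have "\<dots> \<le> 4 * nsq M (Y T)"
  proof (rule SUP_least)
    fix n
    let ?t = "\<lambda>k::nat. T * real k / 2 ^ n"
    have "(\<integral>\<^sup>+\<omega>. (SUP k\<in>{..2 ^ n}. ennreal ((norm (Y (?t k) \<omega>))\<^sup>2)) \<partial>M) \<le> 4 * nsq M (Y (?t (2 ^ n)))"
    proof (rule discrete_maximal_inequality[where G = "\<lambda>k. F (?t k)"])
      show "sq_int M (Y (?t i))" if "i \<le> 2 ^ n" for i using dyadic_in_range[OF T that] Y by auto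
      show "Y (?t i) \<in> borel_measurable (F (?t j))" if "i \<le> j" "j \<le> 2 ^ n" for i j
      proof (rule measurable_filtration_mono)
        show "0 \<le> ?t i" using T by simp
        show "?t i \<le> ?t j" using T that by (intro divide_right_mono mult_left_mono) auto
        show "Y (?t i) \<in> borel_measurable (F (?t i))"
          using ca dyadic_in_range[OF T, of i n] that by (auto simp: continuous_adapted_def)
      qed
      show "(\<integral>\<omega>. (Y (?t (Suc i)) \<omega> - Y (?t i) \<omega>) \<bullet> Z \<omega> \<partial>M) = 0"
        if "i < 2 ^ n" "sq_int M Z" "Z \<in> borel_measurable (F (?t i))" for i Z
      proof (rule mart[OF _ _ _ that(2,3)])
        show "0 \<le> ?t i" using T by simp
        show "?t i \<le> ?t (Suc i)" using T by (intro divide_right_mono mult_left_mono) auto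
        show "?t (Suc i) \<le> T" using dyadic_in_range[OF T, of "Suc i" n] that(1) by simp
      qed
    qed
    then show "(\<integral>\<^sup>+\<omega>. g n \<omega> \<partial>M) \<le> 4 * nsq M (Y T)" unfolding g_def by simp
  qed
  finally show ?thesis .
qed

text \<open>A weighted sum of the suprema of successive differences is integrable, hence finite
  almost surely, and its finiteness forces uniform convergence of almost every path. The rate 1 / 16
  leaves room for the weights.\<close>

lemma sup_sq_complete:
  fixes Z :: "nat \<Rightarrow> real \<Rightarrow> 'w \<Rightarrow> 'h::euclidean_space"
  assumes T: "0 < T" and ca: "\<And>k. continuous_adapted T (Z k)" and c: "0 \<le> c"
    and step: "\<And>k. (\<integral>\<^sup>+\<omega>. sup_sq T (\<lambda>t \<omega>. Z (Suc k) t \<omega> - Z k t \<omega>) \<omega> \<partial>M) \<le> ennreal (c * (1 / 16) ^ k)"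
  obtains Z' where "\<And>t. t \<in> {0..T} \<Longrightarrow> Z' t \<in> borel_measurable (F t)"
    "\<And>\<omega>. continuous_on {0..T} (\<lambda>t. Z' t \<omega>)"
    "(\<lambda>k. \<integral>\<^sup>+\<omega>. sup_sq T (\<lambda>t \<omega>. Z' t \<omega> - Z k t \<omega>) \<omega> \<partial>M) \<longlonglongrightarrow> 0"
proof -
  define \<Delta> where "\<Delta> k = (\<lambda>t \<omega>. Z (Suc k) t \<omega> - Z k t \<omega>)" for k
  have ca\<Delta>: "continuous_adapted T (\<Delta> k)" for k unfolding \<Delta>_def by (intro continuous_adapted_diff ca)
  note [measurable] = dyadic_sup_sq_measurable[OF T ca\<Delta>]
  \<comment> \<open>The weight 4^k leaves c / 4^k in expectation, a convergent series; where the sum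
    is finite, the k-th difference is at most sqrt R / 2^k, uniformly in time.\<close>
  define R where "R \<omega> = (\<Sum>k. ennreal (4 ^ k) * dyadic_sup_sq T (\<Delta> k) \<omega>)" for \<omega>
  have R_meas [measurable]: "R \<in> borel_measurable M" unfolding R_def by measurable
  have "(\<integral>\<^sup>+\<omega>. R \<omega> \<partial>M) = (\<Sum>k. \<integral>\<^sup>+\<omega>. ennreal (4 ^ k) * dyadic_sup_sq T (\<Delta> k) \<omega> \<partial>M)"
    unfolding R_def by (rule nn_integral_suminf) measurable
  also have "\<dots> \<le> (\<Sum>k. ennreal (c * (1 / 4) ^ k))"
  proof (intro suminf_le summableI)
    fix k
    have "(\<integral>\<^sup>+\<omega>. ennreal (4 ^ k) * dyadic_sup_sq T (\<Delta> k) \<omega> \<partial>M) \<le> ennreal (4 ^ k) * ennreal (c * (1 / 16) ^ k)"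
      using step[of k] unfolding \<Delta>_def[symmetric] nn_integral_sup_sq[OF T ca\<Delta>]
      by (subst nn_integral_cmult) (auto intro!: mult_left_mono)
    also have "\<dots> = ennreal (c * (1 / 4) ^ k)"
    proof -
      have "(4::real) ^ k * (1 / 16) ^ k = (1 / 4) ^ k" by (simp add: power_mult_distrib[symmetric])
      then show ?thesis using c by (simp add: ennreal_mult[symmetric] mult.left_commute)
    qed
    finally show "(\<integral>\<^sup>+\<omega>. ennreal (4 ^ k) * dyadic_sup_sq T (\<Delta> k) \<omega> \<partial>M) \<le> ennreal (c * (1 / 4) ^ k)" .
  qed
  also have "\<dots> < \<infinity>"
    using summable_mult[OF summable_geometric[of "1 / 4 :: real"], of c] c
    by (subst suminf_ennreal2) auto
  finally have R_fin: "(\<integral>\<^sup>+\<omega>. R \<omega> \<partial>M) < \<infinity>" .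
  have "AE \<omega> in M. (\<forall>k. continuous_on {0..T} (\<lambda>t. Z k t \<omega>)) \<and>
      (\<forall>k. sup_sq T (\<Delta> k) \<omega> = dyadic_sup_sq T (\<Delta> k) \<omega>) \<and> R \<omega> \<noteq> \<infinity>"
    using ca sup_sq_AE_dyadic[OF T ca\<Delta>] nn_integral_noteq_infinite[OF R_meas] R_fin
    by (auto simp: AE_conj_iff AE_all_countable continuous_adapted_def)
  then obtain N where N: "N \<in> null_sets M"
    and good: "\<And>\<omega>. \<omega> \<in> space M - N \<Longrightarrow> (\<forall>k. continuous_on {0..T} (\<lambda>t. Z k t \<omega>)) \<and>
      (\<forall>k. sup_sq T (\<Delta> k) \<omega> = dyadic_sup_sq T (\<Delta> k) \<omega>) \<and> R \<omega> \<noteq> \<infinity>"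
    by (elim AE_E3) blast
  \<comment> \<open>On the exceptional set the limit is replaced by 0. Every path is then
    continuous, and adaptedness holds because null sets belong to each \<open>F t\<close>.\<close>
  define Z' where "Z' t \<omega> = (if \<omega> \<in> space M - N then lim (\<lambda>k. Z k t \<omega>) else 0)" for t \<omega>
  define r where "r \<omega> = sqrt (enn2real (R \<omega>))" for \<omega>
  have close: "norm (Z k t \<omega> - Z' t \<omega>) \<le> 2 * r \<omega> * (1 / 2) ^ k" if \<omega>: "\<omega> \<in> space M - N" and t: "t \<in> {0..T}" for k t \<omega>
  proof -
    have "norm (Z (Suc k) t \<omega> - Z k t \<omega>) \<le> r \<omega> * (1 / 2) ^ k" for k
    proof -
      have "ennreal (4 ^ k * (norm (\<Delta> k t \<omega>))\<^sup>2) \<le> ennreal (4 ^ k) * sup_sq T (\<Delta> k) \<omega>"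
        unfolding sup_sq_def using t by (auto simp: ennreal_mult intro!: mult_left_mono SUP_upper)
      also have "\<dots> = ennreal (4 ^ k) * dyadic_sup_sq T (\<Delta> k) \<omega>" using good[OF \<omega>] by simp
      also have "\<dots> \<le> R \<omega>"
        unfolding R_def using sum_le_suminf[of "\<lambda>k. ennreal (4 ^ k) * dyadic_sup_sq T (\<Delta> k) \<omega>" "{k}"]
        by (simp add: summableI)
      also have "\<dots> = ennreal (enn2real (R \<omega>))" using good[OF \<omega>] by (simp add: less_top)
      finally have "4 ^ k * (norm (\<Delta> k t \<omega>))\<^sup>2 \<le> enn2real (R \<omega>)" by (simp add: ennreal_le_iff)
      then have "(2 ^ k * norm (\<Delta> k t \<omega>))\<^sup>2 \<le> enn2real (R \<omega>)"
        by (simp add: power_mult_distrib power_mult[symmetric] mult.commute[of k] power_mult[of 2 2])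
      then have "2 ^ k * norm (\<Delta> k t \<omega>) \<le> r \<omega>" unfolding r_def by (rule real_le_rsqrt)
      then show ?thesis by (simp add: \<Delta>_def field_simps power_one_over)
    qed
    from geometric_cauchy(2)[of "\<lambda>k. Z k t \<omega>", OF this, of k] show ?thesis using \<omega> by (simp add: Z'_def)
  qed
  show thesis
  proof (rule that)
    fix t assume t: "t \<in> {0..T}"
    have "N \<in> sets (F t)" using N null_sets_filtration t by auto
    have Zm: "Z k t \<in> borel_measurable (F t)" for k using ca t by (auto simp: continuous_adapted_def)
    have "(\<lambda>\<omega>. if \<omega> \<in> N then 0 else lim (\<lambda>k. Z k t \<omega>)) \<in> borel_measurable (F t)"
      by (intro measurable_If_set borel_measurable_lim_metric Zm measurable_const)
         (use \<open>N \<in> sets (F t)\<close> in auto)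
    then show "Z' t \<in> borel_measurable (F t)"
      by (rule measurable_cong[THEN iffD1, rotated]) (use t space_filtration in \<open>auto simp: Z'_def\<close>)
  next
    fix \<omega>
    show "continuous_on {0..T} (\<lambda>t. Z' t \<omega>)"
    proof (cases "\<omega> \<in> space M - N")
      case True
      have "uniform_limit {0..T} (\<lambda>k t. Z k t \<omega>) (\<lambda>t. Z' t \<omega>) sequentially"
      proof (rule uniform_limitI)
        fix e :: real assume "0 < e"
        have "(\<lambda>k. 2 * r \<omega> * (1 / 2) ^ k) \<longlonglongrightarrow> 2 * r \<omega> * 0" by (intro tendsto_intros LIMSEQ_realpow_zero) auto
        then have "\<forall>\<^sub>F k in sequentially. 2 * r \<omega> * (1 / 2) ^ k < e"
          using \<open>0 < e\<close> by (intro order_tendstoD(2)) auto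
        then show "\<forall>\<^sub>F k in sequentially. \<forall>t\<in>{0..T}. dist (Z k t \<omega>) (Z' t \<omega>) < e"
          by eventually_elim (auto simp: dist_norm intro!: le_less_trans[OF close[OF True]])
      qed
      then show ?thesis
        by (rule uniform_limit_theorem[rotated]) (use good[OF True] in auto)
    next
      case False
      then have "Z' t \<omega> = 0" for t by (auto simp: Z'_def)
      then show ?thesis by simp
    qed
  next
    \<comment> \<open>Squaring the uniform distance 2 r / 2^k, where r is the root of R, gives 4 R /
      4^k.\<close>
    have "(\<integral>\<^sup>+\<omega>. sup_sq T (\<lambda>t \<omega>. Z' t \<omega> - Z k t \<omega>) \<omega> \<partial>M) \<le> ennreal (4 * (1 / 4) ^ k) * (\<integral>\<^sup>+\<omega>. R \<omega> \<partial>M)" for k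
    proof -
      have "(\<integral>\<^sup>+\<omega>. sup_sq T (\<lambda>t \<omega>. Z' t \<omega> - Z k t \<omega>) \<omega> \<partial>M) \<le> (\<integral>\<^sup>+\<omega>. ennreal (4 * (1 / 4) ^ k) * R \<omega> \<partial>M)"
      proof (rule nn_integral_mono_AE)
        have "sup_sq T (\<lambda>t \<omega>. Z' t \<omega> - Z k t \<omega>) \<omega> \<le> ennreal (4 * (1 / 4) ^ k) * R \<omega>" if \<omega>: "\<omega> \<in> space M - N" for \<omega>
          unfolding sup_sq_def
        proof (rule SUP_least)
          fix t assume t: "t \<in> {0..T}"
          have "(norm (Z' t \<omega> - Z k t \<omega>))\<^sup>2 \<le> (2 * r \<omega> * (1 / 2) ^ k)\<^sup>2"
            using close[OF \<omega> t, of k] by (intro power_mono) (auto simp: norm_minus_commute)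
          also have "\<dots> = 4 * (1 / 4) ^ k * enn2real (R \<omega>)"
          proof -
            have "((1 / 2 :: real) ^ k)\<^sup>2 = (1 / 4) ^ k"
              by (simp add: power2_eq_square power_mult_distrib[symmetric])
            then show ?thesis by (simp add: power_mult_distrib r_def)
          qed
          finally have "ennreal ((norm (Z' t \<omega> - Z k t \<omega>))\<^sup>2) \<le> ennreal (4 * (1 / 4) ^ k) * ennreal (enn2real (R \<omega>))"
            by (subst ennreal_mult[symmetric]) (auto intro!: ennreal_leI)
          then show "ennreal ((norm (Z' t \<omega> - Z k t \<omega>))\<^sup>2) \<le> ennreal (4 * (1 / 4) ^ k) * R \<omega>"
            using good[OF \<omega>] by (simp add: less_top)
        qed
        then show "AE \<omega> in M. sup_sq T (\<lambda>t \<omega>. Z' t \<omega> - Z k t \<omega>) \<omega> \<le> ennreal (4 * (1 / 4) ^ k) * R \<omega>"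
          using N by (intro AE_I'[OF N]) auto
      qed
      also have "\<dots> = ennreal (4 * (1 / 4) ^ k) * (\<integral>\<^sup>+\<omega>. R \<omega> \<partial>M)" by (rule nn_integral_cmult) measurable
      finally show ?thesis .
    qed
    moreover have "(\<lambda>k. ennreal (4 * (1 / 4) ^ k) * (\<integral>\<^sup>+\<omega>. R \<omega> \<partial>M)) \<longlonglongrightarrow> 0"
    proof -
      have "(\<lambda>k. (4 * (1 / 4) ^ k) * enn2real (\<integral>\<^sup>+\<omega>. R \<omega> \<partial>M)) \<longlonglongrightarrow> (4 * 0) * enn2real (\<integral>\<^sup>+\<omega>. R \<omega> \<partial>M)"
        by (intro tendsto_intros LIMSEQ_realpow_zero) auto
      then have "(\<lambda>k. ennreal ((4 * (1 / 4) ^ k) * enn2real (\<integral>\<^sup>+\<omega>. R \<omega> \<partial>M))) \<longlonglongrightarrow> ennreal 0"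
        by (intro tendsto_ennrealI) simp
      then show ?thesis using R_fin by (simp add: ennreal_mult)
    qed
    ultimately show "(\<lambda>k. \<integral>\<^sup>+\<omega>. sup_sq T (\<lambda>t \<omega>. Z' t \<omega> - Z k t \<omega>) \<omega> \<partial>M) \<longlonglongrightarrow> 0"
      by (rule tendsto_0_ennreal_le)
  qed
qed

end

section \<open>Existence of the Ito integral of a continuous process\<close>

text \<open>The cells are open on the left and closed on the right, as in a simple integrand, so
  every s > 0 lies in exactly one of them and the left end lies strictly before s.\<close>

lemma uniform_cell:
  fixes T s :: real and n :: nat
  assumes "0 < T" "0 < s" "s \<le> T"
  obtains i where "i \<le> n" "T * real i / real (Suc n) < s" "s - T / real (Suc n) \<le> T * real i / real (Suc n)"
    "\<And>j. s \<in> {T * real j / real (Suc n)<..T * real (Suc j) / real (Suc n)} \<longleftrightarrow> j = i"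
proof -
  define v where "v = s * real (Suc n) / T"
  have v: "0 < v" "v \<le> real (Suc n)" using assms by (auto simp: v_def divide_simps)
  \<comment> \<open>Ceiling minus one instead of the floor: a grid point belongs to the cell that it
    closes.\<close>
  define i where "i = nat (\<lceil>v\<rceil> - 1)"
  have "0 < \<lceil>v\<rceil>" using v by simp
  then have "real i = of_int (\<lceil>v\<rceil> - 1)" unfolding i_def by (intro of_nat_nat) simp
  then have i: "real i < v" "v \<le> real i + 1"
    using ceiling_correct[of v] by auto
  have lt: "T * c / real (Suc n) < s \<longleftrightarrow> c < v" for c
  proof -
    have "T * c / real (Suc n) < s \<longleftrightarrow> T * c < s * real (Suc n)" by (rule divide_less_eq[THEN trans]) simp
    also have "\<dots> \<longleftrightarrow> c < v" unfolding v_def using assms(1) by (simp add: less_divide_eq mult.commute)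
    finally show ?thesis .
  qed
  show thesis
  proof (rule that)
    show "i \<le> n" using i v by linarith
    show "T * real i / real (Suc n) < s" using lt i by blast
    have "\<not> T * (real i + 1) / real (Suc n) < s" using lt i by (simp add: not_less)
    then show "s - T / real (Suc n) \<le> T * real i / real (Suc n)"
      by (simp add: distrib_left add_divide_distrib)
    show "s \<in> {T * real j / real (Suc n)<..T * real (Suc j) / real (Suc n)} \<longleftrightarrow> j = i" for j
      using lt[of "real j"] lt[of "real (Suc j)"] i by (auto simp: not_less[symmetric])
  qed
qed

lemma tendsto_shrinking: "(\<lambda>n. s - T / real (Suc n)) \<longlonglongrightarrow> s"
  using tendsto_diff[OF tendsto_const lim_const_over_n[THEN LIMSEQ_Suc, of T], of s] by simp

context brownian_filtration
begin

text \<open>Replacing s by the grid point of [0, t] just below it leaves countably many values, each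
  \<open>F t\<close>-measurable; the result is jointly measurable, and continuity of every path lets
  the mesh shrink.\<close>

lemma continuous_progressive:
  fixes Y :: "real \<Rightarrow> 'w \<Rightarrow> 'h::euclidean_space"
  assumes ad: "\<And>t. t \<in> {0..T} \<Longrightarrow> Y t \<in> borel_measurable (F t)"
    and c: "\<And>\<omega>. continuous_on {0..T} (\<lambda>t. Y t \<omega>)"
  shows "progressive F T Y"
  unfolding progressive_def
proof
  fix t assume t: "t \<in> {0..T}"
  let ?P = "restrict_space borel {0..t} \<Otimes>\<^sub>M F t"
  define k where "k n s = (if s = 0 then 0 else nat \<lfloor>s * real (Suc n) / t\<rfloor>)" for n and s :: real
  \<comment> \<open>The minimum keeps \<open>r n i\<close> in [0, t] for every i, also for indices
    never attained, because the countable selection asks for measurability at each index.\<close>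
  define r where "r n i = t * real (min i (Suc n)) / real (Suc n)" for n i
  have r: "0 \<le> r n i" "r n i \<le> t" for n i
  proof -
    have "t * real (min i (Suc n)) \<le> t * real (Suc n)" using t by (intro mult_left_mono) auto
    then show "r n i \<le> t" unfolding r_def by (subst divide_le_eq) simp
  qed (use t in \<open>simp add: r_def\<close>)
  have [measurable]: "fst \<in> borel_measurable ?P"
    by (rule measurable_compose[OF measurable_fst]) (simp add: measurable_restrict_space1)
  show "(\<lambda>(s, \<omega>). Y s \<omega>) \<in> borel_measurable ?P"
  proof (rule borel_measurable_LIMSEQ_metric)
    show "(\<lambda>p. Y (r n (k n (fst p))) (snd p)) \<in> borel_measurable ?P" for n
    proof (rule measurable_compose_countable[where f = "\<lambda>i p. Y (r n i) (snd p)" and g = "\<lambda>p. k n (fst p)"])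
      show "(\<lambda>p. Y (r n i) (snd p)) \<in> borel_measurable ?P" for i
        by (rule measurable_compose[OF measurable_snd])
           (use r[of n i] t in \<open>auto intro!: measurable_filtration_mono[OF _ _ ad]\<close>)
      show "(\<lambda>p. k n (fst p)) \<in> measurable ?P (count_space UNIV)"
        unfolding k_def by measurable
    qed
    fix p assume "p \<in> space ?P"
    then obtain s \<omega> where p: "p = (s, \<omega>)" and s: "0 \<le> s" "s \<le> t"
      by (cases p) (auto simp: space_pair_measure space_restrict_space)
    have lower: "r n (k n s) \<le> s \<and> s - t / real (Suc n) \<le> r n (k n s)" for n
    proof (cases "s = 0")
      case True
      then show ?thesis using t by (simp add: r_def k_def)
    next
      case False
      then have st: "0 < t" "0 < s" using s by auto
      define v where "v = s * real (Suc n) / t"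
      have v: "0 \<le> v" "v \<le> real (Suc n)" using s st by (auto simp: v_def divide_simps)
      have "real (k n s) = of_int \<lfloor>v\<rfloor>" using False v by (simp add: k_def v_def)
      then have kv: "real (k n s) \<le> v" "v \<le> real (k n s) + 1" using floor_correct[of v] by auto
      then have "r n (k n s) = t * real (k n s) / real (Suc n)" using v by (simp add: r_def min_def)
      moreover have "t * v / real (Suc n) = s" using st by (simp add: v_def)
      moreover have "t * real (k n s) / real (Suc n) \<le> t * v / real (Suc n)"
        "t * v / real (Suc n) \<le> t * (real (k n s) + 1) / real (Suc n)"
        using kv st by (auto intro!: divide_right_mono mult_left_mono)
      ultimately show ?thesis by (simp add: distrib_left add_divide_distrib)
    qed
    have "(\<lambda>n. r n (k n s)) \<longlonglongrightarrow> s"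
      by (rule tendsto_sandwich[OF _ _ tendsto_shrinking[of s t] tendsto_const])
        (use lower in \<open>auto intro!: always_eventually\<close>)
    then have "(\<lambda>n. Y (r n (k n s)) \<omega>) \<longlonglongrightarrow> Y s \<omega>"
      using s t r order_trans[OF r(2), of T] by (intro continuous_on_tendsto_compose[OF c]) (auto intro!: always_eventually intro: order_trans)
    then show "(\<lambda>n. Y (r n (k n (fst p))) (snd p)) \<longlonglongrightarrow> (\<lambda>(s, \<omega>). Y s \<omega>) p" by (simp add: p)
  qed
qed

lemma sq_norm_L2_le_sup_sq:
  assumes "0 < T" "continuous_adapted T Y"
  shows "sq_norm_L2 M T Y \<le> ennreal T * (\<integral>\<^sup>+\<omega>. sup_sq T Y \<omega> \<partial>M)"
proof -
  note [measurable] = dyadic_sup_sq_measurable[OF assms]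
  have "(\<integral>\<^sup>+t\<in>{0..T}. ennreal ((norm (Y t \<omega>))\<^sup>2) \<partial>lborel) \<le> ennreal T * sup_sq T Y \<omega>" for \<omega>
  proof -
    have "(\<integral>\<^sup>+t\<in>{0..T}. ennreal ((norm (Y t \<omega>))\<^sup>2) \<partial>lborel) \<le> (\<integral>\<^sup>+t. sup_sq T Y \<omega> * indicator {0..T} t \<partial>lborel)"
      by (intro nn_integral_mono) (auto simp: indicator_def sup_sq_def intro!: SUP_upper)
    also have "\<dots> = ennreal T * sup_sq T Y \<omega>"
      using assms(1) by (simp add: nn_integral_cmult_indicator mult.commute)
    finally show ?thesis .
  qed
  then have "sq_norm_L2 M T Y \<le> (\<integral>\<^sup>+\<omega>. ennreal T * sup_sq T Y \<omega> \<partial>M)"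
    unfolding sq_norm_L2_def by (intro nn_integral_mono)
  also have "\<dots> = (\<integral>\<^sup>+\<omega>. ennreal T * dyadic_sup_sq T Y \<omega> \<partial>M)"
  proof (rule nn_integral_cong_AE)
    show "AE \<omega> in M. ennreal T * sup_sq T Y \<omega> = ennreal T * dyadic_sup_sq T Y \<omega>"
      using sup_sq_AE_dyadic[OF assms] by eventually_elim simp
  qed
  also have "\<dots> = ennreal T * (\<integral>\<^sup>+\<omega>. sup_sq T Y \<omega> \<partial>M)"
    unfolding nn_integral_sup_sq[OF assms] by (intro nn_integral_cmult) measurable
  finally show ?thesis .
qed

lemma sq_norm_L2_diff_le:
  fixes a b :: "real \<Rightarrow> 'w \<Rightarrow> 'h::euclidean_space"
  assumes "(\<lambda>(s, \<omega>). a s \<omega>) \<in> borel_measurable (time_measure t \<Otimes>\<^sub>M M)"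
    "(\<lambda>(s, \<omega>). b s \<omega>) \<in> borel_measurable (time_measure t \<Otimes>\<^sub>M M)"
  shows "sq_norm_L2 M t (\<lambda>s \<omega>. a s \<omega> - b s \<omega>) \<le> 2 * sq_norm_L2 M t a + 2 * sq_norm_L2 M t b"
proof -
  have m: "(\<lambda>(s, \<omega>). a s \<omega> - b s \<omega>) \<in> borel_measurable (time_measure t \<Otimes>\<^sub>M M)"
    using borel_measurable_diff[OF assms] by (simp add: split_beta')
  show ?thesis
    using nsq_diff_le[OF assms] unfolding sq_norm_L2_eq_nsq[OF m] sq_norm_L2_eq_nsq[OF assms(1)]
      sq_norm_L2_eq_nsq[OF assms(2)] by (simp add: split_beta')
qed

text \<open>Values at the left ends of uniform cells are adapted. They are replaced by 0 where their
  norm exceeds n, as coefficients of simple integrands must be bounded. Convergence is pointwise by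
  continuity and dominated by the squared supremum.\<close>

lemma continuous_simple_approximation:
  fixes \<phi> :: "real \<Rightarrow> 'w \<Rightarrow> 'h::euclidean_space"
  assumes T: "0 < T" and ad: "\<And>t. t \<in> {0..T} \<Longrightarrow> \<phi> t \<in> borel_measurable (F t)"
    and c: "\<And>\<omega>. continuous_on {0..T} (\<lambda>t. \<phi> t \<omega>)"
    and fin: "(\<integral>\<^sup>+\<omega>. sup_sq T \<phi> \<omega> \<partial>M) < \<infinity>"
  obtains d where "\<And>n::nat. valid_simple M F T (d n)"
    "(\<lambda>n. sq_norm_L2 M T (\<lambda>t \<omega>. \<phi> t \<omega> - simple_integrand (d n) t \<omega>)) \<longlonglongrightarrow> 0"
proof
  define \<tau> where "\<tau> n i = T * real i / real (Suc n)" for n i :: nat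
  define \<xi> where "\<xi> n i \<omega> = (if norm (\<phi> (\<tau> n i) \<omega>) \<le> real n then \<phi> (\<tau> n i) \<omega> else 0)" for n i \<omega>
  define d where "d n = (Suc n, \<tau> n, \<xi> n)" for n
  have \<tau>: "0 \<le> \<tau> n i" "\<tau> n i \<le> \<tau> n (Suc i)" "i \<le> Suc n \<Longrightarrow> \<tau> n i \<le> T" for n i
  proof -
    show "0 \<le> \<tau> n i" "\<tau> n i \<le> \<tau> n (Suc i)"
      unfolding \<tau>_def using T by (auto intro!: divide_right_mono mult_left_mono)
    assume "i \<le> Suc n"
    then have "T * real i \<le> T * real (Suc n)" using T by (intro mult_left_mono) auto
    then show "\<tau> n i \<le> T" unfolding \<tau>_def by (subst divide_le_eq) simp
  qed
  have valid: "valid_simple M F T (d n)" for n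
    unfolding valid_simple_def d_def split_conv
  proof (intro allI impI conjI \<tau>)
    fix i assume i: "i < Suc n"
    show "Suc i \<le> Suc n" using i by simp
    have [measurable]: "\<phi> (\<tau> n i) \<in> borel_measurable (F (\<tau> n i))" using ad \<tau> i by auto
    show "\<xi> n i \<in> borel_measurable (F (\<tau> n i))" unfolding \<xi>_def by measurable
    show "\<exists>c. \<forall>\<omega>\<in>space M. norm (\<xi> n i \<omega>) \<le> c" by (intro exI[of _ "real n"]) (auto simp: \<xi>_def)
  qed
  then show "valid_simple M F T (d n)" for n .
  have ca: "continuous_adapted T \<phi>" using ad c by (auto simp: continuous_adapted_def)
  note [measurable] = dyadic_sup_sq_measurable[OF T ca]
  have sup_dyadic: "sup_sq T \<phi> \<omega> = dyadic_sup_sq T \<phi> \<omega>" for \<omega>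
    unfolding sup_sq_def dyadic_sup_sq_def by (rule SUP_sq_dyadic[OF T c])
  have cell: "\<exists>i\<le>n. \<tau> n i < s \<and> s - T / real (Suc n) \<le> \<tau> n i \<and> (\<forall>\<omega>. simple_integrand (d n) s \<omega> = \<xi> n i \<omega>)"
    if s: "0 < s" "s \<le> T" for n s
  proof -
    obtain i where i: "i \<le> n" "\<tau> n i < s" "s - T / real (Suc n) \<le> \<tau> n i"
      "\<And>j. s \<in> {\<tau> n j<..\<tau> n (Suc j)} \<longleftrightarrow> j = i"
      unfolding \<tau>_def by (rule uniform_cell[OF T s, of n]) blast
    have "simple_integrand (d n) s \<omega> = (\<Sum>j<Suc n. if j = i then \<xi> n j \<omega> else 0)" for \<omega>
      unfolding simple_integrand_def d_def split_conv
      by (intro sum.cong refl) (simp add: indicator_def i(4) del: greaterThanAtMost_iff)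
    also have "\<dots> \<omega> = \<xi> n i \<omega>" for \<omega> using i(1) by (simp add: sum.delta')
    finally show ?thesis using i by blast
  qed
  interpret tm: finite_measure "time_measure T" by (rule finite_time_measure)
  interpret P: pair_sigma_finite "time_measure T" M ..
  let ?\<Pi> = "time_measure T \<Otimes>\<^sub>M M"
  have prog: "progressive F T \<phi>" by (rule continuous_progressive[OF ad c])
  have joint: "(\<lambda>(s, \<omega>). \<phi> s \<omega> - simple_integrand (d n) s \<omega>) \<in> borel_measurable ?\<Pi>" for n
    using borel_measurable_diff[OF progressive_joint[OF prog, of T] simple_integrand_joint[OF valid]] T
    by (simp add: split_beta')
  have [measurable]: "fst \<in> borel_measurable ?\<Pi>"
    by (rule measurable_compose[OF measurable_fst]) (simp add: measurable_restrict_space1)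
  \<comment> \<open>Time 0 lies in no cell and is discarded as a null set.\<close>
  have AE_pos: "AE p in ?\<Pi>. fst p \<noteq> 0"
  proof (rule P.AE_pair_measure)
    show "{x \<in> space ?\<Pi>. fst x \<noteq> 0} \<in> sets ?\<Pi>" by measurable
    have "AE t in lborel. t \<noteq> (0::real)" using AE_lborel_singleton[of "0::real"] by simp
    then show "AE x in time_measure T. AE y in M. fst (x, y) \<noteq> 0"
      by (subst AE_restrict_space_iff) auto
  qed
  have AE_T: "AE p in ?\<Pi>. 0 < fst p \<and> fst p \<le> T"
    using AE_pos AE_space by eventually_elim (auto simp: space_pair_measure space_restrict_space)
  let ?f = "\<lambda>n p. ennreal ((norm ((\<lambda>(s, \<omega>). \<phi> s \<omega> - simple_integrand (d n) s \<omega>) p))\<^sup>2)"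
  have "(\<lambda>n. \<integral>\<^sup>+p. ?f n p \<partial>?\<Pi>) \<longlonglongrightarrow> (\<integral>\<^sup>+p. 0 \<partial>?\<Pi>)"
  proof (rule nn_integral_dominated_convergence)
    show "?f n \<in> borel_measurable ?\<Pi>" for n
      by (rule measurable_compose[OF joint, of "\<lambda>x. ennreal ((norm x)\<^sup>2)"]) simp
    \<comment> \<open>The 4 is 2 + 2: the path and its approximation are both bounded by the
      supremum.\<close>
    show "(\<lambda>p. 4 * dyadic_sup_sq T \<phi> (snd p)) \<in> borel_measurable ?\<Pi>" by measurable
    have "(\<integral>\<^sup>+p. 4 * dyadic_sup_sq T \<phi> (snd p) \<partial>?\<Pi>)
        = (\<integral>\<^sup>+s. \<integral>\<^sup>+\<omega>. 4 * dyadic_sup_sq T \<phi> \<omega> \<partial>M \<partial>time_measure T)"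
      by (subst nn_integral_fst[symmetric]) simp_all
    also have "\<dots> = 4 * (\<integral>\<^sup>+\<omega>. sup_sq T \<phi> \<omega> \<partial>M) * emeasure (time_measure T) (space (time_measure T))"
      by (simp add: nn_integral_cmult nn_integral_sup_sq[OF T ca])
    also have "\<dots> < \<infinity>"
    proof -
      have "emeasure (time_measure T) (space (time_measure T)) < \<infinity>"
        by (metis less_top tm.emeasure_finite infinity_ennreal_def)
      then show ?thesis using fin by (simp add: ennreal_mult_less_top)
    qed
    finally show "(\<integral>\<^sup>+p. 4 * dyadic_sup_sq T \<phi> (snd p) \<partial>?\<Pi>) < \<infinity>" .
    show "AE p in ?\<Pi>. ?f n p \<le> 4 * dyadic_sup_sq T \<phi> (snd p)" for n
      using AE_T
    proof eventually_elim
      case (elim p)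
      obtain s \<omega> where p: "p = (s, \<omega>)" by (cases p)
      obtain i where i: "i \<le> n" "simple_integrand (d n) s \<omega> = \<xi> n i \<omega>"
        using cell[of s n] elim by (auto simp: p)
      have b1: "ennreal ((norm (\<phi> r \<omega>))\<^sup>2) \<le> dyadic_sup_sq T \<phi> \<omega>" if "r \<in> {0..T}" for r
        unfolding sup_dyadic[symmetric] sup_sq_def using that by (rule SUP_upper)
      have b2: "ennreal ((norm (\<xi> n i \<omega>))\<^sup>2) \<le> dyadic_sup_sq T \<phi> \<omega>"
        using b1[of "\<tau> n i"] \<tau>(1)[of n i] \<tau>(3)[of i n] i by (auto simp: \<xi>_def)
      have "?f n p \<le> ennreal (2 * (norm (\<phi> s \<omega>))\<^sup>2 + 2 * (norm (\<xi> n i \<omega>))\<^sup>2)"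
        using norm_add_sq_le[of "\<phi> s \<omega>" "- \<xi> n i \<omega>"] by (auto simp: p i simp del: ennreal_plus intro!: ennreal_leI)
      also have "\<dots> = 2 * ennreal ((norm (\<phi> s \<omega>))\<^sup>2) + 2 * ennreal ((norm (\<xi> n i \<omega>))\<^sup>2)"
        by (simp add: ennreal_mult)
      also have "\<dots> \<le> 2 * dyadic_sup_sq T \<phi> \<omega> + 2 * dyadic_sup_sq T \<phi> \<omega>"
        using elim by (intro add_mono mult_left_mono b1 b2) (auto simp: p)
      also have "\<dots> = 4 * dyadic_sup_sq T \<phi> (snd p)" by (simp add: p distrib_right[symmetric])
      finally show ?case .
    qed
    show "AE p in ?\<Pi>. (\<lambda>n. ?f n p) \<longlonglongrightarrow> 0"
      using AE_T
    proof eventually_elim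
      case (elim p)
      obtain s \<omega> where p: "p = (s, \<omega>)" by (cases p)
      have s: "0 < s" "s \<le> T" using elim by (auto simp: p)
      obtain i where i: "\<And>n. i n \<le> n \<and> \<tau> n (i n) < s \<and> s - T / real (Suc n) \<le> \<tau> n (i n) \<and>
          (\<forall>\<omega>. simple_integrand (d n) s \<omega> = \<xi> n (i n) \<omega>)"
        using cell[OF s] by metis
      have tau_lim: "(\<lambda>n. \<tau> n (i n)) \<longlonglongrightarrow> s"
        by (rule tendsto_sandwich[OF _ _ tendsto_shrinking[of s T] tendsto_const])
           (use i less_imp_le in \<open>auto intro!: always_eventually\<close>)
      have range: "\<tau> n (i n) \<in> {0..T}" for n using \<tau>(1)[of n "i n"] \<tau>(3)[of "i n" n] i[of n] by auto
      have phi_lim: "(\<lambda>n. \<phi> (\<tau> n (i n)) \<omega>) \<longlonglongrightarrow> \<phi> s \<omega>"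
        using s range by (intro continuous_on_tendsto_compose[OF c tau_lim]) (auto intro!: always_eventually)
      have "bounded ((\<lambda>t. \<phi> t \<omega>) ` {0..T})"
        by (intro compact_imp_bounded compact_continuous_image c) simp
      then obtain B where B: "\<forall>t\<in>{0..T}. norm (\<phi> t \<omega>) \<le> B" by (auto simp: bounded_iff)
      obtain n0 :: nat where n0: "B \<le> real n0" using real_arch_simple by blast
      \<comment> \<open>Along a fixed path, bounded by \<open>B\<close>, the truncation is inactive
        as soon as n \<ge> B.\<close>
      have "eventually (\<lambda>n. \<phi> (\<tau> n (i n)) \<omega> = \<xi> n (i n) \<omega>) sequentially"
        using eventually_ge_at_top[of n0]
      proof eventually_elim
        case (elim n)
        then have "norm (\<phi> (\<tau> n (i n)) \<omega>) \<le> real n" using bspec[OF B range[of n]] n0 by linarith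
        then show ?case by (simp add: \<xi>_def)
      qed
      then have "(\<lambda>n. \<xi> n (i n) \<omega>) \<longlonglongrightarrow> \<phi> s \<omega>" using phi_lim by (rule Lim_transform_eventually[rotated])
      then have "(\<lambda>n. ennreal ((norm (\<phi> s \<omega> - \<xi> n (i n) \<omega>))\<^sup>2)) \<longlonglongrightarrow> ennreal ((norm (\<phi> s \<omega> - \<phi> s \<omega>))\<^sup>2)"
        by (intro tendsto_ennrealI tendsto_power tendsto_norm tendsto_diff tendsto_const)
      then show ?case using i by (simp add: p)
    qed
  qed simp
  then show "(\<lambda>n. sq_norm_L2 M T (\<lambda>t \<omega>. \<phi> t \<omega> - simple_integrand (d n) t \<omega>)) \<longlonglongrightarrow> 0"
    using sq_norm_L2_eq_nsq[OF joint] by (simp add: nsq_def)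
qed

lemma simple_integral_continuous_adapted:
  "valid_simple M F T d \<Longrightarrow> continuous_adapted T (simple_integral W d)"
  unfolding continuous_adapted_def
proof
  assume d: "valid_simple M F T d"
  show "\<forall>t\<in>{0..T}. simple_integral W d t \<in> borel_measurable (F t)"
    using simple_integral_adapted[OF d] by auto
  show "AE \<omega> in M. continuous_on {0..T} (\<lambda>t. simple_integral W d t \<omega>)"
    using W_cont by eventually_elim (rule continuous_on_subset[OF simple_integral_continuous[OF d]], auto)
qed

text \<open>For each k a simple integrand with squared error at most 16^-k is selected. The maximal
  inequality then gives the simple integrals the rate that \<open>sup_sq_complete\<close> asks for,
  and the limit is adapted with continuous paths.\<close>

lemma ito_integral_exists:
  fixes \<phi> :: "real \<Rightarrow> 'w \<Rightarrow> 'h::euclidean_space"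
  assumes T: "0 < T" and ad: "\<And>t. t \<in> {0..T} \<Longrightarrow> \<phi> t \<in> borel_measurable (F t)"
    and c: "\<And>\<omega>. continuous_on {0..T} (\<lambda>t. \<phi> t \<omega>)"
    and fin: "(\<integral>\<^sup>+\<omega>. sup_sq T \<phi> \<omega> \<partial>M) < \<infinity>"
  obtains Y where "is_ito_integral M F W T \<phi> Y" "\<And>t. t \<in> {0..T} \<Longrightarrow> Y t \<in> borel_measurable (F t)"
    "\<And>\<omega>. continuous_on {0..T} (\<lambda>t. Y t \<omega>)"
proof -
  obtain d0 where d0: "\<And>n::nat. valid_simple M F T (d0 n)"
    "(\<lambda>n. sq_norm_L2 M T (\<lambda>t \<omega>. \<phi> t \<omega> - simple_integrand (d0 n) t \<omega>)) \<longlonglongrightarrow> 0"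
    by (rule continuous_simple_approximation[OF assms]) (assumption | rule that)+
  have "\<exists>n. sq_norm_L2 M T (\<lambda>t \<omega>. \<phi> t \<omega> - simple_integrand (d0 n) t \<omega>) \<le> ennreal ((1 / 16) ^ k)" for k :: nat
  proof -
    have "0 < ennreal ((1 / 16) ^ k)" by simp
    from order_tendstoD(2)[OF d0(2) this] show ?thesis
      by (meson eventually_happens less_imp_le trivial_limit_sequentially)
  qed
  then obtain r where r: "\<And>k. sq_norm_L2 M T (\<lambda>t \<omega>. \<phi> t \<omega> - simple_integrand (d0 (r k)) t \<omega>) \<le> ennreal ((1 / 16) ^ k)"
    by metis
  define d where "d k = d0 (r k)" for k
  have valid: "valid_simple M F T (d k)" for k by (simp add: d_def d0)
  note dk = r[folded d_def]
  have prog: "progressive F T \<phi>" by (rule continuous_progressive[OF ad c])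
  have ca: "continuous_adapted T \<phi>" using ad c by (auto simp: continuous_adapted_def)
  have joint: "(\<lambda>(s, \<omega>). \<phi> s \<omega> - simple_integrand (d n) s \<omega>) \<in> borel_measurable (time_measure T \<Otimes>\<^sub>M M)" for n
    using borel_measurable_diff[OF progressive_joint[OF prog, of T] simple_integrand_joint[OF valid]] T
    by (simp add: split_beta')
  have lim_geo: "(\<lambda>k. ennreal ((1 / 16) ^ k)) \<longlonglongrightarrow> 0"
    using tendsto_ennrealI[OF LIMSEQ_realpow_zero[of "1 / 16"]] by simp
  let ?I = "\<lambda>k. simple_integral W (d k)"
  obtain Y where Y: "\<And>t. t \<in> {0..T} \<Longrightarrow> Y t \<in> borel_measurable (F t)"
    "\<And>\<omega>. continuous_on {0..T} (\<lambda>t. Y t \<omega>)"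
    "(\<lambda>k. \<integral>\<^sup>+\<omega>. sup_sq T (\<lambda>t \<omega>. Y t \<omega> - ?I k t \<omega>) \<omega> \<partial>M) \<longlonglongrightarrow> 0"
  proof (rule sup_sq_complete[OF T, of ?I 16])
    show "continuous_adapted T (?I k)" for k by (rule simple_integral_continuous_adapted[OF valid])
    fix k
    let ?D = "\<lambda>t \<omega>. ?I (Suc k) t \<omega> - ?I k t \<omega>"
    have "(\<integral>\<^sup>+\<omega>. sup_sq T ?D \<omega> \<partial>M) \<le> 4 * nsq M (?D T)"
    proof (rule maximal_inequality[OF T])
      show "continuous_adapted T ?D"
        by (intro continuous_adapted_diff simple_integral_continuous_adapted valid)
      show "sq_int M (?D t)" for t by (intro sq_int_diff simple_integral_sq_int[OF valid])
      fix s t and Z :: "'w \<Rightarrow> 'h" assume st: "0 \<le> s" "s \<le> t" "t \<le> T" and Z: "sq_int M Z" "Z \<in> borel_measurable (F s)"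
      have i: "integrable M (\<lambda>\<omega>. (?I k t \<omega> - ?I k s \<omega>) \<bullet> Z \<omega>)" for k
        by (intro sq_int_inner sq_int_diff simple_integral_sq_int[OF valid] Z)
      have "(\<integral>\<omega>. (?D t \<omega> - ?D s \<omega>) \<bullet> Z \<omega> \<partial>M)
        = (\<integral>\<omega>. (?I (Suc k) t \<omega> - ?I (Suc k) s \<omega>) \<bullet> Z \<omega> - (?I k t \<omega> - ?I k s \<omega>) \<bullet> Z \<omega> \<partial>M)"
        by (intro Bochner_Integration.integral_cong refl) (simp add: inner_diff_left algebra_simps)
      also have "\<dots> = 0"
        using i simple_integral_martingale[OF valid st(1,2) Z] by simp
      finally show "(\<integral>\<omega>. (?D t \<omega> - ?D s \<omega>) \<bullet> Z \<omega> \<partial>M) = 0" .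
    qed
    also have "nsq M (?D T) = sq_norm_L2 M T (\<lambda>s \<omega>. simple_integrand (d (Suc k)) s \<omega> - simple_integrand (d k) s \<omega>)"
      using T by (intro simple_difference_isometry[OF valid valid]) simp
    also have "\<dots> = sq_norm_L2 M T (\<lambda>s \<omega>. (\<phi> s \<omega> - simple_integrand (d k) s \<omega>) - (\<phi> s \<omega> - simple_integrand (d (Suc k)) s \<omega>))"
      by simp
    also have "\<dots> \<le> 2 * sq_norm_L2 M T (\<lambda>t \<omega>. \<phi> t \<omega> - simple_integrand (d k) t \<omega>)
        + 2 * sq_norm_L2 M T (\<lambda>t \<omega>. \<phi> t \<omega> - simple_integrand (d (Suc k)) t \<omega>)"
      by (rule sq_norm_L2_diff_le[OF joint joint])
    also have "\<dots> \<le> 2 * ennreal ((1 / 16) ^ k) + 2 * ennreal ((1 / 16) ^ k)"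
    proof (intro add_mono mult_left_mono dk)
      show "sq_norm_L2 M T (\<lambda>t \<omega>. \<phi> t \<omega> - simple_integrand (d (Suc k)) t \<omega>) \<le> ennreal ((1 / 16) ^ k)"
        by (rule order_trans[OF dk]) (simp add: ennreal_leI power_Suc)
    qed simp_all
    \<comment> \<open>The constant 16 is 4 from the maximal inequality times 2 + 2 from splitting
      the difference through \<open>\<phi>\<close>.\<close>
    also have "4 * (2 * ennreal ((1 / 16) ^ k) + 2 * ennreal ((1 / 16) ^ k)) = ennreal (16 * (1 / 16) ^ k)"
      by (simp add: ennreal_mult distrib_right[symmetric] mult.assoc[symmetric])
    finally show "(\<integral>\<^sup>+\<omega>. sup_sq T ?D \<omega> \<partial>M) \<le> ennreal (16 * (1 / 16) ^ k)"
      by (simp add: mult_left_mono)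
  qed (simp, blast)
  have "is_ito_integral M F W T \<phi> Y"
    unfolding is_ito_integral_def nsq_def[symmetric]
  proof (intro conjI ballI exI[of _ d] allI valid)
    show "\<phi> \<in> L2F M F T"
      using prog sq_norm_L2_le_sup_sq[OF T ca] fin
      by (auto simp: L2F_def ennreal_mult_less_top intro: le_less_trans)
    show "Y t \<in> borel_measurable M" if "t \<in> {0..T}" for t
      using measurable_filtration_M[OF _ Y(1)[OF that]] that by simp
    show "(\<lambda>k. sq_norm_L2 M T (\<lambda>t \<omega>. \<phi> t \<omega> - simple_integrand (d k) t \<omega>)) \<longlonglongrightarrow> 0"
      by (rule tendsto_0_ennreal_le[OF dk lim_geo])
    show "(\<lambda>k. nsq M (\<lambda>\<omega>. Y t \<omega> - simple_integral W (d k) t \<omega>)) \<longlonglongrightarrow> 0" if t: "t \<in> {0..T}" for t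
    proof (rule tendsto_0_ennreal_le[OF _ Y(3)])
      show "nsq M (\<lambda>\<omega>. Y t \<omega> - ?I k t \<omega>) \<le> (\<integral>\<^sup>+\<omega>. sup_sq T (\<lambda>t \<omega>. Y t \<omega> - ?I k t \<omega>) \<omega> \<partial>M)" for k
        using nsq_le_sup_sq[OF t, of "\<lambda>t \<omega>. Y t \<omega> - ?I k t \<omega>"] .
    qed
  qed
  then show thesis using Y(1,2) that by blast
qed

end

section \<open>Existence of a state process\<close>

lemma bounded_bilinear_matrix_vector: "bounded_bilinear (\<lambda>(A::real^'n^'m) x. A *v x)"
  unfolding bilinear_conv_bounded_bilinear[symmetric] bilinear_def
  by (auto intro!: linearI simp: matrix_vector_mult_add_rdistrib matrix_vector_right_distrib
      matrix_vector_mult_scaleR scaleR_matrix_vector_assoc[symmetric])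

text \<open>Cauchy-Schwarz against the constant 1. Over a probability space it bounds the mean, over
  [0, t] a time integral.\<close>

lemma (in finite_measure) norm_integral_sq_le:
  assumes f: "sq_int M f"
  shows "ennreal ((norm (\<integral>x. f x \<partial>M))\<^sup>2) \<le> emeasure M (space M) * nsq M f"
proof -
  have n: "sq_int M (\<lambda>x. norm (f x))" using f by (auto simp: sq_int_def)
  have one: "sq_int M (\<lambda>x. 1::real)" by simp
  have "norm (\<integral>x. f x \<partial>M) \<le> (\<integral>x. norm (f x) \<partial>M)" by simp
  also have "\<dots> \<le> sqrt (\<integral>x. (norm (f x))\<^sup>2 \<partial>M) * sqrt (measure M (space M))"
    using sq_int_Cauchy_Schwarz[OF n one] by simp
  finally have "(norm (\<integral>x. f x \<partial>M))\<^sup>2 \<le> (sqrt (\<integral>x. (norm (f x))\<^sup>2 \<partial>M) * sqrt (measure M (space M)))\<^sup>2"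
    by (intro power_mono) auto
  also have "\<dots> = measure M (space M) * (\<integral>x. (norm (f x))\<^sup>2 \<partial>M)"
    by (simp add: power_mult_distrib)
  finally have "ennreal ((norm (\<integral>x. f x \<partial>M))\<^sup>2) \<le> ennreal (measure M (space M) * (\<integral>x. (norm (f x))\<^sup>2 \<partial>M))"
    by (rule ennreal_leI)
  also have "\<dots> = emeasure M (space M) * nsq M f"
    using nsq_eq_integral[OF f] by (simp add: ennreal_mult emeasure_eq_measure)
  finally show ?thesis .
qed

lemma set_integral_time_measure:
  fixes f :: "real \<Rightarrow> 'h::euclidean_space"
  shows "(LINT s:{0..t}|lborel. f s) = (\<integral>s. f s \<partial>time_measure t)"
  unfolding set_lebesgue_integral_def by (simp add: integral_restrict_space)

lemma continuous_sq_int_time: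
  fixes f :: "real \<Rightarrow> 'h::euclidean_space"
  assumes "continuous_on {0..T} f" "t \<le> T"
  shows "sq_int (time_measure t) f"
proof -
  have c: "continuous_on {0..t} f" using assms by (auto intro: continuous_on_subset)
  have m: "f \<in> borel_measurable (time_measure t)"
    using borel_measurable_continuous_on_restrict[OF c]
      measurable_cong_sets[OF sets_restrict_space_cong[OF sets_lborel] refl, of "{0..t}" "borel :: 'h measure"] by simp
  have "bounded (f ` {0..t})" by (intro compact_imp_bounded compact_continuous_image c) simp
  then obtain B where "\<forall>s\<in>{0..t}. norm (f s) \<le> B" by (auto simp: bounded_iff)
  then show ?thesis
    by (intro finite_measure.sq_int_of_bounded[OF finite_time_measure m, of B]) (auto simp: space_restrict_space)
qed

lemma norm_time_integral_sq_le:
  fixes f :: "real \<Rightarrow> 'h::euclidean_space"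
  assumes "continuous_on {0..T} f" "0 \<le> t" "t \<le> T"
  shows "ennreal ((norm (LINT s:{0..t}|lborel. f s))\<^sup>2) \<le> ennreal T * nsq (time_measure t) f"
proof -
  have "ennreal ((norm (LINT s:{0..t}|lborel. f s))\<^sup>2) \<le> emeasure (time_measure t) (space (time_measure t)) * nsq (time_measure t) f"
    unfolding set_integral_time_measure
    by (rule finite_measure.norm_integral_sq_le[OF finite_time_measure continuous_sq_int_time[OF assms(1,3)]])
  also have "emeasure (time_measure t) (space (time_measure t)) = ennreal t"
    using assms(2) by (simp add: emeasure_restrict_space space_restrict_space)
  also have "ennreal t * nsq (time_measure t) f \<le> ennreal T * nsq (time_measure t) f"
    using assms(3) by (intro mult_right_mono ennreal_leI) auto
  finally show ?thesis .
qed

lemma continuous_time_integral: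
  fixes f :: "real \<Rightarrow> 'h::euclidean_space"
  assumes c: "continuous_on {0..T} f"
  shows "continuous_on {0..T} (\<lambda>t. LINT s:{0..t}|lborel. f s)"
proof -
  have eq: "(LINT s:{0..t}|lborel. f s) = integral {0..t} f" if "t \<in> {0..T}" for t
    using that by (intro set_borel_integral_eq_integral borel_integrable_atLeastAtMost' continuous_on_subset[OF c]) auto
  have "continuous_on {0..T} (\<lambda>t. integral {0..t} f)"
    using c by (intro indefinite_integral_continuous_1 integrable_continuous_real)
  then show ?thesis by (rule continuous_on_eq) (simp add: eq)
qed

text \<open>Integrating the weight exp (\<beta> s) gains 1 / \<beta>; this gain takes the place of
  Gronwall's inequality in the Picard iteration.\<close>

lemma nn_integral_exp_le:
  fixes \<beta> :: real
  assumes "0 < \<beta>" "0 \<le> t" "0 \<le> c"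
  shows "(\<integral>\<^sup>+s. ennreal (c * exp (\<beta> * s)) \<partial>time_measure t) \<le> ennreal (c * exp (\<beta> * t) / \<beta>)"
proof -
  have "(\<integral>\<^sup>+s. ennreal (c * exp (\<beta> * s)) \<partial>time_measure t)
      = (\<integral>\<^sup>+s. ennreal (c * exp (\<beta> * s)) * indicator {0..t} s \<partial>lborel)"
    by (rule nn_integral_restrict_space) simp
  also have "\<dots> = ennreal (c * exp (\<beta> * t) / \<beta> - c * exp (\<beta> * 0) / \<beta>)"
    using assms by (intro nn_integral_FTC_Icc[where F = "\<lambda>s. c * exp (\<beta> * s) / \<beta>"])
      (auto intro!: derivative_eq_intros)
  also have "\<dots> \<le> ennreal (c * exp (\<beta> * t) / \<beta>)"
    using assms by (intro ennreal_leI) simp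
  finally show ?thesis .
qed

section \<open>Mean-field coefficients and the space of the iteration\<close>

context brownian_filtration
begin

text \<open>For the zero control both drift and diffusion have this form, so each estimate is proved
  once.\<close>

definition mean_field_op ::
    "(real \<Rightarrow> real^'n^'m) \<Rightarrow> (real \<Rightarrow> real^'n^'m) \<Rightarrow> (real \<Rightarrow> 'w \<Rightarrow> real^'n) \<Rightarrow> real \<Rightarrow> 'w \<Rightarrow> real^'m" where
  "mean_field_op a a' X t \<omega> = a t *v X t \<omega> + a' t *v integral\<^sup>L M (X t)"

text \<open>The space in which the Picard iteration runs. Every path is continuous, not only almost
  every one, as \<open>continuous_progressive\<close> and \<open>ito_integral_exists\<close> ask for
  it.\<close>

definition regular :: "real \<Rightarrow> (real \<Rightarrow> 'w \<Rightarrow> 'h::euclidean_space) \<Rightarrow> bool" where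
  "regular T X \<longleftrightarrow> (\<forall>t\<in>{0..T}. X t \<in> borel_measurable (F t)) \<and> (\<forall>\<omega>. continuous_on {0..T} (\<lambda>t. X t \<omega>)) \<and>
     (\<integral>\<^sup>+\<omega>. sup_sq T X \<omega> \<partial>M) < \<infinity>"

lemma regular_continuous_adapted: "regular T X \<Longrightarrow> continuous_adapted T X"
  by (auto simp: regular_def continuous_adapted_def)

lemma regular_sq_int: "regular T X \<Longrightarrow> t \<in> {0..T} \<Longrightarrow> sq_int M (X t)"
  using nsq_le_sup_sq[of t T X] measurable_filtration_M[of t "X t"]
  by (auto simp: regular_def sq_int_iff_nsq intro: le_less_trans)

lemma regular_progressive: "regular T X \<Longrightarrow> progressive F T X"
  by (rule continuous_progressive) (auto simp: regular_def)

lemma regular_joint: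
  "regular T X \<Longrightarrow> 0 \<le> t \<Longrightarrow> t \<le> T \<Longrightarrow> (\<lambda>(s, \<omega>). X s \<omega>) \<in> borel_measurable (time_measure t \<Otimes>\<^sub>M M)"
  using progressive_joint[OF regular_progressive] .

lemma regular_add:
  assumes "0 < T" "regular T X" "regular T Y"
  shows "regular T (\<lambda>t \<omega>. X t \<omega> + Y t \<omega>)"
  using assms sup_sq_add_le[OF assms(1) regular_continuous_adapted[OF assms(2)] regular_continuous_adapted[OF assms(3)]]
    ennreal_two_mult_less_top[of "\<integral>\<^sup>+\<omega>. sup_sq T X \<omega> \<partial>M" "\<integral>\<^sup>+\<omega>. sup_sq T Y \<omega> \<partial>M"]
  by (auto simp: regular_def intro!: continuous_on_add borel_measurable_add intro: le_less_trans)

lemma regular_uminus: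
  assumes "regular T X"
  shows "regular T (\<lambda>t \<omega>. - X t \<omega>)"
proof -
  have "sup_sq T (\<lambda>t \<omega>. - X t \<omega>) = sup_sq T X" by (simp add: sup_sq_def fun_eq_iff)
  then show ?thesis using assms by (auto simp: regular_def intro!: continuous_on_minus)
qed

lemma regular_diff:
  "0 < T \<Longrightarrow> regular T X \<Longrightarrow> regular T Y \<Longrightarrow> regular T (\<lambda>t \<omega>. X t \<omega> - Y t \<omega>)"
  using regular_add[of T X "\<lambda>t \<omega>. - Y t \<omega>"] regular_uminus[of T Y] by simp

lemma regular_const: "0 < T \<Longrightarrow> regular T (\<lambda>t \<omega>. x)"
  by (auto simp: regular_def sup_sq_def emeasure_space_1)

text \<open>Dominated convergence with majorant 1 + sup |X|^2, since a norm is at most 1 plus its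
  square. Continuity of the mean keeps the term with E X in the space of regular processes.\<close>

lemma regular_mean_continuous:
  assumes T: "0 < T" and X: "regular T X"
  shows "continuous_on {0..T} (\<lambda>t. integral\<^sup>L M (X t))"
proof (rule continuous_on_sequentiallyI)
  fix u a assume u: "\<forall>n. u n \<in> {0..T}" "a \<in> {0..T}" "u \<longlonglongrightarrow> a"
  note ca = regular_continuous_adapted[OF X]
  note [measurable] = dyadic_sup_sq_measurable[OF T ca]
  have fin: "(\<integral>\<^sup>+\<omega>. dyadic_sup_sq T X \<omega> \<partial>M) < \<infinity>"
    using X nn_integral_sup_sq[OF T ca] by (simp add: regular_def)
  have Xm: "X t \<in> borel_measurable M" if "t \<in> {0..T}" for t
    using regular_sq_int[OF X that] sq_int_measurable by blast
  show "(\<lambda>n. integral\<^sup>L M (X (u n))) \<longlonglongrightarrow> integral\<^sup>L M (X a)"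
  proof (rule integral_dominated_convergence[where w = "\<lambda>\<omega>. 1 + enn2real (dyadic_sup_sq T X \<omega>)"])
    show "X a \<in> borel_measurable M" "\<And>n. X (u n) \<in> borel_measurable M" using Xm u by auto
    have "(\<integral>\<^sup>+\<omega>. ennreal (enn2real (dyadic_sup_sq T X \<omega>)) \<partial>M) \<le> (\<integral>\<^sup>+\<omega>. dyadic_sup_sq T X \<omega> \<partial>M)"
      by (intro nn_integral_mono) (simp add: ennreal_enn2real_if)
    then have "integrable M (\<lambda>\<omega>. enn2real (dyadic_sup_sq T X \<omega>))"
      using fin by (intro integrableI_bounded) (auto intro: le_less_trans)
    then show "integrable M (\<lambda>\<omega>. 1 + enn2real (dyadic_sup_sq T X \<omega>))" by simp
    show "AE \<omega> in M. (\<lambda>n. X (u n) \<omega>) \<longlonglongrightarrow> X a \<omega>"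
    proof (rule AE_I2)
      fix \<omega>
      have "continuous_on {0..T} (\<lambda>t. X t \<omega>)" using X by (simp add: regular_def)
      then show "(\<lambda>n. X (u n) \<omega>) \<longlonglongrightarrow> X a \<omega>"
        by (rule continuous_on_tendsto_compose) (use u in auto)
    qed
    have "AE \<omega> in M. dyadic_sup_sq T X \<omega> \<noteq> \<infinity>"
      using fin by (intro nn_integral_noteq_infinite) auto
    then show "AE \<omega> in M. norm (X (u n) \<omega>) \<le> 1 + enn2real (dyadic_sup_sq T X \<omega>)" for n
      using sup_sq_AE_dyadic[OF T ca]
    proof eventually_elim
      case (elim \<omega>)
      have "ennreal ((norm (X (u n) \<omega>))\<^sup>2) \<le> dyadic_sup_sq T X \<omega>"
        unfolding elim(2)[symmetric] sup_sq_def using u by (intro SUP_upper) auto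
      also have "\<dots> = ennreal (enn2real (dyadic_sup_sq T X \<omega>))" using elim(1) by (simp add: less_top)
      finally have "(norm (X (u n) \<omega>))\<^sup>2 \<le> enn2real (dyadic_sup_sq T X \<omega>)" by (simp add: ennreal_le_iff)
      moreover have "norm (X (u n) \<omega>) \<le> 1 + (norm (X (u n) \<omega>))\<^sup>2"
      proof -
        have "2 * norm (X (u n) \<omega>) \<le> 1 + (norm (X (u n) \<omega>))\<^sup>2"
          using zero_le_power2[of "norm (X (u n) \<omega>) - 1"] by (simp add: power2_diff)
        then show ?thesis using norm_ge_zero[of "X (u n) \<omega>"] by linarith
      qed
      ultimately show ?case by linarith
    qed
  qed
qed

lemma mean_sq_le: "sq_int M f \<Longrightarrow> ennreal ((norm (integral\<^sup>L M f))\<^sup>2) \<le> nsq M f"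
  using norm_integral_sq_le[of f] by (simp add: emeasure_space_1)

lemma mean_field_op_diff:
  assumes "integrable M (X t)" "integrable M (Y t)"
  shows "mean_field_op a a' X t \<omega> - mean_field_op a a' Y t \<omega> = mean_field_op a a' (\<lambda>t \<omega>. X t \<omega> - Y t \<omega>) t \<omega>"
  using assms by (simp add: mean_field_op_def matrix_vector_mult_diff_distrib)

text \<open>\<open>L\<close> depends on the coefficients alone, not on time, process or sample
  point, which makes the contraction constant uniform. The mean is controlled by the second
  moment.\<close>

lemma mean_field_op_bound:
  fixes a a' :: "real \<Rightarrow> real^'n^'m"
  assumes "continuous_on {0..T} a" "continuous_on {0..T} a'"
  obtains L where "0 < L" "\<And>t X \<omega>. t \<in> {0..T} \<Longrightarrow> sq_int M (X t) \<Longrightarrow>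
    ennreal ((norm (mean_field_op a a' X t \<omega>))\<^sup>2) \<le> ennreal L * (ennreal ((norm (X t \<omega>))\<^sup>2) + nsq M (X t))"
proof -
  obtain K where K: "0 < K" "\<And>(A::real^'n^'m) x. norm (A *v x) \<le> norm A * norm x * K"
    using bounded_bilinear.pos_bounded[OF bounded_bilinear_matrix_vector] by blast
  have "\<exists>B. \<forall>t\<in>{0..T}. norm (f t) \<le> B" if "continuous_on {0..T} f" for f :: "real \<Rightarrow> real^'n^'m"
  proof -
    have "bounded (f ` {0..T})" by (intro compact_imp_bounded compact_continuous_image that) simp
    then show ?thesis by (auto simp: bounded_iff)
  qed
  from this[OF assms(1)] this[OF assms(2)] obtain B B' where
    B: "\<forall>t\<in>{0..T}. norm (a t) \<le> B" "\<forall>t\<in>{0..T}. norm (a' t) \<le> B'" by blast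
  \<comment> \<open>The 1 keeps \<open>D\<close> positive even if the coefficients vanish.\<close>
  define D where "D = max 1 (max B B') * K"
  have D: "0 < D" using K by (simp add: D_def)
  have bd: "norm (a t *v x) \<le> D * norm x" "norm (a' t *v x) \<le> D * norm x" if "t \<in> {0..T}" for t x
  proof -
    have "norm (a t) * (norm x * K) \<le> max 1 (max B B') * (norm x * K)"
      "norm (a' t) * (norm x * K) \<le> max 1 (max B B') * (norm x * K)"
      using B that K by (auto intro!: mult_right_mono simp: max.coboundedI1 max.coboundedI2 le_max_iff_disj)
    then show "norm (a t *v x) \<le> D * norm x" "norm (a' t *v x) \<le> D * norm x"
      using K(2)[of "a t" x] K(2)[of "a' t" x] by (simp_all add: D_def mult_ac)
  qed
  show thesis
  proof (rule that[of "2 * D\<^sup>2"])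
    show "0 < 2 * D\<^sup>2" using D by simp
    fix t \<omega> and X :: "real \<Rightarrow> 'w \<Rightarrow> real^'n"
    assume t: "t \<in> {0..T}" and X: "sq_int M (X t)"
    have "(norm (mean_field_op a a' X t \<omega>))\<^sup>2
        \<le> 2 * (norm (a t *v X t \<omega>))\<^sup>2 + 2 * (norm (a' t *v integral\<^sup>L M (X t)))\<^sup>2"
      unfolding mean_field_op_def by (rule norm_add_sq_le)
    also have "\<dots> \<le> 2 * (D * norm (X t \<omega>))\<^sup>2 + 2 * (D * norm (integral\<^sup>L M (X t)))\<^sup>2"
      using bd[OF t] by (intro add_mono mult_left_mono power_mono) auto
    also have "\<dots> = 2 * D\<^sup>2 * ((norm (X t \<omega>))\<^sup>2 + (norm (integral\<^sup>L M (X t)))\<^sup>2)"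
      by (simp add: power_mult_distrib distrib_left)
    finally have "ennreal ((norm (mean_field_op a a' X t \<omega>))\<^sup>2)
        \<le> ennreal (2 * D\<^sup>2) * (ennreal ((norm (X t \<omega>))\<^sup>2) + ennreal ((norm (integral\<^sup>L M (X t)))\<^sup>2))"
      by (subst ennreal_plus[symmetric], simp, simp, subst ennreal_mult[symmetric]) (auto intro!: ennreal_leI)
    also have "\<dots> \<le> ennreal (2 * D\<^sup>2) * (ennreal ((norm (X t \<omega>))\<^sup>2) + nsq M (X t))"
      by (intro mult_left_mono add_mono order_refl mean_sq_le X) auto
    finally show "ennreal ((norm (mean_field_op a a' X t \<omega>))\<^sup>2)
        \<le> ennreal (2 * D\<^sup>2) * (ennreal ((norm (X t \<omega>))\<^sup>2) + nsq M (X t))" .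
  qed
qed

lemma nsq_mean_field_op_le:
  assumes L: "\<And>\<omega>. ennreal ((norm (mean_field_op a a' X t \<omega>))\<^sup>2) \<le> ennreal L * (ennreal ((norm (X t \<omega>))\<^sup>2) + nsq M (X t))"
    and X: "sq_int M (X t)"
  shows "nsq M (mean_field_op a a' X t) \<le> ennreal (2 * L) * nsq M (X t)"
proof -
  have [measurable]: "X t \<in> borel_measurable M" using X sq_int_measurable by blast
  have "nsq M (mean_field_op a a' X t) \<le> (\<integral>\<^sup>+\<omega>. ennreal L * (ennreal ((norm (X t \<omega>))\<^sup>2) + nsq M (X t)) \<partial>M)"
    unfolding nsq_def[of M "mean_field_op a a' X t"] by (intro nn_integral_mono L)
  also have "\<dots> = ennreal L * (nsq M (X t) + nsq M (X t))"
    unfolding nsq_def by (simp add: nn_integral_cmult nn_integral_add emeasure_space_1)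
  also have "\<dots> = ennreal (2 * L) * nsq M (X t)"
    by (cases "0 \<le> L") (simp_all add: ennreal_mult mult_2[symmetric] mult_ac ennreal_neg)
  finally show ?thesis .
qed

lemma mean_field_op_regular:
  fixes a a' :: "real \<Rightarrow> real^'n^'m"
  assumes T: "0 < T" and a: "continuous_on {0..T} a" "continuous_on {0..T} a'" and X: "regular T X"
  shows "regular T (mean_field_op a a' X)"
  unfolding regular_def
proof (intro conjI ballI allI)
  note ca = regular_continuous_adapted[OF X]
  have cX: "continuous_on {0..T} (\<lambda>t. X t \<omega>)" for \<omega> using X by (simp add: regular_def)
  show "continuous_on {0..T} (\<lambda>t. mean_field_op a a' X t \<omega>)" for \<omega>
    unfolding mean_field_op_def
    by (intro continuous_on_add bounded_bilinear.continuous_on[OF bounded_bilinear_matrix_vector] a cX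
        regular_mean_continuous[OF T X])
  show "mean_field_op a a' X t \<in> borel_measurable (F t)" if "t \<in> {0..T}" for t
  proof -
    have "X t \<in> borel_measurable (F t)" using X that by (simp add: regular_def)
    moreover have "(\<lambda>x. a t *v x) \<in> borel_measurable borel"
      by (intro borel_measurable_continuous_onI linear_continuous_on matrix_vector_mul_bounded_linear)
    ultimately have "(\<lambda>\<omega>. a t *v X t \<omega>) \<in> borel_measurable (F t)" by (rule measurable_compose)
    then have "(\<lambda>\<omega>. a t *v X t \<omega> + a' t *v integral\<^sup>L M (X t)) \<in> borel_measurable (F t)" by simp
    then show ?thesis by (simp add: mean_field_op_def[abs_def])
  qed
  obtain L where L: "0 < L" "\<And>t X \<omega>. t \<in> {0..T} \<Longrightarrow> sq_int M (X t) \<Longrightarrow>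
    ennreal ((norm (mean_field_op a a' X t \<omega>))\<^sup>2) \<le> ennreal L * (ennreal ((norm (X t \<omega>))\<^sup>2) + nsq M (X t))"
    by (rule mean_field_op_bound[OF a]) blast
  let ?S = "\<integral>\<^sup>+\<omega>. sup_sq T X \<omega> \<partial>M"
  have "sup_sq T (mean_field_op a a' X) \<omega> \<le> ennreal L * (sup_sq T X \<omega> + ?S)" for \<omega>
    unfolding sup_sq_def[of T "mean_field_op a a' X"]
  proof (rule SUP_least)
    fix t assume t: "t \<in> {0..T}"
    have "ennreal ((norm (X t \<omega>))\<^sup>2) \<le> sup_sq T X \<omega>" unfolding sup_sq_def using t by (rule SUP_upper)
    then show "ennreal ((norm (mean_field_op a a' X t \<omega>))\<^sup>2) \<le> ennreal L * (sup_sq T X \<omega> + ?S)"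
      by (intro order_trans[OF L(2)[of t X, OF t regular_sq_int[OF X t]]] mult_left_mono add_mono nsq_le_sup_sq t) auto
  qed
  then have "(\<integral>\<^sup>+\<omega>. sup_sq T (mean_field_op a a' X) \<omega> \<partial>M) \<le> (\<integral>\<^sup>+\<omega>. ennreal L * (sup_sq T X \<omega> + ?S) \<partial>M)"
    by (intro nn_integral_mono)
  also have "\<dots> = (\<integral>\<^sup>+\<omega>. ennreal L * (dyadic_sup_sq T X \<omega> + ?S) \<partial>M)"
  proof (rule nn_integral_cong_AE)
    show "AE \<omega> in M. ennreal L * (sup_sq T X \<omega> + ?S) = ennreal L * (dyadic_sup_sq T X \<omega> + ?S)"
      using sup_sq_AE_dyadic[OF T ca] by eventually_elim simp
  qed
  also have "\<dots> = ennreal L * (?S + ?S)"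
    using dyadic_sup_sq_measurable[OF T ca]
    by (simp add: nn_integral_cmult nn_integral_add emeasure_space_1 nn_integral_sup_sq[OF T ca])
  also have "\<dots> < \<infinity>" using X by (auto simp: regular_def ennreal_mult_less_top)
  finally show "(\<integral>\<^sup>+\<omega>. sup_sq T (mean_field_op a a' X) \<omega> \<partial>M) < \<infinity>" .
qed

lemma sq_norm_L2_time:
  assumes "(\<lambda>(s, \<omega>). \<phi> s \<omega>) \<in> borel_measurable (time_measure t \<Otimes>\<^sub>M M)"
  shows "sq_norm_L2 M t \<phi> = (\<integral>\<^sup>+s. nsq M (\<phi> s) \<partial>time_measure t)"
proof -
  have m: "(\<lambda>p. ennreal ((norm ((\<lambda>(s, \<omega>). \<phi> s \<omega>) p))\<^sup>2)) \<in> borel_measurable (time_measure t \<Otimes>\<^sub>M M)"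
    by (rule measurable_compose[OF assms, of "\<lambda>x. ennreal ((norm x)\<^sup>2)"]) simp
  show ?thesis
    unfolding sq_norm_L2_eq_nsq[OF assms] nsq_def nn_integral_fst[OF m, symmetric] by simp
qed

text \<open>Cauchy-Schwarz in time gives the factor T. Adaptedness of \<open>V t\<close> comes from
  progressive measurability: only values on [0, t], jointly measurable with respect to
  \<open>F t\<close>, are integrated.\<close>

lemma time_integral_regular:
  fixes b :: "real \<Rightarrow> 'w \<Rightarrow> 'h::euclidean_space"
  assumes T: "0 < T" and b: "regular T b"
  defines "V \<equiv> \<lambda>t \<omega>. LINT s:{0..t}|lborel. b s \<omega>"
  shows "regular T V" "(\<integral>\<^sup>+\<omega>. sup_sq T V \<omega> \<partial>M) \<le> ennreal T * sq_norm_L2 M T b"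
    "\<And>t. t \<in> {0..T} \<Longrightarrow> nsq M (V t) \<le> ennreal T * sq_norm_L2 M t b"
proof -
  have cb: "continuous_on {0..T} (\<lambda>t. b t \<omega>)" for \<omega> using b by (simp add: regular_def)
  have pt: "ennreal ((norm (V t \<omega>))\<^sup>2) \<le> ennreal T * (\<integral>\<^sup>+s\<in>{0..t}. ennreal ((norm (b s \<omega>))\<^sup>2) \<partial>lborel)"
    if "t \<in> {0..T}" for t \<omega>
    using norm_time_integral_sq_le[OF cb, of t \<omega>] that by (simp add: V_def nsq_def nn_integral_restrict_space)
  have inner: "(\<lambda>\<omega>. \<integral>\<^sup>+s\<in>{0..t}. ennreal ((norm (b s \<omega>))\<^sup>2) \<partial>lborel) \<in> borel_measurable M"
    if "t \<in> {0..T}" for t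
  proof -
    interpret tm: finite_measure "time_measure t" by (rule finite_time_measure)
    interpret P: pair_sigma_finite "time_measure t" M ..
    have "(\<lambda>(s, \<omega>). b s \<omega>) \<in> borel_measurable (time_measure t \<Otimes>\<^sub>M M)"
      using regular_joint[OF b] that by simp
    then have "(\<lambda>p. (\<lambda>(s, \<omega>). b s \<omega>) (snd p, fst p)) \<in> borel_measurable (M \<Otimes>\<^sub>M time_measure t)"
      by (intro measurable_compose[OF measurable_Pair[OF measurable_snd measurable_fst]])
    then have m: "(\<lambda>(\<omega>, s). ennreal ((norm (b s \<omega>))\<^sup>2)) \<in> borel_measurable (M \<Otimes>\<^sub>M time_measure t)"
      by (simp add: split_beta')
    have "(\<lambda>\<omega>. \<integral>\<^sup>+s. ennreal ((norm (b s \<omega>))\<^sup>2) \<partial>time_measure t) \<in> borel_measurable M"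
      using tm.borel_measurable_nn_integral[OF m] .
    then show ?thesis by (simp add: nn_integral_restrict_space)
  qed
  show bound_t: "nsq M (V t) \<le> ennreal T * sq_norm_L2 M t b" if t: "t \<in> {0..T}" for t
  proof -
    have "nsq M (V t) \<le> (\<integral>\<^sup>+\<omega>. ennreal T * (\<integral>\<^sup>+s\<in>{0..t}. ennreal ((norm (b s \<omega>))\<^sup>2) \<partial>lborel) \<partial>M)"
      unfolding nsq_def by (intro nn_integral_mono pt t)
    also have "\<dots> = ennreal T * sq_norm_L2 M t b"
      unfolding sq_norm_L2_def by (rule nn_integral_cmult[OF inner[OF t]])
    finally show ?thesis .
  qed
  show bound: "(\<integral>\<^sup>+\<omega>. sup_sq T V \<omega> \<partial>M) \<le> ennreal T * sq_norm_L2 M T b"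
  proof -
    have "sup_sq T V \<omega> \<le> ennreal T * (\<integral>\<^sup>+s\<in>{0..T}. ennreal ((norm (b s \<omega>))\<^sup>2) \<partial>lborel)" for \<omega>
      unfolding sup_sq_def
    proof (rule SUP_least)
      fix t assume t: "t \<in> {0..T}"
      have "(\<integral>\<^sup>+s\<in>{0..t}. ennreal ((norm (b s \<omega>))\<^sup>2) \<partial>lborel) \<le> (\<integral>\<^sup>+s\<in>{0..T}. ennreal ((norm (b s \<omega>))\<^sup>2) \<partial>lborel)"
        using t by (intro nn_integral_mono) (auto simp: indicator_def)
      then show "ennreal ((norm (V t \<omega>))\<^sup>2) \<le> ennreal T * (\<integral>\<^sup>+s\<in>{0..T}. ennreal ((norm (b s \<omega>))\<^sup>2) \<partial>lborel)"
        by (intro order_trans[OF pt[OF t]] mult_left_mono) auto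
    qed
    then have "(\<integral>\<^sup>+\<omega>. sup_sq T V \<omega> \<partial>M) \<le> (\<integral>\<^sup>+\<omega>. ennreal T * (\<integral>\<^sup>+s\<in>{0..T}. ennreal ((norm (b s \<omega>))\<^sup>2) \<partial>lborel) \<partial>M)"
      by (intro nn_integral_mono)
    also have "\<dots> = ennreal T * sq_norm_L2 M T b"
      unfolding sq_norm_L2_def using T by (intro nn_integral_cmult inner) simp
    finally show ?thesis .
  qed
  show "regular T V"
    unfolding regular_def
  proof (intro conjI ballI allI)
    show "continuous_on {0..T} (\<lambda>t. V t \<omega>)" for \<omega> unfolding V_def by (rule continuous_time_integral[OF cb])
    have "sq_norm_L2 M T b < \<infinity>"
      using sq_norm_L2_le_sup_sq[OF T regular_continuous_adapted[OF b]] b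
      by (auto simp: regular_def ennreal_mult_less_top intro: le_less_trans)
    then show "(\<integral>\<^sup>+\<omega>. sup_sq T V \<omega> \<partial>M) < \<infinity>"
      using bound by (auto simp: ennreal_mult_less_top intro: le_less_trans)
    fix t assume t: "t \<in> {0..T}"
    interpret tm: finite_measure "time_measure t" by (rule finite_time_measure)
    have "(\<lambda>(s, \<omega>). b s \<omega>) \<in> borel_measurable (restrict_space borel {0..t} \<Otimes>\<^sub>M F t)"
      using regular_progressive[OF b] t by (simp add: progressive_def)
    moreover have "(\<lambda>p. (snd p, fst p)) \<in> measurable (F t \<Otimes>\<^sub>M time_measure t) (restrict_space borel {0..t} \<Otimes>\<^sub>M F t)"
      by (intro measurable_Pair measurable_compose[OF measurable_snd] measurable_fst)
        (auto simp: measurable_cong_sets[OF refl sets_restrict_space_cong[OF sets_lborel]])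
    ultimately have "(\<lambda>p. (\<lambda>(s, \<omega>). b s \<omega>) (snd p, fst p)) \<in> borel_measurable (F t \<Otimes>\<^sub>M time_measure t)"
      by (rule measurable_compose[rotated])
    then have m: "(\<lambda>(\<omega>, s). b s \<omega>) \<in> borel_measurable (F t \<Otimes>\<^sub>M time_measure t)"
      by (simp add: split_beta')
    show "V t \<in> borel_measurable (F t)"
      unfolding V_def set_integral_time_measure using tm.borel_measurable_lebesgue_integral[OF m] .
  qed
qed


lemma ito_regular:
  fixes Y :: "real \<Rightarrow> 'w \<Rightarrow> 'h::euclidean_space"
  assumes T: "0 < T" and ito: "is_ito_integral M F W T \<phi> Y"
    and ad: "\<And>t. t \<in> {0..T} \<Longrightarrow> Y t \<in> borel_measurable (F t)"
    and c: "\<And>\<omega>. continuous_on {0..T} (\<lambda>t. Y t \<omega>)"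
  shows "regular T Y"
proof -
  have "(\<integral>\<^sup>+\<omega>. sup_sq T Y \<omega> \<partial>M) \<le> 4 * nsq M (Y T)"
    by (rule maximal_inequality[OF T]) (use ad c ito_sq_int[OF ito] ito_martingale[OF ito] in \<open>auto simp: continuous_adapted_def\<close>)
  also have "\<dots> < \<infinity>" using ito_sq_int[OF ito, of T] T by (simp add: sq_int_iff_nsq ennreal_mult_less_top)
  finally show ?thesis using ad c by (simp add: regular_def)
qed

section \<open>Picard iteration\<close>

lemma picard_step_exists:
  fixes a a' :: "real \<Rightarrow> real^'n^'n" and x :: "real^'n"
  assumes T: "0 < T" and a: "continuous_on {0..T} a" "continuous_on {0..T} a'"
    and c: "continuous_on {0..T} c" "continuous_on {0..T} c'" and X: "regular T X"
  shows "\<exists>X' Y. regular T X' \<and> regular T Y \<and> is_ito_integral M F W T (mean_field_op c c' X) Y \<and>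
    X' = (\<lambda>t \<omega>. x + (LINT s:{0..t}|lborel. mean_field_op a a' X s \<omega>) + Y t \<omega>)"
proof -
  note rc = mean_field_op_regular[OF T c X] and ra = mean_field_op_regular[OF T a X]
  obtain Y where Y: "is_ito_integral M F W T (mean_field_op c c' X) Y" "\<And>t. t \<in> {0..T} \<Longrightarrow> Y t \<in> borel_measurable (F t)"
    "\<And>\<omega>. continuous_on {0..T} (\<lambda>t. Y t \<omega>)"
  proof (rule ito_integral_exists[OF T, of "mean_field_op c c' X"])
    show "mean_field_op c c' X t \<in> borel_measurable (F t)" if "t \<in> {0..T}" for t
      using rc that by (simp add: regular_def)
    show "continuous_on {0..T} (\<lambda>t. mean_field_op c c' X t \<omega>)" for \<omega>
      using rc by (simp add: regular_def)
    show "(\<integral>\<^sup>+\<omega>. sup_sq T (mean_field_op c c' X) \<omega> \<partial>M) < \<infinity>"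
      using rc by (simp add: regular_def)
  qed (rule that)
  have rY: "regular T Y" by (rule ito_regular[OF T Y])
  show ?thesis
    using rY Y(1) regular_add[OF T regular_add[OF T regular_const[OF T, of x] time_integral_regular(1)[OF T ra]] rY]
    by blast
qed

text \<open>Two images under the Picard map differ by a drift part and a martingale part; the
  initial value cancels. The estimate at time t, with the integral up to t only, is the one to
  iterate; the estimate of the supremum supplies uniform convergence.\<close>

lemma picard_contraction:
  fixes a a' c c' :: "real \<Rightarrow> real^'n^'n"
  assumes T: "0 < T" and a: "continuous_on {0..T} a" "continuous_on {0..T} a'"
    and c: "continuous_on {0..T} c" "continuous_on {0..T} c'"
  obtains C where "0 < C"
    "\<And>X1 Y1 X1' X2 Y2 X2' x. regular T X1 \<Longrightarrow> regular T Y1 \<Longrightarrow> is_ito_integral M F W T (mean_field_op c c' X1) Y1 \<Longrightarrow>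
       X1' = (\<lambda>t \<omega>. x + (LINT s:{0..t}|lborel. mean_field_op a a' X1 s \<omega>) + Y1 t \<omega>) \<Longrightarrow>
       regular T X2 \<Longrightarrow> regular T Y2 \<Longrightarrow> is_ito_integral M F W T (mean_field_op c c' X2) Y2 \<Longrightarrow>
       X2' = (\<lambda>t \<omega>. x + (LINT s:{0..t}|lborel. mean_field_op a a' X2 s \<omega>) + Y2 t \<omega>) \<Longrightarrow>
       (\<forall>t\<in>{0..T}. nsq M (\<lambda>\<omega>. X1' t \<omega> - X2' t \<omega>) \<le> ennreal C * (\<integral>\<^sup>+s. nsq M (\<lambda>\<omega>. X1 s \<omega> - X2 s \<omega>) \<partial>time_measure t)) \<and>
       (\<integral>\<^sup>+\<omega>. sup_sq T (\<lambda>t \<omega>. X1' t \<omega> - X2' t \<omega>) \<omega> \<partial>M)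
         \<le> ennreal C * (\<integral>\<^sup>+s. nsq M (\<lambda>\<omega>. X1 s \<omega> - X2 s \<omega>) \<partial>time_measure T)"
proof -
  obtain L1 where L1: "0 < L1" "\<And>t X \<omega>. t \<in> {0..T} \<Longrightarrow> sq_int M (X t) \<Longrightarrow>
    ennreal ((norm (mean_field_op a a' X t \<omega>))\<^sup>2) \<le> ennreal L1 * (ennreal ((norm (X t \<omega>))\<^sup>2) + nsq M (X t))"
    by (rule mean_field_op_bound[OF a]) blast
  obtain L2 where L2: "0 < L2" "\<And>t X \<omega>. t \<in> {0..T} \<Longrightarrow> sq_int M (X t) \<Longrightarrow>
    ennreal ((norm (mean_field_op c c' X t \<omega>))\<^sup>2) \<le> ennreal L2 * (ennreal ((norm (X t \<omega>))\<^sup>2) + nsq M (X t))"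
    by (rule mean_field_op_bound[OF c]) blast
  \<comment> \<open>2 for splitting into drift and martingale part, T from the time integral, 4 from
    the maximal inequality, 2 L1 and 2 L2 from the second moments of the coefficients.\<close>
  define C where "C = 2 * (T * (2 * L1)) + 2 * (4 * (2 * L2))"
  show thesis
  proof (rule that[of C])
    show "0 < C" using T L1(1) L2(1) by (auto simp: C_def intro!: add_pos_pos mult_pos_pos)
    fix X1 Y1 X1' X2 Y2 X2' :: "real \<Rightarrow> 'w \<Rightarrow> real^'n" and x :: "real^'n"
    assume 1: "regular T X1" "regular T Y1" "is_ito_integral M F W T (mean_field_op c c' X1) Y1"
       "X1' = (\<lambda>t \<omega>. x + (LINT s:{0..t}|lborel. mean_field_op a a' X1 s \<omega>) + Y1 t \<omega>)"
    assume 2: "regular T X2" "regular T Y2" "is_ito_integral M F W T (mean_field_op c c' X2) Y2"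
       "X2' = (\<lambda>t \<omega>. x + (LINT s:{0..t}|lborel. mean_field_op a a' X2 s \<omega>) + Y2 t \<omega>)"
    define D where "D = (\<lambda>t \<omega>. X1 t \<omega> - X2 t \<omega>)"
    have D: "regular T D" unfolding D_def by (rule regular_diff[OF T 1(1) 2(1)])
    have D_sq: "sq_int M (D t)" if "t \<in> {0..T}" for t by (rule regular_sq_int[OF D that])
    define N where "N t = (\<integral>\<^sup>+s. nsq M (D s) \<partial>time_measure t)" for t
    have op_diff: "mean_field_op e e' X1 t \<omega> - mean_field_op e e' X2 t \<omega> = mean_field_op e e' D t \<omega>"
      if "t \<in> {0..T}" for e e' :: "real \<Rightarrow> real^'n^'n" and t \<omega>
      unfolding D_def using regular_sq_int[OF 1(1) that] regular_sq_int[OF 2(1) that]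
      by (intro mean_field_op_diff sq_int_integrable)
    define V where "V = (\<lambda>t \<omega>. LINT s:{0..t}|lborel. mean_field_op a a' D s \<omega>)"
    define Z where "Z = (\<lambda>t \<omega>. Y1 t \<omega> - Y2 t \<omega>)"
    note ra = mean_field_op_regular[OF T a D] and rc = mean_field_op_regular[OF T c D]
    note V = time_integral_regular[OF T ra, folded V_def]
    have Z: "regular T Z" unfolding Z_def by (rule regular_diff[OF T 1(2) 2(2)])
    have eq: "X1' t \<omega> - X2' t \<omega> = V t \<omega> + Z t \<omega>" if t: "t \<in> {0..T}" for t \<omega>
    proof -
      have int: "set_integrable lborel {0..t} (\<lambda>s. mean_field_op a a' X s \<omega>)" if "regular T X" for X
      proof -
        have "continuous_on {0..T} (\<lambda>s. mean_field_op a a' X s \<omega>)"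
          using mean_field_op_regular[OF T a that] by (simp add: regular_def)
        then show ?thesis
          by (rule borel_integrable_atLeastAtMost'[OF continuous_on_subset]) (use t in auto)
      qed
      have "V t \<omega> = (LINT s:{0..t}|lborel. mean_field_op a a' X1 s \<omega> - mean_field_op a a' X2 s \<omega>)"
        unfolding V_def using t by (intro set_lebesgue_integral_cong) (auto simp: op_diff)
      also have "\<dots> = (LINT s:{0..t}|lborel. mean_field_op a a' X1 s \<omega>) - (LINT s:{0..t}|lborel. mean_field_op a a' X2 s \<omega>)"
        by (rule set_integral_diff(2)[OF int[OF 1(1)] int[OF 2(1)]])
      finally show ?thesis unfolding 1(4) 2(4) Z_def by (simp add: algebra_simps)
    qed
    have sq_le: "sq_norm_L2 M t (mean_field_op e e' D) \<le> ennreal (2 * L) * N t"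
      if t: "t \<in> {0..T}" and e: "regular T (mean_field_op e e' D)" and
      L: "\<And>t X \<omega>. t \<in> {0..T} \<Longrightarrow> sq_int M (X t) \<Longrightarrow>
        ennreal ((norm (mean_field_op e e' X t \<omega>))\<^sup>2) \<le> ennreal L * (ennreal ((norm (X t \<omega>))\<^sup>2) + nsq M (X t))"
      for e e' :: "real \<Rightarrow> real^'n^'n" and t L
    proof -
      have jD: "(\<lambda>(s, \<omega>). D s \<omega>) \<in> borel_measurable (time_measure t \<Otimes>\<^sub>M M)"
        using regular_joint[OF D] t by simp
      have jm: "(\<lambda>p. ennreal ((norm ((\<lambda>(s, \<omega>). D s \<omega>) p))\<^sup>2)) \<in> borel_measurable (time_measure t \<Otimes>\<^sub>M M)"
        by (rule measurable_compose[OF jD, of "\<lambda>x. ennreal ((norm x)\<^sup>2)"]) simp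
      have Nm: "(\<lambda>s. nsq M (D s)) \<in> borel_measurable (time_measure t)"
        unfolding nsq_def using borel_measurable_nn_integral_fst[OF jm] by simp
      have "sq_norm_L2 M t (mean_field_op e e' D) = (\<integral>\<^sup>+s. nsq M (mean_field_op e e' D s) \<partial>time_measure t)"
        using regular_joint[OF e] t by (intro sq_norm_L2_time) auto
      also have "\<dots> \<le> (\<integral>\<^sup>+s. ennreal (2 * L) * nsq M (D s) \<partial>time_measure t)"
      proof (rule nn_integral_mono)
        fix s assume "s \<in> space (time_measure t)"
        then have s: "s \<in> {0..T}" using t by (auto simp: space_restrict_space)
        show "nsq M (mean_field_op e e' D s) \<le> ennreal (2 * L) * nsq M (D s)"
          by (rule nsq_mean_field_op_le[OF L[of s D, OF s D_sq[OF s]] D_sq[OF s]])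
      qed
      also have "\<dots> = ennreal (2 * L) * N t" unfolding N_def by (rule nn_integral_cmult[OF Nm])
      finally show ?thesis .
    qed
    have Z_iso: "nsq M (Z t) \<le> ennreal (2 * L2) * N t" if t: "t \<in> {0..T}" for t
    proof -
      have "nsq M (Z t) = sq_norm_L2 M t (\<lambda>s \<omega>. mean_field_op c c' X1 s \<omega> - mean_field_op c c' X2 s \<omega>)"
        unfolding Z_def using t by (intro ito_difference_isometry[OF 1(3) 2(3)]) auto
      also have "\<dots> = sq_norm_L2 M t (mean_field_op c c' D)"
        unfolding sq_norm_L2_def using t
        by (intro nn_integral_cong) (auto simp: op_diff indicator_def)
      also have "\<dots> \<le> ennreal (2 * L2) * N t" by (rule sq_le[OF t rc L2(2)])
      finally show ?thesis .
    qed
    have V_le: "nsq M (V t) \<le> ennreal T * (ennreal (2 * L1) * N t)" if t: "t \<in> {0..T}" for t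
    proof -
      have "sq_norm_L2 M t (mean_field_op a a' D) \<le> ennreal (2 * L1) * N t" by (rule sq_le[OF t ra L1(2)])
      moreover have "nsq M (V t) \<le> ennreal T * sq_norm_L2 M t (mean_field_op a a' D)"
        unfolding V_def by (rule time_integral_regular(3)[OF T ra t])
      ultimately show ?thesis by (meson order_trans mult_left_mono zero_le)
    qed
    have C_eq: "2 * (ennreal T * (ennreal (2 * L1) * n)) + 2 * (4 * (ennreal (2 * L2) * n)) = ennreal C * n" for n
    proof -
      have "ennreal C = 2 * (ennreal T * ennreal (2 * L1)) + 2 * (4 * ennreal (2 * L2))"
        unfolding C_def using T L1(1) L2(1) by (simp add: ennreal_mult mult.left_commute)
      then show ?thesis by (simp add: distrib_right mult.assoc)
    qed
    have "nsq M (\<lambda>\<omega>. X1' t \<omega> - X2' t \<omega>) \<le> ennreal C * N t" if t: "t \<in> {0..T}" for t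
    proof -
      have "nsq M (\<lambda>\<omega>. X1' t \<omega> - X2' t \<omega>) = nsq M (\<lambda>\<omega>. V t \<omega> + Z t \<omega>)" using eq[OF t] by simp
      also have "\<dots> \<le> 2 * nsq M (V t) + 2 * nsq M (Z t)"
        by (intro nsq_add_le sq_int_measurable regular_sq_int[OF V(1) t] regular_sq_int[OF Z t])
      \<comment> \<open>The factor 1 is enlarged to 4 in the next step, so that one constant serves
        both estimates.\<close>
      also have "\<dots> \<le> 2 * (ennreal T * (ennreal (2 * L1) * N t)) + 2 * (1 * (ennreal (2 * L2) * N t))"
        using V_le[OF t] Z_iso[OF t] by (intro add_mono mult_left_mono) auto
      also have "\<dots> \<le> 2 * (ennreal T * (ennreal (2 * L1) * N t)) + 2 * (4 * (ennreal (2 * L2) * N t))"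
        by (intro add_mono mult_left_mono mult_right_mono) auto
      finally show ?thesis unfolding C_eq .
    qed
    moreover have "(\<integral>\<^sup>+\<omega>. sup_sq T (\<lambda>t \<omega>. X1' t \<omega> - X2' t \<omega>) \<omega> \<partial>M) \<le> ennreal C * N T"
    proof -
      have TT: "T \<in> {0..T}" using T by simp
      have Zmax: "(\<integral>\<^sup>+\<omega>. sup_sq T Z \<omega> \<partial>M) \<le> 4 * nsq M (Z T)"
      proof (rule maximal_inequality[OF T regular_continuous_adapted[OF Z]])
        show "sq_int M (Z t)" if "0 \<le> t" "t \<le> T" for t using regular_sq_int[OF Z] that by simp
        fix s t and U :: "'w \<Rightarrow> real^'n"
        assume st: "0 \<le> s" "s \<le> t" "t \<le> T" and U: "sq_int M U" "U \<in> borel_measurable (F s)"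
        have i: "integrable M (\<lambda>\<omega>. (Y t \<omega> - Y s \<omega>) \<bullet> U \<omega>)" if "regular T Y" for Y
          using regular_sq_int[OF that, of t] regular_sq_int[OF that, of s] st
          by (intro sq_int_inner sq_int_diff U) auto
        have "(\<integral>\<omega>. (Z t \<omega> - Z s \<omega>) \<bullet> U \<omega> \<partial>M)
            = (\<integral>\<omega>. (Y1 t \<omega> - Y1 s \<omega>) \<bullet> U \<omega> - (Y2 t \<omega> - Y2 s \<omega>) \<bullet> U \<omega> \<partial>M)"
          unfolding Z_def by (intro Bochner_Integration.integral_cong refl) (simp add: inner_diff_left algebra_simps)
        also have "\<dots> = 0"
          using i[OF 1(2)] i[OF 2(2)] ito_martingale[OF 1(3) st U] ito_martingale[OF 2(3) st U] by simp
        finally show "(\<integral>\<omega>. (Z t \<omega> - Z s \<omega>) \<bullet> U \<omega> \<partial>M) = 0" .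
      qed
      have "(\<integral>\<^sup>+\<omega>. sup_sq T (\<lambda>t \<omega>. X1' t \<omega> - X2' t \<omega>) \<omega> \<partial>M) = (\<integral>\<^sup>+\<omega>. sup_sq T (\<lambda>t \<omega>. V t \<omega> + Z t \<omega>) \<omega> \<partial>M)"
        unfolding sup_sq_def by (intro nn_integral_cong SUP_cong refl) (simp add: eq)
      also have "\<dots> \<le> 2 * (\<integral>\<^sup>+\<omega>. sup_sq T V \<omega> \<partial>M) + 2 * (\<integral>\<^sup>+\<omega>. sup_sq T Z \<omega> \<partial>M)"
        by (intro sup_sq_add_le T regular_continuous_adapted V(1) Z)
      also have "\<dots> \<le> 2 * (ennreal T * (ennreal (2 * L1) * N T)) + 2 * (4 * (ennreal (2 * L2) * N T))"
      proof (intro add_mono mult_left_mono)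
        show "(\<integral>\<^sup>+\<omega>. sup_sq T V \<omega> \<partial>M) \<le> ennreal T * (ennreal (2 * L1) * N T)"
        proof -
          have "sq_norm_L2 M T (mean_field_op a a' D) \<le> ennreal (2 * L1) * N T" by (rule sq_le[OF TT ra L1(2)])
          then show ?thesis by (intro order_trans[OF V(2)] mult_left_mono) simp_all
        qed
        show "(\<integral>\<^sup>+\<omega>. sup_sq T Z \<omega> \<partial>M) \<le> 4 * (ennreal (2 * L2) * N T)"
          by (rule order_trans[OF Zmax mult_left_mono[OF Z_iso[OF TT]]]) simp
      qed simp_all
      finally show ?thesis unfolding C_eq .
    qed
    ultimately show "(\<forall>t\<in>{0..T}. nsq M (\<lambda>\<omega>. X1' t \<omega> - X2' t \<omega>) \<le> ennreal C * (\<integral>\<^sup>+s. nsq M (\<lambda>\<omega>. X1 s \<omega> - X2 s \<omega>) \<partial>time_measure t)) \<and>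
       (\<integral>\<^sup>+\<omega>. sup_sq T (\<lambda>t \<omega>. X1' t \<omega> - X2' t \<omega>) \<omega> \<partial>M)
         \<le> ennreal C * (\<integral>\<^sup>+s. nsq M (\<lambda>\<omega>. X1 s \<omega> - X2 s \<omega>) \<partial>time_measure T)"
      unfolding N_def D_def by blast
  qed
qed

text \<open>Squared distances of successive iterates at time t decay like exp (\<beta> t) / 16^k, so
  the iterates converge uniformly along almost every path. The limit solves the equation because one
  more Picard step from it is again a limit of the iterates.\<close>

lemma mean_field_sde_exists:
  fixes a a' c c' :: "real \<Rightarrow> real^'n^'n" and x :: "real^'n"
  assumes T: "0 < T" and a: "continuous_on {0..T} a" "continuous_on {0..T} a'"
    and c: "continuous_on {0..T} c" "continuous_on {0..T} c'"
  obtains X Y where "regular T X" "is_ito_integral M F W T (mean_field_op c c' X) Y"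
    "\<And>t. t \<in> {0..T} \<Longrightarrow> AE \<omega> in M. X t \<omega> = x + (LINT s:{0..t}|lborel. mean_field_op a a' X s \<omega>) + Y t \<omega>"
proof -
  obtain C where C: "0 < C"
    "\<And>X1 Y1 X1' X2 Y2 X2' x. regular T X1 \<Longrightarrow> regular T Y1 \<Longrightarrow> is_ito_integral M F W T (mean_field_op c c' X1) Y1 \<Longrightarrow>
       X1' = (\<lambda>t \<omega>. x + (LINT s:{0..t}|lborel. mean_field_op a a' X1 s \<omega>) + Y1 t \<omega>) \<Longrightarrow>
       regular T X2 \<Longrightarrow> regular T Y2 \<Longrightarrow> is_ito_integral M F W T (mean_field_op c c' X2) Y2 \<Longrightarrow>
       X2' = (\<lambda>t \<omega>. x + (LINT s:{0..t}|lborel. mean_field_op a a' X2 s \<omega>) + Y2 t \<omega>) \<Longrightarrow>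
       (\<forall>t\<in>{0..T}. nsq M (\<lambda>\<omega>. X1' t \<omega> - X2' t \<omega>) \<le> ennreal C * (\<integral>\<^sup>+s. nsq M (\<lambda>\<omega>. X1 s \<omega> - X2 s \<omega>) \<partial>time_measure t)) \<and>
       (\<integral>\<^sup>+\<omega>. sup_sq T (\<lambda>t \<omega>. X1' t \<omega> - X2' t \<omega>) \<omega> \<partial>M)
         \<le> ennreal C * (\<integral>\<^sup>+s. nsq M (\<lambda>\<omega>. X1 s \<omega> - X2 s \<omega>) \<partial>time_measure T)"
    by (rule picard_contraction[OF T a c]) blast
  define step where "step X X' Y \<longleftrightarrow> regular T X' \<and> regular T Y \<and> is_ito_integral M F W T (mean_field_op c c' X) Y \<and>
    X' = (\<lambda>t \<omega>. x + (LINT s:{0..t}|lborel. mean_field_op a a' X s \<omega>) + Y t \<omega>)" for X X' Y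
  have ex: "\<exists>X' Y. step X X' Y" if "regular T X" for X
    unfolding step_def by (rule picard_step_exists[OF T a c that])
  have contr: "(\<forall>t\<in>{0..T}. nsq M (\<lambda>\<omega>. X1' t \<omega> - X2' t \<omega>) \<le> ennreal C * (\<integral>\<^sup>+s. nsq M (\<lambda>\<omega>. X1 s \<omega> - X2 s \<omega>) \<partial>time_measure t)) \<and>
       (\<integral>\<^sup>+\<omega>. sup_sq T (\<lambda>t \<omega>. X1' t \<omega> - X2' t \<omega>) \<omega> \<partial>M)
         \<le> ennreal C * (\<integral>\<^sup>+s. nsq M (\<lambda>\<omega>. X1 s \<omega> - X2 s \<omega>) \<partial>time_measure T)"
    if "regular T X1" "regular T X2" "step X1 X1' Y1" "step X2 X2' Y2" for X1 X2 X1' X2' Y1 Y2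
    using that unfolding step_def by (intro C(2)) auto
  obtain Xs where Xs: "\<And>k::nat. regular T (Xs k)" "\<And>k. \<exists>Y. step (Xs k) (Xs (Suc k)) Y"
  proof -
    have "\<exists>f. f 0 = (\<lambda>t \<omega>. x) \<and> (\<forall>k::nat. regular T (f k) \<and> (\<exists>Y. step (f k) (f (Suc k)) Y))"
    proof -
      have "\<exists>f. \<forall>n::nat. (regular T (f n) \<and> (n = 0 \<longrightarrow> f n = (\<lambda>t \<omega>. x))) \<and> (\<exists>Y. step (f n) (f (Suc n)) Y)"
      proof (rule dependent_nat_choice)
        show "\<exists>X. regular T X \<and> (0 = (0::nat) \<longrightarrow> X = (\<lambda>t \<omega>. x))" using regular_const[OF T] by blast
        show "\<exists>X'. (regular T X' \<and> (Suc n = 0 \<longrightarrow> X' = (\<lambda>t \<omega>. x))) \<and> (\<exists>Y. step X X' Y)"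
          if "regular T X \<and> (n = 0 \<longrightarrow> X = (\<lambda>t \<omega>. x))" for X and n :: nat
          using ex[of X] that unfolding step_def by blast
      qed
      then show ?thesis by blast
    qed
    then show thesis using that by blast
  qed
  define e where "e k t = nsq M (\<lambda>\<omega>. Xs (Suc k) t \<omega> - Xs k t \<omega>)" for k t
  \<comment> \<open>With this exponent one integration gains C / \<beta> = 1 / 16, the ratio in
    \<open>sup_sq_complete\<close>.\<close>
  define \<beta> where "\<beta> = 16 * C"
  have \<beta>: "0 < \<beta>" using C(1) by (simp add: \<beta>_def)
  define K where "K = enn2real (\<integral>\<^sup>+\<omega>. sup_sq T (\<lambda>t \<omega>. Xs (Suc 0) t \<omega> - Xs 0 t \<omega>) \<omega> \<partial>M)"
  have K: "0 \<le> K" by (simp add: K_def)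
  have int_le: "ennreal C * (\<integral>\<^sup>+s. e k s \<partial>time_measure t) \<le> ennreal (K * (1 / 16) ^ Suc k * exp (\<beta> * t))"
    if e: "\<And>s. s \<in> {0..T} \<Longrightarrow> e k s \<le> ennreal (K * (1 / 16) ^ k * exp (\<beta> * s))" and t: "t \<in> {0..T}" for k t
  proof -
    have "(\<integral>\<^sup>+s. e k s \<partial>time_measure t) \<le> (\<integral>\<^sup>+s. ennreal (K * (1 / 16) ^ k * exp (\<beta> * s)) \<partial>time_measure t)"
      using t by (intro nn_integral_mono e) (auto simp: space_restrict_space)
    also have "\<dots> \<le> ennreal (K * (1 / 16) ^ k * exp (\<beta> * t) / \<beta>)"
      using t K by (intro nn_integral_exp_le \<beta>) auto
    finally have "ennreal C * (\<integral>\<^sup>+s. e k s \<partial>time_measure t) \<le> ennreal C * ennreal (K * (1 / 16) ^ k * exp (\<beta> * t) / \<beta>)"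
      by (intro mult_left_mono) auto
    also have "\<dots> = ennreal (K * (1 / 16) ^ Suc k * exp (\<beta> * t))"
      using C(1) K by (simp add: ennreal_mult[symmetric] \<beta>_def)
    finally show ?thesis .
  qed
  have step_e: "(\<forall>t\<in>{0..T}. e (Suc k) t \<le> ennreal C * (\<integral>\<^sup>+s. e k s \<partial>time_measure t)) \<and>
      (\<integral>\<^sup>+\<omega>. sup_sq T (\<lambda>t \<omega>. Xs (Suc (Suc k)) t \<omega> - Xs (Suc k) t \<omega>) \<omega> \<partial>M) \<le> ennreal C * (\<integral>\<^sup>+s. e k s \<partial>time_measure T)" for k
  proof -
    obtain Y1 Y2 where "step (Xs (Suc k)) (Xs (Suc (Suc k))) Y1" "step (Xs k) (Xs (Suc k)) Y2"
      using Xs(2) by blast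
    from contr[OF Xs(1) Xs(1) this] show ?thesis unfolding e_def .
  qed
  have e_le: "t \<in> {0..T} \<Longrightarrow> e k t \<le> ennreal (K * (1 / 16) ^ k * exp (\<beta> * t))" for k t
  proof (induction k arbitrary: t)
    case 0
    have "e 0 t \<le> (\<integral>\<^sup>+\<omega>. sup_sq T (\<lambda>t \<omega>. Xs (Suc 0) t \<omega> - Xs 0 t \<omega>) \<omega> \<partial>M)"
      unfolding e_def using nsq_le_sup_sq[OF 0, of "\<lambda>t \<omega>. Xs (Suc 0) t \<omega> - Xs 0 t \<omega>"] .
    also have "\<dots> = ennreal K"
      using regular_diff[OF T Xs(1) Xs(1), of "Suc 0" 0] by (simp add: K_def regular_def)
    also have "\<dots> \<le> ennreal (K * (1 / 16) ^ 0 * exp (\<beta> * t))"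
      using 0 \<beta> K by (intro ennreal_leI) (auto intro!: mult_left_le[of 1, simplified] simp: mult_le_cancel_left1)
    finally show ?case .
  next
    case (Suc k)
    then show ?case using step_e[of k] int_le[of k t] by (meson order_trans)
  qed
  obtain X where X: "\<And>t. t \<in> {0..T} \<Longrightarrow> X t \<in> borel_measurable (F t)"
    "\<And>\<omega>. continuous_on {0..T} (\<lambda>t. X t \<omega>)"
    "(\<lambda>k. \<integral>\<^sup>+\<omega>. sup_sq T (\<lambda>t \<omega>. X t \<omega> - Xs (Suc k) t \<omega>) \<omega> \<partial>M) \<longlonglongrightarrow> 0"
  \<comment> \<open>The sequence starts at index 1, since the supremum of a difference is bounded by
    the time integral of the preceding difference; this also explains the factor 1 / 16 in the
    constant.\<close>
  proof (rule sup_sq_complete[OF T, of "\<lambda>k. Xs (Suc k)" "K * (1 / 16) * exp (\<beta> * T)"])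
    show "continuous_adapted T (Xs (Suc k))" for k by (rule regular_continuous_adapted[OF Xs(1)])
    show "0 \<le> K * (1 / 16) * exp (\<beta> * T)" using K by simp
    show "(\<integral>\<^sup>+\<omega>. sup_sq T (\<lambda>t \<omega>. Xs (Suc (Suc k)) t \<omega> - Xs (Suc k) t \<omega>) \<omega> \<partial>M)
       \<le> ennreal (K * (1 / 16) * exp (\<beta> * T) * (1 / 16) ^ k)" for k
      using order_trans[OF step_e[of k, THEN conjunct2] int_le[of k T, OF e_le]] T by (simp add: mult_ac)
  qed (assumption | rule that)+
  have ca: "continuous_adapted T X" using X by (auto simp: continuous_adapted_def)
  have rX: "regular T X"
  proof -
    have "eventually (\<lambda>k. (\<integral>\<^sup>+\<omega>. sup_sq T (\<lambda>t \<omega>. X t \<omega> - Xs (Suc k) t \<omega>) \<omega> \<partial>M) < 1) sequentially"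
      using X(3) by (rule order_tendstoD) simp
    then obtain k where k: "(\<integral>\<^sup>+\<omega>. sup_sq T (\<lambda>t \<omega>. X t \<omega> - Xs (Suc k) t \<omega>) \<omega> \<partial>M) < 1"
      by (auto simp: eventually_sequentially)
    then have "regular T (\<lambda>t \<omega>. X t \<omega> - Xs (Suc k) t \<omega>)"
      using X(1,2) Xs(1)[of "Suc k"] unfolding regular_def
      by (auto intro!: borel_measurable_diff continuous_on_diff intro: less_trans[OF k])
    from regular_add[OF T this Xs(1)[of "Suc k"]] show ?thesis by simp
  qed
  \<comment> \<open>One further step from the limit. Its image \<open>X'\<close> has L2 distance 0
    from \<open>X\<close> at each time, as both are limits of the same iterates, and
    \<open>Y\<close> is the required integral.\<close>
  obtain X' Y where st: "step X X' Y" using ex[OF rX] by blast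
  have ae: "AE \<omega> in M. X t \<omega> = X' t \<omega>" if t: "t \<in> {0..T}" for t
  proof -
    let ?S = "\<lambda>k. \<integral>\<^sup>+\<omega>. sup_sq T (\<lambda>t \<omega>. X t \<omega> - Xs (Suc k) t \<omega>) \<omega> \<partial>M"
    have rX': "regular T X'" using st unfolding step_def by blast
    have m: "X t \<in> borel_measurable M" "X' t \<in> borel_measurable M" "Xs k t \<in> borel_measurable M" for k
      using regular_sq_int[OF rX t] regular_sq_int[OF rX' t] regular_sq_int[OF Xs(1) t] sq_int_measurable by blast+
    have bound: "nsq M (\<lambda>\<omega>. X t \<omega> - X' t \<omega>) \<le> 2 * ?S (Suc k) + 2 * (ennreal C * (ennreal T * ?S k))" for k
    proof -
      obtain Y2 where Y2: "step (Xs (Suc k)) (Xs (Suc (Suc k))) Y2" using Xs(2) by blast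
      have "nsq M (\<lambda>\<omega>. X t \<omega> - X' t \<omega>) = nsq M (\<lambda>\<omega>. (X t \<omega> - Xs (Suc (Suc k)) t \<omega>) - (X' t \<omega> - Xs (Suc (Suc k)) t \<omega>))"
        by simp
      also have "\<dots> \<le> 2 * nsq M (\<lambda>\<omega>. X t \<omega> - Xs (Suc (Suc k)) t \<omega>) + 2 * nsq M (\<lambda>\<omega>. X' t \<omega> - Xs (Suc (Suc k)) t \<omega>)"
        by (intro nsq_diff_le borel_measurable_diff m)
      also have "\<dots> \<le> 2 * ?S (Suc k) + 2 * (ennreal C * (ennreal T * ?S k))"
      proof (intro add_mono mult_left_mono)
        show "nsq M (\<lambda>\<omega>. X t \<omega> - Xs (Suc (Suc k)) t \<omega>) \<le> ?S (Suc k)"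
          using nsq_le_sup_sq[OF t, of "\<lambda>t \<omega>. X t \<omega> - Xs (Suc (Suc k)) t \<omega>"] .
        have "nsq M (\<lambda>\<omega>. X' t \<omega> - Xs (Suc (Suc k)) t \<omega>)
            \<le> ennreal C * (\<integral>\<^sup>+s. nsq M (\<lambda>\<omega>. X s \<omega> - Xs (Suc k) s \<omega>) \<partial>time_measure t)"
          using contr[OF rX Xs(1) st Y2] t by blast
        also have "\<dots> \<le> ennreal C * (\<integral>\<^sup>+s. ?S k \<partial>time_measure t)"
          using t nsq_le_sup_sq[of _ T "\<lambda>t \<omega>. X t \<omega> - Xs (Suc k) t \<omega>"]
          by (intro mult_left_mono nn_integral_mono) (auto simp: space_restrict_space)
        also have "\<dots> \<le> ennreal C * (ennreal T * ?S k)"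
          using t by (intro mult_left_mono)
            (auto simp: emeasure_restrict_space space_restrict_space mult.commute intro!: mult_right_mono ennreal_leI)
        finally show "nsq M (\<lambda>\<omega>. X' t \<omega> - Xs (Suc (Suc k)) t \<omega>) \<le> ennreal C * (ennreal T * ?S k)" .
      qed simp_all
      finally show ?thesis .
    qed
    have "(\<lambda>k. 2 * ?S (Suc k) + 2 * (ennreal C * (ennreal T * ?S k))) \<longlonglongrightarrow> 2 * 0 + 2 * (ennreal C * (ennreal T * 0))"
      by (intro tendsto_add ennreal_tendsto_cmult X(3) LIMSEQ_Suc[OF X(3)]) auto
    then have "(\<lambda>k. nsq M (\<lambda>\<omega>. X t \<omega> - X' t \<omega>)) \<longlonglongrightarrow> 0"
      by (intro tendsto_0_ennreal_le[OF bound]) simp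
    then have "nsq M (\<lambda>\<omega>. X t \<omega> - X' t \<omega>) = 0" by (simp add: LIMSEQ_const_iff)
    then have "AE \<omega> in M. ennreal ((norm (X t \<omega> - X' t \<omega>))\<^sup>2) = 0"
      unfolding nsq_def using m by (subst (asm) nn_integral_0_iff_AE) auto
    then show ?thesis by eventually_elim simp
  qed
  have eq: "X' = (\<lambda>t \<omega>. x + (LINT s:{0..t}|lborel. mean_field_op a a' X s \<omega>) + Y t \<omega>)"
    and ito: "is_ito_integral M F W T (mean_field_op c c' X) Y"
    using st unfolding step_def by blast+
  show thesis by (rule that[OF rX ito]) (rule ae[unfolded eq])
qed

end

section \<open>Second moments of Ito processes\<close>

text \<open>Polarization: the mixed term is determined by three squared norms, each of which an
  isometry preserves.\<close>

lemma integral_sq_diff: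
  fixes f g :: "'a \<Rightarrow> real"
  assumes "sq_int N f" "sq_int N g"
  shows "(\<integral>x. (f x - g x)\<^sup>2 \<partial>N) = (\<integral>x. (f x)\<^sup>2 \<partial>N) + (\<integral>x. (g x)\<^sup>2 \<partial>N) - 2 * (\<integral>x. f x * g x \<partial>N)"
  using assms sq_int_mult[OF assms] by (simp add: power2_diff sq_int_def mult.assoc)

text \<open>A moving upper limit becomes an indicator under a fixed measure, ready for
  Fubini.\<close>

lemma triangle_indicator:
  fixes f :: "real \<Rightarrow> real"
  assumes "s \<le> T"
  shows "(LINT r:{0..s}|lborel. f r) = (\<integral>r. indicator {..s} r * f r \<partial>time_measure T)"
  unfolding set_lebesgue_integral_def using assms
  by (subst integral_restrict_space) (auto intro!: Bochner_Integration.integral_cong simp: indicator_def)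

lemma AE_time_measure_neq: "AE s in time_measure T. s \<noteq> r"
  using AE_lborel_singleton[of r] by (subst AE_restrict_space_iff) auto

text \<open>\<open>f\<close> and \<open>g\<close> are merely integrable, so the product rule is not
  differentiated but obtained by Fubini: the product of the two integrals is an integral over a
  square, which the diagonal cuts into two triangles, one for each summand.\<close>

lemma integral_by_parts:
  fixes f g :: "real \<Rightarrow> real" and c d :: real
  assumes f: "integrable (time_measure T) f" and g: "integrable (time_measure T) g" and T: "0 \<le> T"
  defines "F \<equiv> \<lambda>s. c + (LINT r:{0..s}|lborel. f r)" and "G \<equiv> \<lambda>s. d + (LINT r:{0..s}|lborel. g r)"
  shows "integrable (time_measure T) (\<lambda>s. f s * G s + F s * g s)"
    "F T * G T = c * d + (\<integral>s. f s * G s + F s * g s \<partial>time_measure T)"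
proof -
  let ?\<tau> = "time_measure T"
  interpret tm: finite_measure ?\<tau> by (rule finite_time_measure)
  interpret P: pair_sigma_finite ?\<tau> ?\<tau> ..
  define I where "I h s = (\<integral>r. indicator {..s} r * h r \<partial>?\<tau>)" for h :: "real \<Rightarrow> real" and s
  have [measurable]: "f \<in> borel_measurable ?\<tau>" "g \<in> borel_measurable ?\<tau>" using f g by auto
  have id_meas [measurable]: "(\<lambda>s. s) \<in> borel_measurable ?\<tau>" by (simp add: measurable_restrict_space1)
  have fst_meas [measurable]: "fst \<in> borel_measurable (?\<tau> \<Otimes>\<^sub>M ?\<tau>)" "snd \<in> borel_measurable (?\<tau> \<Otimes>\<^sub>M ?\<tau>)"
    using measurable_compose[OF measurable_fst id_meas] measurable_compose[OF measurable_snd id_meas] by auto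
  have trunc: "integrable ?\<tau> (\<lambda>r. indicator {..s} r * h r)" if "integrable ?\<tau> h" for h :: "real \<Rightarrow> real" and s
    using that by (rule Bochner_Integration.integrable_bound) (use that in \<open>auto simp: indicator_def\<close>)
  have I_meas: "I h \<in> borel_measurable ?\<tau>" if [measurable]: "h \<in> borel_measurable ?\<tau>" for h
  proof -
    have "(\<lambda>p. if snd p \<le> fst p then h (snd p) else 0) \<in> borel_measurable (?\<tau> \<Otimes>\<^sub>M ?\<tau>)" by measurable
    then have "(\<lambda>(s, r). indicator {..s} r * h r) \<in> borel_measurable (?\<tau> \<Otimes>\<^sub>M ?\<tau>)"
      by (rule measurable_cong[THEN iffD1, rotated]) (auto simp: indicator_def)
    then show ?thesis unfolding I_def by (rule tm.borel_measurable_lebesgue_integral)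
  qed
  have I_bound: "\<bar>I h s\<bar> \<le> (\<integral>r. \<bar>h r\<bar> \<partial>?\<tau>)" if "integrable ?\<tau> h" for h s
  proof -
    have "\<bar>I h s\<bar> \<le> (\<integral>r. \<bar>indicator {..s} r * h r\<bar> \<partial>?\<tau>)" unfolding I_def by (rule integral_abs_bound)
    also have "\<dots> \<le> (\<integral>r. \<bar>h r\<bar> \<partial>?\<tau>)"
      using that trunc[OF that, of s] by (intro integral_mono integrable_abs) (auto simp: indicator_def)
    finally show ?thesis .
  qed
  have mult_I: "integrable ?\<tau> (\<lambda>s. h s * I k s)" if h: "integrable ?\<tau> h" and k: "integrable ?\<tau> k" for h k
  proof (rule Bochner_Integration.integrable_bound)
    show "integrable ?\<tau> (\<lambda>s. h s * (\<integral>r. \<bar>k r\<bar> \<partial>?\<tau>))" using h by simp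
    show "(\<lambda>s. h s * I k s) \<in> borel_measurable ?\<tau>" using h k I_meas[of k] by auto
    show "AE s in ?\<tau>. norm (h s * I k s) \<le> norm (h s * (\<integral>r. \<bar>k r\<bar> \<partial>?\<tau>))"
    proof (rule AE_I2)
      fix s
      have "\<bar>h s\<bar> * \<bar>I k s\<bar> \<le> \<bar>h s\<bar> * \<bar>\<integral>r. \<bar>k r\<bar> \<partial>?\<tau>\<bar>"
        by (intro mult_left_mono order_trans[OF I_bound[OF k] abs_ge_self]) simp
      then show "norm (h s * I k s) \<le> norm (h s * (\<integral>r. \<bar>k r\<bar> \<partial>?\<tau>))"
        by (simp only: real_norm_def abs_mult)
    qed
  qed
  have FI: "F s = c + I f s" "G s = d + I g s" if "s \<le> T" for s
    using triangle_indicator[OF that] by (simp_all add: F_def G_def I_def)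
  have sp: "s \<le> T" if "s \<in> space ?\<tau>" for s using that by (simp add: space_restrict_space)
  have pt: "f s * G s + F s * g s = d * f s + c * g s + (f s * I g s + g s * I f s)" if "s \<in> space ?\<tau>" for s
    unfolding FI[OF sp[OF that]] by (simp add: algebra_simps)
  have e1: "integrable ?\<tau> (\<lambda>s. f s * G s + F s * g s) \<longleftrightarrow> integrable ?\<tau> (\<lambda>s. d * f s + c * g s + (f s * I g s + g s * I f s))"
    by (rule Bochner_Integration.integrable_cong[OF refl pt])
  have e2: "(\<integral>s. f s * G s + F s * g s \<partial>?\<tau>) = (\<integral>s. d * f s + c * g s + (f s * I g s + g s * I f s) \<partial>?\<tau>)"
    by (rule Bochner_Integration.integral_cong[OF refl pt])
  show "integrable ?\<tau> (\<lambda>s. f s * G s + F s * g s)"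
    unfolding e1 by (intro Bochner_Integration.integrable_add integrable_mult_right mult_I f g)
  \<comment> \<open>The integrand on the triangle r \<le> s of the square.\<close>
  define k where "k = (\<lambda>(r, s). indicator {..s} r * (f r * g s))"
  have k_meas [measurable]: "k \<in> borel_measurable (?\<tau> \<Otimes>\<^sub>M ?\<tau>)"
  proof -
    have "(\<lambda>p. if fst p \<le> snd p then f (fst p) * g (snd p) else 0) \<in> borel_measurable (?\<tau> \<Otimes>\<^sub>M ?\<tau>)" by measurable
    then show ?thesis
      by (rule measurable_cong[THEN iffD1, rotated]) (auto simp: indicator_def k_def)
  qed
  have k_int1: "integrable ?\<tau> (\<lambda>s. k (r, s))" for r
  proof (rule Bochner_Integration.integrable_bound)
    show "integrable ?\<tau> (\<lambda>s. f r * g s)" using g by simp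
    have "(\<lambda>s. if r \<le> s then f r * g s else 0) \<in> borel_measurable ?\<tau>" by measurable
    then show "(\<lambda>s. k (r, s)) \<in> borel_measurable ?\<tau>"
      by (rule measurable_cong[THEN iffD1, rotated]) (auto simp: indicator_def k_def)
  qed (auto simp: k_def indicator_def)
  have k_int: "integrable (?\<tau> \<Otimes>\<^sub>M ?\<tau>) k"
  proof (rule P.Fubini_integrable)
    show "AE r in ?\<tau>. integrable ?\<tau> (\<lambda>s. k (r, s))" using k_int1 by simp
    show "integrable ?\<tau> (\<lambda>r. \<integral>s. norm (k (r, s)) \<partial>?\<tau>)"
    proof (rule Bochner_Integration.integrable_bound)
      show "integrable ?\<tau> (\<lambda>r. f r * (\<integral>s. \<bar>g s\<bar> \<partial>?\<tau>))" using f by simp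
      show "(\<lambda>r. \<integral>s. norm (k (r, s)) \<partial>?\<tau>) \<in> borel_measurable ?\<tau>" by measurable
      have "(\<integral>s. norm (k (r, s)) \<partial>?\<tau>) \<le> \<bar>f r\<bar> * (\<integral>s. \<bar>g s\<bar> \<partial>?\<tau>)" for r
      proof -
        have "(\<integral>s. norm (k (r, s)) \<partial>?\<tau>) \<le> (\<integral>s. \<bar>f r\<bar> * \<bar>g s\<bar> \<partial>?\<tau>)"
        proof (rule integral_mono[OF integrable_norm[OF k_int1]])
          show "integrable ?\<tau> (\<lambda>s. \<bar>f r\<bar> * \<bar>g s\<bar>)" using g by simp
          show "norm (k (r, s)) \<le> \<bar>f r\<bar> * \<bar>g s\<bar>" for s by (simp add: k_def indicator_def abs_mult)
        qed
        then show ?thesis by simp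
      qed
      then show "AE r in ?\<tau>. norm (\<integral>s. norm (k (r, s)) \<partial>?\<tau>) \<le> norm (f r * (\<integral>s. \<bar>g s\<bar> \<partial>?\<tau>))"
        by (auto simp: abs_mult integral_nonneg_AE)
    qed
  qed measurable
  \<comment> \<open>In row r the part s \<ge> r gives \<open>k\<close> and the part s \<le> r gives
    \<open>I g r\<close>; they overlap only at s = r, a null set.\<close>
  have row: "f r * (\<integral>s. g s \<partial>?\<tau>) = (\<integral>s. k (r, s) \<partial>?\<tau>) + f r * I g r" for r
  proof -
    have "f r * (\<integral>s. g s \<partial>?\<tau>) = (\<integral>s. f r * g s \<partial>?\<tau>)" by simp
    also have "\<dots> = (\<integral>s. k (r, s) + f r * (indicator {..r} s * g s) \<partial>?\<tau>)"
    proof (rule integral_cong_AE)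
      show "AE s in ?\<tau>. f r * g s = k (r, s) + f r * (indicator {..r} s * g s)"
        using AE_time_measure_neq[of r T] by eventually_elim (auto simp: k_def indicator_def)
    qed (use k_int1[of r] trunc[OF g, of r] in auto)
    also have "\<dots> = (\<integral>s. k (r, s) \<partial>?\<tau>) + f r * I g r"
      using k_int1[of r] trunc[OF g, of r] by (simp add: I_def)
    finally show ?thesis .
  qed
  have "(\<integral>r. f r \<partial>?\<tau>) * (\<integral>s. g s \<partial>?\<tau>) = (\<integral>r. f r * (\<integral>s. g s \<partial>?\<tau>) \<partial>?\<tau>)" by simp
  also have "\<dots> = (\<integral>r. (\<integral>s. k (r, s) \<partial>?\<tau>) + f r * I g r \<partial>?\<tau>)" by (simp only: row)
  also have "\<dots> = (\<integral>r. (\<integral>s. k (r, s) \<partial>?\<tau>) \<partial>?\<tau>) + (\<integral>r. f r * I g r \<partial>?\<tau>)"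
    using P.integrable_fst'[OF k_int] mult_I[OF f g] by simp
  also have "(\<integral>r. (\<integral>s. k (r, s) \<partial>?\<tau>) \<partial>?\<tau>) = (\<integral>s. (\<integral>r. k (r, s) \<partial>?\<tau>) \<partial>?\<tau>)"
    using P.Fubini_integral[of "\<lambda>r s. k (r, s)"] k_int by simp
  also have "\<dots> = (\<integral>s. g s * I f s \<partial>?\<tau>)"
  proof (intro Bochner_Integration.integral_cong refl)
    fix s
    have "(\<integral>r. k (r, s) \<partial>?\<tau>) = (\<integral>r. g s * (indicator {..s} r * f r) \<partial>?\<tau>)"
      by (intro Bochner_Integration.integral_cong refl) (simp add: k_def)
    then show "(\<integral>r. k (r, s) \<partial>?\<tau>) = g s * I f s" by (simp add: I_def)
  qed
  finally have prod: "(\<integral>r. f r \<partial>?\<tau>) * (\<integral>s. g s \<partial>?\<tau>) = (\<integral>s. g s * I f s \<partial>?\<tau>) + (\<integral>r. f r * I g r \<partial>?\<tau>)" .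
  have IT: "I h T = (\<integral>r. h r \<partial>?\<tau>)" for h
    unfolding I_def by (rule Bochner_Integration.integral_cong[OF refl]) (simp add: space_restrict_space)
  show "F T * G T = c * d + (\<integral>s. f s * G s + F s * g s \<partial>?\<tau>)"
    unfolding e2 FI[OF order_refl] IT using f g mult_I[OF f g] mult_I[OF g f] prod
    by (simp add: algebra_simps)
qed

section \<open>Means and products of scalar Ito processes\<close>

context brownian_filtration
begin

lemma progressive_adapted:
  assumes "progressive F T \<phi>" "t \<in> {0..T}"
  shows "\<phi> t \<in> borel_measurable (F t)"
proof -
  have "(\<lambda>(s, \<omega>). \<phi> s \<omega>) \<in> borel_measurable (restrict_space borel {0..t} \<Otimes>\<^sub>M F t)"
    using assms by (simp add: progressive_def)
  moreover have "(\<lambda>\<omega>. (t, \<omega>)) \<in> measurable (F t) (restrict_space borel {0..t} \<Otimes>\<^sub>M F t)"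
    using assms(2) by (intro measurable_Pair1') (simp add: space_restrict_space)
  ultimately have "(\<lambda>\<omega>. (\<lambda>(s, \<omega>). \<phi> s \<omega>) (t, \<omega>)) \<in> borel_measurable (F t)" by (rule measurable_compose[rotated])
  then show ?thesis by simp
qed

lemma L2F_iff_sq_int:
  assumes "0 \<le> T"
  shows "\<phi> \<in> L2F M F T \<longleftrightarrow> progressive F T \<phi> \<and> sq_int (time_measure T \<Otimes>\<^sub>M M) (\<lambda>(s, \<omega>). \<phi> s \<omega>)"
  using L2F_sq_int[OF _ assms order_refl, of \<phi>] sq_norm_L2_eq_nsq[of \<phi> T]
  by (auto simp: L2F_def sq_int_iff_nsq)

lemma L2F_adapted: "\<phi> \<in> L2F M F T \<Longrightarrow> t \<in> {0..T} \<Longrightarrow> \<phi> t \<in> borel_measurable (F t)"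
  using progressive_adapted by (auto simp: L2F_def)

text \<open>At an individual time a process in \<open>L2F\<close> need not be square integrable;
  Fubini gives it at almost every time. This is why later identities for the coefficients hold
  almost everywhere in time.\<close>

lemma L2F_AE_sq_int:
  assumes "\<phi> \<in> L2F M F T" "0 \<le> t" "t \<le> T"
  shows "AE s in time_measure t. sq_int M (\<phi> s)"
proof -
  interpret tm: finite_measure "time_measure t" by (rule finite_time_measure)
  interpret P: pair_sigma_finite "time_measure t" M ..
  have "integrable (time_measure t \<Otimes>\<^sub>M M) (\<lambda>(s, \<omega>). (norm (\<phi> s \<omega>))\<^sup>2)"
    using L2F_sq_int[OF assms] by (simp add: sq_int_def split_beta')
  from P.AE_integrable_fst[OF this] AE_space[of "time_measure t"] show ?thesis
  proof eventually_elim
    case (elim s)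
    then have "s \<in> {0..T}" "0 \<le> s" using assms by (auto simp: space_restrict_space)
    then have "\<phi> s \<in> borel_measurable M" using L2F_adapted[OF assms(1)] measurable_filtration_M by blast
    then show ?case using elim by (simp add: sq_int_def)
  qed
qed

lemma L2F_section_sq_int:
  assumes "\<phi> \<in> L2F M F T" "0 \<le> t" "t \<le> T"
  shows "AE \<omega> in M. sq_int (time_measure t) (\<lambda>s. \<phi> s \<omega>)"
proof -
  interpret tm: finite_measure "time_measure t" by (rule finite_time_measure)
  interpret P: pair_sigma_finite "time_measure t" M ..
  note sq = L2F_sq_int[OF assms]
  have "integrable (time_measure t \<Otimes>\<^sub>M M) (\<lambda>(s, \<omega>). (norm (\<phi> s \<omega>))\<^sup>2)"
    using sq by (simp add: sq_int_def split_beta')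
  from P.AE_integrable_snd[OF this] AE_space[of M] show ?thesis
  proof eventually_elim
    case (elim \<omega>)
    have "(\<lambda>s. (\<lambda>(s, \<omega>). \<phi> s \<omega>) (s, \<omega>)) \<in> borel_measurable (time_measure t)"
      by (rule measurable_compose[OF measurable_Pair2'[OF elim(2)] sq_int_measurable[OF sq]])
    then show ?case using elim(1) by (simp add: sq_int_def)
  qed
qed

text \<open>The weak martingale property between 0 and t, tested with constant basis
  vectors.\<close>

lemma ito_mean:
  fixes Y :: "real \<Rightarrow> 'w \<Rightarrow> 'h::euclidean_space"
  assumes T: "0 \<le> T" and ito: "is_ito_integral M F W T \<phi> Y" and t: "t \<in> {0..T}"
  shows "integral\<^sup>L M (Y t) = 0"
proof (rule euclidean_eqI)
  fix e :: 'h assume "e \<in> Basis"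
  have Y: "sq_int M (Y t)" "sq_int M (Y 0)" using ito_sq_int[OF ito] t by auto
  have "integral\<^sup>L M (Y t) \<bullet> e = (\<integral>\<omega>. Y t \<omega> \<bullet> e \<partial>M)"
    using sq_int_integrable[OF Y(1)] by simp
  also have "\<dots> = (\<integral>\<omega>. (Y t \<omega> - Y 0 \<omega>) \<bullet> e \<partial>M)"
  proof (rule integral_cong_AE)
    show "AE \<omega> in M. Y t \<omega> \<bullet> e = (Y t \<omega> - Y 0 \<omega>) \<bullet> e"
      using ito_initial[OF ito T] by eventually_elim simp
  qed (use Y in \<open>auto dest!: sq_int_measurable\<close>)
  also have "\<dots> = 0" using t by (intro ito_martingale[OF ito]) auto
  finally show "integral\<^sup>L M (Y t) \<bullet> e = 0 \<bullet> e" by simp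
qed

text \<open>Polarization of the isometry, which is applied to both integrals and to their
  difference.\<close>

lemma ito_covariance:
  fixes Y1 Y2 :: "real \<Rightarrow> 'w \<Rightarrow> real"
  assumes ito: "is_ito_integral M F W T \<phi>1 Y1" "is_ito_integral M F W T \<phi>2 Y2" and t: "t \<in> {0..T}"
  shows "(\<integral>\<omega>. Y1 t \<omega> * Y2 t \<omega> \<partial>M) = (\<integral>p. \<phi>1 (fst p) (snd p) * \<phi>2 (fst p) (snd p) \<partial>(time_measure t \<Otimes>\<^sub>M M))"
proof -
  let ?\<Pi> = "time_measure t \<Otimes>\<^sub>M M"
  have t': "0 \<le> t" "t \<le> T" using t by auto
  have L: "\<phi>1 \<in> L2F M F T" "\<phi>2 \<in> L2F M F T" using ito by (auto simp: is_ito_integral_def)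
  have s: "sq_int ?\<Pi> (\<lambda>p. \<phi>1 (fst p) (snd p))" "sq_int ?\<Pi> (\<lambda>p. \<phi>2 (fst p) (snd p))"
    using L2F_sq_int[OF L(1) t'] L2F_sq_int[OF L(2) t'] by (simp_all add: split_beta')
  have y: "sq_int M (Y1 t)" "sq_int M (Y2 t)" using ito_sq_int[OF ito(1) t'] ito_sq_int[OF ito(2) t'] .
  have iso: "(\<integral>\<omega>. (Z \<omega>)\<^sup>2 \<partial>M) = (\<integral>p. (\<psi> (fst p) (snd p))\<^sup>2 \<partial>?\<Pi>)"
    if "nsq M Z = sq_norm_L2 M t \<psi>" "sq_int M Z" "sq_int ?\<Pi> (\<lambda>p. \<psi> (fst p) (snd p))"
    for Z :: "'w \<Rightarrow> real" and \<psi> :: "real \<Rightarrow> 'w \<Rightarrow> real"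
  proof -
    have "sq_norm_L2 M t \<psi> = nsq ?\<Pi> (\<lambda>p. \<psi> (fst p) (snd p))"
      using sq_norm_L2_eq_nsq[of \<psi> t] sq_int_measurable[OF that(3)] by (simp add: split_beta')
    then show ?thesis
      using that(1) nsq_eq_integral[OF that(2)] nsq_eq_integral[OF that(3)]
      by (simp add: integral_nonneg_AE)
  qed
  have "(\<integral>\<omega>. (Y1 t \<omega>)\<^sup>2 \<partial>M) = (\<integral>p. (\<phi>1 (fst p) (snd p))\<^sup>2 \<partial>?\<Pi>)"
    by (rule iso[OF ito_isometry[OF ito(1) t'] y(1) s(1)])
  moreover have "(\<integral>\<omega>. (Y2 t \<omega>)\<^sup>2 \<partial>M) = (\<integral>p. (\<phi>2 (fst p) (snd p))\<^sup>2 \<partial>?\<Pi>)"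
    by (rule iso[OF ito_isometry[OF ito(2) t'] y(2) s(2)])
  moreover have "(\<integral>\<omega>. (Y1 t \<omega> - Y2 t \<omega>)\<^sup>2 \<partial>M) = (\<integral>p. (\<phi>1 (fst p) (snd p) - \<phi>2 (fst p) (snd p))\<^sup>2 \<partial>?\<Pi>)"
    by (rule iso[OF ito_difference_isometry[OF ito t'] sq_int_diff[OF y] sq_int_diff[OF s]])
  ultimately show ?thesis using integral_sq_diff[OF y] integral_sq_diff[OF s] by linarith
qed

text \<open>The drift is only in \<open>L2F\<close>, unlike the continuous one in
  \<open>time_integral_regular\<close>. Its paths are square integrable for almost every sample
  point, and joint measurability of \<open>V\<close> is obtained through the indicator of r \<le>
  s.\<close>

lemma drift_integral:
  fixes b :: "real \<Rightarrow> 'w \<Rightarrow> real"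
  assumes b: "b \<in> L2F M F T" and t: "t \<in> {0..T}"
  defines "V \<equiv> \<lambda>s \<omega>. LINT r:{0..s}|lborel. b r \<omega>"
  shows "sq_int (time_measure t \<Otimes>\<^sub>M M) (\<lambda>p. V (fst p) (snd p))" "\<And>s. s \<in> {0..t} \<Longrightarrow> sq_int M (V s)"
proof -
  let ?\<tau> = "time_measure t" and ?\<Pi> = "time_measure t \<Otimes>\<^sub>M M"
  have t': "0 \<le> t" "t \<le> T" using t by auto
  interpret tm: finite_measure ?\<tau> by (rule finite_time_measure)
  interpret P: pair_sigma_finite ?\<tau> M ..
  define U where "U s \<omega> = (\<integral>r. indicator {..s} r * b r \<omega> \<partial>?\<tau>)" for s \<omega>
  have VU: "V s \<omega> = U s \<omega>" if "s \<le> t" for s \<omega>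
    unfolding V_def U_def by (rule triangle_indicator[OF that])
  have jb: "(\<lambda>p. b (fst p) (snd p)) \<in> borel_measurable ?\<Pi>"
    using sq_int_measurable[OF L2F_sq_int[OF b t']] by (simp add: split_beta')
  have id_meas [measurable]: "(\<lambda>s. s) \<in> borel_measurable ?\<tau>" by (simp add: measurable_restrict_space1)
  have U_joint: "(\<lambda>p. U (fst p) (snd p)) \<in> borel_measurable ?\<Pi>"
    unfolding U_def
  proof (rule tm.borel_measurable_lebesgue_integral)
    have [measurable]: "(\<lambda>q. fst (fst q)) \<in> borel_measurable (?\<Pi> \<Otimes>\<^sub>M ?\<tau>)" "(\<lambda>q. snd q) \<in> borel_measurable (?\<Pi> \<Otimes>\<^sub>M ?\<tau>)"
      using measurable_compose[OF measurable_compose[OF measurable_fst measurable_fst] id_meas]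
        measurable_compose[OF measurable_snd id_meas] by auto
    have "(\<lambda>q. (snd q, snd (fst q))) \<in> measurable (?\<Pi> \<Otimes>\<^sub>M ?\<tau>) ?\<Pi>"
      by (intro measurable_Pair measurable_snd measurable_compose[OF measurable_fst measurable_snd])
    from measurable_compose[OF this jb]
    have [measurable]: "(\<lambda>q. b (snd q) (snd (fst q))) \<in> borel_measurable (?\<Pi> \<Otimes>\<^sub>M ?\<tau>)" by simp
    have "(\<lambda>q. if snd q \<le> fst (fst q) then b (snd q) (snd (fst q)) else 0) \<in> borel_measurable (?\<Pi> \<Otimes>\<^sub>M ?\<tau>)"
      by measurable
    then show "(\<lambda>(p, r). indicator {..fst p} r * b r (snd p)) \<in> borel_measurable (?\<Pi> \<Otimes>\<^sub>M ?\<tau>)"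
      by (rule measurable_cong[THEN iffD1, rotated]) (auto simp: indicator_def)
  qed
  have V_joint: "(\<lambda>p. V (fst p) (snd p)) \<in> borel_measurable ?\<Pi>"
    using U_joint by (rule measurable_cong[THEN iffD1, rotated])
      (auto simp: VU space_pair_measure space_restrict_space)
  have Vs: "V s \<in> borel_measurable M" if "s \<in> {0..t}" for s
  proof -
    have "s \<in> space ?\<tau>" using that by (simp add: space_restrict_space)
    from measurable_compose[OF measurable_Pair1'[OF this] V_joint] show ?thesis by simp
  qed
  have nsqV: "nsq M (V s) \<le> ennreal t * sq_norm_L2 M t b" if s: "s \<in> {0..t}" for s
  proof -
    have "nsq M (V s) \<le> (\<integral>\<^sup>+\<omega>. ennreal t * nsq ?\<tau> (\<lambda>r. b r \<omega>) \<partial>M)"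
      unfolding nsq_def[of M]
    proof (rule nn_integral_mono_AE)
      show "AE \<omega> in M. ennreal ((norm (V s \<omega>))\<^sup>2) \<le> ennreal t * nsq ?\<tau> (\<lambda>r. b r \<omega>)"
        using L2F_section_sq_int[OF b t']
      proof eventually_elim
        case (elim \<omega>)
        have "sq_int ?\<tau> (\<lambda>r. indicator {..s} r * b r \<omega>)"
          unfolding sq_int_def
        proof
          have [measurable]: "(\<lambda>r. b r \<omega>) \<in> borel_measurable ?\<tau>" using elim by (rule sq_int_measurable)
          have "(\<lambda>r. if r \<le> s then b r \<omega> else 0) \<in> borel_measurable ?\<tau>" by measurable
          then show m: "(\<lambda>r. indicator {..s} r * b r \<omega>) \<in> borel_measurable ?\<tau>"
            by (rule measurable_cong[THEN iffD1, rotated]) (auto simp: indicator_def)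
          show "integrable ?\<tau> (\<lambda>r. (norm (indicator {..s} r * b r \<omega>))\<^sup>2)"
          proof (rule Bochner_Integration.integrable_bound)
            show "integrable ?\<tau> (\<lambda>r. (norm (b r \<omega>))\<^sup>2)" using elim by (simp add: sq_int_def)
          qed (use m in \<open>auto simp: indicator_def\<close>)
        qed
        from tm.norm_integral_sq_le[OF this]
        have "ennreal ((norm (V s \<omega>))\<^sup>2) \<le> emeasure ?\<tau> (space ?\<tau>) * nsq ?\<tau> (\<lambda>r. indicator {..s} r * b r \<omega>)"
          using s by (simp add: VU U_def)
        also have "\<dots> \<le> ennreal t * nsq ?\<tau> (\<lambda>r. b r \<omega>)"
          unfolding nsq_def using t'
          by (intro mult_mono nn_integral_mono ennreal_leI)
            (auto simp: emeasure_restrict_space space_restrict_space indicator_def)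
        finally show ?case .
      qed
    qed
    also have "\<dots> = ennreal t * (\<integral>\<^sup>+\<omega>. nsq ?\<tau> (\<lambda>r. b r \<omega>) \<partial>M)"
    proof (rule nn_integral_cmult)
      have "(\<lambda>p. (\<lambda>q. ennreal ((norm (b (fst q) (snd q)))\<^sup>2)) (snd p, fst p)) \<in> borel_measurable (M \<Otimes>\<^sub>M ?\<tau>)"
        using jb by (intro measurable_compose[OF measurable_Pair[OF measurable_snd measurable_fst]]) auto
      then have "(\<lambda>(\<omega>, r). ennreal ((norm (b r \<omega>))\<^sup>2)) \<in> borel_measurable (M \<Otimes>\<^sub>M ?\<tau>)" by (simp add: split_beta')
      then show "(\<lambda>\<omega>. nsq ?\<tau> (\<lambda>r. b r \<omega>)) \<in> borel_measurable M"
        unfolding nsq_def by (rule tm.borel_measurable_nn_integral)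
    qed
    also have "(\<integral>\<^sup>+\<omega>. nsq ?\<tau> (\<lambda>r. b r \<omega>) \<partial>M) = sq_norm_L2 M t b"
      unfolding sq_norm_L2_def nsq_def by (intro nn_integral_cong nn_integral_restrict_space) simp
    finally show ?thesis .
  qed
  have fin: "ennreal t * sq_norm_L2 M t b < \<infinity>"
    using b sq_norm_L2_mono[OF t'(2), of b] by (auto simp: L2F_def ennreal_mult_less_top intro: le_less_trans)
  show "sq_int M (V s)" if "s \<in> {0..t}" for s
    using Vs[OF that] nsqV[OF that] fin by (auto simp: sq_int_iff_nsq intro: le_less_trans)
  have "nsq ?\<Pi> (\<lambda>p. V (fst p) (snd p)) = sq_norm_L2 M t V"
    using sq_norm_L2_eq_nsq[of V t] V_joint by (simp add: split_beta')
  also have "\<dots> = (\<integral>\<^sup>+s. nsq M (V s) \<partial>?\<tau>)"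
    using V_joint by (intro sq_norm_L2_time) (simp add: split_beta')
  also have "\<dots> \<le> (\<integral>\<^sup>+s. ennreal t * sq_norm_L2 M t b \<partial>?\<tau>)"
    using nsqV by (intro nn_integral_mono) (auto simp: space_restrict_space)
  also have "\<dots> < \<infinity>"
  proof -
    have "emeasure ?\<tau> (space ?\<tau>) < \<infinity>" by (metis less_top tm.emeasure_finite infinity_ennreal_def)
    then show ?thesis using fin by (simp add: ennreal_mult_less_top)
  qed
  finally show "sq_int ?\<Pi> (\<lambda>p. V (fst p) (snd p))" using V_joint by (simp add: sq_int_iff_nsq)
qed


text \<open>Paired with b' s, which is known at time s, Y t may be replaced by Y s. The definition
  does not make Y jointly measurable in time and sample point; X - x minus the drift integral is,
  and equals Y s almost surely at each s, so it appears on the right side.\<close>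

lemma ito_drift_covariance:
  fixes b b' X Y :: "real \<Rightarrow> 'w \<Rightarrow> real"
  assumes T: "0 < T" and ito: "is_ito_integral M F W T \<sigma> Y" and b: "b \<in> L2F M F T" and b': "b' \<in> L2F M F T"
    and X: "X \<in> L2F M F T"
    and eq: "\<And>t. t \<in> {0..T} \<Longrightarrow> AE \<omega> in M. X t \<omega> = x + (LINT s:{0..t}|lborel. b s \<omega>) + Y t \<omega>"
    and t: "t \<in> {0..T}"
  shows "(\<integral>\<omega>. Y t \<omega> * (y + (LINT s:{0..t}|lborel. b' s \<omega>)) \<partial>M)
    = (\<integral>p. (X (fst p) (snd p) - x - (LINT r:{0..fst p}|lborel. b r (snd p))) * b' (fst p) (snd p) \<partial>(time_measure t \<Otimes>\<^sub>M M))"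
proof -
  let ?\<tau> = "time_measure t" and ?\<Pi> = "time_measure t \<Otimes>\<^sub>M M"
  have t': "0 \<le> t" "t \<le> T" using t by auto
  interpret tm: finite_measure ?\<tau> by (rule finite_time_measure)
  interpret P: pair_sigma_finite ?\<tau> M ..
  interpret \<Pi>: finite_measure ?\<Pi> by (rule finite_measure_pair_measure[OF finite_measure_axioms tm.finite_measure_axioms])
  define V where "V s \<omega> = (LINT r:{0..s}|lborel. b r \<omega>)" for s \<omega>
  define V' where "V' s \<omega> = (LINT r:{0..s}|lborel. b' r \<omega>)" for s \<omega>
  have sV: "sq_int ?\<Pi> (\<lambda>p. V (fst p) (snd p))" "\<And>s. s \<in> {0..t} \<Longrightarrow> sq_int M (V s)"
    unfolding V_def[abs_def] by (rule drift_integral[OF b t]; assumption?)+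
  have sV': "sq_int M (V' t)"
    unfolding V'_def[abs_def] by (rule drift_integral(2)[OF b' t]) (use t in auto)
  have sb': "sq_int ?\<Pi> (\<lambda>p. b' (fst p) (snd p))" and sX: "sq_int ?\<Pi> (\<lambda>p. X (fst p) (snd p))"
    using L2F_sq_int[OF b' t'] L2F_sq_int[OF X t'] by (simp_all add: split_beta')
  have sY: "sq_int M (Y t)" by (rule ito_sq_int[OF ito t'])
  have sYP: "sq_int ?\<Pi> (\<lambda>p. Y t (snd p))"
  proof -
    have [measurable]: "Y t \<in> borel_measurable M" using sY by (rule sq_int_measurable)
    have "nsq ?\<Pi> (\<lambda>p. Y t (snd p)) = (\<integral>\<^sup>+s. nsq M (Y t) \<partial>?\<tau>)"
      unfolding nsq_def by (subst nn_integral_fst[symmetric]) simp_all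
    also have "\<dots> < \<infinity>"
      using sY tm.emeasure_finite[of "space ?\<tau>"]
      by (simp add: sq_int_iff_nsq ennreal_mult_eq_top_iff less_top[symmetric] del: tm.emeasure_finite)
    finally show ?thesis by (simp add: sq_int_iff_nsq)
  qed
  have i1: "integrable ?\<Pi> (\<lambda>p. Y t (snd p) * b' (fst p) (snd p))" by (rule sq_int_mult[OF sYP sb'])
  have sZ: "sq_int ?\<Pi> (\<lambda>p. X (fst p) (snd p) - x - V (fst p) (snd p))"
    by (intro sq_int_diff sX sV(1)) simp
  have i2: "integrable ?\<Pi> (\<lambda>p. (X (fst p) (snd p) - x - V (fst p) (snd p)) * b' (fst p) (snd p))"
    by (rule sq_int_mult[OF sZ sb'])
  have "(\<integral>\<omega>. Y t \<omega> * V' t \<omega> \<partial>M) = (\<integral>\<omega>. (\<integral>s. Y t \<omega> * b' s \<omega> \<partial>?\<tau>) \<partial>M)"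
    by (intro Bochner_Integration.integral_cong refl) (simp add: V'_def set_integral_time_measure)
  also have "\<dots> = (\<integral>s. (\<integral>\<omega>. Y t \<omega> * b' s \<omega> \<partial>M) \<partial>?\<tau>)"
    by (rule P.Fubini_integral) (use i1 in \<open>simp add: split_beta'\<close>)
  also have "\<dots> = (\<integral>s. (\<integral>\<omega>. (X s \<omega> - x - V s \<omega>) * b' s \<omega> \<partial>M) \<partial>?\<tau>)"
  proof (rule integral_cong_AE)
    show "(\<lambda>s. \<integral>\<omega>. Y t \<omega> * b' s \<omega> \<partial>M) \<in> borel_measurable ?\<tau>"
      by (rule borel_measurable_lebesgue_integral) (use i1 in \<open>auto simp: split_beta'\<close>)
    show "(\<lambda>s. \<integral>\<omega>. (X s \<omega> - x - V s \<omega>) * b' s \<omega> \<partial>M) \<in> borel_measurable ?\<tau>"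
      by (rule borel_measurable_lebesgue_integral) (use i2 in \<open>auto simp: split_beta'\<close>)
    show "AE s in ?\<tau>. (\<integral>\<omega>. Y t \<omega> * b' s \<omega> \<partial>M) = (\<integral>\<omega>. (X s \<omega> - x - V s \<omega>) * b' s \<omega> \<partial>M)"
      using L2F_AE_sq_int[OF b' t'] L2F_AE_sq_int[OF X t'] AE_space[of ?\<tau>]
    proof eventually_elim
      case (elim s)
      then have s: "0 \<le> s" "s \<le> t" "s \<in> {0..T}" "s \<le> T" using t' by (auto simp: space_restrict_space)
      have sYs: "sq_int M (Y s)" by (rule ito_sq_int[OF ito s(1,4)])
      have "(\<integral>\<omega>. (Y t \<omega> - Y s \<omega>) \<bullet> b' s \<omega> \<partial>M) = 0"
        by (rule ito_martingale[OF ito s(1,2) t'(2) elim(1) L2F_adapted[OF b' s(3)]])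
      moreover have "(\<integral>\<omega>. (Y t \<omega> - Y s \<omega>) \<bullet> b' s \<omega> \<partial>M) = (\<integral>\<omega>. Y t \<omega> * b' s \<omega> \<partial>M) - (\<integral>\<omega>. Y s \<omega> * b' s \<omega> \<partial>M)"
        using sq_int_mult[OF sY elim(1)] sq_int_mult[OF sYs elim(1)] by (simp add: left_diff_distrib)
      moreover have "(\<integral>\<omega>. Y s \<omega> * b' s \<omega> \<partial>M) = (\<integral>\<omega>. (X s \<omega> - x - V s \<omega>) * b' s \<omega> \<partial>M)"
      proof (rule integral_cong_AE)
        show "AE \<omega> in M. Y s \<omega> * b' s \<omega> = (X s \<omega> - x - V s \<omega>) * b' s \<omega>"
          using eq[OF s(3)] by eventually_elim (simp add: V_def)
        show "(\<lambda>\<omega>. Y s \<omega> * b' s \<omega>) \<in> borel_measurable M"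
          using sq_int_mult[OF sYs elim(1)] by auto
        have "sq_int M (V s)" using s by (intro sV(2)) auto
        then show "(\<lambda>\<omega>. (X s \<omega> - x - V s \<omega>) * b' s \<omega>) \<in> borel_measurable M"
          using elim by (auto dest!: sq_int_measurable)
      qed
      ultimately show ?case by simp
    qed
  qed
  also have "\<dots> = (\<integral>p. (X (fst p) (snd p) - x - V (fst p) (snd p)) * b' (fst p) (snd p) \<partial>?\<Pi>)"
    using P.integral_fst[of "\<lambda>s \<omega>. (X s \<omega> - x - V s \<omega>) * b' s \<omega>"] i2 by (simp add: split_beta')
  finally have "(\<integral>\<omega>. Y t \<omega> * V' t \<omega> \<partial>M) = \<dots>" .
  moreover have "(\<integral>\<omega>. Y t \<omega> * (y + V' t \<omega>) \<partial>M) = (\<integral>\<omega>. Y t \<omega> * V' t \<omega> \<partial>M)"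
  proof -
    have "(\<integral>\<omega>. Y t \<omega> * (y + V' t \<omega>) \<partial>M) = (\<integral>\<omega>. Y t \<omega> * y \<partial>M) + (\<integral>\<omega>. Y t \<omega> * V' t \<omega> \<partial>M)"
      unfolding distrib_left using sq_int_integrable[OF sY] sq_int_mult[OF sY sV'] by simp
    then show ?thesis using ito_mean[OF less_imp_le[OF T] ito t] by simp
  qed
  ultimately show ?thesis unfolding V_def V'_def by simp
qed

text \<open>Ito's product rule in expectation. The decompositions into initial value, drift and
  martingale part are multiplied out: drift with drift by pathwise integration by parts, drift with
  martingale by \<open>ito_drift_covariance\<close>, martingale with martingale by
  \<open>ito_covariance\<close>.\<close>

lemma ito_product:
  fixes b1 b2 X1 X2 Y1 Y2 :: "real \<Rightarrow> 'w \<Rightarrow> real"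
  assumes T: "0 < T" and ito: "is_ito_integral M F W T \<sigma>1 Y1" "is_ito_integral M F W T \<sigma>2 Y2"
    and b: "b1 \<in> L2F M F T" "b2 \<in> L2F M F T" and X: "X1 \<in> L2F M F T" "X2 \<in> L2F M F T"
    and eq: "\<And>t. t \<in> {0..T} \<Longrightarrow> AE \<omega> in M. X1 t \<omega> = x1 + (LINT s:{0..t}|lborel. b1 s \<omega>) + Y1 t \<omega>"
      "\<And>t. t \<in> {0..T} \<Longrightarrow> AE \<omega> in M. X2 t \<omega> = x2 + (LINT s:{0..t}|lborel. b2 s \<omega>) + Y2 t \<omega>"
    and t: "t \<in> {0..T}"
  defines "k \<equiv> \<lambda>s \<omega>. b1 s \<omega> * X2 s \<omega> + X1 s \<omega> * b2 s \<omega> + \<sigma>1 s \<omega> * \<sigma>2 s \<omega>"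
  shows "integrable (time_measure t \<Otimes>\<^sub>M M) (\<lambda>p. k (fst p) (snd p))"
    "(\<integral>\<omega>. X1 t \<omega> * X2 t \<omega> \<partial>M) = x1 * x2 + (\<integral>p. k (fst p) (snd p) \<partial>(time_measure t \<Otimes>\<^sub>M M))"
proof -
  let ?\<tau> = "time_measure t" and ?\<Pi> = "time_measure t \<Otimes>\<^sub>M M"
  have t': "0 \<le> t" "t \<le> T" using t by auto
  interpret tm: finite_measure ?\<tau> by (rule finite_time_measure)
  interpret P: pair_sigma_finite ?\<tau> M ..
  interpret \<Pi>: finite_measure ?\<Pi> by (rule finite_measure_pair_measure[OF finite_measure_axioms tm.finite_measure_axioms])
  define V1 where "V1 s \<omega> = (LINT r:{0..s}|lborel. b1 r \<omega>)" for s \<omega>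
  define V2 where "V2 s \<omega> = (LINT r:{0..s}|lborel. b2 r \<omega>)" for s \<omega>
  have tt: "t \<in> {0..t}" using t by simp
  have sV1: "sq_int ?\<Pi> (\<lambda>p. V1 (fst p) (snd p))" "sq_int M (V1 t)"
    unfolding V1_def[abs_def] by (rule drift_integral[OF b(1) t])+ (rule tt)
  have sV2: "sq_int ?\<Pi> (\<lambda>p. V2 (fst p) (snd p))" "sq_int M (V2 t)"
    unfolding V2_def[abs_def] by (rule drift_integral[OF b(2) t])+ (rule tt)
  have sL: "sq_int ?\<Pi> (\<lambda>p. \<phi> (fst p) (snd p))" if "\<phi> \<in> L2F M F T" for \<phi> :: "real \<Rightarrow> 'w \<Rightarrow> real"
    using L2F_sq_int[OF that t'] by (simp add: split_beta')
  have \<sigma>: "\<sigma>1 \<in> L2F M F T" "\<sigma>2 \<in> L2F M F T" using ito by (auto simp: is_ito_integral_def)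
  have sY: "sq_int M (Y1 t)" "sq_int M (Y2 t)" using ito_sq_int[OF ito(1) t'] ito_sq_int[OF ito(2) t'] .
  note ik = sq_int_mult[OF sL[OF b(1)] sL[OF X(2)]] sq_int_mult[OF sL[OF X(1)] sL[OF b(2)]]
    sq_int_mult[OF sL[OF \<sigma>(1)] sL[OF \<sigma>(2)]]
  show "integrable ?\<Pi> (\<lambda>p. k (fst p) (snd p))" unfolding k_def using ik by simp
  \<comment> \<open>The density of the product of the two drift parts. When the mixed terms are
    added, initial values and drift integrals cancel and b1 X2 + X1 b2 remains.\<close>
  define h where "h s \<omega> = b1 s \<omega> * (x2 + V2 s \<omega>) + (x1 + V1 s \<omega>) * b2 s \<omega>" for s \<omega>
  have sxV1: "sq_int ?\<Pi> (\<lambda>p. x1 + V1 (fst p) (snd p))" and sxV2: "sq_int ?\<Pi> (\<lambda>p. x2 + V2 (fst p) (snd p))"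
    by (intro sq_int_add sV1 sV2; simp)+
  have ih: "integrable ?\<Pi> (\<lambda>(s, \<omega>). h s \<omega>)"
    unfolding h_def split_beta'
    by (intro Bochner_Integration.integrable_add sq_int_mult sL b sxV1 sxV2)
  have sxV1t: "sq_int M (\<lambda>\<omega>. x1 + V1 t \<omega>)" and sxV2t: "sq_int M (\<lambda>\<omega>. x2 + V2 t \<omega>)"
    by (intro sq_int_add sV1 sV2; simp)+
  have A: "(\<integral>\<omega>. (x1 + V1 t \<omega>) * (x2 + V2 t \<omega>) \<partial>M) = x1 * x2 + (\<integral>p. h (fst p) (snd p) \<partial>?\<Pi>)"
  proof -
    have "(\<integral>\<omega>. (x1 + V1 t \<omega>) * (x2 + V2 t \<omega>) \<partial>M) = (\<integral>\<omega>. x1 * x2 + (\<integral>s. h s \<omega> \<partial>?\<tau>) \<partial>M)"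
    proof (rule integral_cong_AE)
      show "(\<lambda>\<omega>. (x1 + V1 t \<omega>) * (x2 + V2 t \<omega>)) \<in> borel_measurable M"
        using sq_int_mult[OF sxV1t sxV2t] by auto
      show "(\<lambda>\<omega>. x1 * x2 + (\<integral>s. h s \<omega> \<partial>?\<tau>)) \<in> borel_measurable M"
        using P.integrable_snd[OF ih] by auto
      show "AE \<omega> in M. (x1 + V1 t \<omega>) * (x2 + V2 t \<omega>) = x1 * x2 + (\<integral>s. h s \<omega> \<partial>?\<tau>)"
        using L2F_section_sq_int[OF b(1) t'] L2F_section_sq_int[OF b(2) t']
      proof eventually_elim
        case (elim \<omega>)
        show ?case
          using integral_by_parts(2)[OF tm.sq_int_integrable[OF elim(1)] tm.sq_int_integrable[OF elim(2)] t'(1), of x1 x2]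
          unfolding h_def V1_def V2_def .
      qed
    qed
    also have "\<dots> = x1 * x2 + (\<integral>\<omega>. (\<integral>s. h s \<omega> \<partial>?\<tau>) \<partial>M)"
      using P.integrable_snd[OF ih] by (simp add: prob_space)
    also have "(\<integral>\<omega>. (\<integral>s. h s \<omega> \<partial>?\<tau>) \<partial>M) = (\<integral>p. h (fst p) (snd p) \<partial>?\<Pi>)"
      using P.integral_snd[OF ih] by (simp add: split_beta')
    finally show ?thesis .
  qed
  have B1: "(\<integral>\<omega>. Y1 t \<omega> * (x2 + V2 t \<omega>) \<partial>M)
      = (\<integral>p. (X1 (fst p) (snd p) - x1 - V1 (fst p) (snd p)) * b2 (fst p) (snd p) \<partial>?\<Pi>)"
    unfolding V1_def V2_def by (rule ito_drift_covariance[OF T ito(1) b X(1) eq(1) t])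
  have B2: "(\<integral>\<omega>. Y2 t \<omega> * (x1 + V1 t \<omega>) \<partial>M)
      = (\<integral>p. (X2 (fst p) (snd p) - x2 - V2 (fst p) (snd p)) * b1 (fst p) (snd p) \<partial>?\<Pi>)"
    unfolding V1_def V2_def by (rule ito_drift_covariance[OF T ito(2) b(2,1) X(2) eq(2) t])
  note C = ito_covariance[OF ito t]
  have "(\<integral>\<omega>. X1 t \<omega> * X2 t \<omega> \<partial>M) = (\<integral>\<omega>. (x1 + V1 t \<omega> + Y1 t \<omega>) * (x2 + V2 t \<omega> + Y2 t \<omega>) \<partial>M)"
  proof (rule integral_cong_AE)
    show "AE \<omega> in M. X1 t \<omega> * X2 t \<omega> = (x1 + V1 t \<omega> + Y1 t \<omega>) * (x2 + V2 t \<omega> + Y2 t \<omega>)"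
      using eq(1)[OF t] eq(2)[OF t] by eventually_elim (simp add: V1_def V2_def)
    show "(\<lambda>\<omega>. X1 t \<omega> * X2 t \<omega>) \<in> borel_measurable M"
      using measurable_filtration_M[OF t'(1) L2F_adapted[OF X(1) t]] measurable_filtration_M[OF t'(1) L2F_adapted[OF X(2) t]]
      by (rule borel_measurable_times)
    show "(\<lambda>\<omega>. (x1 + V1 t \<omega> + Y1 t \<omega>) * (x2 + V2 t \<omega> + Y2 t \<omega>)) \<in> borel_measurable M"
      using sq_int_mult[OF sq_int_add[OF sxV1t sY(1)] sq_int_add[OF sxV2t sY(2)]] by auto
  qed
  also have "\<dots> = (\<integral>\<omega>. (x1 + V1 t \<omega>) * (x2 + V2 t \<omega>) + Y1 t \<omega> * (x2 + V2 t \<omega>) + Y2 t \<omega> * (x1 + V1 t \<omega>) + Y1 t \<omega> * Y2 t \<omega> \<partial>M)"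
    by (intro Bochner_Integration.integral_cong refl) (simp add: algebra_simps)
  also have "\<dots> = (\<integral>\<omega>. (x1 + V1 t \<omega>) * (x2 + V2 t \<omega>) \<partial>M) + (\<integral>\<omega>. Y1 t \<omega> * (x2 + V2 t \<omega>) \<partial>M)
      + (\<integral>\<omega>. Y2 t \<omega> * (x1 + V1 t \<omega>) \<partial>M) + (\<integral>\<omega>. Y1 t \<omega> * Y2 t \<omega> \<partial>M)"
    using sq_int_mult[OF sxV1t sxV2t] sq_int_mult[OF sY(1) sxV2t] sq_int_mult[OF sY(2) sxV1t] sq_int_mult[OF sY]
    by (simp del: integral_mult_right_zero integral_mult_left_zero)
  also have "\<dots> = x1 * x2 + ((\<integral>p. h (fst p) (snd p) \<partial>?\<Pi>)
      + (\<integral>p. (X1 (fst p) (snd p) - x1 - V1 (fst p) (snd p)) * b2 (fst p) (snd p) \<partial>?\<Pi>)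
      + (\<integral>p. (X2 (fst p) (snd p) - x2 - V2 (fst p) (snd p)) * b1 (fst p) (snd p) \<partial>?\<Pi>)
      + (\<integral>p. \<sigma>1 (fst p) (snd p) * \<sigma>2 (fst p) (snd p) \<partial>?\<Pi>))"
    unfolding A B1 B2 C by simp
  also have "\<dots> = x1 * x2 + (\<integral>p. h (fst p) (snd p) + (X1 (fst p) (snd p) - x1 - V1 (fst p) (snd p)) * b2 (fst p) (snd p)
      + (X2 (fst p) (snd p) - x2 - V2 (fst p) (snd p)) * b1 (fst p) (snd p)
      + \<sigma>1 (fst p) (snd p) * \<sigma>2 (fst p) (snd p) \<partial>?\<Pi>)"
  proof -
    have c1: "integrable ?\<Pi> (\<lambda>p. (X1 (fst p) (snd p) - x1 - V1 (fst p) (snd p)) * b2 (fst p) (snd p))"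
      by (rule sq_int_mult[OF sq_int_diff[OF sq_int_diff[OF sL[OF X(1)] \<Pi>.sq_int_const] sV1(1)] sL[OF b(2)]])
    have c2: "integrable ?\<Pi> (\<lambda>p. (X2 (fst p) (snd p) - x2 - V2 (fst p) (snd p)) * b1 (fst p) (snd p))"
      by (rule sq_int_mult[OF sq_int_diff[OF sq_int_diff[OF sL[OF X(2)] \<Pi>.sq_int_const] sV2(1)] sL[OF b(1)]])
    have c0: "integrable ?\<Pi> (\<lambda>p. h (fst p) (snd p))" using ih by (simp add: split_beta')
    show ?thesis
      by (simp only: Bochner_Integration.integral_add Bochner_Integration.integrable_add c0 c1 c2 ik(3))
  qed
  also have "\<dots> = x1 * x2 + (\<integral>p. k (fst p) (snd p) \<partial>?\<Pi>)"
    by (intro arg_cong2[where f = "(+)"] refl Bochner_Integration.integral_cong) (simp add: h_def k_def algebra_simps)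
  finally show "(\<integral>\<omega>. X1 t \<omega> * X2 t \<omega> \<partial>M) = x1 * x2 + (\<integral>p. k (fst p) (snd p) \<partial>?\<Pi>)" .
qed

end

lemma matrix_inner_sum:
  fixes N :: "real^'n^'m"
  shows "(N *v f) \<bullet> g = (\<Sum>i\<in>UNIV. \<Sum>j\<in>UNIV. N $ i $ j * (f $ j * g $ i))"
  by (simp add: inner_vec_def matrix_vector_mult_def sum_distrib_right mult.assoc)

section \<open>Vector-valued processes and Ito's formula in expectation\<close>

context brownian_filtration
begin

lemma L2F_add:
  assumes T: "0 \<le> T" and "\<phi> \<in> L2F M F T" "\<psi> \<in> L2F M F T"
  shows "(\<lambda>t \<omega>. \<phi> t \<omega> + \<psi> t \<omega>) \<in> L2F M F T"
proof -
  have "progressive F T (\<lambda>t \<omega>. \<phi> t \<omega> + \<psi> t \<omega>)"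
    using assms unfolding L2F_def progressive_def split_beta' by (auto intro!: borel_measurable_add)
  moreover have "sq_int (time_measure T \<Otimes>\<^sub>M M) (\<lambda>(s, \<omega>). \<phi> s \<omega> + \<psi> s \<omega>)"
    using sq_int_add[OF L2F_sq_int[OF assms(2) T order_refl] L2F_sq_int[OF assms(3) T order_refl]]
    by (simp add: split_beta')
  ultimately show ?thesis using L2F_iff_sq_int[OF T] by blast
qed

lemma L2F_linear:
  assumes T: "0 \<le> T" and L: "bounded_linear L" and \<phi>: "\<phi> \<in> L2F M F T"
  shows "(\<lambda>t \<omega>. L (\<phi> t \<omega>)) \<in> L2F M F T"
proof -
  have Lm: "L \<in> borel_measurable borel"
    using L by (intro borel_measurable_continuous_onI linear_continuous_on)
  have "progressive F T (\<lambda>t \<omega>. L (\<phi> t \<omega>))"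
    using \<phi> measurable_compose[OF _ Lm] unfolding L2F_def progressive_def split_beta' by blast
  moreover have "sq_int (time_measure T \<Otimes>\<^sub>M M) (\<lambda>(s, \<omega>). L (\<phi> s \<omega>))"
    using sq_int_bounded_linear[OF L L2F_sq_int[OF \<phi> T order_refl]] by (simp add: split_beta')
  ultimately show ?thesis using L2F_iff_sq_int[OF T] by blast
qed

lemma L2F_matrix:
  fixes a :: "real \<Rightarrow> real^'n^'m"
  assumes T: "0 \<le> T" and a: "continuous_on {0..T} a" and \<phi>: "\<phi> \<in> L2F M F T"
  shows "(\<lambda>t \<omega>. a t *v \<phi> t \<omega>) \<in> L2F M F T"
proof -
  interpret bb: bounded_bilinear "\<lambda>(A::real^'n^'m) x. A *v x" by (rule bounded_bilinear_matrix_vector)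
  have meas: "(\<lambda>p. a (fst p) *v \<phi> (fst p) (snd p)) \<in> borel_measurable N"
    if "(\<lambda>p. a (fst p)) \<in> borel_measurable N" "(\<lambda>p. \<phi> (fst p) (snd p)) \<in> borel_measurable N" for N
    using that by (rule borel_measurable_continuous_Pair) (intro bb.continuous_on continuous_intros)
  have am: "a \<in> borel_measurable (restrict_space borel {0..t})" if "t \<le> T" for t
    using that by (intro borel_measurable_continuous_on_restrict continuous_on_subset[OF a]) auto
  have prog: "progressive F T (\<lambda>t \<omega>. a t *v \<phi> t \<omega>)"
    unfolding progressive_def split_beta'
  proof
    fix t assume "t \<in> {0..T}"
    then show "(\<lambda>p. a (fst p) *v \<phi> (fst p) (snd p)) \<in> borel_measurable (restrict_space borel {0..t} \<Otimes>\<^sub>M F t)"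
      using \<phi> by (intro meas measurable_compose[OF measurable_fst am]) (auto simp: L2F_def progressive_def split_beta')
  qed
  obtain K where K: "0 < K" "\<And>(A::real^'n^'m) x. norm (A *v x) \<le> norm A * norm x * K"
    using bb.pos_bounded by blast
  have "bounded (a ` {0..T})" by (intro compact_imp_bounded compact_continuous_image a) simp
  then obtain B where B: "\<forall>t\<in>{0..T}. norm (a t) \<le> B" by (auto simp: bounded_iff)
  have "sq_int (time_measure T \<Otimes>\<^sub>M M) (\<lambda>(s, \<omega>). a s *v \<phi> s \<omega>)"
    unfolding sq_int_def
  proof
    show m: "(\<lambda>(s, \<omega>). a s *v \<phi> s \<omega>) \<in> borel_measurable (time_measure T \<Otimes>\<^sub>M M)"
      using progressive_joint[OF prog T order_refl] .
    show "integrable (time_measure T \<Otimes>\<^sub>M M) (\<lambda>p. (norm (case p of (s, \<omega>) \<Rightarrow> a s *v \<phi> s \<omega>))\<^sup>2)"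
    proof (rule Bochner_Integration.integrable_bound)
      show "integrable (time_measure T \<Otimes>\<^sub>M M) (\<lambda>p. (B * K)\<^sup>2 * (norm (case p of (s, \<omega>) \<Rightarrow> \<phi> s \<omega>))\<^sup>2)"
        using L2F_sq_int[OF \<phi> T order_refl] by (simp add: sq_int_def)
      show "AE p in time_measure T \<Otimes>\<^sub>M M. norm ((norm (case p of (s, \<omega>) \<Rightarrow> a s *v \<phi> s \<omega>))\<^sup>2)
          \<le> norm ((B * K)\<^sup>2 * (norm (case p of (s, \<omega>) \<Rightarrow> \<phi> s \<omega>))\<^sup>2)"
      proof (rule AE_I2)
        fix p assume "p \<in> space (time_measure T \<Otimes>\<^sub>M M)"
        then obtain s \<omega> where p: "p = (s, \<omega>)" and s: "s \<in> {0..T}"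
          by (auto simp: space_pair_measure space_restrict_space)
        have "norm (a s *v \<phi> s \<omega>) \<le> norm (a s) * norm (\<phi> s \<omega>) * K" by (rule K(2))
        also have "\<dots> \<le> B * norm (\<phi> s \<omega>) * K"
          using B s K(1) by (intro mult_right_mono) auto
        finally have "norm (a s *v \<phi> s \<omega>) \<le> (B * K) * norm (\<phi> s \<omega>)" by (simp add: mult_ac)
        then have "(norm (a s *v \<phi> s \<omega>))\<^sup>2 \<le> ((B * K) * norm (\<phi> s \<omega>))\<^sup>2" by (intro power_mono) auto
        then show "norm ((norm (case p of (s, \<omega>) \<Rightarrow> a s *v \<phi> s \<omega>))\<^sup>2)
          \<le> norm ((B * K)\<^sup>2 * (norm (case p of (s, \<omega>) \<Rightarrow> \<phi> s \<omega>))\<^sup>2)"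
          by (simp add: p power_mult_distrib)
      qed
    qed (use m in measurable)
  qed
  with prog show ?thesis using L2F_iff_sq_int[OF T] by blast
qed

text \<open>Averaging over the sample space does not increase the L2 norm at a fixed time. The means
  thereby count as processes on the same footing as X and u.\<close>

lemma L2F_mean:
  fixes \<phi> :: "real \<Rightarrow> 'w \<Rightarrow> 'h::euclidean_space"
  assumes T: "0 \<le> T" and \<phi>: "\<phi> \<in> L2F M F T"
  shows "(\<lambda>t \<omega>. integral\<^sup>L M (\<phi> t)) \<in> L2F M F T"
proof -
  have meas: "(\<lambda>s. integral\<^sup>L M (\<phi> s)) \<in> borel_measurable (restrict_space borel {0..t})" if t: "0 \<le> t" "t \<le> T" for t
  proof -
    have "(\<lambda>s. integral\<^sup>L M (\<phi> s)) \<in> borel_measurable (time_measure t)"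
      by (rule borel_measurable_lebesgue_integral[OF sq_int_measurable[OF L2F_sq_int[OF \<phi> t]]])
    then show ?thesis
      using measurable_cong_sets[OF sets_restrict_space_cong[OF sets_lborel] refl, of "{0..t}" "borel :: 'h measure"] by simp
  qed
  have prog: "progressive F T (\<lambda>t \<omega>. integral\<^sup>L M (\<phi> t))"
    unfolding progressive_def split_beta'
    using measurable_compose[OF measurable_fst meas] by auto
  have "sq_norm_L2 M T (\<lambda>t \<omega>. integral\<^sup>L M (\<phi> t)) = (\<integral>\<^sup>+s. nsq M (\<lambda>\<omega>. integral\<^sup>L M (\<phi> s)) \<partial>time_measure T)"
    by (rule sq_norm_L2_time[OF progressive_joint[OF prog T order_refl]])
  also have "\<dots> \<le> (\<integral>\<^sup>+s. nsq M (\<phi> s) \<partial>time_measure T)"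
  proof (rule nn_integral_mono_AE)
    show "AE s in time_measure T. nsq M (\<lambda>\<omega>. integral\<^sup>L M (\<phi> s)) \<le> nsq M (\<phi> s)"
      using L2F_AE_sq_int[OF \<phi> T order_refl]
    proof eventually_elim
      case (elim s)
      then show ?case using mean_sq_le[of "\<phi> s"] by (simp add: nsq_def emeasure_space_1)
    qed
  qed
  also have "\<dots> = sq_norm_L2 M T \<phi>"
    using sq_norm_L2_time[OF sq_int_measurable[OF L2F_sq_int[OF \<phi> T order_refl]]] by simp
  also have "\<dots> < \<infinity>" using \<phi> by (simp add: L2F_def)
  finally show ?thesis using prog by (simp add: L2F_def)
qed

lemma L2F_C_imp_L2F:
  assumes "0 < T" "X \<in> L2F_C M F T"
  shows "X \<in> L2F M F T" "\<And>t. t \<in> {0..T} \<Longrightarrow> sq_int M (X t)"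
proof -
  have prog: "progressive F T X" and fin: "(\<integral>\<^sup>+\<omega>. sup_sq T X \<omega> \<partial>M) < \<infinity>"
    using assms(2) by (auto simp: L2F_C_def sup_sq_def)
  have ca: "continuous_adapted T X"
    using assms(2) progressive_adapted[OF prog] by (simp add: L2F_C_def continuous_adapted_def)
  show "X \<in> L2F M F T"
    using prog fin sq_norm_L2_le_sup_sq[OF assms(1) ca]
    by (auto simp: L2F_def ennreal_mult_less_top intro: le_less_trans)
  show "sq_int M (X t)" if "t \<in> {0..T}" for t
    using nsq_le_sup_sq[OF that, of X] fin continuous_adapted_measurable[OF ca, of t] that
    by (auto simp: sq_int_iff_nsq intro: le_less_trans)
qed

text \<open>The martingale part has mean 0, and Fubini moves the expectation under the time
  integral. Thus the mean is itself an Ito process without diffusion, to which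
  \<open>quadratic_moment\<close> applies.\<close>

lemma ito_process_mean:
  fixes X b Y :: "real \<Rightarrow> 'w \<Rightarrow> 'h::euclidean_space"
  assumes T: "0 < T" and ito: "is_ito_integral M F W T \<sigma> Y" and b: "b \<in> L2F M F T"
    and X: "X \<in> L2F M F T"
    and eq: "\<And>t. t \<in> {0..T} \<Longrightarrow> AE \<omega> in M. X t \<omega> = x + (LINT s:{0..t}|lborel. b s \<omega>) + Y t \<omega>"
    and t: "t \<in> {0..T}"
  shows "integral\<^sup>L M (X t) = x + (LINT s:{0..t}|lborel. integral\<^sup>L M (b s))"
proof -
  have t': "0 \<le> t" "t \<le> T" using t by auto
  interpret tm: finite_measure "time_measure t" by (rule finite_time_measure)
  interpret P: pair_sigma_finite "time_measure t" M ..
  interpret \<Pi>: finite_measure "time_measure t \<Otimes>\<^sub>M M"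
    by (rule finite_measure_pair_measure[OF finite_measure_axioms tm.finite_measure_axioms])
  have ib: "integrable (time_measure t \<Otimes>\<^sub>M M) (\<lambda>(s, \<omega>). b s \<omega>)"
    by (rule \<Pi>.sq_int_integrable[OF L2F_sq_int[OF b t']])
  have V: "integrable M (\<lambda>\<omega>. LINT s:{0..t}|lborel. b s \<omega>)"
    unfolding set_integral_time_measure by (rule P.integrable_snd[OF ib])
  note Y = sq_int_integrable[OF ito_sq_int[OF ito t']]
  have "integral\<^sup>L M (X t) = (\<integral>\<omega>. x + (LINT s:{0..t}|lborel. b s \<omega>) + Y t \<omega> \<partial>M)"
  proof (rule integral_cong_AE)
    show "X t \<in> borel_measurable M" using measurable_filtration_M[OF t'(1) L2F_adapted[OF X t]] .
    show "(\<lambda>\<omega>. x + (LINT s:{0..t}|lborel. b s \<omega>) + Y t \<omega>) \<in> borel_measurable M"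
      using V Y by auto
  qed (rule eq[OF t])
  also have "\<dots> = x + (\<integral>\<omega>. (LINT s:{0..t}|lborel. b s \<omega>) \<partial>M)"
    using V Y ito_mean[OF less_imp_le[OF T] ito t] by (simp add: prob_space)
  also have "(\<integral>\<omega>. (LINT s:{0..t}|lborel. b s \<omega>) \<partial>M) = (\<integral>\<omega>. (\<integral>s. b s \<omega> \<partial>time_measure t) \<partial>M)"
    by (simp add: set_integral_time_measure)
  also have "\<dots> = (\<integral>s. integral\<^sup>L M (b s) \<partial>time_measure t)"
    using P.Fubini_integral[OF ib] by simp
  also have "\<dots> = (LINT s:{0..t}|lborel. integral\<^sup>L M (b s))" by (simp add: set_integral_time_measure)
  finally show ?thesis .
qed

lemma integral_matrix_inner:
  fixes N :: "real^'n^'m"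
  assumes "sq_int M f" "sq_int M g"
  shows "(\<integral>\<omega>. (N *v f \<omega>) \<bullet> g \<omega> \<partial>M) = (\<Sum>i\<in>UNIV. \<Sum>j\<in>UNIV. N $ i $ j * (\<integral>\<omega>. f \<omega> $ j * g \<omega> $ i \<partial>M))"
proof -
  have "integrable M (\<lambda>\<omega>. f \<omega> $ j * g \<omega> $ i)" for i j
    using assms by (intro sq_int_mult sq_int_bounded_linear[OF bounded_linear_vec_nth])
  then show ?thesis unfolding matrix_inner_sum by (subst integral_sum2) auto
qed

text \<open>Ito's formula for <H X, X> in expectation. By \<open>ito_product\<close> each E (X_j
  X_i) is absolutely continuous in time, and integration by parts couples it with the entry of H.
  The integrand is returned as \<open>r\<close>, with its formula almost everywhere, because the
  separate moments exist only at almost every time.\<close>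

lemma quadratic_moment:
  fixes X b Y \<sigma> :: "real \<Rightarrow> 'w \<Rightarrow> real^'n" and H h :: "real \<Rightarrow> real^'n^'n"
  assumes T: "0 < T" and ito: "is_ito_integral M F W T \<sigma> Y" and b: "b \<in> L2F M F T"
    and X: "X \<in> L2F M F T" and XT: "\<And>t. t \<in> {0..T} \<Longrightarrow> sq_int M (X t)"
    and eq: "\<And>t. t \<in> {0..T} \<Longrightarrow> AE \<omega> in M. X t \<omega> = x + (LINT s:{0..t}|lborel. b s \<omega>) + Y t \<omega>"
    and h: "continuous_on {0..T} h" and H: "\<And>t. t \<in> {0..T} \<Longrightarrow> H t = H 0 + (LINT s:{0..t}|lborel. h s)"
  obtains r where "integrable (time_measure T) r"
    "(\<integral>\<omega>. (H T *v X T \<omega>) \<bullet> X T \<omega> \<partial>M) = (H 0 *v x) \<bullet> x + (\<integral>s. r s \<partial>time_measure T)"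
    "AE s in time_measure T. r s = (\<integral>\<omega>. (h s *v X s \<omega>) \<bullet> X s \<omega> \<partial>M) + (\<integral>\<omega>. (H s *v b s \<omega>) \<bullet> X s \<omega> \<partial>M)
       + (\<integral>\<omega>. (H s *v X s \<omega>) \<bullet> b s \<omega> \<partial>M) + (\<integral>\<omega>. (H s *v \<sigma> s \<omega>) \<bullet> \<sigma> s \<omega> \<partial>M)"
proof -
  let ?\<tau> = "time_measure T"
  have T0: "0 \<le> T" using T by simp
  have TT: "T \<in> {0..T}" using T by simp
  have \<sigma>: "\<sigma> \<in> L2F M F T" using ito by (simp add: is_ito_integral_def)
  \<comment> \<open>The density of \<open>p i j\<close> in time.\<close>
  define g where "g i j s = (\<integral>\<omega>. b s \<omega> $ j * X s \<omega> $ i + X s \<omega> $ j * b s \<omega> $ i + \<sigma> s \<omega> $ j * \<sigma> s \<omega> $ i \<partial>M)" for i j s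
  define p where "p i j t = (\<integral>\<omega>. X t \<omega> $ j * X t \<omega> $ i \<partial>M)" for i j t
  note comp = L2F_linear[OF T0 bounded_linear_vec_nth]
  have eqi: "AE \<omega> in M. X t \<omega> $ i = x $ i + (LINT s:{0..t}|lborel. b s \<omega> $ i) + Y t \<omega> $ i" if t: "t \<in> {0..T}" for t i
  proof -
    have t': "0 \<le> t" "t \<le> T" using t by auto
    show ?thesis
      using eq[OF t] L2F_section_sq_int[OF b t']
    proof eventually_elim
      case (elim \<omega>)
      have "integrable (time_measure t) (\<lambda>s. b s \<omega>)"
        using finite_measure.sq_int_integrable[OF finite_time_measure elim(2)] .
      from integral_bounded_linear[OF bounded_linear_vec_nth[of i] this]
      have "(LINT s:{0..t}|lborel. b s \<omega>) $ i = (LINT s:{0..t}|lborel. b s \<omega> $ i)"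
        by (simp add: set_integral_time_measure)
      then show ?case using elim(1) by simp
    qed
  qed
  have prod: "integrable (time_measure t \<Otimes>\<^sub>M M) (\<lambda>p. (\<lambda>s \<omega>. b s \<omega> $ j * X s \<omega> $ i + X s \<omega> $ j * b s \<omega> $ i + \<sigma> s \<omega> $ j * \<sigma> s \<omega> $ i) (fst p) (snd p))"
    "p i j t = x $ j * x $ i + (\<integral>p. (\<lambda>s \<omega>. b s \<omega> $ j * X s \<omega> $ i + X s \<omega> $ j * b s \<omega> $ i + \<sigma> s \<omega> $ j * \<sigma> s \<omega> $ i) (fst p) (snd p) \<partial>(time_measure t \<Otimes>\<^sub>M M))"
    if t: "t \<in> {0..T}" for i j t
    unfolding p_def
    by (rule ito_product[OF T ito_linear[OF bounded_linear_vec_nth ito] ito_linear[OF bounded_linear_vec_nth ito]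
        comp[OF b] comp[OF b] comp[OF X] comp[OF X] eqi eqi t]; assumption)+
  have g: "integrable (time_measure t) (g i j)" "p i j t = x $ j * x $ i + (LINT s:{0..t}|lborel. g i j s)"
    if t: "t \<in> {0..T}" for i j t
  proof -
    interpret tm: finite_measure "time_measure t" by (rule finite_time_measure)
    interpret P: pair_sigma_finite "time_measure t" M ..
    show "integrable (time_measure t) (g i j)"
      unfolding g_def by (rule P.integrable_fst) (use prod(1)[OF t, of j i] in \<open>simp add: split_beta'\<close>)
    show "p i j t = x $ j * x $ i + (LINT s:{0..t}|lborel. g i j s)"
      unfolding prod(2)[OF t] set_integral_time_measure g_def
      by (subst P.integral_fst) (use prod(1)[OF t, of j i] in \<open>simp_all add: split_beta'\<close>)
  qed
  have hc: "continuous_on {0..T} (\<lambda>s. h s $ i $ j)" for i j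
    using h by (intro continuous_intros)
  have hint: "integrable ?\<tau> (\<lambda>s. h s $ i $ j)" for i j
    by (rule finite_measure.sq_int_integrable[OF finite_time_measure continuous_sq_int_time[OF hc order_refl]])
  have Hij: "H t $ i $ j = H 0 $ i $ j + (LINT s:{0..t}|lborel. h s $ i $ j)" if t: "t \<in> {0..T}" for i j t
  proof -
    have "integrable (time_measure t) h"
      using t by (intro finite_measure.sq_int_integrable[OF finite_time_measure continuous_sq_int_time[OF h]]) auto
    from integral_bounded_linear[OF bounded_linear_compose[OF bounded_linear_vec_nth[of j] bounded_linear_vec_nth[of i]] this]
    have "(LINT s:{0..t}|lborel. h s) $ i $ j = (LINT s:{0..t}|lborel. h s $ i $ j)"
      by (simp add: set_integral_time_measure)
    then show ?thesis using H[OF t] by simp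
  qed
  define r where "r i j s = g i j s * H s $ i $ j + p i j s * h s $ i $ j" for i j s
  have r: "integrable ?\<tau> (r i j)" "p i j T * H T $ i $ j = (x $ j * x $ i) * H 0 $ i $ j + (\<integral>s. r i j s \<partial>?\<tau>)" for i j
  proof -
    note ibp = integral_by_parts[where c = "x $ j * x $ i" and d = "H 0 $ i $ j", OF g(1)[OF TT, of i j] hint[of i j] T0]
    \<comment> \<open>The integrand in the form produced by \<open>integral_by_parts\<close>; on the
      time interval it coincides with \<open>r i j\<close>.\<close>
    define q where "q s = g i j s * (H 0 $ i $ j + (LINT s:{0..s}|lborel. h s $ i $ j)) +
        (x $ j * x $ i + (LINT s:{0..s}|lborel. g i j s)) * h s $ i $ j" for s
    have cong: "q s = r i j s" if "s \<in> space ?\<tau>" for s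
      using that Hij[of s i j] g(2)[of s i j] by (simp add: q_def r_def space_restrict_space)
    have "integrable ?\<tau> q" using ibp(1) unfolding q_def .
    then show "integrable ?\<tau> (r i j)"
      by (rule Bochner_Integration.integrable_cong[OF refl cong, THEN iffD1, rotated])
    have "p i j T * H T $ i $ j = (x $ j * x $ i) * H 0 $ i $ j + (\<integral>s. q s \<partial>?\<tau>)"
      using ibp(2) Hij[OF TT, of i j] g(2)[OF TT, of i j] by (simp add: q_def)
    also have "(\<integral>s. q s \<partial>?\<tau>) = (\<integral>s. r i j s \<partial>?\<tau>)"
      by (rule Bochner_Integration.integral_cong[OF refl cong])
    finally show "p i j T * H T $ i $ j = (x $ j * x $ i) * H 0 $ i $ j + (\<integral>s. r i j s \<partial>?\<tau>)" .
  qed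
  show thesis
  proof (rule that[of "\<lambda>s. \<Sum>i\<in>UNIV. \<Sum>j\<in>UNIV. r i j s"])
    show "integrable ?\<tau> (\<lambda>s. \<Sum>i\<in>UNIV. \<Sum>j\<in>UNIV. r i j s)"
      by (intro Bochner_Integration.integrable_sum r(1))
    have "(\<integral>\<omega>. (H T *v X T \<omega>) \<bullet> X T \<omega> \<partial>M) = (\<Sum>i\<in>UNIV. \<Sum>j\<in>UNIV. p i j T * H T $ i $ j)"
      unfolding integral_matrix_inner[OF XT[OF TT] XT[OF TT]] p_def by (simp add: mult.commute)
    also have "\<dots> = (\<Sum>i\<in>UNIV. \<Sum>j\<in>UNIV. (x $ j * x $ i) * H 0 $ i $ j) + (\<Sum>i\<in>UNIV. \<Sum>j\<in>UNIV. \<integral>s. r i j s \<partial>?\<tau>)"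
      by (simp add: r(2) sum.distrib)
    also have "(\<Sum>i\<in>UNIV. \<Sum>j\<in>UNIV. (x $ j * x $ i) * H 0 $ i $ j) = (H 0 *v x) \<bullet> x"
      unfolding matrix_inner_sum by (simp add: mult.commute)
    also have "(\<Sum>i\<in>UNIV. \<Sum>j\<in>UNIV. \<integral>s. r i j s \<partial>?\<tau>) = (\<integral>s. (\<Sum>i\<in>UNIV. \<Sum>j\<in>UNIV. r i j s) \<partial>?\<tau>)"
      by (rule integral_sum2[symmetric]) (rule r(1))
    finally show "(\<integral>\<omega>. (H T *v X T \<omega>) \<bullet> X T \<omega> \<partial>M)
        = (H 0 *v x) \<bullet> x + (\<integral>s. (\<Sum>i\<in>UNIV. \<Sum>j\<in>UNIV. r i j s) \<partial>?\<tau>)" .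
    show "AE s in ?\<tau>. (\<Sum>i\<in>UNIV. \<Sum>j\<in>UNIV. r i j s) =
        (\<integral>\<omega>. (h s *v X s \<omega>) \<bullet> X s \<omega> \<partial>M) + (\<integral>\<omega>. (H s *v b s \<omega>) \<bullet> X s \<omega> \<partial>M)
       + (\<integral>\<omega>. (H s *v X s \<omega>) \<bullet> b s \<omega> \<partial>M) + (\<integral>\<omega>. (H s *v \<sigma> s \<omega>) \<bullet> \<sigma> s \<omega> \<partial>M)"
      using L2F_AE_sq_int[OF b T0 order_refl] L2F_AE_sq_int[OF X T0 order_refl] L2F_AE_sq_int[OF \<sigma> T0 order_refl]
    proof eventually_elim
      case (elim s)
      have i: "integrable M (\<lambda>\<omega>. f \<omega> $ j * k \<omega> $ i)" if "sq_int M f" "sq_int M k" for f k :: "'w \<Rightarrow> real^'n" and i j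
        using that by (intro sq_int_mult sq_int_bounded_linear[OF bounded_linear_vec_nth])
      have "r i j s = h s $ i $ j * (\<integral>\<omega>. X s \<omega> $ j * X s \<omega> $ i \<partial>M) + H s $ i $ j * (\<integral>\<omega>. b s \<omega> $ j * X s \<omega> $ i \<partial>M)
          + H s $ i $ j * (\<integral>\<omega>. X s \<omega> $ j * b s \<omega> $ i \<partial>M) + H s $ i $ j * (\<integral>\<omega>. \<sigma> s \<omega> $ j * \<sigma> s \<omega> $ i \<partial>M)" for i j
        unfolding r_def g_def p_def using i[OF elim(1,2)] i[OF elim(2,1)] i[OF elim(3,3)]
        by (simp add: algebra_simps)
      then show ?case
        unfolding integral_matrix_inner[OF elim(2,2)] integral_matrix_inner[OF elim(1,2)]
          integral_matrix_inner[OF elim(2,1)] integral_matrix_inner[OF elim(3,3)]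
        by (simp add: sum.distrib)
    qed
  qed
qed

end

section \<open>The lower bound\<close>

lemma transpose_inner:
  fixes A :: "real^'n^'m"
  shows "(transpose A *v x) \<bullet> y = x \<bullet> (A *v y)"
  by (simp add: dot_lmul_matrix)

lemma symmetric_matrix_inner: "symmetric_matrix H \<Longrightarrow> (H *v x) \<bullet> y = (H *v y) \<bullet> x"
  using transpose_inner[of H x y] by (simp add: symmetric_matrix_def inner_commute)

text \<open>Expanding the matrices gives the running cost plus the drift that Ito's formula produces
  for <L y, y>, with the diffusion weighted by H. It is applied with L = H to the centred pair, and
  with L = K and hatted coefficients to the means.\<close>

lemma compensated_quadratic_form:
  fixes A C H L Q l :: "real^'n^'n" and B D S :: "real^'m^'n" and R :: "real^'m^'m"
  assumes "symmetric_matrix H" "symmetric_matrix L"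
  shows "((l + L ** A + transpose A ** L + transpose C ** H ** C + Q) *v y) \<bullet> y
      + 2 * (((L ** B + transpose C ** H ** D + S) *v w) \<bullet> y) + ((transpose D ** H ** D + R) *v w) \<bullet> w
    = (Q *v y) \<bullet> y + 2 * ((S *v w) \<bullet> y) + (R *v w) \<bullet> w + (l *v y) \<bullet> y
      + (L *v (A *v y + B *v w)) \<bullet> y + (L *v y) \<bullet> (A *v y + B *v w)
      + (H *v (C *v y + D *v w)) \<bullet> (C *v y + D *v w)"
proof -
  have "(L *v y) \<bullet> (B *v w) = (L *v (B *v w)) \<bullet> y" "(H *v (C *v y)) \<bullet> (D *v w) = (H *v (D *v w)) \<bullet> (C *v y)"
    using assms symmetric_matrix_inner by blast+
  then show ?thesis
    by (simp add: matrix_vector_mult_add_rdistrib matrix_vector_right_distrib matrix_vector_mul_assoc[symmetric]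
        inner_add_left inner_add_right dot_lmul_matrix)
qed

definition join :: "real^'a \<Rightarrow> real^'b \<Rightarrow> real^('a + 'b)" where
  "join y w = (\<chi> k. case k of Inl i \<Rightarrow> y $ i | Inr j \<Rightarrow> w $ j)"

lemma sum_UNIV_Plus:
  "(\<Sum>k\<in>(UNIV :: ('a::finite + 'b::finite) set). f k) = (\<Sum>i\<in>UNIV. f (Inl i)) + (\<Sum>j\<in>UNIV. f (Inr j))"
  by (simp add: UNIV_Plus_UNIV[symmetric] sum.Plus del: UNIV_Plus_UNIV)

lemma join_inner: "join a b \<bullet> join c d = a \<bullet> c + b \<bullet> d"
  by (simp add: inner_vec_def join_def sum_UNIV_Plus)

lemma block_mult_join: "block X Y Z V *v join y w = join (X *v y + Y *v w) (Z *v y + V *v w)"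
  by (auto simp: vec_eq_iff matrix_vector_mult_def block_def join_def sum_UNIV_Plus split: sum.split)

lemma block_diag_mult_join: "block_diag X V *v join y w = join (X *v y) (V *v w)"
  by (simp add: block_diag_def block_mult_join)

text \<open>Block-diagonal entries decouple the unhatted and the hatted form; setting one pair of
  vectors to 0 isolates the other.\<close>

lemma psd_block_diag_form:
  fixes Q :: "real^'n^'n" and R :: "real^'m^'m"
  assumes "psd (block (block_diag Q Q') (block_diag S S') (transpose (block_diag S S')) (block_diag R R'))"
  shows "0 \<le> (Q *v y) \<bullet> y + 2 * ((S *v w) \<bullet> y) + (R *v w) \<bullet> w"
    "0 \<le> (Q' *v y') \<bullet> y' + 2 * ((S' *v w') \<bullet> y') + (R' *v w') \<bullet> w'"
proof -
  have *: "0 \<le> (Q *v y) \<bullet> y + (Q' *v y') \<bullet> y' + 2 * ((S *v w) \<bullet> y + (S' *v w') \<bullet> y')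
      + ((R *v w) \<bullet> w + (R' *v w') \<bullet> w')" for y y' w w'
  proof -
    let ?v = "join (join y y') (join w w')"
    have "0 \<le> (block (block_diag Q Q') (block_diag S S') (transpose (block_diag S S')) (block_diag R R') *v ?v) \<bullet> ?v"
      using assms by (simp add: psd_def)
    then have "0 \<le> (Q *v y) \<bullet> y + (Q' *v y') \<bullet> y' + ((S *v w) \<bullet> y + (S' *v w') \<bullet> y')
        + (y \<bullet> (S *v w) + y' \<bullet> (S' *v w')) + ((R *v w) \<bullet> w + (R' *v w') \<bullet> w')"
      by (simp add: block_mult_join block_diag_mult_join join_inner dot_lmul_matrix inner_add_left)
    then show ?thesis by (simp add: inner_commute)
  qed
  show "0 \<le> (Q *v y) \<bullet> y + 2 * ((S *v w) \<bullet> y) + (R *v w) \<bullet> w" using *[of y 0 w 0] by simp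
  show "0 \<le> (Q' *v y') \<bullet> y' + 2 * ((S' *v w') \<bullet> y') + (R' *v w') \<bullet> w'" using *[of 0 y' 0 w'] by simp
qed

lemma psd_block_diag:
  assumes "psd (block_diag X V)"
  shows "0 \<le> (X *v y) \<bullet> y" "0 \<le> (V *v w) \<bullet> w"
proof -
  have *: "0 \<le> (X *v y) \<bullet> y + (V *v w) \<bullet> w" for y w
  proof -
    have "0 \<le> (block_diag X V *v join y w) \<bullet> join y w" using assms by (simp add: psd_def)
    then show ?thesis by (simp add: block_diag_mult_join join_inner)
  qed
  show "0 \<le> (X *v y) \<bullet> y" "0 \<le> (V *v w) \<bullet> w" using *[of y 0] *[of 0 w] by simp_all
qed

section \<open>Separation into centred and mean parts\<close>

context prob_space
begin

lemma sq_int_matrix: "sq_int M f \<Longrightarrow> sq_int M (\<lambda>\<omega>. (N::real^'n^'m) *v f \<omega>)"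
  by (rule sq_int_bounded_linear[OF matrix_vector_mul_bounded_linear])

lemma integral_matrix: "sq_int M f \<Longrightarrow> (\<integral>\<omega>. (N::real^'n^'m) *v f \<omega> \<partial>M) = N *v integral\<^sup>L M f"
  by (rule integral_bounded_linear[OF matrix_vector_mul_bounded_linear sq_int_integrable])

text \<open>Cross terms between a centred variable and a constant integrate to 0.\<close>

lemma integral_centered:
  fixes N :: "real^'n^'m"
  assumes f: "sq_int M f" and g: "sq_int M g"
  shows "(\<integral>\<omega>. (N *v f \<omega>) \<bullet> g \<omega> \<partial>M)
    = (\<integral>\<omega>. (N *v (f \<omega> - integral\<^sup>L M f)) \<bullet> (g \<omega> - integral\<^sup>L M g) \<partial>M) + (N *v integral\<^sup>L M f) \<bullet> integral\<^sup>L M g"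
proof -
  let ?a = "integral\<^sup>L M f" and ?c = "integral\<^sup>L M g"
  have i: "integrable M (\<lambda>\<omega>. (N *v f \<omega>) \<bullet> g \<omega>)" "integrable M (\<lambda>\<omega>. (N *v f \<omega>) \<bullet> ?c)" "integrable M (\<lambda>\<omega>. (N *v ?a) \<bullet> g \<omega>)"
    by (intro sq_int_inner sq_int_matrix f g sq_int_const)+
  have "(\<integral>\<omega>. (N *v (f \<omega> - ?a)) \<bullet> (g \<omega> - ?c) \<partial>M)
      = (\<integral>\<omega>. (N *v f \<omega>) \<bullet> g \<omega> - (N *v f \<omega>) \<bullet> ?c - (N *v ?a) \<bullet> g \<omega> + (N *v ?a) \<bullet> ?c \<partial>M)"
    by (intro Bochner_Integration.integral_cong refl)
      (simp add: matrix_vector_mult_diff_distrib inner_diff_left inner_diff_right)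
  also have "\<dots> = (\<integral>\<omega>. (N *v f \<omega>) \<bullet> g \<omega> \<partial>M) - (\<integral>\<omega>. (N *v f \<omega>) \<bullet> ?c \<partial>M) - (\<integral>\<omega>. (N *v ?a) \<bullet> g \<omega> \<partial>M) + (N *v ?a) \<bullet> ?c"
    using i by (simp add: prob_space)
  also have "(\<integral>\<omega>. (N *v f \<omega>) \<bullet> ?c \<partial>M) = (N *v ?a) \<bullet> ?c"
    using integral_bounded_linear[OF bounded_linear_inner_left sq_int_integrable[OF sq_int_matrix[OF f, of N]], of ?c]
      integral_matrix[OF f, of N] by simp
  also have "(\<integral>\<omega>. (N *v ?a) \<bullet> g \<omega> \<partial>M) = (N *v ?a) \<bullet> ?c"
    using sq_int_integrable[OF g] by (simp add: integral_inner_right)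
  finally show ?thesis by simp
qed

text \<open>At a fixed time every second moment is split into a centred and a mean part. The centred
  terms add up to the expectation of the unhatted form. In the mean terms h and H cancel against the
  k - h and K - H of the correction, which leaves k and K, while the mean of the diffusion stays
  with H: this is the hatted form at the means.\<close>

lemma compensated_integrand_nonneg:
  fixes X :: "'a \<Rightarrow> real^'n" and u :: "'a \<Rightarrow> real^'m"
    and A A' C C' Q Q' H K h k :: "real^'n^'n" and B B' D D' S S' :: "real^'m^'n" and R R' :: "real^'m^'m"
  assumes X: "sq_int M X" and u: "sq_int M u" and H: "symmetric_matrix H" and K: "symmetric_matrix K"
    and pos: "\<And>y w. 0 \<le> ((h + H ** A + transpose A ** H + transpose C ** H ** C + Q) *v y) \<bullet> y
      + 2 * (((H ** B + transpose C ** H ** D + S) *v w) \<bullet> y) + ((transpose D ** H ** D + R) *v w) \<bullet> w"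
    and pos': "\<And>y w. 0 \<le> ((k + K ** (A + A') + transpose (A + A') ** K + transpose (C + C') ** H ** (C + C') + (Q + Q')) *v y) \<bullet> y
      + 2 * (((K ** (B + B') + transpose (C + C') ** H ** (D + D') + (S + S')) *v w) \<bullet> y)
      + ((transpose (D + D') ** H ** (D + D') + (R + R')) *v w) \<bullet> w"
  defines "m \<equiv> integral\<^sup>L M X" and "v \<equiv> integral\<^sup>L M u"
  defines "b \<equiv> \<lambda>\<omega>. A *v X \<omega> + A' *v m + B *v u \<omega> + B' *v v"
    and "\<sigma> \<equiv> \<lambda>\<omega>. C *v X \<omega> + C' *v m + D *v u \<omega> + D' *v v"
  shows "0 \<le> (\<integral>\<omega>. (Q *v X \<omega>) \<bullet> X \<omega> + (Q' *v m) \<bullet> m + 2 * ((S *v u \<omega>) \<bullet> X \<omega>) + 2 * ((S' *v v) \<bullet> m)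
        + (R *v u \<omega>) \<bullet> u \<omega> + (R' *v v) \<bullet> v \<partial>M)
     + ((\<integral>\<omega>. (h *v X \<omega>) \<bullet> X \<omega> \<partial>M) + (\<integral>\<omega>. (H *v b \<omega>) \<bullet> X \<omega> \<partial>M) + (\<integral>\<omega>. (H *v X \<omega>) \<bullet> b \<omega> \<partial>M)
        + (\<integral>\<omega>. (H *v \<sigma> \<omega>) \<bullet> \<sigma> \<omega> \<partial>M))
     + (((k - h) *v m) \<bullet> m + ((K - H) *v integral\<^sup>L M b) \<bullet> m + ((K - H) *v m) \<bullet> integral\<^sup>L M b)"
proof -
  define X0 where "X0 \<omega> = X \<omega> - m" for \<omega>
  define u0 where "u0 \<omega> = u \<omega> - v" for \<omega>
  \<comment> \<open>The means of drift and diffusion. Averaging merges each coefficient with its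
    mean-field partner, which is where the hatted coefficients arise.\<close>
  define bm where "bm = (A + A') *v m + (B + B') *v v"
  define \<sigma>m where "\<sigma>m = (C + C') *v m + (D + D') *v v"
  have sb: "sq_int M b" and s\<sigma>: "sq_int M \<sigma>"
    unfolding b_def \<sigma>_def by (intro sq_int_add sq_int_matrix X u sq_int_const)+
  have int: "(\<integral>\<omega>. N1 *v X \<omega> + c + N2 *v u \<omega> + c' \<partial>M) = N1 *v m + c + N2 *v v + c'"
    for N1 :: "real^'n^'n" and N2 :: "real^'m^'n" and c c'
    using sq_int_integrable[OF sq_int_matrix[OF X, of N1]] sq_int_integrable[OF sq_int_matrix[OF u, of N2]]
      integral_matrix[OF X, of N1] integral_matrix[OF u, of N2] by (simp add: prob_space m_def v_def)
  have Eb: "integral\<^sup>L M b = bm" and E\<sigma>: "integral\<^sup>L M \<sigma> = \<sigma>m"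
    unfolding b_def \<sigma>_def int bm_def \<sigma>m_def by (simp_all add: matrix_vector_mult_add_rdistrib)
  have b0: "b \<omega> - bm = A *v X0 \<omega> + B *v u0 \<omega>" and \<sigma>0: "\<sigma> \<omega> - \<sigma>m = C *v X0 \<omega> + D *v u0 \<omega>" for \<omega>
    by (simp_all add: b_def bm_def \<sigma>_def \<sigma>m_def X0_def u0_def matrix_vector_mult_add_rdistrib
        matrix_vector_mult_diff_distrib)
  have sX0: "sq_int M X0" and su0: "sq_int M u0"
    unfolding X0_def[abs_def] u0_def[abs_def] by (intro sq_int_diff X u sq_int_const)+
  have sb0: "sq_int M (\<lambda>\<omega>. A *v X0 \<omega> + B *v u0 \<omega>)" and s\<sigma>0: "sq_int M (\<lambda>\<omega>. C *v X0 \<omega> + D *v u0 \<omega>)"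
    by (intro sq_int_add sq_int_matrix sX0 su0)+
  have i: "integrable M (\<lambda>\<omega>. (N *v f \<omega>) \<bullet> g \<omega>)" if "sq_int M f" "sq_int M g"
    for N :: "real^'p^'q" and f :: "'a \<Rightarrow> real^'p" and g :: "'a \<Rightarrow> real^'q"
    by (intro sq_int_inner sq_int_matrix that)
  have "(\<integral>\<omega>. (Q *v X \<omega>) \<bullet> X \<omega> + (Q' *v m) \<bullet> m + 2 * ((S *v u \<omega>) \<bullet> X \<omega>) + 2 * ((S' *v v) \<bullet> m)
        + (R *v u \<omega>) \<bullet> u \<omega> + (R' *v v) \<bullet> v \<partial>M)
      = (\<integral>\<omega>. (Q *v X \<omega>) \<bullet> X \<omega> \<partial>M) + 2 * (\<integral>\<omega>. (S *v u \<omega>) \<bullet> X \<omega> \<partial>M) + (\<integral>\<omega>. (R *v u \<omega>) \<bullet> u \<omega> \<partial>M)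
        + (Q' *v m) \<bullet> m + 2 * ((S' *v v) \<bullet> m) + (R' *v v) \<bullet> v"
    using sq_int_inner[OF sq_int_matrix[OF X, of Q] X] sq_int_inner[OF sq_int_matrix[OF u, of S] X]
      sq_int_inner[OF sq_int_matrix[OF u, of R] u] by (simp add: prob_space)
  moreover have "(\<integral>\<omega>. (Q *v X \<omega>) \<bullet> X \<omega> \<partial>M) = (\<integral>\<omega>. (Q *v X0 \<omega>) \<bullet> X0 \<omega> \<partial>M) + (Q *v m) \<bullet> m"
    using integral_centered[OF X X, of Q] by (simp add: X0_def m_def)
  moreover have "(\<integral>\<omega>. (S *v u \<omega>) \<bullet> X \<omega> \<partial>M) = (\<integral>\<omega>. (S *v u0 \<omega>) \<bullet> X0 \<omega> \<partial>M) + (S *v v) \<bullet> m"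
    using integral_centered[OF u X, of S] by (simp add: X0_def m_def u0_def v_def)
  moreover have "(\<integral>\<omega>. (R *v u \<omega>) \<bullet> u \<omega> \<partial>M) = (\<integral>\<omega>. (R *v u0 \<omega>) \<bullet> u0 \<omega> \<partial>M) + (R *v v) \<bullet> v"
    using integral_centered[OF u u, of R] by (simp add: u0_def v_def)
  moreover have "(\<integral>\<omega>. (h *v X \<omega>) \<bullet> X \<omega> \<partial>M) = (\<integral>\<omega>. (h *v X0 \<omega>) \<bullet> X0 \<omega> \<partial>M) + (h *v m) \<bullet> m"
    using integral_centered[OF X X, of h] by (simp add: X0_def m_def)
  moreover have "(\<integral>\<omega>. (H *v b \<omega>) \<bullet> X \<omega> \<partial>M)
      = (\<integral>\<omega>. (H *v (A *v X0 \<omega> + B *v u0 \<omega>)) \<bullet> X0 \<omega> \<partial>M) + (H *v bm) \<bullet> m"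
    using integral_centered[OF sb X, of H] unfolding Eb b0 by (simp add: X0_def m_def)
  moreover have "(\<integral>\<omega>. (H *v X \<omega>) \<bullet> b \<omega> \<partial>M)
      = (\<integral>\<omega>. (H *v X0 \<omega>) \<bullet> (A *v X0 \<omega> + B *v u0 \<omega>) \<partial>M) + (H *v m) \<bullet> bm"
    using integral_centered[OF X sb, of H] unfolding Eb b0 by (simp add: X0_def m_def)
  moreover have "(\<integral>\<omega>. (H *v \<sigma> \<omega>) \<bullet> \<sigma> \<omega> \<partial>M)
      = (\<integral>\<omega>. (H *v (C *v X0 \<omega> + D *v u0 \<omega>)) \<bullet> (C *v X0 \<omega> + D *v u0 \<omega>) \<partial>M) + (H *v \<sigma>m) \<bullet> \<sigma>m"
    using integral_centered[OF s\<sigma> s\<sigma>, of H] unfolding E\<sigma> \<sigma>0 .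
  moreover have "0 \<le> (\<integral>\<omega>. (Q *v X0 \<omega>) \<bullet> X0 \<omega> \<partial>M) + 2 * (\<integral>\<omega>. (S *v u0 \<omega>) \<bullet> X0 \<omega> \<partial>M) + (\<integral>\<omega>. (R *v u0 \<omega>) \<bullet> u0 \<omega> \<partial>M)
      + (\<integral>\<omega>. (h *v X0 \<omega>) \<bullet> X0 \<omega> \<partial>M) + (\<integral>\<omega>. (H *v (A *v X0 \<omega> + B *v u0 \<omega>)) \<bullet> X0 \<omega> \<partial>M)
      + (\<integral>\<omega>. (H *v X0 \<omega>) \<bullet> (A *v X0 \<omega> + B *v u0 \<omega>) \<partial>M)
      + (\<integral>\<omega>. (H *v (C *v X0 \<omega> + D *v u0 \<omega>)) \<bullet> (C *v X0 \<omega> + D *v u0 \<omega>) \<partial>M)" (is "0 \<le> ?E")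
  proof -
    have "0 \<le> (\<integral>\<omega>. (Q *v X0 \<omega>) \<bullet> X0 \<omega> + 2 * ((S *v u0 \<omega>) \<bullet> X0 \<omega>) + (R *v u0 \<omega>) \<bullet> u0 \<omega> + (h *v X0 \<omega>) \<bullet> X0 \<omega>
      + (H *v (A *v X0 \<omega> + B *v u0 \<omega>)) \<bullet> X0 \<omega> + (H *v X0 \<omega>) \<bullet> (A *v X0 \<omega> + B *v u0 \<omega>)
      + (H *v (C *v X0 \<omega> + D *v u0 \<omega>)) \<bullet> (C *v X0 \<omega> + D *v u0 \<omega>) \<partial>M)"
      unfolding compensated_quadratic_form[OF H H, symmetric]
      by (intro integral_nonneg_AE AE_I2 pos)
    also have "\<dots> = ?E"
      using sq_int_inner[OF sq_int_matrix[OF sX0, of Q] sX0] sq_int_inner[OF sq_int_matrix[OF su0, of S] sX0]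
        sq_int_inner[OF sq_int_matrix[OF su0, of R] su0] sq_int_inner[OF sq_int_matrix[OF sX0, of h] sX0]
        sq_int_inner[OF sq_int_matrix[OF sb0, of H] sX0] sq_int_inner[OF sq_int_matrix[OF sX0, of H] sb0]
        sq_int_inner[OF sq_int_matrix[OF s\<sigma>0, of H] s\<sigma>0]
      by (simp only: Bochner_Integration.integral_add Bochner_Integration.integrable_add
          integral_mult_right_zero integrable_mult_right)
    finally show ?thesis .
  qed
  moreover have "0 \<le> (Q *v m) \<bullet> m + 2 * ((S *v v) \<bullet> m) + (R *v v) \<bullet> v + (Q' *v m) \<bullet> m + 2 * ((S' *v v) \<bullet> m) + (R' *v v) \<bullet> v
      + (k *v m) \<bullet> m + (K *v bm) \<bullet> m + (K *v m) \<bullet> bm + (H *v \<sigma>m) \<bullet> \<sigma>m"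
    using pos'[of m v] unfolding compensated_quadratic_form[OF H K] bm_def[symmetric] \<sigma>m_def[symmetric]
    by (simp add: matrix_vector_mult_add_rdistrib inner_add_left algebra_simps)
  moreover have "((k - h) *v m) \<bullet> m + ((K - H) *v integral\<^sup>L M b) \<bullet> m + ((K - H) *v m) \<bullet> integral\<^sup>L M b
     = (k *v m) \<bullet> m - (h *v m) \<bullet> m + ((K *v bm) \<bullet> m - (H *v bm) \<bullet> m) + ((K *v m) \<bullet> bm - (H *v m) \<bullet> bm)"
    unfolding Eb by (simp add: matrix_vector_mult_diff_rdistrib inner_diff_left)
  ultimately show ?thesis by linarith
qed

end

lemma Linf_continuous: "\<phi> \<in> Linf T \<Longrightarrow> continuous_on {0..T} \<phi>"
  by (simp add: Linf_def)

lemma Linf_sym_continuous: "\<phi> \<in> Linf_sym T \<Longrightarrow> continuous_on {0..T} \<phi>"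
  by (simp add: Linf_def Linf_sym_def)

lemma lq_coefficients_continuous:
  assumes "lq_coefficients T P"
  shows "continuous_on {0..T} (Aco P)" "continuous_on {0..T} (Bco P)" "continuous_on {0..T} (Cco P)"
    "continuous_on {0..T} (Dco P)" "continuous_on {0..T} (Qco P)" "continuous_on {0..T} (Sco P)"
    "continuous_on {0..T} (Rco P)"
  using assms Linf_continuous Linf_sym_continuous unfolding lq_coefficients_def by blast+

text \<open>The density is continuous, so the fundamental theorem of calculus gives a derivative at
  every time, one-sided at the end points; this is the derivative that enters
  \<open>Q_comp\<close>.\<close>

lemma LambdaE:
  fixes L :: "real \<Rightarrow> real^'n^'n"
  assumes T: "0 < T" and L: "L \<in> Lambda T"
  obtains l where "continuous_on {0..T} l" "\<And>t. t \<in> {0..T} \<Longrightarrow> L t = L 0 + (LINT s:{0..t}|lborel. l s)"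
    "\<And>t. t \<in> {0..T} \<Longrightarrow> vector_derivative L (at t within {0..T}) = l t"
    "\<And>t. t \<in> {0..T} \<Longrightarrow> symmetric_matrix (L t)"
proof -
  from L obtain l where l: "l \<in> Linf_sym T" and eq: "\<And>t. t \<in> {0..T} \<Longrightarrow> L t = L 0 + (LINT s:{0..t}|lborel. l s)"
    and sym: "\<And>t. t \<in> {0..T} \<Longrightarrow> symmetric_matrix (L t)"
    unfolding Lambda_def by blast
  have c: "continuous_on {0..T} l" using l by (rule Linf_sym_continuous)
  have HK: "(LINT s:{0..t}|lborel. l s) = integral {0..t} l" if "t \<in> {0..T}" for t
    using that by (intro set_borel_integral_eq_integral borel_integrable_atLeastAtMost' continuous_on_subset[OF c]) auto
  have "vector_derivative L (at t within {0..T}) = l t" if t: "t \<in> {0..T}" for t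
  proof -
    have "((\<lambda>u. L 0 + integral {0..u} l) has_vector_derivative 0 + l t) (at t within {0..T})"
      by (intro has_vector_derivative_add has_vector_derivative_const integral_has_vector_derivative c t)
    moreover have "L u = L 0 + integral {0..u} l" if "u \<in> {0..T}" for u
      using eq[OF that] unfolding HK[OF that] .
    ultimately have "((\<lambda>u. L u) has_vector_derivative 0 + l t) (at t within {0..T})"
      by (rule has_vector_derivative_transform[OF t, rotated])
    then show ?thesis
      using vector_derivative_within_cbox[of 0 T t L "l t"] t T by simp
  qed
  note vd = this
  show thesis by (rule that[OF c eq vd sym])
qed

section \<open>Lower bound for the cost\<close>

context brownian_filtration
begin

text \<open>\<open>quadratic_moment\<close> is used twice: for X with H, and for its deterministic
  mean with K - H. The sum rewrites the terminal values as <K(0) x, x> plus time integrals whose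
  integrands, added to the expected running cost, are nonnegative at almost every time.\<close>

lemma cost_lower_bound:
  fixes P P' :: "('n::finite, 'm::finite) lq_data" and X :: "real \<Rightarrow> 'w \<Rightarrow> real^'n" and u :: "real \<Rightarrow> 'w \<Rightarrow> real^'m"
  assumes T: "0 < T" and P: "lq_coefficients T P" and P': "lq_coefficients T P'"
    and comp: "relaxed_compensator T P P' H K"
    and XC: "X \<in> L2F_C M F T" and u: "u \<in> L2F M F T"
    and ito: "is_ito_integral M F W T (diffusion_term M P P' u X) Y"
    and eq: "\<And>t. t \<in> {0..T} \<Longrightarrow> AE \<omega> in M. X t \<omega> = x + (LINT s:{0..t}|lborel. drift_term M P P' u X s \<omega>) + Y t \<omega>"
  shows "(K 0 *v x) \<bullet> x \<le> cost M T P P' u X"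
proof -
  let ?\<tau> = "time_measure T"
  have T0: "0 \<le> T" and TT: "T \<in> {0..T}" using T by auto
  note X = L2F_C_imp_L2F[OF T XC]
  note cP = lq_coefficients_continuous[OF P] and cP' = lq_coefficients_continuous[OF P']
  define b where "b = drift_term M P P' u X"
  define \<sigma> where "\<sigma> = diffusion_term M P P' u X"
  define m where "m t = integral\<^sup>L M (X t)" for t
  define v where "v t = integral\<^sup>L M (u t)" for t
  have mL: "(\<lambda>t \<omega>. m t) \<in> L2F M F T" unfolding m_def by (rule L2F_mean[OF T0 X(1)])
  have vL: "(\<lambda>t \<omega>. v t) \<in> L2F M F T" unfolding v_def by (rule L2F_mean[OF T0 u])
  have b_eq: "b = (\<lambda>t \<omega>. Aco P t *v X t \<omega> + Aco P' t *v m t + Bco P t *v u t \<omega> + Bco P' t *v v t)"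
    by (simp add: b_def drift_term_def m_def v_def fun_eq_iff)
  have \<sigma>_eq: "\<sigma> = (\<lambda>t \<omega>. Cco P t *v X t \<omega> + Cco P' t *v m t + Dco P t *v u t \<omega> + Dco P' t *v v t)"
    by (simp add: \<sigma>_def diffusion_term_def m_def v_def fun_eq_iff)
  have bL: "b \<in> L2F M F T"
    unfolding b_eq by (intro L2F_add[OF T0] L2F_matrix[OF T0] cP cP' X(1) u mL vL)
  have HL: "H \<in> Lambda T" "K \<in> Lambda T"
    using comp unfolding relaxed_compensator_def by blast+
  obtain h where h: "continuous_on {0..T} h" "\<And>t. t \<in> {0..T} \<Longrightarrow> H t = H 0 + (LINT s:{0..t}|lborel. h s)"
    "\<And>t. t \<in> {0..T} \<Longrightarrow> vector_derivative H (at t within {0..T}) = h t" "\<And>t. t \<in> {0..T} \<Longrightarrow> symmetric_matrix (H t)"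
    by (rule LambdaE[OF T HL(1)]) blast
  obtain k where k: "continuous_on {0..T} k" "\<And>t. t \<in> {0..T} \<Longrightarrow> K t = K 0 + (LINT s:{0..t}|lborel. k s)"
    "\<And>t. t \<in> {0..T} \<Longrightarrow> vector_derivative K (at t within {0..T}) = k t" "\<And>t. t \<in> {0..T} \<Longrightarrow> symmetric_matrix (K t)"
    by (rule LambdaE[OF T HL(2)]) blast
  obtain r where r: "integrable ?\<tau> r"
    "(\<integral>\<omega>. (H T *v X T \<omega>) \<bullet> X T \<omega> \<partial>M) = (H 0 *v x) \<bullet> x + (\<integral>s. r s \<partial>?\<tau>)"
    "AE s in ?\<tau>. r s = (\<integral>\<omega>. (h s *v X s \<omega>) \<bullet> X s \<omega> \<partial>M) + (\<integral>\<omega>. (H s *v b s \<omega>) \<bullet> X s \<omega> \<partial>M)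
       + (\<integral>\<omega>. (H s *v X s \<omega>) \<bullet> b s \<omega> \<partial>M) + (\<integral>\<omega>. (H s *v \<sigma> s \<omega>) \<bullet> \<sigma> s \<omega> \<partial>M)"
    by (rule quadratic_moment[OF T ito[folded \<sigma>_def] bL X eq[folded b_def] h(1,2)])
  have m_eq: "m t = x + (LINT s:{0..t}|lborel. integral\<^sup>L M (b s))" if t: "t \<in> {0..T}" for t
    unfolding m_def by (rule ito_process_mean[OF T ito bL X(1) eq[folded b_def] t])
  have DK: "K t - H t = (K 0 - H 0) + (LINT s:{0..t}|lborel. k s - h s)" if t: "t \<in> {0..T}" for t
  proof -
    have "(LINT s:{0..t}|lborel. k s - h s) = (LINT s:{0..t}|lborel. k s) - (LINT s:{0..t}|lborel. h s)"
      using t by (intro set_integral_diff(2) borel_integrable_atLeastAtMost' continuous_on_subset[OF k(1)]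
          continuous_on_subset[OF h(1)]) auto
    then show ?thesis using h(2)[OF t] k(2)[OF t] by simp
  qed
  \<comment> \<open>The mean as an Ito process with martingale part \<open>ito_zero\<close>; the
    last summand is its vanishing diffusion term.\<close>
  obtain r' where r': "integrable ?\<tau> r'"
    "(\<integral>\<omega>. ((K T - H T) *v m T) \<bullet> m T \<partial>M) = ((K 0 - H 0) *v x) \<bullet> x + (\<integral>s. r' s \<partial>?\<tau>)"
    "AE s in ?\<tau>. r' s = (\<integral>\<omega>. ((k s - h s) *v m s) \<bullet> m s \<partial>M) + (\<integral>\<omega>. ((K s - H s) *v integral\<^sup>L M (b s)) \<bullet> m s \<partial>M)
       + (\<integral>\<omega>. ((K s - H s) *v m s) \<bullet> integral\<^sup>L M (b s) \<partial>M) + (\<integral>\<omega>. ((K s - H s) *v 0) \<bullet> (0 :: real^'n) \<partial>M)"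
  proof (rule quadratic_moment[OF T ito_zero L2F_mean[OF T0 bL] mL])
    show "sq_int M (\<lambda>\<omega>. m t)" for t by simp
    show "AE \<omega> in M. m t = x + (LINT s:{0..t}|lborel. integral\<^sup>L M (b s)) + 0" if "t \<in> {0..T}" for t
      using m_eq[OF that] by simp
    show "continuous_on {0..T} (\<lambda>s. k s - h s)" by (intro continuous_on_diff k h)
    show "K t - H t = K 0 - H 0 + (LINT s:{0..t}|lborel. k s - h s)" if "t \<in> {0..T}" for t by (rule DK[OF that])
  qed (rule that)
  define running where "running t \<omega> = (Qco P t *v X t \<omega>) \<bullet> X t \<omega> + (Qco P' t *v m t) \<bullet> m t + 2 * ((Sco P t *v u t \<omega>) \<bullet> X t \<omega>)
      + 2 * ((Sco P' t *v v t) \<bullet> m t) + (Rco P t *v u t \<omega>) \<bullet> u t \<omega> + (Rco P' t *v v t) \<bullet> v t" for t \<omega>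
  interpret tm: finite_measure ?\<tau> by (rule finite_time_measure)
  interpret PM: pair_sigma_finite ?\<tau> M ..
  have term_int: "integrable (?\<tau> \<Otimes>\<^sub>M M) (\<lambda>p. (a (fst p) *v f (fst p) (snd p)) \<bullet> g (fst p) (snd p))"
    if "continuous_on {0..T} a" "f \<in> L2F M F T" "g \<in> L2F M F T"
    for a :: "real \<Rightarrow> real^'p^'q" and f g
    using sq_int_inner[OF L2F_sq_int[OF L2F_matrix[OF T0 that(1,2)] T0 order_refl] L2F_sq_int[OF that(3) T0 order_refl]]
    by (simp add: split_beta')
  have l_int: "integrable (?\<tau> \<Otimes>\<^sub>M M) (\<lambda>(s, \<omega>). running s \<omega>)"
    unfolding running_def split_beta'
    using term_int[OF cP(5) X(1) X(1)] term_int[OF cP'(5) mL mL] term_int[OF cP(6) u X(1)] term_int[OF cP'(6) vL mL]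
      term_int[OF cP(7) u u] term_int[OF cP'(7) vL vL]
    by (intro Bochner_Integration.integrable_add integrable_mult_right)
  \<comment> \<open>Fubini exchanges expectation and time integral, so that the running cost can be
    combined with \<open>r\<close> and \<open>r'\<close> at each time.\<close>
  define R where "R s = (\<integral>\<omega>. running s \<omega> \<partial>M)" for s
  have R_int: "integrable ?\<tau> R" unfolding R_def by (rule PM.integrable_fst[OF l_int])
  note XT = X(2)[OF TT]
  have GX: "integrable M (\<lambda>\<omega>. (N *v X T \<omega>) \<bullet> X T \<omega>)" for N
    by (rule sq_int_inner[OF sq_int_matrix[OF XT] XT])
  have cost_eq: "cost M T P P' u X = (\<integral>s. R s \<partial>?\<tau>) + (\<integral>\<omega>. (Gco P *v X T \<omega>) \<bullet> X T \<omega> \<partial>M) + (Gco P' *v m T) \<bullet> m T"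
  proof -
    have "cost M T P P' u X = (\<integral>\<omega>. (\<integral>s. running s \<omega> \<partial>?\<tau>) + (Gco P *v X T \<omega>) \<bullet> X T \<omega> + (Gco P' *v m T) \<bullet> m T \<partial>M)"
      unfolding cost_def running_def m_def v_def set_integral_time_measure ..
    also have "\<dots> = (\<integral>\<omega>. (\<integral>s. running s \<omega> \<partial>?\<tau>) \<partial>M) + (\<integral>\<omega>. (Gco P *v X T \<omega>) \<bullet> X T \<omega> \<partial>M) + (Gco P' *v m T) \<bullet> m T"
      using PM.integrable_snd[OF l_int] GX[of "Gco P"] by (simp add: prob_space)
    also have "(\<integral>\<omega>. (\<integral>s. running s \<omega> \<partial>?\<tau>) \<partial>M) = (\<integral>s. R s \<partial>?\<tau>)"
      unfolding R_def by (rule PM.Fubini_integral[OF l_int])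
    finally show ?thesis .
  qed
  have psdB: "AE s in lborel. s \<in> {0..T} \<longrightarrow> psd (block
      (block_diag (Q_comp T P H H s) (Q_comp T (hat_data P P') K H s))
      (block_diag (S_comp P H H s) (S_comp (hat_data P P') K H s))
      (transpose (block_diag (S_comp P H H s) (S_comp (hat_data P P') K H s)))
      (block_diag (R_comp P H s) (R_comp (hat_data P P') H s)))"
    and psdG: "psd (block_diag (G_comp T P H) (G_comp T (hat_data P P') K))"
    using comp unfolding relaxed_compensator_def Let_def nonneg_on_def by blast+
  have "AE s in ?\<tau>. 0 \<le> R s + r s + r' s"
  proof -
    have "AE s in ?\<tau>. psd (block
      (block_diag (Q_comp T P H H s) (Q_comp T (hat_data P P') K H s))
      (block_diag (S_comp P H H s) (S_comp (hat_data P P') K H s))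
      (transpose (block_diag (S_comp P H H s) (S_comp (hat_data P P') K H s)))
      (block_diag (R_comp P H s) (R_comp (hat_data P P') H s)))"
      using psdB by (subst AE_restrict_space_iff) auto
    then show ?thesis
      using L2F_AE_sq_int[OF X(1) T0 order_refl] L2F_AE_sq_int[OF u T0 order_refl] r(3) r'(3) AE_space[of ?\<tau>]
    proof eventually_elim
      case (elim s)
      have s: "s \<in> {0..T}" using elim(6) by (simp add: space_restrict_space)
      note pf = psd_block_diag_form[OF elim(1)]
      have "0 \<le> R s + ((\<integral>\<omega>. (h s *v X s \<omega>) \<bullet> X s \<omega> \<partial>M) + (\<integral>\<omega>. (H s *v b s \<omega>) \<bullet> X s \<omega> \<partial>M)
          + (\<integral>\<omega>. (H s *v X s \<omega>) \<bullet> b s \<omega> \<partial>M) + (\<integral>\<omega>. (H s *v \<sigma> s \<omega>) \<bullet> \<sigma> s \<omega> \<partial>M))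
         + (((k s - h s) *v m s) \<bullet> m s + ((K s - H s) *v integral\<^sup>L M (b s)) \<bullet> m s
          + ((K s - H s) *v m s) \<bullet> integral\<^sup>L M (b s))"
        unfolding R_def running_def b_eq \<sigma>_eq m_def v_def
      proof (rule compensated_integrand_nonneg[OF elim(2,3) h(4)[OF s] k(4)[OF s]])
        show "0 \<le> ((h s + H s ** Aco P s + transpose (Aco P s) ** H s + transpose (Cco P s) ** H s ** Cco P s + Qco P s) *v y) \<bullet> y
          + 2 * (((H s ** Bco P s + transpose (Cco P s) ** H s ** Dco P s + Sco P s) *v w) \<bullet> y)
          + ((transpose (Dco P s) ** H s ** Dco P s + Rco P s) *v w) \<bullet> w" for y w
          using pf(1)[of y w] unfolding Q_comp_def S_comp_def R_comp_def h(3)[OF s] .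
        show "0 \<le> ((k s + K s ** (Aco P s + Aco P' s) + transpose (Aco P s + Aco P' s) ** K s
            + transpose (Cco P s + Cco P' s) ** H s ** (Cco P s + Cco P' s) + (Qco P s + Qco P' s)) *v y) \<bullet> y
          + 2 * (((K s ** (Bco P s + Bco P' s) + transpose (Cco P s + Cco P' s) ** H s ** (Dco P s + Dco P' s)
            + (Sco P s + Sco P' s)) *v w) \<bullet> y)
          + ((transpose (Dco P s + Dco P' s) ** H s ** (Dco P s + Dco P' s) + (Rco P s + Rco P' s)) *v w) \<bullet> w" for y w
          using pf(2)[of y w] unfolding Q_comp_def S_comp_def R_comp_def k(3)[OF s] hat_data_def by simp
      qed
      then show ?case unfolding elim(4,5) by (simp add: prob_space)
    qed
  qed
  then have "0 \<le> (\<integral>s. R s + r s + r' s \<partial>?\<tau>)" by (rule integral_nonneg_AE)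
  then have run: "0 \<le> (\<integral>s. R s \<partial>?\<tau>) + (\<integral>s. r s \<partial>?\<tau>) + (\<integral>s. r' s \<partial>?\<tau>)"
    using R_int r(1) r'(1) by simp
  \<comment> \<open>The terminal condition enters like the running one: the unhatted matrix at the
    centred terminal value, the hatted one at the mean.\<close>
  have G1: "0 \<le> (\<integral>\<omega>. ((Gco P - H T) *v (X T \<omega> - m T)) \<bullet> (X T \<omega> - m T) \<partial>M)"
    using psd_block_diag(1)[OF psdG] by (intro integral_nonneg_AE AE_I2) (simp add: G_comp_def)
  have G2: "0 \<le> ((Gco P + Gco P' - K T) *v m T) \<bullet> m T"
    using psd_block_diag(2)[OF psdG] by (simp add: G_comp_def hat_data_def)
  have "(\<integral>\<omega>. (Gco P *v X T \<omega>) \<bullet> X T \<omega> \<partial>M) - (\<integral>\<omega>. (H T *v X T \<omega>) \<bullet> X T \<omega> \<partial>M)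
      = (\<integral>\<omega>. ((Gco P - H T) *v X T \<omega>) \<bullet> X T \<omega> \<partial>M)"
    using GX[of "Gco P"] GX[of "H T"] by (simp add: matrix_vector_mult_diff_rdistrib inner_diff_left)
  also have "\<dots> = (\<integral>\<omega>. ((Gco P - H T) *v (X T \<omega> - m T)) \<bullet> (X T \<omega> - m T) \<partial>M) + ((Gco P - H T) *v m T) \<bullet> m T"
    using integral_centered[OF XT XT, of "Gco P - H T"] by (simp add: m_def)
  finally have terminal: "(\<integral>\<omega>. (Gco P *v X T \<omega>) \<bullet> X T \<omega> \<partial>M) - (\<integral>\<omega>. (H T *v X T \<omega>) \<bullet> X T \<omega> \<partial>M)
      \<ge> ((Gco P - H T) *v m T) \<bullet> m T" using G1 by linarith
  have mT: "((K T - H T) *v m T) \<bullet> m T = ((K 0 - H 0) *v x) \<bullet> x + (\<integral>s. r' s \<partial>?\<tau>)"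
    using r'(2) by (simp add: prob_space)
  show ?thesis
    using run terminal G2 mT r(2) unfolding cost_eq
    by (simp add: matrix_vector_mult_add_rdistrib matrix_vector_mult_diff_rdistrib inner_add_left inner_diff_left)
qed

section \<open>A state for the zero control, and the theorem\<close>

lemma uncontrolled_state_exists:
  fixes P P' :: "('n::finite, 'm::finite) lq_data" and x :: "real^'n"
  assumes T: "0 < T" and P: "lq_coefficients T P" and P': "lq_coefficients T P'"
  obtains X Y where "X \<in> L2F_C M F T" "is_ito_integral M F W T (diffusion_term M P P' (\<lambda>_ _. 0) X) Y"
    "\<And>t. t \<in> {0..T} \<Longrightarrow> AE \<omega> in M. X t \<omega> = x + (LINT s:{0..t}|lborel. drift_term M P P' (\<lambda>_ _. 0) X s \<omega>) + Y t \<omega>"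
proof -
  note cP = lq_coefficients_continuous[OF P] and cP' = lq_coefficients_continuous[OF P']
  obtain X Y where X: "regular T X" "is_ito_integral M F W T (mean_field_op (Cco P) (Cco P') X) Y"
    "\<And>t. t \<in> {0..T} \<Longrightarrow> AE \<omega> in M. X t \<omega> = x + (LINT s:{0..t}|lborel. mean_field_op (Aco P) (Aco P') X s \<omega>) + Y t \<omega>"
    by (rule mean_field_sde_exists[OF T cP(1) cP'(1) cP(3) cP'(3), of x]) (rule that)
  have d: "drift_term M P P' (\<lambda>_ _. 0) X = mean_field_op (Aco P) (Aco P') X"
    "diffusion_term M P P' (\<lambda>_ _. 0) X = mean_field_op (Cco P) (Cco P') X"
    by (simp_all add: fun_eq_iff drift_term_def diffusion_term_def mean_field_op_def)
  have "X \<in> L2F_C M F T"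
    using X(1) regular_progressive[OF X(1)] by (simp add: L2F_C_def regular_def sup_sq_def)
  then show thesis by (rule that[of X Y, unfolded d]) (rule X(2), rule X(3))
qed

end

text \<open>Monotonicity and the null sets are read off from the generators of the augmented
  filtration; the other properties are part of the definition of Brownian motion.\<close>

lemma brownian_motion_filtration:
  assumes "prob_space M" and W: "brownian_motion M (augmented_filtration M W) W"
  shows "brownian_filtration M (augmented_filtration M W) W"
proof -
  let ?F = "augmented_filtration M W"
  let ?G = "\<lambda>t. {W s -` B \<inter> space M | s B. 0 \<le> s \<and> s \<le> t \<and> B \<in> sets borel} \<union> null_sets M"
  interpret prob_space M by fact
  have G: "?G t \<subseteq> Pow (space M)" for t using sets.sets_into_space[of _ M] by (auto simp: null_sets_def)
  have sets_F: "sets (?F t) = sigma_sets (space M) (?G t)" for t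
    unfolding augmented_filtration_def by (rule sets_measure_of[OF G])
  show ?thesis
  proof
    show "subalgebra M (?F t)" "W t \<in> borel_measurable (?F t)" if "0 \<le> t" for t
      using W that by (auto simp: brownian_motion_def)
    show "sets (?F s) \<subseteq> sets (?F t)" if "s \<le> t" for s t
      unfolding sets_F using that by (intro sigma_sets_mono') (auto intro: order_trans)
    show "null_sets M \<subseteq> sets (?F t)" for t
      unfolding sets_F by (auto intro: sigma_sets.Basic)
    show "AE \<omega> in M. continuous_on {0..} (\<lambda>t. W t \<omega>)"
      using W by (simp add: brownian_motion_def)
    show "distributed M lborel (\<lambda>\<omega>. W t \<omega> - W s \<omega>) (normal_density 0 (sqrt (t - s)))"
      "indep_set (sets (?F s)) (sets (vimage_algebra (space M) (\<lambda>\<omega>. W t \<omega> - W s \<omega>) borel))"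
      if "0 \<le> s" "s < t" for s t
      using W that by (auto simp: brownian_motion_def)
  qed
qed

theorem corollary4p3:
  fixes M :: "'w measure"
    and W :: "real \<Rightarrow> 'w \<Rightarrow> real"
    and T :: real
    and P P' :: "('n::finite, 'm::finite) lq_data"
  assumes "prob_space M"
    and "complete_measure M"
    and "brownian_motion M (augmented_filtration M W) W"
    and "0 < T"
    and "lq_coefficients T P"
    and "lq_coefficients T P'"
    and "\<exists>H K. relaxed_compensator T P P' H K"
  shows "well_posed M W T P P'"
proof -
  let ?F = "augmented_filtration M W"
  interpret brownian_filtration M ?F W by (rule brownian_motion_filtration[OF assms(1,3)])
  obtain H K where HK: "relaxed_compensator T P P' H K" using assms(7) by blast
  have "\<bar>value_function M W T P P' x\<bar> \<noteq> \<infinity>" for x :: "real^'n"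
  proof -
    \<comment> \<open>The bound depends neither on the control nor on the chosen version of the
      state, so it passes through both infima.\<close>
    have "ereal ((K 0 *v x) \<bullet> x) \<le> value_function M W T P P' x"
      unfolding value_function_def
    proof (intro INF_greatest)
      fix u X assume u: "u \<in> admissible_controls M W T" and "X \<in> {X. is_state M W T P P' x u X}"
      then obtain Y where "X \<in> L2F_C M ?F T" "is_ito_integral M ?F W T (diffusion_term M P P' u X) Y"
        "\<And>t. t \<in> {0..T} \<Longrightarrow> AE \<omega> in M. X t \<omega> = x + (LINT s:{0..t}|lborel. drift_term M P P' u X s \<omega>) + Y t \<omega>"
        unfolding is_state_def by blast
      from cost_lower_bound[OF assms(4-6) HK this(1) u[unfolded admissible_controls_def] this(2,3)]
      show "ereal ((K 0 *v x) \<bullet> x) \<le> ereal (cost M T P P' u X)" by simp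
    qed
    \<comment> \<open>A single state with its real-valued cost keeps the infimum below \<infinity>;
      the zero control provides one.\<close>
    moreover have "value_function M W T P P' x < \<infinity>"
    proof -
      obtain X Y where "X \<in> L2F_C M ?F T" "is_ito_integral M ?F W T (diffusion_term M P P' (\<lambda>_ _. 0) X) Y"
        "\<And>t. t \<in> {0..T} \<Longrightarrow> AE \<omega> in M. X t \<omega> = x + (LINT s:{0..t}|lborel. drift_term M P P' (\<lambda>_ _. 0) X s \<omega>) + Y t \<omega>"
        by (rule uncontrolled_state_exists[OF assms(4-6), of x]) (rule that)
      then have X: "X \<in> {X. is_state M W T P P' x (\<lambda>_ _. 0) X}" unfolding is_state_def by blast
      have u: "(\<lambda>_ _. 0) \<in> admissible_controls M W T"
        by (simp add: admissible_controls_def L2F_def progressive_def sq_norm_L2_def)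
      have "value_function M W T P P' x \<le> ereal (cost M T P P' (\<lambda>_ _. 0) X)"
        unfolding value_function_def by (rule INF_lower2[OF u]) (rule INF_lower[OF X])
      then show ?thesis by (rule le_less_trans) simp
    qed
    ultimately show ?thesis by auto
  qed
  then show ?thesis by (simp add: well_posed_def)
qed

end
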